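(* For every $x\in2\mathbb Z+1$ and every $t\in[0,\infty)$, $$\mathbb E\,h(F,x,t)=\mathbb E\,s(F,x,t)=\frac4\pi\,t .$$
   Context: $\mathbb N=\{1,2,\dots\}$ and $\mathbb H=\{(x,y)\in\mathbb Z\times\mathbb N: x+y\text{ even}\}$, with the partial order $(x,y)\le(x',y')$ iff $x+y\le x'+y'$ and $y-x\le y'-x'$. For $c+n$ odd, $T(c,n)=\{z\in\mathbb H: z\le(c,n-1)\}$. $A\subset\mathbb H$ is downward closed if $z\in A$, $w\le z$ imply $w\in A$. Tableau process. For downward closed $A\subset T(c,n)$ put $B=T(c,n)\setminus A$. The hook of $w=(x,y)\in B$ is $H_w=\{(x+k,y-k)\in B:k\ge0\}\cup\{(x-k,y-k)\in B:k\ge0\}$, $h_w=|H_w|$; the reverse hook of $z$ is $R_z=\{w\in B\setminus\{z\}:z\in H_w\}$; $z\in B$ is a corner if $H_z=\{z\}$. The hook probability of a corner is $\mathbf P(B,z)=\frac1{|B|}\prod_{y\in R_z}\frac{h_y}{h_y-1}$. The tableau process $X(c,n,r)(t)$ is the continuous-time Markov process on downward closed subsets of $T(c,n)$, started at $\emptyset$, that jumps from $A$ to $A\cup\{z\}$ at rate $r\,\mathbf P(T(c,n)\setminus A,z)$ for each corner $z$, with no other jumps. Its inclusion function is $z\mapsto\inf\{t:z\in X(t)\}\in[0,\infty]$, $z\in\mathbb H$. $F:\mathbb H\to[0,\infty)$ denotes the random function that is the limit in distribution (in $[0,\infty]^{\mathbb H}$ with the product topology) of the inclusion functions of $X(c_n,n,n)$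 for any integers $c_n=o(n)$ with $c_n+n$ odd (the limit exists and does not depend on the choice of $c_n$). Height. For $J\in[0,\infty]^{\mathbb H}$, $x\in2\mathbb Z+1$: $h(J,x,t)=|\{z=(z_1,z_2)\in\mathbb H: z_1\in\{x,x+1\},\ J(z)<t\}|$. Swaps. Let $\mathcal I$ be the set of $G:\mathbb H\to[0,\infty]$ such that $G$ restricted to $\{G\ne\infty\}$ is order-preserving and injective and, for every $t$, $G(x,1)>t$ for infinitely many $x>0$ and infinitely many $x<0$; almost surely $F\in\mathcal I$. For $G\in\mathcal I$ the swap process $\mathrm{EG}(G)$ is defined up to time $t$ as follows. The set $\{z:G(z)\le t\}$ splits into finite downward closed sets $A_i$ contained in pairwise disjoint sets $T(\ell_i,k_i)$. For each $i$ let $G_0=G$ on $A_i$ and $G_0=\infty$ elsewhere, and for $j=1,\dots,|A_i|$: let $z_*=(k,1)$ ($k$ odd) be the point at which $G_{j-1}$ is minimal; a swap occurs at location $k$ (exchanging the particles at positions $k-1,k+1\in2\mathbb Z$) at time $G_{j-1}(z_* )$; form the sliding path $z_1=z_*$ and, if $z_m=(x,m)$, $z_{m+1}$ is whichever of $(x-1,m+1),(x+1,m+1)$ has the smaller value of $G_{j-1}$ (arbitrary if both are $\infty$); set $G_j(z_m)=G_{j-1}(z_{m+1})$ along the path and $G_j=G_{j-1}$ off it. These definitions are consistent for different $t$. For $x\in2\mathbb Z+1$, $s(G,x,t)$ is the number of swaps at location $x$ before time $t$ in $\mathrm{EG}(G)$. *)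

theory Defs
  imports "HOL-Probability.Probability"
begin

section \<open>The half-plane lattice\<close>

definition HH :: "(int \<times> int) set" where
  "HH = {(x, y). 1 \<le> y \<and> even (x + y)}"

definition le_H :: "int \<times> int \<Rightarrow> int \<times> int \<Rightarrow> bool" where
  "le_H z w \<longleftrightarrow> fst z + snd z \<le> fst w + snd w \<and> snd z - fst z \<le> snd w - fst w"

text \<open>Only used for \<open>c + n\<close> odd, so that the apex \<open>(c, n - 1)\<close> lies on the lattice
  (or, for \<open>n \<le> 1\<close>, just below it, and then the triangle is empty).\<close>

definition TT :: "int \<Rightarrow> nat \<Rightarrow> (int \<times> int) set" where
  "TT c n = {z \<in> HH. le_H z (c, int n - 1)}"

definition down_closed :: "(int \<times> int) set \<Rightarrow> bool" where
  "down_closed A \<longleftrightarrow> A \<subseteq> HH \<and> (\<forall>z\<in>A. \<forall>w\<in>HH. le_H w z \<longrightarrow> w \<in> A)"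

section \<open>Hooks\<close>

definition hook :: "(int \<times> int) set \<Rightarrow> int \<times> int \<Rightarrow> (int \<times> int) set" where
  "hook B w = {v \<in> B. \<exists>k\<ge>0. v = (fst w + k, snd w - k) \<or> v = (fst w - k, snd w - k)}"

definition rev_hook :: "(int \<times> int) set \<Rightarrow> int \<times> int \<Rightarrow> (int \<times> int) set" where
  "rev_hook B z = {w \<in> B - {z}. z \<in> hook B w}"

definition corners :: "(int \<times> int) set \<Rightarrow> (int \<times> int) set" where
  "corners B = {z \<in> B. hook B z = {z}}"

definition hook_prob :: "(int \<times> int) set \<Rightarrow> int \<times> int \<Rightarrow> real" where
  "hook_prob B z =
     1 / real (card B) *
     (\<Prod>w\<in>rev_hook B z. real (card (hook B w)) / (real (card (hook B w)) - 1))"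

section \<open>Continuous-time Markov processes on a finite state space\<close>

text \<open>\<open>rate a b\<close> is the rate of jumps from \<open>a\<close> to \<open>b\<close>; it should vanish for \<open>a = b\<close>.\<close>

definition exit_rate :: "'s set \<Rightarrow> ('s \<Rightarrow> 's \<Rightarrow> real) \<Rightarrow> 's \<Rightarrow> real" where
  "exit_rate St rate a = (\<Sum>b\<in>St. rate a b)"

definition jump_prob :: "'s set \<Rightarrow> ('s \<Rightarrow> 's \<Rightarrow> real) \<Rightarrow> 's \<Rightarrow> 's \<Rightarrow> real" where
  "jump_prob St rate a b =
     (if exit_rate St rate a = 0 then of_bool (a = b) else rate a b / exit_rate St rate a)"

text \<open>The description by jump chain and holding times: \<open>Y\<close> is a Markov chain with transition matrix
  \<open>jump_prob\<close> started at \<open>a\<^sub>0\<close> and, given \<open>Y\<close>, the holding times \<open>S i\<close> are independent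
  exponential variables with parameters \<open>exit_rate (Y i)\<close> (parameter \<open>0\<close> meaning \<open>S i = \<infinity>\<close>
  almost surely). The process sits at \<open>Y k\<close> during
  \<open>[S 0 + \<dots> + S (k - 1), S 0 + \<dots> + S k)\<close>.\<close>

definition markov_jump_process ::
  "'w measure \<Rightarrow> 's set \<Rightarrow> ('s \<Rightarrow> 's \<Rightarrow> real) \<Rightarrow> 's \<Rightarrow> (real \<Rightarrow> 'w \<Rightarrow> 's) \<Rightarrow> bool" where
  "markov_jump_process M St rate a\<^sub>0 X \<longleftrightarrow>
     prob_space M \<and>
     (\<exists>(Y :: nat \<Rightarrow> 'w \<Rightarrow> 's) (S :: nat \<Rightarrow> 'w \<Rightarrow> ennreal).
        (\<forall>k. Y k \<in> measurable M (count_space St)) \<and>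
        (\<forall>k. S k \<in> borel_measurable M) \<and>
        (\<forall>k ys s. (\<forall>i\<le>k. ys i \<in> St \<and> 0 \<le> s i) \<longrightarrow>
           measure M {\<omega> \<in> space M. \<forall>i\<le>k. Y i \<omega> = ys i \<and> ennreal (s i) < S i \<omega>} =
             of_bool (ys 0 = a\<^sub>0) *
             (\<Prod>i<k. jump_prob St rate (ys i) (ys (Suc i))) *
             (\<Prod>i\<le>k. exp (- (exit_rate St rate (ys i) * s i)))) \<and>
        (\<forall>\<omega>\<in>space M. \<forall>t\<ge>0. \<exists>k.
           (\<Sum>i<k. S i \<omega>) \<le> ennreal t \<and> ennreal t < (\<Sum>i\<le>k. S i \<omega>) \<and> X t \<omega> = Y k \<omega>))"

section \<open>The tableau process\<close>

definition tableau_states :: "int \<Rightarrow> nat \<Rightarrow> (int \<times> int) set set" where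
  "tableau_states c n = {A. down_closed A \<and> A \<subseteq> TT c n}"

text \<open>The sum has at most one term, namely the corner that \<open>A'\<close> adds to \<open>A\<close>.\<close>

definition tableau_rate ::
  "int \<Rightarrow> nat \<Rightarrow> real \<Rightarrow> (int \<times> int) set \<Rightarrow> (int \<times> int) set \<Rightarrow> real" where
  "tableau_rate c n r A A' =
     (\<Sum>z\<in>{z \<in> corners (TT c n - A). A' = insert z A}. r * hook_prob (TT c n - A) z)"

definition tableau_process ::
  "'w measure \<Rightarrow> int \<Rightarrow> nat \<Rightarrow> real \<Rightarrow> (real \<Rightarrow> 'w \<Rightarrow> (int \<times> int) set) \<Rightarrow> bool" where
  "tableau_process M c n r X \<longleftrightarrow>
     markov_jump_process M (tableau_states c n) (tableau_rate c n r) {} X"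

definition inclusion_fun :: "(real \<Rightarrow> 'w \<Rightarrow> (int \<times> int) set) \<Rightarrow> 'w \<Rightarrow> int \<times> int \<Rightarrow> ennreal" where
  "inclusion_fun X \<omega> z = (INF t\<in>{t. 0 \<le> t \<and> z \<in> X t \<omega>}. ennreal t)"

section \<open>Convergence in distribution\<close>

text \<open>Functions are defined on all of \<open>int \<times> int\<close>, but only their restriction to the lattice
  matters: test functions live on the product space \<open>[0,\<infinity>]\<^bsup>HH\<^esup>\<close>.\<close>

definition conv_in_distr ::
  "(nat \<Rightarrow> 'b measure) \<Rightarrow> (nat \<Rightarrow> 'b \<Rightarrow> int \<times> int \<Rightarrow> ennreal) \<Rightarrow>
   'a measure \<Rightarrow> ('a \<Rightarrow> int \<times> int \<Rightarrow> ennreal) \<Rightarrow> bool" where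
  "conv_in_distr N J M F \<longleftrightarrow>
     (\<forall>f :: (int \<times> int \<Rightarrow> ennreal) \<Rightarrow> real.
        continuous_map (product_topology (\<lambda>_. euclidean) HH) euclidean f \<and>
        bounded (f ` (HH \<rightarrow>\<^sub>E UNIV)) \<longrightarrow>
        (\<lambda>n. \<integral>\<omega>. f (restrict (J n \<omega>) HH) \<partial>N n) \<longlonglongrightarrow> (\<integral>\<omega>. f (restrict (F \<omega>) HH) \<partial>M))"

section \<open>Height\<close>

text \<open>Cardinality as an element of \<open>[0,\<infinity>]\<close>, so that infinite sets are not counted as \<open>0\<close>.\<close>

definition col_height :: "(int \<times> int \<Rightarrow> ennreal) \<Rightarrow> int \<Rightarrow> real \<Rightarrow> ennreal" where
  "col_height J x t = emeasure (count_space UNIV) {z \<in> HH. fst z \<in> {x, x + 1} \<and> J z < ennreal t}"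

section \<open>Swaps\<close>

definition swap_class :: "(int \<times> int \<Rightarrow> ennreal) set" where
  "swap_class = {G.
     (\<forall>z\<in>HH. \<forall>w\<in>HH. G z \<noteq> \<infinity> \<longrightarrow> G w \<noteq> \<infinity> \<longrightarrow> le_H z w \<longrightarrow> G z \<le> G w) \<and>
     inj_on G {z \<in> HH. G z \<noteq> \<infinity>} \<and>
     (\<forall>t::real. 0 \<le> t \<longrightarrow>
        infinite {x. 0 < x \<and> (x, 1) \<in> HH \<and> ennreal t < G (x, 1)} \<and>
        infinite {x. x < 0 \<and> (x, 1) \<in> HH \<and> ennreal t < G (x, 1)})}"

definition min_point :: "(int \<times> int \<Rightarrow> ennreal) \<Rightarrow> int \<times> int" where
  "min_point G = arg_min G (\<lambda>z. z \<in> HH)"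

text \<open>The path is indexed from \<open>0\<close>; its \<open>m\<close>-th point lies in row \<open>m + 1\<close>. When both candidates
  have value \<open>\<infinity>\<close> the choice is irrelevant, and the left one is taken.\<close>

primrec slide_path :: "(int \<times> int \<Rightarrow> ennreal) \<Rightarrow> nat \<Rightarrow> int \<times> int" where
  "slide_path G 0 = min_point G"
| "slide_path G (Suc m) =
     (let x = fst (slide_path G m); y = snd (slide_path G m)
      in if G (x - 1, y + 1) \<le> G (x + 1, y + 1) then (x - 1, y + 1) else (x + 1, y + 1))"

definition slide :: "(int \<times> int \<Rightarrow> ennreal) \<Rightarrow> int \<times> int \<Rightarrow> ennreal" where
  "slide G z =
     (if \<exists>m. slide_path G m = z
      then G (slide_path G (Suc (LEAST m. slide_path G m = z)))
      else G z)"

text \<open>A decomposition is given by the set of index pairs \<open>(\<ell>\<^sub>i, k\<^sub>i)\<close> of the disjoint triangles; the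
  pieces are then necessarily \<open>A\<^sub>i = {z \<in> TT \<ell>\<^sub>i k\<^sub>i. G z \<le> t}\<close>.\<close>

definition piece :: "(int \<times> int \<Rightarrow> ennreal) \<Rightarrow> real \<Rightarrow> int \<times> nat \<Rightarrow> (int \<times> int) set" where
  "piece G t d = {z \<in> TT (fst d) (snd d). G z \<le> ennreal t}"

definition decomposition :: "(int \<times> int \<Rightarrow> ennreal) \<Rightarrow> real \<Rightarrow> (int \<times> nat) set \<Rightarrow> bool" where
  "decomposition G t D \<longleftrightarrow>
     (\<forall>d\<in>D. odd (fst d + int (snd d))) \<and>
     disjoint_family_on (\<lambda>d. TT (fst d) (snd d)) D \<and>
     (\<forall>d\<in>D. finite (piece G t d) \<and> down_closed (piece G t d)) \<and>
     {z \<in> HH. G z \<le> ennreal t} = (\<Union>d\<in>D. piece G t d)"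

definition EG_state ::
  "(int \<times> int \<Rightarrow> ennreal) \<Rightarrow> (int \<times> int) set \<Rightarrow> nat \<Rightarrow> int \<times> int \<Rightarrow> ennreal" where
  "EG_state G A j = (slide ^^ j) (\<lambda>z. if z \<in> A then G z else \<infinity>)"

text \<open>The swaps up to time \<open>t\<close> as triples (index of the swap, location, time). Swaps are indexed by
  the triangle and by the number \<open>j - 1 \<in> {0..<|A\<^sub>i|}\<close> of earlier slides in it. The set
  \<open>D\<close> is an arbitrary decomposition (the swaps do not depend on which).\<close>

definition EG_swaps ::
  "(int \<times> int \<Rightarrow> ennreal) \<Rightarrow> real \<Rightarrow> (((int \<times> nat) \<times> nat) \<times> int \<times> ennreal) set" where
  "EG_swaps G t =
     (let D = (SOME D. decomposition G t D) in
      {((d, j), fst (min_point G'), G' (min_point G')) | d j G'.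
         d \<in> D \<and> j < card (piece G t d) \<and> G' = EG_state G (piece G t d) j})"

definition swaps :: "(int \<times> int \<Rightarrow> ennreal) \<Rightarrow> int \<Rightarrow> real \<Rightarrow> ennreal" where
  "swaps G x t =
     emeasure (count_space UNIV) {e \<in> EG_swaps G t. fst (snd e) = x \<and> snd (snd e) < ennreal t}"

end

theory Submission
  imports Defs
begin

text \<open>By the Greene-Nijenhuis-Wilf hook walk, \<open>hook_prob B z = f (B - {z}) / f B\<close> where \<open>f\<close> counts
  linear extensions. So the jump chain of the tableau process is a uniformly random linear extension,
  run at the times of an independent Poisson process. Promotion permutes the linear extensions of the
  triangle, and in the swap process of \<open>G\<close> the first swap at \<open>x\<close> happens at time \<open>G (x, 1)\<close>;
  hence each of the swaps of the tableau process is at \<open>x\<close> with the same probability \<open>p\<close>, and \<open>m\<close> consecutive swaps all miss \<open>x\<close> with probability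
  at most \<open>(1 - p) ^ m\<close>. Wallis' product gives \<open>n * p \<longlonglongrightarrow> 4 / \<pi>\<close>.

  Having many swaps at \<open>x\<close> before \<open>t\<close> and having no swap at \<open>x\<close> during \<open>[s, u]\<close> are open
  conditions. The portmanteau inequality for the former and Fatou's lemma bound the expected number of
  swaps of the limit by \<open>4 t / \<pi>\<close>; the latter has limiting probability at most
  \<open>exp (- 4 (u - s) / \<pi>)\<close>, and cutting \<open>[0, t]\<close> into short windows gives the matching lower bound.

  Taking \<open>c\<^sub>n\<close> and \<open>c\<^sub>n + 2\<close> as apexes shows that \<open>F\<close> is invariant under translation by \<open>2\<close>.
  Within a maximal interval of the bottom row on which \<open>F < t\<close> every cell with \<open>F < t\<close> contributes
  exactly one swap, so the heights and the swap counts have the same sum over the interval; by mass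
  transport they have the same expectation.\<close>

text \<open>Convergence in distribution carries over neither the mean nor the exact law of a swap
  count: uniform integrability is not established, and conditions that are not open may fail to pass
  to the limit. Hence both bounds are phrased with open sets, and the lower one goes through
  avoidance probabilities, which suffice because \<open>m * (1 - exp (- a / m))\<close> tends to
  \<open>a\<close>. The bound \<open>(1 - p) ^ m\<close> holds because the hook probability of a
  corner can only grow while the remaining shape shrinks. Swaps of an infinite function become
  tractable by locality: over an interval of the bottom row flanked by large values, the swaps below
  a level depend only on the cells over that interval, and their locations only on the relative
  order of the values. Origin of the constant: hooks in the triangle have odd lengths, and the two
  diagonals rising from \<open>(x, 1)\<close> have about \<open>n / 2\<close> cells each, so each
  contributes a product of \<open>(2 k + 1) / (2 k)\<close> of size about
  \<open>sqrt (2 n / \<pi>)\<close>. Dividing by the roughly \<open>n\<^sup>2 / 2\<close> cells and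
  multiplying by the speed \<open>n\<close> leaves \<open>4 / \<pi>\<close>.\<close>

declare split_paired_All [simp del] split_paired_Ex [simp del] slide_path.simps(2) [simp del]

section \<open>Sliding paths and swaps\<close>

lemma HH_up: "z \<in> HH \<Longrightarrow> (fst z - 1, snd z + 1) \<in> HH" "z \<in> HH \<Longrightarrow> (fst z + 1, snd z + 1) \<in> HH"
  by (auto simp: HH_def)

lemma HH_down: "z \<in> HH \<Longrightarrow> snd z \<noteq> 1 \<Longrightarrow> (fst z - 1, snd z - 1) \<in> HH"
  "z \<in> HH \<Longrightarrow> snd z \<noteq> 1 \<Longrightarrow> (fst z + 1, snd z - 1) \<in> HH"
  by (auto simp: HH_def)

lemma le_H_refl [simp]: "le_H z z"
  by (simp add: le_H_def)

lemma le_H_trans: "le_H u v \<Longrightarrow> le_H v w \<Longrightarrow> le_H u w"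
  by (auto simp: le_H_def)

text \<open>On the lattice \<open>x + y\<close> and \<open>y - x\<close> are both even, so a strict
  inequality in either is a gap of at least 2, and one diagonal step uses up exactly 2.\<close>

lemma le_H_cover:
  assumes "z \<in> HH" "w \<in> HH" "le_H z w" "z \<noteq> w"
  shows "le_H (fst z - 1, snd z + 1) w \<or> le_H (fst z + 1, snd z + 1) w"
proof -
  obtain a b where z: "z = (a, b)" by (cases z)
  obtain c d where w: "w = (c, d)" by (cases w)
  have "even (a + b)" "even (c + d)" using assms by (auto simp: HH_def z w)
  moreover have "a + b \<le> c + d" "b - a \<le> d - c" using assms by (auto simp: le_H_def z w)
  moreover have "a \<noteq> c \<or> b \<noteq> d" using assms by (auto simp: z w)
  ultimately have "b - a + 2 \<le> d - c \<or> a + b + 2 \<le> c + d" by presburger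
  then show ?thesis using \<open>a + b \<le> c + d\<close> \<open>b - a \<le> d - c\<close> by (auto simp: le_H_def z w)
qed

lemma le_H_snd: "le_H z w \<Longrightarrow> snd z \<le> snd w"
  by (auto simp: le_H_def)

lemma mono_from_covers:
  fixes G :: "int \<times> int \<Rightarrow> 'a :: preorder"
  assumes c: "\<And>z. z \<in> HH \<Longrightarrow> G z \<le> G (fst z - 1, snd z + 1)"
      "\<And>z. z \<in> HH \<Longrightarrow> G z \<le> G (fst z + 1, snd z + 1)"
    and "z \<in> HH" "w \<in> HH" "le_H z w"
  shows "G z \<le> G w"
  using assms(3-5)
proof (induction "nat (snd w - snd z)" arbitrary: z rule: less_induct)
  case less
  show ?case
  proof (cases "z = w")
    case False
    obtain v where v: "v = (fst z - 1, snd z + 1) \<or> v = (fst z + 1, snd z + 1)" "le_H v w"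
      using le_H_cover[OF less.prems False] by blast
    have "v \<in> HH" "G z \<le> G v" using v(1) HH_up[OF less.prems(1)] c[OF less.prems(1)] by auto
    moreover have "nat (snd w - snd v) < nat (snd w - snd z)"
      using v le_H_snd[OF v(2)] by auto
    ultimately show ?thesis using less.hyps[of v] less.prems v(2) order_trans by blast
  qed simp
qed

text \<open>The footprint of a cell on the bottom row: the interval of odd positions spanned by the
  triangle hanging below the cell. Being inside a triangle, or lying over an interval, becomes an
  inclusion of footprints.\<close>

definition base :: "int \<times> int \<Rightarrow> int set" where
  "base z = {k. odd k \<and> le_H (k, 1) z}"

lemma base_iff: "k \<in> base (a, b) \<longleftrightarrow> odd k \<and> k + 1 \<le> a + b \<and> 1 - k \<le> b - a"
  by (auto simp: base_def le_H_def)

lemma base_mono: "le_H z w \<Longrightarrow> base z \<subseteq> base w"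
  by (auto simp: base_def intro: le_H_trans)

lemma row_one_HH: "odd k \<Longrightarrow> (k, 1) \<in> HH"
  by (auto simp: HH_def)

definition supp :: "(int \<times> int \<Rightarrow> ennreal) \<Rightarrow> (int \<times> int) set" where
  "supp G = {z \<in> HH. G z \<noteq> \<infinity>}"

text \<open>The value infinity marks an empty cell. Monotonicity is demanded across empty cells too,
  so the support is downward closed and sliding needs no boundary cases.\<close>

definition fin_tableau :: "(int \<times> int \<Rightarrow> ennreal) \<Rightarrow> bool" where
  "fin_tableau G \<longleftrightarrow> (\<forall>z. z \<notin> HH \<longrightarrow> G z = \<infinity>) \<and> finite (supp G) \<and> inj_on G (supp G) \<and>
     (\<forall>z\<in>HH. \<forall>w\<in>HH. le_H z w \<longrightarrow> G z \<le> G w)"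

lemma fin_tableauD:
  assumes "fin_tableau G"
  shows "z \<notin> HH \<Longrightarrow> G z = \<infinity>" "finite (supp G)" "inj_on G (supp G)"
    "z \<in> HH \<Longrightarrow> w \<in> HH \<Longrightarrow> le_H z w \<Longrightarrow> G z \<le> G w"
  using assms unfolding fin_tableau_def by blast+

lemma fin_tableau_strict:
  assumes "fin_tableau G" "z \<in> HH" "w \<in> HH" "le_H z w" "z \<noteq> w" "G z \<noteq> \<infinity>"
  shows "G z < G w"
proof -
  have "G z \<le> G w" using fin_tableauD(4)[OF assms(1-4)] .
  moreover have "G z \<noteq> G w"
  proof
    assume e: "G z = G w"
    have "z = w"
      by (rule inj_onD[OF fin_tableauD(3)[OF assms(1)] e]) (use assms e in \<open>auto simp: supp_def\<close>)
    with assms show False by simp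
  qed
  ultimately show ?thesis by simp
qed

text \<open>Finite support provides a true minimum, so \<open>arg_min\<close> is no arbitrary
  choice; a minimum above the bottom row would have a lower neighbour of strictly smaller
  value.\<close>

lemma min_point_props:
  assumes "fin_tableau G" "supp G \<noteq> {}"
  shows "min_point G \<in> supp G" "w \<in> HH \<Longrightarrow> G (min_point G) \<le> G w" "snd (min_point G) = 1"
    "odd (fst (min_point G))"
proof -
  obtain z where z: "z \<in> supp G" "\<And>w. w \<in> supp G \<Longrightarrow> G z \<le> G w"
    using ex_is_arg_min_if_finite[OF fin_tableauD(2)[OF assms(1)] assms(2), of G]
    by (auto simp: is_arg_min_def not_less)
  have "is_arg_min G (\<lambda>z. z \<in> HH) z"
    unfolding is_arg_min_def
  proof (intro conjI notI)
    show "z \<in> HH" using z by (auto simp: supp_def)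
    assume "\<exists>y. y \<in> HH \<and> G y < G z"
    then obtain y where y: "y \<in> HH" "G y < G z" by blast
    then have "y \<in> supp G" by (auto simp: supp_def)
    from z(2)[OF this] y show False by simp
  qed
  then have a: "is_arg_min G (\<lambda>z. z \<in> HH) (min_point G)"
    unfolding min_point_def arg_min_def by (rule someI)
  show m: "G (min_point G) \<le> G w" if "w \<in> HH" for w
    using a that by (auto simp: is_arg_min_def not_less)
  have "z \<in> HH" "G z \<noteq> \<infinity>" using z by (auto simp: supp_def)
  with m[of z] have fin: "G (min_point G) \<noteq> \<infinity>" by (auto simp: top_unique)
  have inH: "min_point G \<in> HH" using a by (auto simp: is_arg_min_def)
  then show "min_point G \<in> supp G" using fin by (auto simp: supp_def)
  show s: "snd (min_point G) = 1"
  proof (rule ccontr)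
    assume n: "snd (min_point G) \<noteq> 1"
    let ?v = "(fst (min_point G) - 1, snd (min_point G) - 1)"
    have v: "?v \<in> HH" using HH_down[OF inH n] by auto
    have "le_H ?v (min_point G)" "?v \<noteq> min_point G" by (auto simp: le_H_def prod_eq_iff)
    moreover have "G ?v \<noteq> \<infinity>" using fin fin_tableauD(4)[OF assms(1) v inH] calculation(1)
      by (auto simp: top_unique)
    ultimately have "G ?v < G (min_point G)" using fin_tableau_strict[OF assms(1) v inH] by auto
    with m[OF v] show False by simp
  qed
  show "odd (fst (min_point G))" using inH s by (auto simp: HH_def split: prod.splits)
qed

lemma min_point_unique:
  assumes "fin_tableau G" "z \<in> HH" "G z \<noteq> \<infinity>" "\<And>w. w \<in> HH \<Longrightarrow> G z \<le> G w"
  shows "min_point G = z"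
proof -
  have z: "z \<in> supp G" using assms by (auto simp: supp_def)
  have ne: "supp G \<noteq> {}" using z by auto
  note mp = min_point_props[OF assms(1) ne]
  have "G (min_point G) = G z" using mp(1) mp(2)[OF assms(2)] assms(4)
    by (intro antisym) (auto simp: supp_def)
  then show ?thesis using inj_onD[OF fin_tableauD(3)[OF assms(1)] _ mp(1) z] by blast
qed

section \<open>Geometry of the sliding path\<close>

lemma slide_path_Suc_cases:
  "slide_path G (Suc m) = (fst (slide_path G m) - 1, snd (slide_path G m) + 1) \<or>
   slide_path G (Suc m) = (fst (slide_path G m) + 1, snd (slide_path G m) + 1)"
  by (auto simp: Let_def slide_path.simps(2))

lemma slide_path_le_up:
  "G (slide_path G (Suc m)) \<le> G (fst (slide_path G m) - 1, snd (slide_path G m) + 1)"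
  "G (slide_path G (Suc m)) \<le> G (fst (slide_path G m) + 1, snd (slide_path G m) + 1)"
  by (auto simp: Let_def slide_path.simps(2))

lemma snd_slide_path: "snd (slide_path G m) = snd (min_point G) + int m"
  by (induction m) (auto simp: Let_def slide_path.simps(2))

lemma slide_path_inj: "slide_path G m = slide_path G m' \<longleftrightarrow> m = m'"
  by (metis add_left_cancel of_nat_eq_iff snd_slide_path)

lemma slide_on: "slide G (slide_path G m) = G (slide_path G (Suc m))"
proof -
  have "(LEAST k. slide_path G k = slide_path G m) = m"
    by (rule Least_equality) (auto simp: slide_path_inj)
  then show ?thesis unfolding slide_def by auto
qed

lemma slide_off: "(\<And>m. slide_path G m \<noteq> z) \<Longrightarrow> slide G z = G z"
  by (auto simp: slide_def)

lemma slide_path_HH: "min_point G \<in> HH \<Longrightarrow> slide_path G m \<in> HH"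
proof (induction m)
  case (Suc m)
  then show ?case using slide_path_Suc_cases[of G m] HH_up[OF Suc.IH] by auto
qed simp

lemma slide_path_le: "le_H (slide_path G m) (slide_path G (Suc m))"
  using slide_path_Suc_cases[of G m] by (auto simp: le_H_def)

lemma slide_path_ge_start: "le_H (min_point G) (slide_path G m)"
  by (induction m) (use slide_path_le le_H_trans in \<open>auto\<close>)

text \<open>Writes a slide as composition with a map of cells. As the path goes on forever, through
  empty cells too, this map is a bijection from \<open>HH\<close> onto \<open>HH\<close> without the
  start of the path; injectivity and the set of values then transfer to the slid tableau at
  once.\<close>

definition slide_shift :: "(int \<times> int \<Rightarrow> ennreal) \<Rightarrow> int \<times> int \<Rightarrow> int \<times> int" where
  "slide_shift G z = (if \<exists>m. slide_path G m = z then slide_path G (Suc (LEAST m. slide_path G m = z)) else z)"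

lemma slide_eq_shift: "slide G z = G (slide_shift G z)"
  by (simp add: slide_def slide_shift_def)

lemma slide_shift_on: "slide_shift G (slide_path G m) = slide_path G (Suc m)"
proof -
  have "(LEAST k. slide_path G k = slide_path G m) = m"
    by (rule Least_equality) (auto simp: slide_path_inj)
  then show ?thesis unfolding slide_shift_def by auto
qed

lemma slide_shift_off: "(\<And>m. slide_path G m \<noteq> z) \<Longrightarrow> slide_shift G z = z"
  by (auto simp: slide_shift_def)

lemma slide_shift_bij:
  assumes "min_point G \<in> HH"
  shows "bij_betw (slide_shift G) HH (HH - {min_point G})"
proof -
  have p: "slide_shift G z \<in> HH - {min_point G}" if "z \<in> HH" for z
  proof (cases "\<exists>m. slide_path G m = z")
    case True
    then obtain m where "z = slide_path G m" by auto
    then show ?thesis using slide_shift_on[of G m] slide_path_HH[OF assms, of "Suc m"]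
        slide_path_inj[of G "Suc m" 0] by (auto)
  next
    case False
    then show ?thesis using slide_shift_off[of G z] that by (metis DiffI singletonD slide_path.simps(1))
  qed
  have inj: "inj (slide_shift G)"
  proof (rule injI)
    fix z w assume e: "slide_shift G z = slide_shift G w"
    show "z = w"
    proof (cases "\<exists>m. slide_path G m = z")
      case True
      then obtain m where m: "z = slide_path G m" by auto
      show ?thesis
      proof (cases "\<exists>m. slide_path G m = w")
        case True
        then obtain m' where m': "w = slide_path G m'" by auto
        show ?thesis using e slide_path_inj[of G "Suc m" "Suc m'"]
          by (simp add: m m' slide_shift_on)
      next
        case False
        then show ?thesis using e slide_shift_off[of G w] by (metis m slide_shift_on)
      qed
    next
      case False
      then have "slide_shift G z = z" by (intro slide_shift_off) auto
      with e False show ?thesis by (metis slide_shift_off slide_shift_on)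
    qed
  qed
  have "HH - {min_point G} \<subseteq> slide_shift G ` HH"
  proof
    fix z assume z: "z \<in> HH - {min_point G}"
    show "z \<in> slide_shift G ` HH"
    proof (cases "\<exists>m. slide_path G m = z")
      case True
      then obtain m where m: "z = slide_path G m" by auto
      with z have "m \<noteq> 0" by (metis DiffE insertCI slide_path.simps(1))
      then obtain k where "m = Suc k" by (cases m) auto
      then have "z = slide_shift G (slide_path G k)" by (simp only: slide_shift_on m)
      then show ?thesis using slide_path_HH[OF assms] by blast
    next
      case False
      then have "slide_shift G z = z" by (intro slide_shift_off) auto
      then show ?thesis using z by (metis DiffD1 image_eqI)
    qed
  qed
  moreover have "slide_shift G ` HH \<subseteq> HH - {min_point G}" using p by (rule image_subsetI)
  ultimately show ?thesis using inj_on_subset[OF inj subset_UNIV] unfolding bij_betw_def by blast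
qed

lemma slide_notin_HH: "min_point G \<in> HH \<Longrightarrow> z \<notin> HH \<Longrightarrow> slide G z = G z"
  by (rule slide_off) (use slide_path_HH in auto)

lemma slide_ge:
  assumes "fin_tableau G" "supp G \<noteq> {}"
  shows "G z \<le> slide G z"
proof (cases "\<exists>m. slide_path G m = z")
  case True
  then obtain m where m: "z = slide_path G m" by auto
  have "min_point G \<in> HH" using min_point_props(1)[OF assms] by (auto simp: supp_def)
  from slide_path_HH[OF this] show ?thesis
    unfolding m slide_on by (intro fin_tableauD(4)[OF assms(1)] slide_path_le)
next
  case False
  then show ?thesis using slide_off[of G z] by auto
qed

lemma supp_slide_subset: "fin_tableau G \<Longrightarrow> supp G \<noteq> {} \<Longrightarrow> supp (slide G) \<subseteq> supp G"
  using slide_ge[of G] by (auto simp: supp_def) (metis top_unique)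

text \<open>A cell on the path receives the smaller of the values of its two upper neighbours, and
  no value decreases under a slide; so every covering relation stays ordered.\<close>

lemma fin_tableau_slide:
  assumes "fin_tableau G" "supp G \<noteq> {}"
  shows "fin_tableau (slide G)"
proof -
  have mp: "min_point G \<in> HH" using min_point_props(1)[OF assms] by (auto simp: supp_def)
  note bij = slide_shift_bij[OF mp]
  have "inj_on (slide G) (supp (slide G))"
  proof (rule inj_onI)
    fix z w assume a: "z \<in> supp (slide G)" "w \<in> supp (slide G)" "slide G z = slide G w"
    have H: "z \<in> HH" "w \<in> HH" using a by (auto simp: supp_def)
    then have "slide_shift G z \<in> HH" "slide_shift G w \<in> HH" using bij by (auto simp: bij_betw_def)
    with a have "slide_shift G z \<in> supp G" "slide_shift G w \<in> supp G"
      by (auto simp: supp_def slide_eq_shift)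
    with a(3) inj_onD[OF fin_tableauD(3)[OF assms(1)]] have "slide_shift G z = slide_shift G w"
      unfolding slide_eq_shift by blast
    with bij H show "z = w" unfolding bij_betw_def by (blast dest: inj_onD)
  qed
  moreover have cov: "slide G z \<le> slide G w" if zH: "z \<in> HH" and w: "w = (fst z - 1, snd z + 1) \<or> w = (fst z + 1, snd z + 1)" for z w
  proof -
    have wH: "w \<in> HH" using w HH_up[OF zH] by auto
    have le: "le_H z w" using w by (auto simp: le_H_def)
    show ?thesis
    proof (cases "\<exists>m. slide_path G m = z")
      case True
      then obtain m where m: "z = slide_path G m" by auto
      have "slide G z = G (slide_path G (Suc m))" by (simp only: m slide_on)
      also have "\<dots> \<le> G w" using w slide_path_le_up[of G m] unfolding m by metis
      also have "\<dots> \<le> slide G w" by (rule slide_ge[OF assms])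
      finally show ?thesis .
    next
      case False
      then have "slide G z = G z" by (intro slide_off) auto
      also have "\<dots> \<le> G w" by (rule fin_tableauD(4)[OF assms(1) zH wH le])
      also have "\<dots> \<le> slide G w" by (rule slide_ge[OF assms])
      finally show ?thesis .
    qed
  qed
  have "slide G z \<le> slide G w" if "z \<in> HH" "w \<in> HH" "le_H z w" for z w
    by (rule mono_from_covers[OF _ _ that]) (auto intro: cov)
  moreover have "finite (supp (slide G))"
    using fin_tableauD(2)[OF assms(1)] supp_slide_subset[OF assms] by (rule rev_finite_subset)
  moreover have "slide G z = \<infinity>" if "z \<notin> HH" for z
    using slide_notin_HH[OF mp that] fin_tableauD(1)[OF assms(1) that] by simp
  ultimately show ?thesis by (auto simp: fin_tableau_def)
qed

lemma slide_values:
  assumes "fin_tableau G" "supp G \<noteq> {}"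
  shows "slide G ` supp (slide G) = G ` supp G - {G (min_point G)}"
proof -
  have mps: "min_point G \<in> supp G" using min_point_props(1)[OF assms] .
  then have mp: "min_point G \<in> HH" by (auto simp: supp_def)
  note bij = slide_shift_bij[OF mp]
  have "slide G ` supp (slide G) = G ` (slide_shift G ` HH \<inter> supp G)"
    using bij unfolding bij_betw_def supp_def slide_eq_shift by blast
  also have "slide_shift G ` HH \<inter> supp G = supp G - {min_point G}"
    using bij by (auto simp: bij_betw_def supp_def)
  also have "G ` \<dots> = G ` supp G - {G (min_point G)}"
    using inj_on_image_set_diff[OF fin_tableauD(3)[OF assms(1)], of "supp G" "{min_point G}"] mps by auto
  finally show ?thesis .
qed

lemma card_supp_slide:
  assumes "fin_tableau G" "supp G \<noteq> {}"
  shows "card (supp G) = Suc (card (supp (slide G)))"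
proof -
  have "card (supp (slide G)) = card (slide G ` supp (slide G))"
    using fin_tableauD(3)[OF fin_tableau_slide[OF assms]] by (simp add: card_image)
  also have "\<dots> = card (G ` supp G) - 1"
    unfolding slide_values[OF assms]
    using fin_tableauD(2)[OF assms(1)] min_point_props(1)[OF assms] by (intro card_Diff_singleton) auto
  also have "card (G ` supp G) = card (supp G)"
    using fin_tableauD(3)[OF assms(1)] by (simp add: card_image)
  finally have e: "card (supp (slide G)) = card (supp G) - 1" .
  have "card (supp G) > 0" using assms fin_tableauD(2)[OF assms(1)] by (simp add: card_gt_0_iff)
  with e show ?thesis by simp
qed

text \<open>Each slide empties exactly one cell, so repeated sliding exhausts the tableau.\<close>

lemma fin_tableau_induct [consumes 1, case_names empty slide]:
  assumes "fin_tableau G"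
    and "\<And>G. fin_tableau G \<Longrightarrow> supp G = {} \<Longrightarrow> P G"
    and "\<And>G. fin_tableau G \<Longrightarrow> supp G \<noteq> {} \<Longrightarrow> fin_tableau (slide G) \<Longrightarrow> P (slide G) \<Longrightarrow> P G"
  shows "P G"
  using assms(1)
proof (induction "card (supp G)" arbitrary: G)
  case 0
  then show ?case using assms(2) fin_tableauD(2) by (metis card_0_eq)
next
  case (Suc n)
  then have ne: "supp G \<noteq> {}" by auto
  show ?case
    using assms(3)[OF Suc.prems ne fin_tableau_slide[OF Suc.prems ne]]
      Suc.hyps(1)[of "slide G"] Suc.hyps(2) card_supp_slide[OF Suc.prems ne] fin_tableau_slide[OF Suc.prems ne]
    by auto
qed

text \<open>A set of pairs (location, time) loses nothing for a finite tableau: the times are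
  distinct (\<open>sw_inj\<close>) and are exactly the finite values
  (\<open>sw_snd\<close>).\<close>

definition sw :: "(int \<times> int \<Rightarrow> ennreal) \<Rightarrow> (int \<times> ennreal) set" where
  "sw G = (\<lambda>j. (fst (min_point ((slide ^^ j) G)), ((slide ^^ j) G) (min_point ((slide ^^ j) G)))) ` {..<card (supp G)}"

lemma sw_empty [simp]: "supp G = {} \<Longrightarrow> sw G = {}"
  by (simp add: sw_def)

lemma sw_rec:
  assumes "fin_tableau G" "supp G \<noteq> {}"
  shows "sw G = insert (fst (min_point G), G (min_point G)) (sw (slide G))"
  unfolding sw_def card_supp_slide[OF assms] lessThan_Suc_eq_insert_0 image_insert image_image funpow_Suc_right
  by simp

lemma sw_snd: "fin_tableau G \<Longrightarrow> snd ` sw G = G ` supp G"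
proof (induction rule: fin_tableau_induct)
  case (slide G)
  then show ?case using sw_rec[of G] slide_values[of G] min_point_props(1)[of G] by auto
qed simp

lemma sw_inj: "fin_tableau G \<Longrightarrow> inj_on snd (sw G)"
proof (induction rule: fin_tableau_induct)
  case (slide G)
  have "G (min_point G) \<notin> snd ` sw (slide G)"
    unfolding sw_snd[OF slide(3)] slide_values[OF slide(1,2)] by auto
  then show ?case using slide sw_rec[of G] by auto
qed simp

lemma finite_sw: "finite (sw G)"
  by (simp add: sw_def)

lemma card_sw: "fin_tableau G \<Longrightarrow> card (sw G) = card (supp G)"
  using sw_snd[of G] sw_inj[of G] fin_tableauD(3)[of G] by (metis card_image)

lemma sw_finite_value: "fin_tableau G \<Longrightarrow> (k, v) \<in> sw G \<Longrightarrow> \<exists>z\<in>HH. v = G z \<and> G z \<noteq> \<infinity>"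
  using sw_snd[of G] by (force simp: supp_def)

lemma sw_ge_min:
  assumes "fin_tableau G" "supp G \<noteq> {}" "(k, v) \<in> sw G"
  shows "G (min_point G) \<le> v"
  using sw_finite_value[OF assms(1,3)] min_point_props(2)[OF assms(1,2)] by auto

text \<open>Values only grow under slides, so when \<open>(k, 1)\<close> becomes the minimum its
  current value is at least the original one.\<close>

lemma sw_location: "fin_tableau G \<Longrightarrow> (k, v) \<in> sw G \<Longrightarrow> odd k \<and> (k, 1) \<in> supp G \<and> G (k, 1) \<le> v"
proof (induction arbitrary: k v rule: fin_tableau_induct)
  case (slide G)
  note mp = min_point_props[OF slide(1,2)]
  show ?case
  proof (cases "(k, v) \<in> sw (slide G)")
    case True
    then show ?thesis using slide.IH[OF True] supp_slide_subset[OF slide(1,2)] slide_ge[OF slide(1,2), of "(k,1)"] by auto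
  next
    case False
    then have "k = fst (min_point G)" "v = G (min_point G)" using slide.prems sw_rec[OF slide(1,2)] by auto
    moreover then have "(k, 1) = min_point G" using mp by (auto simp: prod_eq_iff)
    ultimately show ?thesis using mp by auto
  qed
qed simp

text \<open>The path meets the bottom row only at its start, so \<open>(k, 1)\<close> keeps its
  value until it is itself the minimum.\<close>

lemma sw_first: "fin_tableau G \<Longrightarrow> (k, 1) \<in> supp G \<Longrightarrow> (k, G (k, 1)) \<in> sw G"
proof (induction arbitrary: k rule: fin_tableau_induct)
  case (slide G)
  note mp = min_point_props[OF slide(1,2)]
  show ?case
  proof (cases "min_point G = (k, 1)")
    case True
    then show ?thesis using sw_rec[OF slide(1,2)] by auto
  next
    case False
    have "slide_path G m \<noteq> (k, 1)" for m
      using snd_slide_path[of G m] mp(3) False by (cases m) (auto)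
    then have e: "slide G (k, 1) = G (k, 1)" by (rule slide_off)
    then have "(k, 1) \<in> supp (slide G)" using slide.prems by (auto simp: supp_def)
    from slide.IH[OF this] show ?thesis using sw_rec[OF slide(1,2)] e by auto
  qed
qed simp

section \<open>Locality of swaps\<close>

text \<open>In the applications \<open>L\<close> is an initial segment of times and \<open>R\<close>
  an interval of positions; everything else is made to look empty, so a view is what an observer of
  \<open>R\<close> knows up to a given time.\<close>

definition view :: "int set \<Rightarrow> ennreal set \<Rightarrow> (int \<times> int \<Rightarrow> ennreal) \<Rightarrow> int \<times> int \<Rightarrow> ennreal" where
  "view R L G z = (if z \<in> HH \<and> base z \<subseteq> R \<and> G z \<in> L then G z else \<infinity>)"

definition lower_set :: "ennreal set \<Rightarrow> bool" where
  "lower_set L \<longleftrightarrow> \<infinity> \<notin> L \<and> (\<forall>v\<in>L. \<forall>u\<le>v. u \<in> L)"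

text \<open>No cell with value in \<open>L\<close> straddles the boundary of \<open>R\<close>; up to
  this level nothing can slide across it.\<close>

definition separated :: "int set \<Rightarrow> ennreal set \<Rightarrow> (int \<times> int \<Rightarrow> ennreal) \<Rightarrow> bool" where
  "separated R L G \<longleftrightarrow> (\<forall>z\<in>HH. G z \<in> L \<longrightarrow> base z \<subseteq> R \<or> base z \<inter> R = {})"

lemma lower_setD: "lower_set L \<Longrightarrow> v \<in> L \<Longrightarrow> u \<le> v \<Longrightarrow> u \<in> L" "lower_set L \<Longrightarrow> \<infinity> \<notin> L"
  "lower_set L \<Longrightarrow> \<top> \<notin> L" "lower_set L \<Longrightarrow> v \<in> L \<Longrightarrow> v \<noteq> \<infinity>"
  by (auto simp: lower_set_def)

lemma supp_view: "lower_set L \<Longrightarrow> supp (view R L G) = {z\<in>HH. base z \<subseteq> R \<and> G z \<in> L}"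
  by (auto simp: supp_def view_def lower_set_def)

lemma view_ge: "G z \<le> view R L G z"
  by (simp add: view_def)

lemma fin_tableau_viewI:
  assumes "lower_set L" "finite {z\<in>HH. base z \<subseteq> R \<and> G z \<in> L}"
    "inj_on G {z\<in>HH. base z \<subseteq> R \<and> G z \<in> L}"
    "\<And>z w. z \<in> HH \<Longrightarrow> w \<in> HH \<Longrightarrow> le_H z w \<Longrightarrow> G z \<le> G w"
  shows "fin_tableau (view R L G)"
proof -
  have "inj_on (view R L G) (supp (view R L G))"
    unfolding supp_view[OF assms(1)] using assms(3) by (auto simp: inj_on_def view_def)
  moreover have "view R L G z \<le> view R L G w" if h: "z \<in> HH" "w \<in> HH" "le_H z w" for z w
  proof (cases "base w \<subseteq> R \<and> G w \<in> L")
    case True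
    then have "base z \<subseteq> R" "G z \<in> L"
      using base_mono[OF h(3)] lower_setD(1)[OF assms(1)] assms(4)[OF h] by auto
    then show ?thesis using True h assms(4)[OF h] by (auto simp: view_def)
  qed (auto simp: view_def)
  ultimately show ?thesis unfolding fin_tableau_def using assms(2) supp_view[OF assms(1)]
    by (auto simp: view_def)
qed

lemma fin_tableau_view: "fin_tableau G \<Longrightarrow> lower_set L \<Longrightarrow> fin_tableau (view R L G)"
proof (rule fin_tableau_viewI)
  assume G: "fin_tableau G" and L: "lower_set L"
  have sub: "{z\<in>HH. base z \<subseteq> R \<and> G z \<in> L} \<subseteq> supp G"
    using lower_setD(4)[OF L] by (auto simp: supp_def)
  show "finite {z\<in>HH. base z \<subseteq> R \<and> G z \<in> L}"
    using finite_subset[OF sub fin_tableauD(2)[OF G]] .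
  show "inj_on G {z\<in>HH. base z \<subseteq> R \<and> G z \<in> L}"
    using inj_on_subset[OF fin_tableauD(3)[OF G] sub] .
qed (auto intro: fin_tableauD)

lemma finite_base_subset:
  assumes "finite R"
  shows "finite {z\<in>HH. base z \<subseteq> R}"
proof -
  let ?f = "\<lambda>z :: int \<times> int. (fst z - snd z + 1, fst z + snd z - 1)"
  have "inj_on ?f {z\<in>HH. base z \<subseteq> R}" by (auto simp: inj_on_def)
  moreover have "?f ` {z\<in>HH. base z \<subseteq> R} \<subseteq> R \<times> R"
  proof
    fix y assume "y \<in> ?f ` {z\<in>HH. base z \<subseteq> R}"
    then obtain a b where z: "(a, b) \<in> HH" "base (a, b) \<subseteq> R" "y = (a - b + 1, a + b - 1)" by force
    have "a - b + 1 \<in> base (a, b)" "a + b - 1 \<in> base (a, b)"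
      using z(1) by (auto simp: base_iff HH_def)
    with z show "y \<in> R \<times> R" by auto
  qed
  ultimately show ?thesis using assms by (meson finite_SigmaI finite_imageD finite_subset)
qed

text \<open>All path points lie above the start, so their footprints meet \<open>R\<close>; while
  their values are in \<open>L\<close>, separation forces them to lie over \<open>R\<close>, where
  the view shows the same values. Hiding a rival neighbour only raises its value, so the comparison
  is decided in the same way.\<close>

lemma view_path_agree:
  assumes G: "fin_tableau G" and L: "lower_set L" and sep: "separated R L G"
    and ne: "supp G \<noteq> {}" and mp: "G (min_point G) \<in> L" "fst (min_point G) \<in> R"
  shows "min_point (view R L G) = min_point G"
    and "G (slide_path G m) \<in> L \<Longrightarrow> slide_path (view R L G) m = slide_path G m"
    and "G (slide_path G m) \<in> L \<Longrightarrow> base (slide_path G m) \<subseteq> R"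
proof -
  let ?V = "view R L G"
  note mpp = min_point_props[OF G ne]
  have mpH: "min_point G \<in> HH" using mpp(1) by (auto simp: supp_def)
  have mpr: "min_point G = (fst (min_point G), 1)" using mpp(3) by (metis prod.collapse)
  have bmp: "base (min_point G) = {fst (min_point G)}"
    using mpp(4) by (subst mpr) (auto simp: base_iff)
  have Vmp: "?V (min_point G) = G (min_point G)" using mp mpH bmp by (auto simp: view_def)
  show m0: "min_point ?V = min_point G"
  proof (rule min_point_unique[OF fin_tableau_view[OF G L] mpH])
    show "?V (min_point G) \<noteq> \<infinity>" unfolding Vmp using lower_setD(4)[OF L mp(1)] .
    show "?V (min_point G) \<le> ?V w" if "w \<in> HH" for w
      unfolding Vmp using mpp(2)[OF that] view_ge order_trans by blast
  qed
  show b: "base (slide_path G m) \<subseteq> R" if "G (slide_path G m) \<in> L" for m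
  proof -
    have "fst (min_point G) \<in> base (slide_path G m)"
      using base_mono[OF slide_path_ge_start[of G m]] bmp by auto
    with mp(2) sep that slide_path_HH[OF mpH, of m] show ?thesis unfolding separated_def by blast
  qed
  show "slide_path ?V m = slide_path G m" if "G (slide_path G m) \<in> L"
    using that
  proof (induction m)
    case (Suc m)
    have "G (slide_path G m) \<le> G (slide_path G (Suc m))"
      using fin_tableauD(4)[OF G _ _ slide_path_le] slide_path_HH[OF mpH] by blast
    then have IH: "slide_path ?V m = slide_path G m" using Suc lower_setD(1)[OF L] by blast
    have VG: "?V (slide_path G (Suc m)) = G (slide_path G (Suc m))"
      using b[OF Suc.prems] Suc.prems slide_path_HH[OF mpH, of "Suc m"] by (auto simp: view_def)
    let ?l = "(fst (slide_path G m) - 1, snd (slide_path G m) + 1)"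
    let ?r = "(fst (slide_path G m) + 1, snd (slide_path G m) + 1)"
    show ?case
    proof (cases "G ?l \<le> G ?r")
      case True
      then have e: "slide_path G (Suc m) = ?l" by (simp add: slide_path.simps(2))
      have "?V ?l \<le> ?V ?r" using VG order_trans[OF True view_ge[of G ?r R L]] unfolding e by simp
      then show ?thesis using e IH by (simp add: slide_path.simps(2))
    next
      case False
      then have e: "slide_path G (Suc m) = ?r" by (simp add: slide_path.simps(2))
      have "\<not> ?V ?l \<le> ?V ?r"
        using VG False order_trans[OF view_ge[of G ?l R L], of "G ?r"] unfolding e by auto
      then show ?thesis using e IH by (simp add: slide_path.simps(2))
    qed
  qed (simp add: m0)
qed

text \<open>The converse direction: if the next value on the path in the view is visible, then the
  value chosen by \<open>G\<close> is no larger and hence also in \<open>L\<close>, and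
  \<open>view_path_agree\<close> applies.\<close>

lemma view_path_agree':
  assumes G: "fin_tableau G" and L: "lower_set L" and sep: "separated R L G"
    and ne: "supp G \<noteq> {}" and mp: "G (min_point G) \<in> L" "fst (min_point G) \<in> R"
  shows "view R L G (slide_path (view R L G) m) \<noteq> \<infinity> \<Longrightarrow>
    slide_path (view R L G) m = slide_path G m \<and> G (slide_path G m) \<in> L"
proof (induction m)
  case 0
  then show ?case using view_path_agree(1)[OF assms] mp by simp
next
  case (Suc m)
  let ?V = "view R L G"
  have V: "fin_tableau ?V" using fin_tableau_view[OF G L] .
  have mpH: "min_point ?V \<in> HH" using min_point_props(1)[OF G ne] view_path_agree(1)[OF assms] by (auto simp: supp_def)
  have "?V (slide_path ?V m) \<le> ?V (slide_path ?V (Suc m))"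
    using fin_tableauD(4)[OF V _ _ slide_path_le] slide_path_HH[OF mpH] by blast
  then have "?V (slide_path ?V m) \<noteq> \<infinity>" using Suc.prems by (auto simp: top_unique)
  from Suc.IH[OF this] have IH: "slide_path ?V m = slide_path G m" by simp
  have "G (slide_path ?V (Suc m)) \<in> L" using Suc.prems view_def[of R L G "slide_path ?V (Suc m)"] by presburger
  moreover have "G (slide_path G (Suc m)) \<le> G (slide_path ?V (Suc m))"
    using slide_path_Suc_cases[of ?V m] slide_path_le_up[of G m] unfolding IH by metis
  ultimately have "G (slide_path G (Suc m)) \<in> L" using lower_setD(1)[OF L] by blast
  then show ?case using view_path_agree(2)[OF assms] by blast
qed

lemma view_slide_inside:
  assumes G: "fin_tableau G" and L: "lower_set L" and sep: "separated R L G"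
    and ne: "supp G \<noteq> {}" and mp: "G (min_point G) \<in> L" "fst (min_point G) \<in> R"
  shows "slide (view R L G) = view R L (slide G)"
proof
  fix z
  let ?V = "view R L G"
  have V: "fin_tableau ?V" using fin_tableau_view[OF G L] .
  have mpH: "min_point G \<in> HH" using min_point_props(1)[OF G ne] by (auto simp: supp_def)
  have neV: "supp ?V \<noteq> {}"
    using view_path_agree(3)[OF assms, of 0] mp mpH unfolding supp_view[OF L] by auto
  show "slide ?V z = view R L (slide G) z"
  proof (cases "?V z = \<infinity>")
    case True
    then have "slide ?V z = \<infinity>" using slide_ge[OF V neV, of z] by (auto simp: top_unique)
    moreover have "G z \<in> L" if "slide G z \<in> L"
      using slide_ge[OF G ne, of z] lower_setD(1)[OF L that] by blast
    then have "view R L (slide G) z = \<infinity>"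
      using True lower_setD(4)[OF L] by (auto simp: view_def split: if_splits)
    ultimately show ?thesis by simp
  next
    case False
    then have z: "z \<in> HH" "base z \<subseteq> R" "G z \<in> L" by (auto simp: view_def split: if_splits)
    show ?thesis
    proof (cases "\<exists>m. slide_path G m = z")
      case True
      then obtain m where m: "slide_path G m = z" by auto
      then have Vm: "slide_path ?V m = z" using view_path_agree(2)[OF assms, of m] z by auto
      have s: "slide G z = G (slide_path G (Suc m))" "slide ?V z = ?V (slide_path ?V (Suc m))"
        using slide_on[of G m] slide_on[of ?V m] by (simp_all only: m Vm)
      show ?thesis
      proof (cases "G (slide_path G (Suc m)) \<in> L")
        case True
        then show ?thesis using view_path_agree(2,3)[OF assms True] slide_path_HH[OF mpH, of "Suc m"] s z
          by (simp add: view_def)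
      next
        case False
        then have "?V (slide_path ?V (Suc m)) = \<infinity>" using view_path_agree'[OF assms, of "Suc m"] by blast
        then show ?thesis using s False by (simp add: view_def)
      qed
    next
      case off: False
      have "slide_path ?V m \<noteq> z" for m
        using view_path_agree'[OF assms, of m] False off by metis
      then have "slide ?V z = ?V z" by (rule slide_off)
      moreover have "slide G z = G z" using off by (intro slide_off) auto
      ultimately show ?thesis by (simp add: view_def)
    qed
  qed
qed

text \<open>A path starting outside \<open>R\<close> only visits cells whose footprint contains the
  start, and the view hides all of these.\<close>

lemma view_slide_outside:
  assumes G: "fin_tableau G" and L: "lower_set L"
    and ne: "supp G \<noteq> {}" and mp: "fst (min_point G) \<notin> R"
  shows "view R L G = view R L (slide G)"
proof
  fix z
  note mpp = min_point_props[OF G ne]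
  have mpr: "min_point G = (fst (min_point G), 1)" using mpp(3) by (metis prod.collapse)
  have bmp: "fst (min_point G) \<in> base (min_point G)"
    using mpp(4) by (subst (2) mpr) (auto simp: base_iff)
  show "view R L G z = view R L (slide G) z"
  proof (cases "base z \<subseteq> R")
    case True
    have "slide_path G m \<noteq> z" for m
      using base_mono[OF slide_path_ge_start[of G m]] bmp mp True by auto
    then have "slide G z = G z" by (rule slide_off)
    then show ?thesis by (simp add: view_def)
  qed (simp add: view_def)
qed

lemma separated_slide:
  assumes "fin_tableau G" "lower_set L" "separated R L G" "supp G \<noteq> {}"
  shows "separated R L (slide G)"
  using assms(3) slide_ge[OF assms(1,4)] lower_setD(1)[OF assms(2)] unfolding separated_def by blast

text \<open>Locality, by induction over slides. A slide from \<open>R\<close> at a level in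
  \<open>L\<close> commutes with hiding, one from outside \<open>R\<close> is invisible, and once
  the minimum leaves \<open>L\<close> no later swap has a time in \<open>L\<close>.\<close>

theorem sw_view:
  assumes "fin_tableau G" "lower_set L" "separated R L G"
  shows "sw (view R L G) = {(k, v) \<in> sw G. k \<in> R \<and> v \<in> L}"
  using assms(1,3)
proof (induction rule: fin_tableau_induct)
  case (empty G)
  then have "supp (view R L G) = {}" using assms(2) by (auto simp: supp_def view_def)
  then show ?case using empty by simp
next
  case (slide G)
  note IH = slide.IH[OF separated_slide[OF slide(1) assms(2) slide.prems slide(2)]]
  have V: "fin_tableau (view R L G)" using fin_tableau_view[OF slide(1) assms(2)] .
  note mpp = min_point_props[OF slide(1,2)]
  have mpH: "min_point G \<in> HH" using mpp(1) by (auto simp: supp_def)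
  show ?case
  proof (cases "G (min_point G) \<in> L")
    case False
    have out: "v \<notin> L" if "G (min_point G) \<le> v" for v
      using False lower_setD(1)[OF assms(2) _ that] by auto
    then have "supp (view R L G) = {}" unfolding supp_view[OF assms(2)] using mpp(2) by auto
    moreover have "v \<notin> L" if "(k, v) \<in> sw G" for k v using out sw_ge_min[OF slide(1,2) that] by auto
    ultimately show ?thesis by auto
  next
    case inL: True
    show ?thesis
    proof (cases "fst (min_point G) \<in> R")
      case True
      note a = slide(1) assms(2) slide.prems slide(2) inL True
      have "G (slide_path G 0) \<in> L" using inL by simp
      from view_path_agree(3)[OF a this] have "base (min_point G) \<subseteq> R" by simp
      then have in_supp: "min_point G \<in> supp (view R L G)" unfolding supp_view[OF assms(2)] using inL mpH by auto
      then have "sw (view R L G) = insert (fst (min_point G), view R L G (min_point G)) (sw (slide (view R L G)))"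
        using sw_rec[OF V] view_path_agree(1)[OF a] by auto
      also have "view R L G (min_point G) = G (min_point G)"
        using in_supp by (auto simp: supp_def view_def split: if_splits)
      also have "slide (view R L G) = view R L (slide G)" by (rule view_slide_inside[OF a])
      finally show ?thesis using IH sw_rec[OF slide(1,2)] True inL by auto
    next
      case False
      then show ?thesis using IH view_slide_outside[OF slide(1) assms(2) slide(2) False]
        sw_rec[OF slide(1,2)] by auto
    qed
  qed
qed

text \<open>Slides consult values only through comparisons. The map \<open>\<phi>\<close> has to
  respect the order only on a set \<open>A\<close> containing the values that occur, which admits
  maps such as truncated subtraction of 1; even translations preserve the lattice.\<close>

lemma shift_relabel_step:
  fixes \<phi> :: "ennreal \<Rightarrow> ennreal" and d :: int
  assumes G: "fin_tableau G" and d: "even d" and A: "range G \<subseteq> A" "\<infinity> \<in> A"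
    and \<phi>: "\<forall>a\<in>A. \<forall>b\<in>A. \<phi> a \<le> \<phi> b \<longleftrightarrow> a \<le> b" "\<phi> \<infinity> = \<infinity>"
  defines "G' \<equiv> \<lambda>z. \<phi> (G (fst z + d, snd z))"
  shows "fin_tableau G'" "supp G' = (\<lambda>z. (fst z - d, snd z)) ` supp G"
    "supp G \<noteq> {} \<Longrightarrow> min_point G' = (fst (min_point G) - d, snd (min_point G))"
    "supp G \<noteq> {} \<Longrightarrow> slide G' = (\<lambda>z. \<phi> (slide G (fst z + d, snd z)))"
proof -
  have GA: "G z \<in> A" for z using A by auto
  have le: "\<phi> (G z) \<le> \<phi> (G w) \<longleftrightarrow> G z \<le> G w" for z w
    using \<phi>(1) GA by blast
  have eq: "\<phi> (G z) = \<phi> (G w) \<longleftrightarrow> G z = G w" for z w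
    using le[of z w] le[of w z] by (metis order_antisym order_refl)
  have "\<infinity> \<le> \<phi> (G z) \<longleftrightarrow> \<infinity> \<le> G z" for z
    using \<phi> GA A(2) by metis
  then have inf: "\<phi> (G z) = \<infinity> \<longleftrightarrow> G z = \<infinity>" for z
    by (simp add: top_unique)
  note inf = inf inf[unfolded infinity_ennreal_def]
  have HHs: "(fst z + d, snd z) \<in> HH \<longleftrightarrow> z \<in> HH" for z
    using d by (auto simp: HH_def split: prod.splits)
  have HHs': "(fst z - d, snd z) \<in> HH \<longleftrightarrow> z \<in> HH" for z
    using d by (auto simp: HH_def split: prod.splits)
  show S: "supp G' = (\<lambda>z. (fst z - d, snd z)) ` supp G"
  proof -
    have "z \<in> supp G' \<longleftrightarrow> (fst z + d, snd z) \<in> supp G" for z by (simp add: supp_def G'_def HHs inf)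
    moreover have "(fst z + d, snd z) \<in> supp G \<longleftrightarrow> z \<in> (\<lambda>z. (fst z - d, snd z)) ` supp G" for z
      by (auto simp: image_iff prod_eq_iff intro!: bexI[of _ "(fst z + d, snd z)"])
    ultimately show ?thesis by blast
  qed
  show T: "fin_tableau G'"
    unfolding fin_tableau_def
  proof (intro conjI allI impI ballI)
    show "finite (supp G')" using S fin_tableauD(2)[OF G] by simp
    show "G' z = \<infinity>" if "z \<notin> HH" for z
      using fin_tableauD(1)[OF G, of "(fst z + d, snd z)"] that \<phi>(2) by (simp add: HHs G'_def)
    show "G' z \<le> G' w" if "z \<in> HH" "w \<in> HH" "le_H z w" for z w
      unfolding G'_def le by (rule fin_tableauD(4)[OF G]) (use that HHs in \<open>auto simp: le_H_def\<close>)
    show "inj_on G' (supp G')"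
    proof (rule inj_onI)
      fix z w assume a: "z \<in> supp G'" "w \<in> supp G'" "G' z = G' w"
      then have "(fst z + d, snd z) = (fst w + d, snd w)"
        using inj_onD[OF fin_tableauD(3)[OF G], of "(fst z + d, snd z)" "(fst w + d, snd w)"]
        by (auto simp: supp_def G'_def HHs inf eq)
      then show "z = w" by (auto simp: prod_eq_iff)
    qed
  qed
  assume ne: "supp G \<noteq> {}"
  note mpp = min_point_props[OF G ne]
  have mpH: "min_point G \<in> HH" using mpp(1) by (auto simp: supp_def)
  show mp: "min_point G' = (fst (min_point G) - d, snd (min_point G))"
  proof (rule min_point_unique[OF T])
    show "(fst (min_point G) - d, snd (min_point G)) \<in> HH" using mpH HHs' by auto
    show "G' (fst (min_point G) - d, snd (min_point G)) \<noteq> \<infinity>"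
      using mpp(1) inf by (auto simp: G'_def supp_def)
    show "G' (fst (min_point G) - d, snd (min_point G)) \<le> G' w" if "w \<in> HH" for w
      using mpp(2)[of "(fst w + d, snd w)"] HHs that by (auto simp: G'_def le)
  qed
  have path: "slide_path G' m = (fst (slide_path G m) - d, snd (slide_path G m))" for m
  proof (induction m)
    case (Suc m)
    let ?l = "(fst (slide_path G m) - 1, snd (slide_path G m) + 1)"
    let ?r = "(fst (slide_path G m) + 1, snd (slide_path G m) + 1)"
    have "G' (fst (slide_path G' m) - 1, snd (slide_path G' m) + 1) = \<phi> (G ?l)"
      "G' (fst (slide_path G' m) + 1, snd (slide_path G' m) + 1) = \<phi> (G ?r)"
      unfolding Suc by (simp_all add: G'_def algebra_simps)
    then show ?case unfolding slide_path.simps(2)[of G'] slide_path.simps(2)[of G] Let_def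
      by (simp only: le) (auto simp: Suc)
  qed (simp add: mp)
  show "slide G' = (\<lambda>z. \<phi> (slide G (fst z + d, snd z)))"
  proof
    fix z
    show "slide G' z = \<phi> (slide G (fst z + d, snd z))"
    proof (cases "\<exists>m. slide_path G' m = z")
      case True
      then obtain m where m: "z = slide_path G' m" by auto
      have "slide G' z = G' (slide_path G' (Suc m))" unfolding m slide_on ..
      also have "\<dots> = \<phi> (G (slide_path G (Suc m)))" unfolding path by (simp add: G'_def)
      also have "G (slide_path G (Suc m)) = slide G (fst z + d, snd z)" unfolding m path by (simp flip: slide_on)
      finally show ?thesis .
    next
      case False
      have "slide_path G m \<noteq> (fst z + d, snd z)" for m
      proof
        assume "slide_path G m = (fst z + d, snd z)"
        then have "slide_path G' m = z" unfolding path by simp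
        with False show False by auto
      qed
      then have "slide G (fst z + d, snd z) = G (fst z + d, snd z)" by (rule slide_off)
      moreover have "slide G' z = G' z" using False by (intro slide_off) auto
      ultimately show ?thesis by (simp add: G'_def)
    qed
  qed
qed

theorem sw_shift_relabel:
  fixes \<phi> :: "ennreal \<Rightarrow> ennreal" and d :: int
  assumes "fin_tableau G" "even d" "range G \<subseteq> A" "\<infinity> \<in> A"
    and \<phi>: "\<forall>a\<in>A. \<forall>b\<in>A. \<phi> a \<le> \<phi> b \<longleftrightarrow> a \<le> b" "\<phi> \<infinity> = \<infinity>"
  shows "sw (\<lambda>z. \<phi> (G (fst z + d, snd z))) = (\<lambda>(k, v). (k - d, \<phi> v)) ` sw G"
  using assms(1,3)
proof (induction rule: fin_tableau_induct)
  case (empty G)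
  then show ?case using shift_relabel_step(2)[OF empty(1) assms(2) empty(3) assms(4) \<phi>] by simp
next
  case (slide G)
  let ?G' = "\<lambda>z. \<phi> (G (fst z + d, snd z))"
  note st = shift_relabel_step[OF slide(1) assms(2) slide.prems assms(4) \<phi>]
  have "range (slide G) \<subseteq> A" using slide.prems by (auto simp: slide_eq_shift)
  note IH = slide.IH[OF this]
  have "sw ?G' = insert (fst (min_point ?G'), ?G' (min_point ?G')) (sw (slide ?G'))"
    using sw_rec[OF st(1)] st(2) slide(2) by simp
  also have "\<dots> = (\<lambda>(k, v). (k - d, \<phi> v)) ` sw G"
    unfolding sw_rec[OF slide(1,2)] st(4)[OF slide(2)] IH st(3)[OF slide(2)] by simp
  finally show ?case .
qed

text \<open>Footprints are intervals: one that meets the positions from \<open>a\<close> to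
  \<open>b\<close> without being inside contains \<open>a - 2\<close> or \<open>b + 2\<close>, and
  monotonicity then keeps the value of its cell out of \<open>L\<close>.\<close>

lemma separated_interval:
  fixes a b :: int
  assumes mono: "\<And>z w. z \<in> HH \<Longrightarrow> w \<in> HH \<Longrightarrow> le_H z w \<Longrightarrow> G z \<le> G w"
    and L: "lower_set L" and ab: "odd a" "odd b" and out: "G (a - 2, 1) \<notin> L" "G (b + 2, 1) \<notin> L"
  shows "separated {k. odd k \<and> a \<le> k \<and> k \<le> b} L G"
  unfolding separated_def
proof (intro ballI impI)
  fix z assume z: "z \<in> HH" "G z \<in> L"
  obtain p q where pq: "z = (p, q)" by (cases z)
  have notin: "k \<notin> base z" if "G (k, 1) \<notin> L" for k
    using mono[of "(k, 1)" z] z that lower_setD(1)[OF L z(2)] by (auto simp: base_def row_one_HH)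
  from notin[OF out(1)] notin[OF out(2)]
  have "\<not> (a - 1 \<le> p + q \<and> 3 - a \<le> q - p)" "\<not> (b + 3 \<le> p + q \<and> - 1 - b \<le> q - p)"
    using ab by (auto simp: pq base_iff)
  moreover have "even (p + q)" "1 \<le> q" using z by (auto simp: pq HH_def)
  ultimately show "base z \<subseteq> {k. odd k \<and> a \<le> k \<and> k \<le> b} \<or> base z \<inter> {k. odd k \<and> a \<le> k \<and> k \<le> b} = {}"
    using ab by (auto simp: pq base_iff elim!: oddE evenE)
qed

section \<open>The hook walk\<close>

definition young :: "(nat \<times> nat) set \<Rightarrow> bool" where
  "young D \<longleftrightarrow> finite D \<and> (\<forall>i j i' j'. (i, j) \<in> D \<longrightarrow> i' \<le> i \<longrightarrow> j' \<le> j \<longrightarrow> (i', j') \<in> D)"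

definition yhook :: "(nat \<times> nat) set \<Rightarrow> nat \<times> nat \<Rightarrow> (nat \<times> nat) set" where
  "yhook D w = {v \<in> D. (fst v = fst w \<and> snd w \<le> snd v) \<or> (snd v = snd w \<and> fst w \<le> fst v)}"

definition ycorners :: "(nat \<times> nat) set \<Rightarrow> (nat \<times> nat) set" where
  "ycorners D = {z \<in> D. yhook D z = {z}}"

definition yrev :: "(nat \<times> nat) set \<Rightarrow> nat \<times> nat \<Rightarrow> (nat \<times> nat) set" where
  "yrev D z = {w \<in> D - {z}. z \<in> yhook D w}"

lemma youngD: "young D \<Longrightarrow> (i, j) \<in> D \<Longrightarrow> i' \<le> i \<Longrightarrow> j' \<le> j \<Longrightarrow> (i', j') \<in> D"
  by (auto simp: young_def)

lemma down_closed_nat_set: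
  fixes S :: "nat set"
  assumes "finite S" "\<And>i j. i \<in> S \<Longrightarrow> j \<le> i \<Longrightarrow> j \<in> S"
  shows "S = {..<card S}"
proof -
  have "\<exists>n. S = {..<n}"
  proof (cases "S = {}")
    case False
    have "x \<in> S \<longleftrightarrow> x < Suc (Max S)" for x
      using assms(2)[OF Max_in[OF assms(1) False], of x] Max_ge[OF assms(1), of x] by (auto simp: less_Suc_eq_le)
    then have "S = {..<Suc (Max S)}" by blast
    then show ?thesis by blast
  qed auto
  then show ?thesis by auto
qed

definition rlen :: "(nat \<times> nat) set \<Rightarrow> nat \<Rightarrow> nat" where "rlen D i = card {j. (i, j) \<in> D}"
definition clen :: "(nat \<times> nat) set \<Rightarrow> nat \<Rightarrow> nat" where "clen D j = card {i. (i, j) \<in> D}"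

lemma rlen_iff: assumes "young D" shows "(i, j) \<in> D \<longleftrightarrow> j < rlen D i"
proof -
  have "{j. (i, j) \<in> D} \<subseteq> snd ` D" by force
  then have "finite {j. (i, j) \<in> D}" using assms by (auto simp: young_def intro: finite_subset)
  then have "{j. (i, j) \<in> D} = {..<rlen D i}"
    unfolding rlen_def by (rule down_closed_nat_set) (use assms in \<open>auto intro: youngD\<close>)
  then show ?thesis by blast
qed

lemma clen_iff: assumes "young D" shows "(i, j) \<in> D \<longleftrightarrow> i < clen D j"
proof -
  have "{i. (i, j) \<in> D} \<subseteq> fst ` D" by force
  then have "finite {i. (i, j) \<in> D}" using assms by (auto simp: young_def intro: finite_subset)
  then have "{i. (i, j) \<in> D} = {..<clen D j}"
    unfolding clen_def by (rule down_closed_nat_set) (use assms in \<open>auto intro: youngD\<close>)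
  then show ?thesis by blast
qed

lemma yhook_eq:
  assumes "young D" "(a, b) \<in> D"
  shows "yhook D (a, b) = (\<lambda>i. (i, b)) ` {a<..<clen D b} \<union> (\<lambda>j. (a, j)) ` {b<..<rlen D a} \<union> {(a, b)}"
  using assms by (auto simp: yhook_def rlen_iff[OF assms(1), symmetric] clen_iff[OF assms(1), symmetric])

lemma sum_yhook:
  fixes f :: "nat \<times> nat \<Rightarrow> real"
  assumes "young D" "(a, b) \<in> D"
  shows "(\<Sum>w\<in>yhook D (a, b) - {(a, b)}. f w) =
    (\<Sum>i\<in>{a<..<clen D b}. f (i, b)) + (\<Sum>j\<in>{b<..<rlen D a}. f (a, j))"
proof -
  have "yhook D (a, b) - {(a, b)} = (\<lambda>i. (i, b)) ` {a<..<clen D b} \<union> (\<lambda>j. (a, j)) ` {b<..<rlen D a}"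
    unfolding yhook_eq[OF assms] by auto
  moreover have "(\<lambda>i. (i, b)) ` {a<..<clen D b} \<inter> (\<lambda>j. (a, j)) ` {b<..<rlen D a} = {}" by auto
  ultimately show ?thesis by (simp add: sum.union_disjoint sum.reindex inj_on_def)
qed

lemma finite_yhook: "young D \<Longrightarrow> finite (yhook D w)"
  by (auto simp: young_def yhook_def)

lemma yhook_self: "w \<in> D \<Longrightarrow> w \<in> yhook D w"
  by (simp add: yhook_def)

text \<open>Arm length plus leg length; it is \<open>h - 1\<close>, not \<open>h\<close>, that is
  additive in the way the hook walk needs.\<close>

lemma card_yhook:
  assumes "young D" "(a, b) \<in> D"
  shows "real (card (yhook D (a, b))) - 1 = real (clen D b) - real a - 1 + (real (rlen D a) - real b - 1)"
proof -
  have "real (card (yhook D (a, b))) - 1 = real (card (yhook D (a, b) - {(a, b)}))"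
    using yhook_self[OF assms(2)] finite_yhook[OF assms(1)] card_gt_0_iff[of "yhook D (a, b)"]
    by (auto simp: card_Diff_singleton of_nat_diff)
  also have "\<dots> = (\<Sum>w\<in>yhook D (a, b) - {(a, b)}. 1)" by simp
  also have "\<dots> = real (clen D b - a - 1) + real (rlen D a - b - 1)"
    unfolding sum_yhook[OF assms] by simp
  finally show ?thesis
    using rlen_iff[OF assms(1), of a b] clen_iff[OF assms(1), of a b] assms(2) by linarith
qed

lemma ycorner_len:
  assumes "young D" "(\<alpha>, \<beta>) \<in> ycorners D"
  shows "clen D \<beta> = Suc \<alpha>" "rlen D \<alpha> = Suc \<beta>"
proof -
  have in_D: "(\<alpha>, \<beta>) \<in> D" and h: "yhook D (\<alpha>, \<beta>) = {(\<alpha>, \<beta>)}" using assms by (auto simp: ycorners_def)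
  have "(Suc \<alpha>, \<beta>) \<notin> yhook D (\<alpha>, \<beta>)" "(\<alpha>, Suc \<beta>) \<notin> yhook D (\<alpha>, \<beta>)"
    unfolding h by auto
  then have "(Suc \<alpha>, \<beta>) \<notin> D" "(\<alpha>, Suc \<beta>) \<notin> D" by (auto simp: yhook_def)
  then show "clen D \<beta> = Suc \<alpha>" "rlen D \<alpha> = Suc \<beta>"
    using in_D rlen_iff[OF assms(1)] clen_iff[OF assms(1)] by (metis less_Suc_eq not_less_eq linorder_neqE_nat)+
qed

text \<open>The probability that the hook walk from \<open>(a, b)\<close> ends in the corner \<open>(\<alpha>, \<beta>)\<close> factorises into
  a function of \<open>a\<close> and a function of \<open>b\<close>, because
  \<open>h (a, b) - 1 = (h (a, \<beta>) - 1) + (h (\<alpha>, b) - 1)\<close>.\<close>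

definition tail_prod :: "(nat \<Rightarrow> real) \<Rightarrow> nat \<Rightarrow> nat \<Rightarrow> real" where
  "tail_prod x \<alpha> a = (\<Prod>i\<in>{a..<\<alpha>}. 1 + x i)"

text \<open>Expanding \<open>tail_prod\<close> gives one term for each set of rows that the walk may
  visit on its way to row \<open>\<alpha>\<close>; collected here are the terms whose first row is
  \<open>a\<close>. The final row itself has weight 1.\<close>

definition tail_diff :: "(nat \<Rightarrow> real) \<Rightarrow> nat \<Rightarrow> nat \<Rightarrow> real" where
  "tail_diff x \<alpha> a = (if a < \<alpha> then x a * tail_prod x \<alpha> (Suc a) else of_bool (a = \<alpha>))"

lemma tail_prod_Suc: "a < \<alpha> \<Longrightarrow> tail_prod x \<alpha> a = (1 + x a) * tail_prod x \<alpha> (Suc a)"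
  unfolding tail_prod_def by (subst prod.atLeast_Suc_lessThan) auto

lemma sum_tail_diff: "a \<le> \<alpha> \<Longrightarrow> (\<Sum>i\<in>{a..\<alpha>}. tail_diff x \<alpha> i) = tail_prod x \<alpha> a"
proof (induction "\<alpha> - a" arbitrary: a)
  case 0
  then show ?case by (simp add: tail_diff_def tail_prod_def)
next
  case (Suc d)
  then have "a < \<alpha>" by simp
  then have "(\<Sum>i\<in>{a..\<alpha>}. tail_diff x \<alpha> i) = tail_diff x \<alpha> a + (\<Sum>i\<in>{Suc a..\<alpha>}. tail_diff x \<alpha> i)"
    by (subst sum.atLeast_Suc_atMost) auto
  also have "(\<Sum>i\<in>{Suc a..\<alpha>}. tail_diff x \<alpha> i) = tail_prod x \<alpha> (Suc a)"
    using Suc by (intro Suc.hyps(1)) auto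
  finally show ?case using \<open>a < \<alpha>\<close> by (simp add: tail_prod_Suc tail_diff_def algebra_simps)
qed

lemma sum_tail_diff_beyond:
  assumes "\<alpha> < l"
  shows "(\<Sum>i\<in>{a<..<l}. tail_diff x \<alpha> i) = (if a < \<alpha> then tail_prod x \<alpha> (Suc a) else 0)"
proof -
  have "(\<Sum>i\<in>{a<..<l}. tail_diff x \<alpha> i) = (\<Sum>i\<in>{Suc a..\<alpha>}. tail_diff x \<alpha> i)"
    by (rule sum.mono_neutral_right) (use assms in \<open>auto simp: tail_diff_def\<close>)
  then show ?thesis using sum_tail_diff[of "Suc a" \<alpha> x] by auto
qed

definition walk :: "(nat \<times> nat) set \<Rightarrow> nat \<times> nat \<Rightarrow> nat \<times> nat \<Rightarrow> real" where
  "walk D z w =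
     tail_diff (\<lambda>i. 1 / (real (card (yhook D (i, snd z))) - 1)) (fst z) (fst w) *
     tail_diff (\<lambda>j. 1 / (real (card (yhook D (fst z, j))) - 1)) (snd z) (snd w)"

text \<open>Harmonicity for the walk that jumps uniformly within the hook. The row factors of all
  later rows sum to \<open>h (a, \<beta>) - 1\<close> times the factor of row \<open>a\<close>,
  likewise for columns, and additivity of \<open>h - 1\<close> combines the two. For
  \<open>a = \<alpha>\<close> or \<open>b = \<beta>\<close> the corresponding term is 0 on both
  sides.\<close>

lemma walk_step:
  assumes "young D" "z \<in> ycorners D" "w \<in> D" "w \<noteq> z"
  shows "(real (card (yhook D w)) - 1) * walk D z w = (\<Sum>v\<in>yhook D w - {w}. walk D z v)"
proof -
  obtain \<alpha> \<beta> where z: "z = (\<alpha>, \<beta>)" by (cases z)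
  obtain a b where w: "w = (a, b)" by (cases w)
  define x where "x = (\<lambda>i. 1 / (real (card (yhook D (i, \<beta>))) - 1))"
  define y where "y = (\<lambda>j. 1 / (real (card (yhook D (\<alpha>, j))) - 1))"
  define U where "U = tail_diff x \<alpha>"
  define V where "V = tail_diff y \<beta>"
  have W: "walk D z (i, j) = U i * V j" for i j by (simp add: walk_def z U_def V_def x_def y_def)
  have len: "clen D \<beta> = Suc \<alpha>" "rlen D \<alpha> = Suc \<beta>" using ycorner_len[OF assms(1)] assms(2) z by auto
  have zD: "(\<alpha>, \<beta>) \<in> D" using assms(2) by (auto simp: ycorners_def z)
  have wD: "(a, b) \<in> D" using assms(3) w by simp
  have S: "(\<Sum>v\<in>yhook D w - {w}. walk D z v) = (\<Sum>i\<in>{a<..<clen D b}. U i) * V b + U a * (\<Sum>j\<in>{b<..<rlen D a}. V j)"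
    unfolding w sum_yhook[OF assms(1) wD] W by (simp add: sum_distrib_left sum_distrib_right)
  have zU: "U i = 0" if "i > \<alpha>" for i using that by (simp add: U_def tail_diff_def)
  have zV: "V i = 0" if "i > \<beta>" for i using that by (simp add: V_def tail_diff_def)
  show ?thesis
  proof (cases "a \<le> \<alpha> \<and> b \<le> \<beta>")
    case False
    then consider "a > \<alpha>" | "b > \<beta>" by linarith
    then show ?thesis
    proof cases
      case 1
      then have "(\<Sum>i\<in>{a<..<clen D b}. U i) = 0" by (intro sum.neutral) (auto simp: zU)
      then show ?thesis unfolding S unfolding w W using zU[OF 1] by simp
    next
      case 2
      then have "(\<Sum>i\<in>{b<..<rlen D a}. V i) = 0" by (intro sum.neutral) (auto simp: zV)
      then show ?thesis unfolding S unfolding w W using zV[OF 2] by simp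
    qed
  next
    case True
    have cb: "\<alpha> < clen D b" "\<beta> < rlen D a"
      using True youngD[OF assms(1) zD] by (simp_all flip: clen_iff[OF assms(1)] rlen_iff[OF assms(1)])
    have h: "real (card (yhook D w)) - 1 = (real (card (yhook D (a, \<beta>))) - 1) + (real (card (yhook D (\<alpha>, b))) - 1)"
      using card_yhook[OF assms(1) wD] card_yhook[OF assms(1), of a \<beta>] card_yhook[OF assms(1), of \<alpha> b]
        youngD[OF assms(1) zD] True len w by auto
    have posU: "real (card (yhook D (a, \<beta>))) - 1 > 0" if "a < \<alpha>"
      using card_yhook[OF assms(1), of a \<beta>] youngD[OF assms(1) zD, of a \<beta>] that len cb by simp
    have posV: "real (card (yhook D (\<alpha>, b))) - 1 > 0" if "b < \<beta>"
      using card_yhook[OF assms(1), of \<alpha> b] youngD[OF assms(1) zD, of \<alpha> b] that len cb by simp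
    have zeroU: "real (card (yhook D (\<alpha>, b))) - 1 = 0" if "b = \<beta>"
      using card_yhook[OF assms(1), of \<alpha> b] zD that len by simp
    have zeroV: "real (card (yhook D (a, \<beta>))) - 1 = 0" if "a = \<alpha>"
      using card_yhook[OF assms(1), of a \<beta>] zD that len by simp
    have SU: "(\<Sum>i\<in>{a<..<clen D b}. U i) = (real (card (yhook D (a, \<beta>))) - 1) * U a"
      unfolding U_def sum_tail_diff_beyond[OF cb(1)]
      using True posU zeroV by (cases "a < \<alpha>") (auto simp: tail_diff_def x_def)
    have SV: "(\<Sum>i\<in>{b<..<rlen D a}. V i) = (real (card (yhook D (\<alpha>, b))) - 1) * V b"
      unfolding V_def sum_tail_diff_beyond[OF cb(2)]
      using True posV zeroU by (cases "b < \<beta>") (auto simp: tail_diff_def y_def)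
    show ?thesis unfolding S SU SV h unfolding w W by (simp add: algebra_simps)
  qed
qed

text \<open>Different corners are incomparable, so one coordinate overshoots and the factor
  belonging to it vanishes.\<close>

lemma walk_corner:
  assumes "young D" "z \<in> ycorners D" "w \<in> ycorners D"
  shows "walk D z w = of_bool (w = z)"
proof (cases "w = z")
  case True
  then show ?thesis by (simp add: walk_def tail_diff_def)
next
  case False
  obtain \<alpha> \<beta> where z: "z = (\<alpha>, \<beta>)" by (cases z)
  obtain a b where w: "w = (a, b)" by (cases w)
  have zD: "(\<alpha>, \<beta>) \<in> D" using assms by (auto simp: ycorners_def z w)
  have "\<not> (a \<le> \<alpha> \<and> b \<le> \<beta>)"
  proof
    assume le: "a \<le> \<alpha> \<and> b \<le> \<beta>"
    then have "(a, \<beta>) \<in> D" "(\<alpha>, b) \<in> D" using youngD[OF assms(1) zD] by auto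
    then have "\<alpha> < Suc a" "\<beta> < Suc b"
      using ycorner_len[OF assms(1)] assms(3) clen_iff[OF assms(1)] rlen_iff[OF assms(1)] unfolding w by metis+
    then show False using le False z w by auto
  qed
  then show ?thesis using False by (auto simp: walk_def tail_diff_def z w)
qed

text \<open>From every cell the walk ends in some corner: all cells of a hook other than its head
  have smaller hooks, so the claim follows from harmonicity by induction on the hook length.\<close>

lemma sum_walk:
  assumes "young D" "w \<in> D"
  shows "(\<Sum>z\<in>ycorners D. walk D z w) = 1"
  using assms(2)
proof (induction "card (yhook D w)" arbitrary: w rule: less_induct)
  case less
  have fc: "finite (ycorners D)" using assms by (auto simp: ycorners_def young_def)
  show ?case
  proof (cases "w \<in> ycorners D")
    case True
    have "(\<Sum>z\<in>ycorners D. walk D z w) = (\<Sum>z\<in>ycorners D. of_bool (w = z))"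
      using walk_corner[OF assms(1) _ True] by simp
    then show ?thesis using fc True by (simp add: of_bool_def)
  next
    case False
    obtain a b where w: "w = (a, b)" by (cases w)
    have "card (yhook D v) < card (yhook D w)" if v: "v \<in> yhook D w - {w}" for v
    proof -
      obtain i j where ij: "v = (i, j)" by (cases v)
      have vD: "(i, j) \<in> D" using v ij by (auto simp: yhook_def)
      have "i \<ge> a" "j \<ge> b" "i > a \<or> j > b" using v by (auto simp: yhook_def ij w)
      moreover have "clen D j \<le> clen D b"
        using youngD[OF assms(1)] \<open>j \<ge> b\<close> clen_iff[OF assms(1)] by (metis le_refl not_less)
      moreover have "rlen D i \<le> rlen D a"
        using youngD[OF assms(1)] \<open>i \<ge> a\<close> rlen_iff[OF assms(1)] by (metis le_refl not_less)
      ultimately have "real (card (yhook D v)) < real (card (yhook D w))"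
        using card_yhook[OF assms(1) vD] card_yhook[OF assms(1) less.prems[unfolded w]] by (auto simp: ij w)
      then show ?thesis by simp
    qed
    then have one: "(\<Sum>z\<in>ycorners D. walk D z v) = 1" if "v \<in> yhook D w - {w}" for v
      using less.hyps that by (auto simp: yhook_def)
    have fin: "finite (yhook D w)" using finite_yhook[OF assms(1)] .
    have self: "w \<in> yhook D w" using less.prems by (rule yhook_self)
    have "yhook D w - {w} \<noteq> {}" using False less.prems self by (auto simp: ycorners_def)
    then have pos: "card (yhook D w - {w}) > 0" using fin by (simp add: card_gt_0_iff)
    have cardm: "real (card (yhook D w)) - 1 = real (card (yhook D w - {w}))"
      using self fin pos by (simp add: card_Diff_singleton of_nat_diff)
    have "(real (card (yhook D w)) - 1) * (\<Sum>z\<in>ycorners D. walk D z w)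
        = (\<Sum>z\<in>ycorners D. \<Sum>v\<in>yhook D w - {w}. walk D z v)"
      unfolding sum_distrib_left by (rule sum.cong) (use walk_step[OF assms(1) _ less.prems] False in auto)
    also have "\<dots> = (\<Sum>v\<in>yhook D w - {w}. \<Sum>z\<in>ycorners D. walk D z v)" by (rule sum.swap)
    also have "\<dots> = real (card (yhook D w)) - 1" unfolding cardm using one by simp
    finally show ?thesis using pos cardm by simp
  qed
qed

text \<open>Summing over the starting cell separates into rows times columns, each sum being a full
  \<open>tail_prod\<close>, whose factors \<open>1 + 1 / (h - 1)\<close> are the ratios
  \<open>h / (h - 1)\<close>. Cells beyond the corner in either coordinate contribute 0.\<close>

lemma sum_walk_start:
  assumes "young D" "z \<in> ycorners D"
  shows "(\<Sum>w\<in>D. walk D z w) = (\<Prod>w\<in>yrev D z. real (card (yhook D w)) / (real (card (yhook D w)) - 1))"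
proof -
  obtain \<alpha> \<beta> where z: "z = (\<alpha>, \<beta>)" by (cases z)
  define x where "x = (\<lambda>i. 1 / (real (card (yhook D (i, \<beta>))) - 1))"
  define y where "y = (\<lambda>j. 1 / (real (card (yhook D (\<alpha>, j))) - 1))"
  have len: "clen D \<beta> = Suc \<alpha>" "rlen D \<alpha> = Suc \<beta>" using ycorner_len[OF assms(1)] assms(2) z by auto
  have zD: "(\<alpha>, \<beta>) \<in> D" using assms(2) by (auto simp: ycorners_def z)
  have fD: "finite D" using assms(1) by (simp add: young_def)
  have "(\<Sum>w\<in>D. walk D z w) = (\<Sum>w\<in>{0..\<alpha>} \<times> {0..\<beta>}. walk D z w)"
  proof (rule sum.mono_neutral_right[OF fD])
    show "{0..\<alpha>} \<times> {0..\<beta>} \<subseteq> D" using youngD[OF assms(1) zD] by auto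
  qed (auto simp: walk_def tail_diff_def z)
  also have "\<dots> = (\<Sum>i\<in>{0..\<alpha>}. tail_diff x \<alpha> i) * (\<Sum>j\<in>{0..\<beta>}. tail_diff y \<beta> j)"
    unfolding sum_product sum.cartesian_product by (rule sum.cong) (auto simp: walk_def z x_def y_def)
  also have "\<dots> = tail_prod x \<alpha> 0 * tail_prod y \<beta> 0" by (simp add: sum_tail_diff)
  also have "tail_prod x \<alpha> 0 = (\<Prod>i\<in>{0..<\<alpha>}. real (card (yhook D (i, \<beta>))) / (real (card (yhook D (i, \<beta>))) - 1))"
    unfolding tail_prod_def
  proof (rule prod.cong[OF refl])
    fix i assume i: "i \<in> {0..<\<alpha>}"
    have "real (card (yhook D (i, \<beta>))) - 1 > 0"
      using card_yhook[OF assms(1), of i \<beta>] youngD[OF assms(1) zD, of i \<beta>] i len rlen_iff[OF assms(1), of i \<beta>] by simp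
    then show "1 + x i = real (card (yhook D (i, \<beta>))) / (real (card (yhook D (i, \<beta>))) - 1)"
      by (simp add: x_def field_simps)
  qed
  also have "tail_prod y \<beta> 0 = (\<Prod>i\<in>{0..<\<beta>}. real (card (yhook D (\<alpha>, i))) / (real (card (yhook D (\<alpha>, i))) - 1))"
    unfolding tail_prod_def
  proof (rule prod.cong[OF refl])
    fix i assume i: "i \<in> {0..<\<beta>}"
    have "real (card (yhook D (\<alpha>, i))) - 1 > 0"
      using card_yhook[OF assms(1), of \<alpha> i] youngD[OF assms(1) zD, of \<alpha> i] i len clen_iff[OF assms(1), of \<alpha> i] by simp
    then show "1 + y i = real (card (yhook D (\<alpha>, i))) / (real (card (yhook D (\<alpha>, i))) - 1)"
      by (simp add: y_def field_simps)
  qed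
  also have "yrev D z = (\<lambda>i. (i, \<beta>)) ` {0..<\<alpha>} \<union> (\<lambda>j. (\<alpha>, j)) ` {0..<\<beta>}"
  proof -
    have "(\<lambda>i. (i, \<beta>)) ` {0..<\<alpha>} \<union> (\<lambda>j. (\<alpha>, j)) ` {0..<\<beta>} \<subseteq> D"
      using youngD[OF assms(1) zD] by auto
    then show ?thesis using zD by (auto simp: yrev_def yhook_def z)
  qed
  then have "(\<Prod>w\<in>yrev D z. real (card (yhook D w)) / (real (card (yhook D w)) - 1)) =
     (\<Prod>i\<in>{0..<\<alpha>}. real (card (yhook D (i, \<beta>))) / (real (card (yhook D (i, \<beta>))) - 1)) *
     (\<Prod>i\<in>{0..<\<beta>}. real (card (yhook D (\<alpha>, i))) / (real (card (yhook D (\<alpha>, i))) - 1))"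
    by (subst \<open>yrev D z = _\<close>, subst prod.union_disjoint) (auto simp: prod.reindex inj_on_def)
  ultimately show ?thesis by simp
qed

theorem sum_ycorners:
  assumes "young D"
  shows "(\<Sum>z\<in>ycorners D. \<Prod>w\<in>yrev D z. real (card (yhook D w)) / (real (card (yhook D w)) - 1)) = real (card D)"
proof -
  have "(\<Sum>z\<in>ycorners D. \<Prod>w\<in>yrev D z. real (card (yhook D w)) / (real (card (yhook D w)) - 1))
      = (\<Sum>z\<in>ycorners D. \<Sum>w\<in>D. walk D z w)"
    using sum_walk_start[OF assms] by simp
  also have "\<dots> = (\<Sum>w\<in>D. \<Sum>z\<in>ycorners D. walk D z w)" by (rule sum.swap)
  also have "\<dots> = real (card D)" using sum_walk[OF assms] by simp
  finally show ?thesis .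
qed

section \<open>Uniform linear extensions\<close>

text \<open>Coordinates that turn the triangle upside down, so that its upward closed subsets become Young
  diagrams.\<close>

definition cell :: "int \<Rightarrow> nat \<Rightarrow> nat \<times> nat \<Rightarrow> int \<times> int" where
  "cell c n w = (c - int (fst w) + int (snd w), int n - 1 - int (fst w) - int (snd w))"

definition up_closed :: "int \<Rightarrow> nat \<Rightarrow> (int \<times> int) set \<Rightarrow> bool" where
  "up_closed c n B \<longleftrightarrow> B \<subseteq> TT c n \<and> (\<forall>z\<in>B. \<forall>w\<in>TT c n. le_H z w \<longrightarrow> w \<in> B)"

lemma inj_cell: "inj (cell c n)"
  by (auto simp: inj_def cell_def prod_eq_iff)

lemma cell_in_TT: "odd (c + int n) \<Longrightarrow> cell c n (i, j) \<in> TT c n \<longleftrightarrow> i + j + 2 \<le> n"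
  by (auto simp: cell_def TT_def HH_def le_H_def)

lemma TT_cell:
  assumes "odd (c + int n)" "z \<in> TT c n"
  obtains i j where "z = cell c n (i, j)" "i + j + 2 \<le> n"
proof -
  obtain x y where z: "z = (x, y)" by (cases z)
  have h: "even (x + y)" "x + y \<le> c + int n - 1" "y - x \<le> int n - 1 - c" "1 \<le> y"
    using assms(2) by (auto simp: TT_def HH_def le_H_def z)
  define i where "i = nat ((c + int n - 1 - x - y) div 2)"
  define j where "j = nat ((int n - 1 - c - y + x) div 2)"
  have e: "even (c + int n - 1 - x - y)" "even (int n - 1 - c - y + x)" using assms(1) h(1) by auto
  have "2 * int i = c + int n - 1 - x - y" "2 * int j = int n - 1 - c - y + x"
    using h e by (auto simp: i_def j_def)
  then have "z = cell c n (i, j)" "i + j + 2 \<le> n" using h(4) by (auto simp: z cell_def)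
  then show ?thesis by (rule that)
qed

lemma finite_TT: "odd (c + int n) \<Longrightarrow> finite (TT c n)"
proof -
  assume o: "odd (c + int n)"
  have "TT c n \<subseteq> cell c n ` ({..n} \<times> {..n})"
  proof
    fix z assume "z \<in> TT c n"
    then obtain i j where "z = cell c n (i, j)" "i + j + 2 \<le> n" by (rule TT_cell[OF o])
    then show "z \<in> cell c n ` ({..n} \<times> {..n})" by auto
  qed
  then show ?thesis by (rule finite_subset) auto
qed

lemma TT_HH: "TT c n \<subseteq> HH" by (auto simp: TT_def)

lemma up_closedD: "up_closed c n B \<Longrightarrow> B \<subseteq> TT c n"
  "up_closed c n B \<Longrightarrow> z \<in> B \<Longrightarrow> w \<in> TT c n \<Longrightarrow> le_H z w \<Longrightarrow> w \<in> B"
  by (auto simp: up_closed_def)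

lemma up_closed_TT: "up_closed c n (TT c n)" by (auto simp: up_closed_def)

lemma up_closed_cell:
  assumes "odd (c + int n)" "up_closed c n B"
  obtains D where "young D" "B = cell c n ` D"
proof
  let ?D = "{w. cell c n w \<in> B}"
  show "B = cell c n ` ?D" 
  proof (intro equalityI subsetI)
    fix z assume z: "z \<in> B"
    then have "z \<in> TT c n" using up_closedD(1)[OF assms(2)] by blast
    then obtain i j where "z = cell c n (i, j)" by (rule TT_cell[OF assms(1)])
    then show "z \<in> cell c n ` ?D" using z by blast
  qed blast
  have "finite B" using finite_TT[OF assms(1)] up_closedD(1)[OF assms(2)] finite_subset by blast
  then have "finite ?D" using finite_vimageI[OF _ inj_cell] by (auto simp: vimage_def)
  moreover have "cell c n (i', j') \<in> B" if "cell c n (i, j) \<in> B" "i' \<le> i" "j' \<le> j" for i j i' j'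
  proof (rule up_closedD(2)[OF assms(2) that(1)])
    have "i + j + 2 \<le> n" using that(1) up_closedD(1)[OF assms(2)] cell_in_TT[OF assms(1)] by blast
    then show "cell c n (i', j') \<in> TT c n" using that cell_in_TT[OF assms(1)] by auto
    show "le_H (cell c n (i, j)) (cell c n (i', j'))" using that by (auto simp: le_H_def cell_def)
  qed
  ultimately show "young ?D" unfolding young_def by blast
qed

lemma hook_cell:
  "hook (cell c n ` D) (cell c n w) = cell c n ` yhook D w"
proof (intro set_eqI iffI)
  fix v assume "v \<in> hook (cell c n ` D) (cell c n w)"
  then obtain u k where u: "u \<in> D" "v = cell c n u" "k \<ge> 0"
    "v = (fst (cell c n w) + k, snd (cell c n w) - k) \<or> v = (fst (cell c n w) - k, snd (cell c n w) - k)"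
    by (auto simp: hook_def)
  then have "(fst u = fst w \<and> snd w \<le> snd u) \<or> (snd u = snd w \<and> fst w \<le> fst u)"
    by (auto simp: cell_def)
  then show "v \<in> cell c n ` yhook D w" using u by (auto simp: yhook_def)
next
  fix v assume "v \<in> cell c n ` yhook D w"
  then obtain u where u: "u \<in> D" "v = cell c n u"
    "(fst u = fst w \<and> snd w \<le> snd u) \<or> (snd u = snd w \<and> fst w \<le> fst u)" by (auto simp: yhook_def)
  let ?k = "int (fst u) - int (fst w) + (int (snd u) - int (snd w))"
  have "?k \<ge> 0" "v = (fst (cell c n w) + ?k, snd (cell c n w) - ?k) \<or> v = (fst (cell c n w) - ?k, snd (cell c n w) - ?k)"
    using u by (auto simp: cell_def)
  then show "v \<in> hook (cell c n ` D) (cell c n w)" using u by (auto simp: hook_def)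
qed

lemma corners_cell: "corners (cell c n ` D) = cell c n ` ycorners D"
proof -
  have "cell c n ` X = {cell c n z} \<longleftrightarrow> X = {z}" for X z
    using inj_image_eq_iff[OF inj_cell, of c n X "{z}"] by simp
  then have "cell c n z \<in> corners (cell c n ` D) \<longleftrightarrow> z \<in> ycorners D" for z
    by (simp add: corners_def ycorners_def hook_cell inj_image_mem_iff[OF inj_cell])
  moreover have "corners (cell c n ` D) \<subseteq> cell c n ` D" "ycorners D \<subseteq> D" by (auto simp: corners_def ycorners_def)
  ultimately show ?thesis by blast
qed

lemma hook_prob_cell:
  "hook_prob (cell c n ` D) (cell c n z) =
   1 / real (card D) * (\<Prod>w\<in>yrev D z. real (card (yhook D w)) / (real (card (yhook D w)) - 1))"
proof -
  have inj: "inj_on (cell c n) X" for X using inj_cell inj_on_subset by blast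
  have "rev_hook (cell c n ` D) (cell c n z) = cell c n ` yrev D z"
    by (auto simp: rev_hook_def yrev_def hook_cell inj_image_mem_iff[OF inj_cell] inj_eq[OF inj_cell])
  then show ?thesis
    by (simp add: hook_prob_def prod.reindex[OF inj] card_image[OF inj] hook_cell)
qed

theorem sum_hook_prob:
  assumes "odd (c + int n)" "up_closed c n B" "B \<noteq> {}"
  shows "(\<Sum>z\<in>corners B. hook_prob B z) = 1"
proof -
  obtain D where D: "young D" "B = cell c n ` D" using up_closed_cell[OF assms(1,2)] .
  have "D \<noteq> {}" "finite D" using D assms(3) by (auto simp: young_def)
  then have pos: "real (card D) > 0" by (simp add: card_gt_0_iff)
  have "inj_on (cell c n) (ycorners D)" using inj_cell inj_on_subset by blast
  then have "(\<Sum>z\<in>corners B. hook_prob B z) = (\<Sum>z\<in>ycorners D. hook_prob B (cell c n z))"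
    by (simp add: D(2) corners_cell sum.reindex)
  also have "\<dots> = 1 / real (card D) * (\<Sum>z\<in>ycorners D. \<Prod>w\<in>yrev D z. real (card (yhook D w)) / (real (card (yhook D w)) - 1))"
    by (simp add: D(2) hook_prob_cell sum_distrib_left)
  also have "\<dots> = 1" using sum_ycorners[OF D(1)] pos by simp
  finally show ?thesis .
qed

lemma le_H_cover_down:
  assumes "z \<in> HH" "w \<in> HH" "le_H w z" "w \<noteq> z"
  obtains v where "v \<in> HH" "v = (fst z - 1, snd z - 1) \<or> v = (fst z + 1, snd z - 1)" "le_H w v" "le_H v z" "v \<noteq> z"
proof -
  obtain a b where w: "w = (a, b)" by (cases w)
  obtain c d where z: "z = (c, d)" by (cases z)
  have e: "even (a + b)" "even (c + d)" "1 \<le> b" using assms by (auto simp: HH_def z w)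
  moreover have le: "a + b \<le> c + d" "b - a \<le> d - c" using assms by (auto simp: le_H_def z w)
  moreover have "a \<noteq> c \<or> b \<noteq> d" using assms by (auto simp: z w)
  ultimately have "b - a + 2 \<le> d - c \<or> a + b + 2 \<le> c + d" by presburger
  then show ?thesis
  proof
    assume h: "b - a + 2 \<le> d - c"
    show ?thesis by (rule that[of "(c + 1, d - 1)"]) (use h e le in \<open>auto simp: HH_def z w le_H_def\<close>)
  next
    assume h: "a + b + 2 \<le> c + d"
    show ?thesis by (rule that[of "(c - 1, d - 1)"]) (use h e le in \<open>auto simp: HH_def z w le_H_def\<close>)
  qed
qed

text \<open>Hooks only see the two lower diagonals. A smaller point of \<open>B\<close> off them
  still yields a lower neighbour of \<open>z\<close> between the two points, which is in
  \<open>B\<close> by upward closedness.\<close>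

lemma corner_iff:
  assumes "up_closed c n B"
  shows "z \<in> corners B \<longleftrightarrow> z \<in> B \<and> (\<forall>w\<in>B. le_H w z \<longrightarrow> w = z)"
proof (intro iffI conjI ballI impI)
  assume z: "z \<in> corners B"
  then show zB: "z \<in> B" by (simp add: corners_def)
  fix w assume w: "w \<in> B" "le_H w z"
  show "w = z"
  proof (rule ccontr)
    assume ne: "w \<noteq> z"
    have H: "z \<in> HH" "w \<in> HH" "le_H z (c, int n - 1)"
      using zB w up_closedD(1)[OF assms] by (auto simp: TT_def)
    obtain v where v: "v \<in> HH" "v = (fst z - 1, snd z - 1) \<or> v = (fst z + 1, snd z - 1)" "le_H w v" "le_H v z" "v \<noteq> z"
      using le_H_cover_down[OF H(1,2) w(2) ne] by metis
    have "v \<in> TT c n" using v(1) le_H_trans[OF v(4) H(3)] by (auto simp: TT_def)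
    then have "v \<in> B" using up_closedD(2)[OF assms w(1)] v by auto
    then have "v \<in> hook B z" using v(2) by (auto simp: hook_def intro: exI[of _ 1])
    then show False using z v(5) by (auto simp: corners_def)
  qed
next
  assume a: "z \<in> B \<and> (\<forall>w\<in>B. le_H w z \<longrightarrow> w = z)"
  have "z \<in> hook B z" using a by (auto simp: hook_def intro: exI[of _ 0])
  moreover have "w = z" if "w \<in> hook B z" for w
  proof -
    have "w \<in> B" "le_H w z" using that by (auto simp: hook_def le_H_def)
    then show ?thesis using a by auto
  qed
  ultimately show "z \<in> corners B" using a by (auto simp: corners_def)
qed

lemma up_closed_remove:
  assumes "up_closed c n B" "z \<in> corners B"
  shows "up_closed c n (B - {z})"
  unfolding up_closed_def
proof (intro conjI ballI impI)
  show "B - {z} \<subseteq> TT c n" using up_closedD(1)[OF assms(1)] by blast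
  fix u w assume u: "u \<in> B - {z}" "w \<in> TT c n" "le_H u w"
  then have "w \<in> B" using up_closedD(2)[OF assms(1)] by blast
  moreover have "w \<noteq> z" using u assms(2) corner_iff[OF assms(1)] by blast
  ultimately show "w \<in> B - {z}" by blast
qed

lemma finite_up_closed: "odd (c + int n) \<Longrightarrow> up_closed c n B \<Longrightarrow> finite B"
  by (rule finite_subset[OF up_closedD(1) finite_TT])

section \<open>Counting linear extensions by hook lengths\<close>

lemma hook_self: "w \<in> B \<Longrightarrow> w \<in> hook B w"
  by (auto simp: hook_def intro: exI[of _ 0])

text \<open>The hook length formula, for the time being as a mere number; \<open>card_LE\<close>
  shows that it counts linear extensions.\<close>

definition hook_count :: "(int \<times> int) set \<Rightarrow> real" where
  "hook_count B = fact (card B) / (\<Prod>w\<in>B. real (card (hook B w)))"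

lemma hook_count_pos:
  assumes "finite B"
  shows "hook_count B > 0"
proof -
  have "card (hook B w) > 0" if "w \<in> B" for w
    proof -
    have "hook B w \<subseteq> B" by (auto simp: hook_def)
    then show ?thesis using hook_self[OF that] finite_subset[OF _ assms] by (auto simp: card_gt_0_iff)
  qed
  then show ?thesis unfolding hook_count_def by (intro divide_pos_pos prod_pos) auto
qed

text \<open>Deleting the corner shortens by one exactly the hooks through it, those with heads in
  \<open>rev_hook B z\<close>, and the factorial loses the factor \<open>card B\<close>; the
  quotient is the hook probability.\<close>

lemma hook_count_remove:
  assumes "finite B" "z \<in> corners B"
  shows "hook_count (B - {z}) = hook_prob B z * hook_count B"
proof -
  have zB: "z \<in> B" and hz: "hook B z = {z}" using assms(2) by (auto simp: corners_def)
  have fin: "finite (hook B w)" for w using assms(1) by (auto simp: hook_def)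
  have pos: "card (hook B w) > 0" if "w \<in> B" for w using hook_self[OF that] fin by (auto simp: card_gt_0_iff)
  have R: "rev_hook B z \<subseteq> B - {z}" by (auto simp: rev_hook_def)
  have h1: "real (card (hook (B - {z}) w)) = real (card (hook B w)) - 1 \<and> card (hook B w) > 1" if "w \<in> rev_hook B z" for w
  proof -
    have "hook (B - {z}) w = hook B w - {z}" by (auto simp: hook_def)
    moreover have "{w, z} \<subseteq> hook B w" "w \<noteq> z" using that hook_self by (auto simp: rev_hook_def)
    then have "card {w, z} \<le> card (hook B w)" "w \<noteq> z" using fin card_mono by blast+
    ultimately show ?thesis using \<open>{w, z} \<subseteq> hook B w\<close> fin by (simp add: card_Diff_singleton of_nat_diff)
  qed
  have h2: "hook (B - {z}) w = hook B w" if "w \<in> B - {z} - rev_hook B z" for w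
    using that by (auto simp: hook_def rev_hook_def)
  define h where "h = (\<lambda>w. real (card (hook B w)))"
  have P: "(\<Prod>w\<in>B. h w) = (\<Prod>w\<in>rev_hook B z. h w) * (\<Prod>w\<in>B - {z} - rev_hook B z. h w)"
  proof -
    have "(\<Prod>w\<in>B. h w) = h z * (\<Prod>w\<in>B - {z}. h w)" using assms(1) zB by (rule prod.remove)
    moreover have "h z = 1" by (simp add: h_def hz)
    ultimately show ?thesis using prod.subset_diff[OF R, of h] assms(1) by (simp add: mult.commute)
  qed
  have P': "(\<Prod>w\<in>B - {z}. real (card (hook (B - {z}) w))) = (\<Prod>w\<in>rev_hook B z. h w - 1) * (\<Prod>w\<in>B - {z} - rev_hook B z. h w)"
  proof -
    have "(\<Prod>w\<in>rev_hook B z. real (card (hook (B - {z}) w))) = (\<Prod>w\<in>rev_hook B z. h w - 1)"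
      by (rule prod.cong) (use h1 in \<open>auto simp: h_def\<close>)
    moreover have "(\<Prod>w\<in>B - {z} - rev_hook B z. real (card (hook (B - {z}) w))) = (\<Prod>w\<in>B - {z} - rev_hook B z. h w)"
      by (rule prod.cong) (use h2 in \<open>auto simp: h_def\<close>)
    ultimately show ?thesis
      using prod.subset_diff[OF R, of "\<lambda>w. real (card (hook (B - {z}) w))"] assms(1) by (simp add: mult.commute)
  qed
  have hp: "h w > 0" if "w \<in> B" for w using pos[OF that] by (simp add: h_def)
  have "(\<Prod>w\<in>B - {z} - rev_hook B z. h w) > 0" "(\<Prod>w\<in>rev_hook B z. h w) > 0"
    using R by (intro prod_pos hp; blast)+
  moreover have "(\<Prod>w\<in>rev_hook B z. h w - 1) > 0"
  proof (rule prod_pos)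
    fix w assume "w \<in> rev_hook B z"
    from h1[OF this] show "h w - 1 > 0" by (simp add: h_def)
  qed
  ultimately have nz: "(\<Prod>w\<in>B - {z} - rev_hook B z. h w) \<noteq> 0" "(\<Prod>w\<in>rev_hook B z. h w) \<noteq> 0"
    "(\<Prod>w\<in>rev_hook B z. h w - 1) \<noteq> 0" by linarith+
  have c: "card B = Suc (card (B - {z}))" using zB assms(1) by (metis card.remove)
  have 1: "hook_prob B z = 1 / real (card B) * ((\<Prod>w\<in>rev_hook B z. h w) / (\<Prod>w\<in>rev_hook B z. h w - 1))"
    unfolding hook_prob_def prod_dividef h_def ..
  have 2: "hook_count B = fact (card B) / ((\<Prod>w\<in>rev_hook B z. h w) * (\<Prod>w\<in>B - {z} - rev_hook B z. h w))"
    using P by (simp add: hook_count_def h_def)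
  have 3: "fact (card B) = real (card B) * fact (card (B - {z}))" "real (card B) > 0" unfolding c by simp_all
  show ?thesis unfolding 1 2 hook_count_def[of "B - {z}"] P' 3(1) using nz 3(2) by (simp add: field_simps)
qed

text \<open>Linear extensions as lists. Since \<open>le_H\<close> is reflexive, the condition on
  pairs also excludes repetitions.\<close>

definition LE :: "(int \<times> int) set \<Rightarrow> (int \<times> int) list set" where
  "LE B = {zs. set zs = B \<and> sorted_wrt (\<lambda>z w. \<not> le_H w z) zs}"

lemma LE_distinct: "zs \<in> LE B \<Longrightarrow> distinct zs"
proof -
  have "sorted_wrt (\<lambda>z w. \<not> le_H w z) zs \<Longrightarrow> distinct zs"
    by (induction zs) auto
  then show "zs \<in> LE B \<Longrightarrow> distinct zs" by (simp add: LE_def)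
qed

lemma LE_length: "zs \<in> LE B \<Longrightarrow> length zs = card B"
  using LE_distinct[of zs B] by (auto simp: LE_def distinct_card)

lemma finite_LE: "finite B \<Longrightarrow> finite (LE B)"
  by (rule finite_subset[OF _ finite_lists_length_eq[of B "card B"]]) (use LE_length in \<open>auto simp: LE_def\<close>)

lemma LE_empty: "LE {} = {[]}" by (auto simp: LE_def)

lemma LE_Cons: 
  assumes "up_closed c n B"
  shows "z # zs \<in> LE B \<longleftrightarrow> z \<in> corners B \<and> zs \<in> LE (B - {z})"
proof
  assume a: "z # zs \<in> LE B"
  from LE_distinct[OF this] have d: "z \<notin> set zs" by simp
  show "z \<in> corners B \<and> zs \<in> LE (B - {z})"
    unfolding corner_iff[OF assms] using a d by (auto simp: LE_def)
next
  assume a: "z \<in> corners B \<and> zs \<in> LE (B - {z})"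
  then show "z # zs \<in> LE B" unfolding corner_iff[OF assms] by (auto simp: LE_def)
qed

lemma LE_rec:
  assumes "up_closed c n B" "B \<noteq> {}"
  shows "LE B = (\<Union>z\<in>corners B. (#) z ` LE (B - {z}))"
proof -
  have nil: "[] \<notin> LE B" using assms(2) by (auto simp: LE_def)
  have "zs \<in> LE B \<longleftrightarrow> zs \<in> (\<Union>z\<in>corners B. (#) z ` LE (B - {z}))" for zs
  proof (cases zs)
    case Nil
    then show ?thesis using nil by auto
  next
    case (Cons z ys)
    then have "zs \<in> (\<Union>z\<in>corners B. (#) z ` LE (B - {z})) \<longleftrightarrow> z \<in> corners B \<and> ys \<in> LE (B - {z})" by blast
    then show ?thesis using LE_Cons[OF assms(1)] Cons by simp
  qed
  then show ?thesis by blast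
qed

lemma card_LE_restrict:
  assumes "odd (c + int n)" "up_closed c n B" "B \<noteq> {}"
  shows "card {zs \<in> LE B. P zs} = (\<Sum>z\<in>corners B. card {zs \<in> LE (B - {z}). P (z # zs)})"
proof -
  have fB: "finite B" using finite_up_closed[OF assms(1,2)] .
  have "{zs \<in> LE B. P zs} = (\<Union>z\<in>corners B. (#) z ` {zs \<in> LE (B - {z}). P (z # zs)})"
    unfolding LE_rec[OF assms(2,3)] by auto
  also have "card \<dots> = (\<Sum>z\<in>corners B. card ((#) z ` {zs \<in> LE (B - {z}). P (z # zs)}))"
    by (rule card_UN_disjoint) (use fB finite_LE in \<open>auto simp: corners_def\<close>)
  also have "\<dots> = (\<Sum>z\<in>corners B. card {zs \<in> LE (B - {z}). P (z # zs)})"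
    by (simp add: card_image)
  finally show ?thesis .
qed

text \<open>Both sides satisfy the same recursion over the first corner removed; for
  \<open>hook_count\<close> this is the hook walk identity that the corner probabilities sum to
  1.\<close>

theorem card_LE:
  assumes "odd (c + int n)" "up_closed c n B"
  shows "real (card (LE B)) = hook_count B"
  using assms(2)
proof (induction "card B" arbitrary: B rule: less_induct)
  case less
  have fB: "finite B" using finite_up_closed[OF assms(1) less.prems] .
  show ?case
  proof (cases "B = {}")
    case True
    then show ?thesis by (simp add: LE_empty hook_count_def)
  next
    case False
    have "card (LE B) = (\<Sum>z\<in>corners B. card (LE (B - {z})))"
      using card_LE_restrict[OF assms(1) less.prems False, of "\<lambda>_. True"] by simp
    then have "real (card (LE B)) = (\<Sum>z\<in>corners B. real (card (LE (B - {z}))))" by simp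
    also have "\<dots> = (\<Sum>z\<in>corners B. hook_prob B z * hook_count B)"
    proof (rule sum.cong[OF refl])
      fix z assume z: "z \<in> corners B"
      then have "card (B - {z}) < card B" using fB by (intro psubset_card_mono) (auto simp: corners_def)
      then show "real (card (LE (B - {z}))) = hook_prob B z * hook_count B"
        using less.hyps up_closed_remove[OF less.prems z] hook_count_remove[OF fB z] by simp
    qed
    also have "\<dots> = hook_count B"
      using sum_hook_prob[OF assms(1) less.prems False] by (simp flip: sum_distrib_right)
    finally show ?thesis .
  qed
qed

text \<open>Each factor is a quotient of consecutive counts, so the product telescopes. This is the
  source of the uniformity of the jump chain.\<close>

lemma LE_path_prob:
  assumes "odd (c + int n)" "up_closed c n B" "zs \<in> LE B"
  shows "(\<Prod>i<length zs. hook_prob (B - set (take i zs)) (zs ! i)) = 1 / real (card (LE B))"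
  using assms(2,3)
proof (induction zs arbitrary: B)
  case Nil
  then have "B = {}" by (simp add: LE_def)
  then show ?case by (simp add: LE_empty)
next
  case (Cons z zs)
  then have z: "z \<in> corners B" "zs \<in> LE (B - {z})" using LE_Cons[OF Cons.prems(1)] by auto
  have fB: "finite B" using finite_up_closed[OF assms(1) Cons.prems(1)] .
  have u: "up_closed c n (B - {z})" using up_closed_remove[OF Cons.prems(1) z(1)] .
  have "(\<Prod>i<length (z # zs). hook_prob (B - set (take i (z # zs))) ((z # zs) ! i)) =
     hook_prob B z * (\<Prod>i<length zs. hook_prob (B - {z} - set (take i zs)) (zs ! i))"
  proof -
    have "B - set (take (Suc i) (z # zs)) = B - {z} - set (take i zs)" for i by auto
    then show ?thesis by (simp only: length_Cons prod.lessThan_Suc_shift) simp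
  qed
  also have "\<dots> = hook_prob B z / (hook_prob B z * hook_count B)"
    using Cons.IH[OF u z(2)] card_LE[OF assms(1) u] hook_count_remove[OF fB z(1)] by simp
  also have "\<dots> = 1 / hook_count B"
    using hook_count_pos[of "B - {z}"] hook_count_remove[OF fB z(1)] fB by (auto simp: field_simps)
  finally show ?case using card_LE[OF assms(1) Cons.prems(1)] by simp
qed

lemma LE_step:
  assumes "up_closed c n B" "zs \<in> LE B" "i < length zs"
  shows "up_closed c n (B - set (take i zs)) \<and> zs ! i \<in> corners (B - set (take i zs))"
  using assms
proof (induction zs arbitrary: B i)
  case (Cons z zs)
  then have z: "z \<in> corners B" "zs \<in> LE (B - {z})" using LE_Cons[OF Cons.prems(1)] by auto
  show ?case
  proof (cases i)
    case 0
    then show ?thesis using z Cons.prems by simp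
  next
    case (Suc k)
    have "B - set (take i (z # zs)) = B - {z} - set (take k zs)" unfolding Suc by auto
    then show ?thesis using Cons.IH[OF up_closed_remove[OF Cons.prems(1) z(1)] z(2), of k] Cons.prems(3) Suc
      by simp
  qed
qed simp

text \<open>Points whose hooks contain \<open>z\<close> lie above it and hence stay in
  \<open>B\<close>. Passing from the triangle to \<open>B\<close> shortens these hooks and lowers
  the number of cells, so both \<open>h / (h - 1)\<close> and \<open>1 / card\<close> can only
  grow.\<close>

lemma hook_prob_mono:
  assumes "odd (c + int n)" "up_closed c n B" "z \<in> B"
  shows "hook_prob (TT c n) z \<le> hook_prob B z"
proof -
  let ?T = "TT c n"
  have fT: "finite ?T" using finite_TT[OF assms(1)] .
  have BT: "B \<subseteq> ?T" using up_closedD(1)[OF assms(2)] .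
  have fB: "finite B" using fT BT finite_subset by blast
  have R: "rev_hook ?T z = rev_hook B z"
  proof
    show "rev_hook B z \<subseteq> rev_hook ?T z" using BT by (auto simp: rev_hook_def hook_def)
    show "rev_hook ?T z \<subseteq> rev_hook B z"
    proof
      fix w assume w: "w \<in> rev_hook ?T z"
      then have "le_H z w" "w \<in> ?T" by (auto simp: rev_hook_def hook_def le_H_def)
      then have "w \<in> B" using up_closedD(2)[OF assms(2,3)] by auto
      then show "w \<in> rev_hook B z" using w assms(3) by (auto simp: rev_hook_def hook_def)
    qed
  qed
  have two: "2 \<le> card (hook B w)" if "w \<in> rev_hook B z" for w
  proof -
    have "{w, z} \<subseteq> hook B w" "w \<noteq> z" using that hook_self by (auto simp: rev_hook_def)
    moreover have "finite (hook B w)" using fB by (auto simp: hook_def)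
    ultimately have "card {w, z} \<le> card (hook B w)" "w \<noteq> z" using card_mono by blast+
    then show ?thesis by simp
  qed
  have "(\<Prod>w\<in>rev_hook B z. real (card (hook ?T w)) / (real (card (hook ?T w)) - 1)) \<le>
    (\<Prod>w\<in>rev_hook B z. real (card (hook B w)) / (real (card (hook B w)) - 1))"
  proof (rule prod_mono)
    fix w assume w: "w \<in> rev_hook B z"
    have "hook B w \<subseteq> hook ?T w" using BT by (auto simp: hook_def)
    moreover have "finite (hook ?T w)" using fT by (auto simp: hook_def)
    ultimately have "card (hook B w) \<le> card (hook ?T w)" by (rule card_mono[rotated])
    then show "0 \<le> real (card (hook ?T w)) / (real (card (hook ?T w)) - 1) \<and>
      real (card (hook ?T w)) / (real (card (hook ?T w)) - 1) \<le> real (card (hook B w)) / (real (card (hook B w)) - 1)"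
      using two[OF w] by (auto simp: field_simps)
  qed
  moreover have "1 / real (card ?T) \<le> 1 / real (card B)"
  proof -
    have "0 < card B" using assms(3) fB by (auto simp: card_gt_0_iff)
    then show ?thesis using card_mono[OF fT BT] by (simp add: frac_le)
  qed
  moreover have "0 \<le> (\<Prod>w\<in>rev_hook B z. real (card (hook ?T w)) / (real (card (hook ?T w)) - 1))"
  proof (rule prod_nonneg)
    fix w assume w: "w \<in> rev_hook B z"
    have "hook B w \<subseteq> hook ?T w" using BT by (auto simp: hook_def)
    moreover have "finite (hook ?T w)" using fT by (auto simp: hook_def)
    ultimately have "card (hook B w) \<le> card (hook ?T w)" by (rule card_mono[rotated])
    then show "0 \<le> real (card (hook ?T w)) / (real (card (hook ?T w)) - 1)" using two[OF w] by auto
  qed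
  ultimately show ?thesis unfolding hook_prob_def R by (intro mult_mono) auto
qed

lemma hook_prob_LE:
  assumes "odd (c + int n)" "up_closed c n B" "z \<in> corners B"
  shows "real (card (LE (B - {z}))) = hook_prob B z * real (card (LE B))"
  using card_LE[OF assms(1,2)] card_LE[OF assms(1) up_closed_remove[OF assms(2,3)]]
    hook_count_remove[OF finite_up_closed[OF assms(1,2)] assms(3)] by simp

lemma card_LE_pos: 
  assumes "odd (c + int n)" "up_closed c n B"
  shows "card (LE B) > 0"
  using card_LE[OF assms] hook_count_pos[OF finite_up_closed[OF assms]] by simp

lemma hook_prob_bounds:
  assumes "odd (c + int n)" "up_closed c n B" "z \<in> corners B"
  shows "0 \<le> hook_prob B z" "hook_prob B z \<le> 1"
proof -
  have a: "hook_prob B z = real (card (LE (B - {z}))) / real (card (LE B))"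
    if "z \<in> corners B" for z
    using hook_prob_LE[OF assms(1,2) that] card_LE_pos[OF assms(1,2)] by simp
  show "0 \<le> hook_prob B z" by (simp add: a[OF assms(3)])
  have "B \<noteq> {}" using assms(3) by (auto simp: corners_def)
  have fc: "finite (corners B)" using finite_up_closed[OF assms(1,2)] by (auto simp: corners_def)
  have "hook_prob B z \<le> (\<Sum>z\<in>corners B. hook_prob B z)"
    by (rule member_le_sum[OF assms(3) _ fc]) (simp add: a)
  then show "hook_prob B z \<le> 1" using sum_hook_prob[OF assms(1,2) \<open>B \<noteq> {}\<close>] by simp
qed

text \<open>A corner of the triangle remains a corner until it is removed, and its conditional
  probability of being next never falls below the initial one (\<open>hook_prob_mono\<close>). So
  every step avoids it with conditional probability at most \<open>1 - p\<close>.\<close>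

theorem card_LE_avoid:
  assumes "odd (c + int n)" "z \<in> corners (TT c n)" "up_closed c n B" "z \<in> B"
  shows "real (card {zs \<in> LE B. z \<notin> set (take m zs)}) \<le> (1 - hook_prob (TT c n) z) ^ m * real (card (LE B))"
  using assms(3,4)
proof (induction m arbitrary: B)
  case (Suc m)
  let ?p = "hook_prob (TT c n) z"
  have ne: "B \<noteq> {}" using Suc.prems by auto
  have fB: "finite B" using finite_up_closed[OF assms(1) Suc.prems(1)] .
  have fc: "finite (corners B)" using fB by (auto simp: corners_def)
  have zc: "z \<in> corners B"
    using assms(2) Suc.prems up_closedD(1)[OF Suc.prems(1)] corner_iff[OF up_closed_TT] corner_iff[OF Suc.prems(1)] by blast
  have p: "?p \<le> hook_prob B z" "?p \<le> 1" using hook_prob_mono[OF assms(1) Suc.prems] hook_prob_bounds[OF assms(1) up_closed_TT assms(2)] by auto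
  have "card {zs \<in> LE B. z \<notin> set (take (Suc m) zs)} =
     (\<Sum>y\<in>corners B. card {zs \<in> LE (B - {y}). z \<notin> set (take (Suc m) (y # zs))})"
    by (rule card_LE_restrict[OF assms(1) Suc.prems(1) ne])
  also have "\<dots> = (\<Sum>y\<in>corners B - {z}. card {zs \<in> LE (B - {y}). z \<notin> set (take (Suc m) (y # zs))})"
    by (rule sum.mono_neutral_right[OF fc]) auto
  also have "\<dots> = (\<Sum>y\<in>corners B - {z}. card {zs \<in> LE (B - {y}). z \<notin> set (take m zs)})"
    by (rule sum.cong) auto
  finally have "real (card {zs \<in> LE B. z \<notin> set (take (Suc m) zs)}) =
     (\<Sum>y\<in>corners B - {z}. real (card {zs \<in> LE (B - {y}). z \<notin> set (take m zs)}))" by simp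
  also have "\<dots> \<le> (\<Sum>y\<in>corners B - {z}. (1 - ?p) ^ m * real (card (LE (B - {y}))))"
    by (rule sum_mono, rule Suc.IH) (use up_closed_remove[OF Suc.prems(1)] Suc.prems in auto)
  also have "\<dots> = (1 - ?p) ^ m * (\<Sum>y\<in>corners B - {z}. hook_prob B y * real (card (LE B)))"
    unfolding sum_distrib_left by (rule sum.cong) (auto simp: hook_prob_LE[OF assms(1) Suc.prems(1)])
  also have "(\<Sum>y\<in>corners B - {z}. hook_prob B y * real (card (LE B))) = (1 - hook_prob B z) * real (card (LE B))"
  proof -
    have "(\<Sum>y\<in>corners B - {z}. hook_prob B y) = 1 - hook_prob B z"
      using sum_hook_prob[OF assms(1) Suc.prems(1) ne] sum.remove[OF fc zc, of "hook_prob B"] by simp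
    then show ?thesis by (simp flip: sum_distrib_right)
  qed
  also have "(1 - ?p) ^ m * \<dots> \<le> (1 - ?p) ^ m * ((1 - ?p) * real (card (LE B)))"
    using p by (intro mult_left_mono mult_right_mono) auto
  finally show ?case by (simp add: mult.assoc mult.left_commute)
qed simp

lemma card_LE_first:
  assumes "odd (c + int n)" "z \<in> corners (TT c n)"
  shows "real (card {zs \<in> LE (TT c n). hd zs = z}) = hook_prob (TT c n) z * real (card (LE (TT c n)))"
proof -
  have ne: "TT c n \<noteq> {}" using assms(2) by (auto simp: corners_def)
  have "{zs \<in> LE (TT c n). hd zs = z} = (#) z ` LE (TT c n - {z})"
    unfolding LE_rec[OF up_closed_TT ne] using assms(2) by auto
  then show ?thesis using hook_prob_LE[OF assms(1) up_closed_TT assms(2)] by (simp add: card_image)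
qed

lemma corner_TT: "(k, 1) \<in> TT c n \<Longrightarrow> (k, 1) \<in> corners (TT c n)"
proof (subst corner_iff[OF up_closed_TT], intro conjI ballI impI)
  fix w assume w: "w \<in> TT c n" "le_H w (k, 1)"
  then have "snd w \<ge> 1" by (auto simp: TT_def HH_def split: prod.splits)
  then show "w = (k, 1)" using w by (auto simp: le_H_def prod_eq_iff)
qed

section \<open>Promotion\<close>

text \<open>Linear extensions once more, now as tableaux with entries
  \<open>0, ..., card T - 1\<close>, so that \<open>slide\<close> and \<open>sw\<close> apply to
  them.\<close>

definition ranks :: "(int \<times> int) set \<Rightarrow> (int \<times> int \<Rightarrow> ennreal) set" where
  "ranks T = {Q. (\<forall>z. z \<notin> T \<longrightarrow> Q z = \<infinity>) \<and> bij_betw Q T (of_nat ` {..<card T}) \<and>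
     (\<forall>z\<in>T. \<forall>w\<in>T. le_H z w \<longrightarrow> Q z \<le> Q w)}"

definition list_rank :: "(int \<times> int) list \<Rightarrow> int \<times> int \<Rightarrow> ennreal" where
  "list_rank zs z = (if z \<in> set zs then of_nat (LEAST i. i < length zs \<and> zs ! i = z) else \<infinity>)"

lemma list_rank_nth: "distinct zs \<Longrightarrow> i < length zs \<Longrightarrow> list_rank zs (zs ! i) = of_nat i"
proof -
  assume a: "distinct zs" "i < length zs"
  have "(LEAST k. k < length zs \<and> zs ! k = zs ! i) = i"
    by (rule Least_equality) (use a nth_eq_iff_index_eq in auto)
  then show ?thesis using a by (simp add: list_rank_def)
qed

lemma ranksD:
  assumes "Q \<in> ranks T"
  shows "z \<notin> T \<Longrightarrow> Q z = \<infinity>" "inj_on Q T" "Q ` T = of_nat ` {..<card T}"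
    "z \<in> T \<Longrightarrow> w \<in> T \<Longrightarrow> le_H z w \<Longrightarrow> Q z \<le> Q w"
  using assms unfolding ranks_def bij_betw_def by simp_all

lemma ranks_value:
  assumes "Q \<in> ranks T" "z \<in> T"
  obtains i where "Q z = of_nat i" "i < card T"
proof -
  have "Q z \<in> of_nat ` {..<card T}" using ranksD(3)[OF assms(1)] assms(2) by blast
  then show ?thesis using that by auto
qed

lemma ranks_finite_iff:
  assumes "Q \<in> ranks T"
  shows "Q z \<noteq> \<infinity> \<longleftrightarrow> z \<in> T"
proof (cases "z \<in> T")
  case True
  then obtain i where "Q z = of_nat i" "i < card T" by (rule ranks_value[OF assms])
  then show ?thesis using True by simp
next
  case False
  then show ?thesis using ranksD(1)[OF assms] by simp
qed

lemma list_rank_bij: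
  assumes "finite T"
  shows "bij_betw list_rank (LE T) (ranks T)"
proof (rule bij_betw_imageI)
  show "inj_on list_rank (LE T)"
  proof (rule inj_onI)
    fix xs ys assume a: "xs \<in> LE T" "ys \<in> LE T" "list_rank xs = list_rank ys"
    have len: "length xs = length ys" using LE_length[OF a(1)] LE_length[OF a(2)] by simp
    show "xs = ys"
    proof (rule nth_equalityI[OF len])
      fix i assume i: "i < length xs"
      have "set ys = set xs" using a(1,2) by (simp add: LE_def)
      then have "xs ! i \<in> set ys" using nth_mem[OF i] by simp
      then obtain k where k: "k < length ys" "ys ! k = xs ! i" by (auto simp: in_set_conv_nth)
      have "(of_nat i :: ennreal) = of_nat k"
        using list_rank_nth[OF LE_distinct[OF a(1)] i] list_rank_nth[OF LE_distinct[OF a(2)] k(1)] a(3) k(2) by simp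
      then show "xs ! i = ys ! i" using k by simp
    qed
  qed
  show "list_rank ` LE T = ranks T"
  proof (intro equalityI subsetI)
    fix Q assume "Q \<in> list_rank ` LE T"
    then obtain zs where zs: "zs \<in> LE T" "Q = list_rank zs" by auto
    have T: "T = set zs" and srt: "sorted_wrt (\<lambda>z w. \<not> le_H w z) zs" using zs by (auto simp: LE_def)
    have d: "distinct zs" using LE_distinct zs(1) by auto
    have nth: "list_rank zs (zs ! i) = of_nat i" if "i < length zs" for i using list_rank_nth[OF d that] .
    have "inj_on Q T"
    proof (rule inj_onI)
      fix z w assume h: "z \<in> T" "w \<in> T" "Q z = Q w"
      then obtain i j where "i < length zs" "z = zs ! i" "j < length zs" "w = zs ! j"
        unfolding T by (auto simp: in_set_conv_nth)
      then show "z = w" using h(3) nth zs(2) by simp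
    qed
    moreover have "Q ` T = of_nat ` {..<card T}"
      
    proof -
      have "set zs = (!) zs ` {..<length zs}" by (auto simp: set_conv_nth)
      then have "Q ` T = (\<lambda>i. list_rank zs (zs ! i)) ` {..<length zs}" by (simp add: T zs(2) image_image)
      also have "\<dots> = of_nat ` {..<card T}" unfolding T distinct_card[OF d] using nth by (intro image_cong) auto
      finally show ?thesis .
    qed
    moreover have "Q z \<le> Q w" if h: "z \<in> T" "w \<in> T" "le_H z w" for z w
    proof -
      obtain i j where ij: "i < length zs" "z = zs ! i" "j < length zs" "w = zs ! j"
        using h unfolding T by (auto simp: in_set_conv_nth)
      have "i \<le> j"
      proof (rule ccontr)
        assume "\<not> i \<le> j"
        then have "\<not> le_H (zs ! i) (zs ! j)" using sorted_wrt_nth_less[OF srt, of j i] ij by simp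
        then show False using h ij by simp
      qed
      then show ?thesis using ij nth zs(2) by simp
    qed
    moreover have "Q z = \<infinity>" if "z \<notin> T" for z using that by (simp add: zs(2) T list_rank_def)
    ultimately show "Q \<in> ranks T" unfolding ranks_def bij_betw_def by blast
  next
    fix Q assume Q: "Q \<in> ranks T"
    define f where "f = (\<lambda>i. the_inv_into T Q (of_nat i))"
    define zs where "zs = map f [0..<card T]"
    have f: "f i \<in> T" "Q (f i) = of_nat i" if "i < card T" for i
    proof -
      have "(of_nat i :: ennreal) \<in> Q ` T" using ranksD(3)[OF Q] that by auto
      then show "f i \<in> T" "Q (f i) = of_nat i"
        unfolding f_def using the_inv_into_into[OF ranksD(2)[OF Q]] f_the_inv_into_f[OF ranksD(2)[OF Q]] by auto
    qed
    have set: "set zs = T"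
    proof
      show "set zs \<subseteq> T" using f by (auto simp: zs_def)
      show "T \<subseteq> set zs"
      proof
        fix z assume z: "z \<in> T"
        obtain i where i: "Q z = of_nat i" "i < card T" by (rule ranks_value[OF Q z])
        have "f i = z" by (rule inj_onD[OF ranksD(2)[OF Q]]) (use f[OF i(2)] i(1) z in auto)
        then show "z \<in> set zs" using i by (force simp: zs_def)
      qed
    qed
    have srt: "sorted_wrt (\<lambda>z w. \<not> le_H w z) zs"
      unfolding sorted_wrt_iff_nth_less
    proof (intro allI impI notI)
      fix i j assume ij: "i < j" "j < length zs" and le: "le_H (zs ! j) (zs ! i)"
      then have l: "j < card T" "i < card T" by (auto simp: zs_def)
      have "Q (f j) \<le> Q (f i)" using ranksD(4)[OF Q f(1)[OF l(1)] f(1)[OF l(2)]] le l by (simp add: zs_def)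
      then show False using f(2) l ij by simp
    qed
    have L: "zs \<in> LE T" using set srt by (simp add: LE_def)
    have "list_rank zs z = Q z" for z
    proof (cases "z \<in> T")
      case False
      then show ?thesis using ranksD(1)[OF Q False] set by (simp add: list_rank_def)
    next
      case True
      then obtain i where i: "i < length zs" "z = zs ! i" using set by (auto simp: in_set_conv_nth)
      then have "Q z = of_nat i" using f by (simp add: zs_def)
      then show ?thesis using list_rank_nth[OF LE_distinct[OF L] i(1)] i by simp
    qed
    then have "Q = list_rank zs" by auto
    then show "Q \<in> list_rank ` LE T" using L by blast
  qed
qed

text \<open>Schuetzenberger promotion with ranks from 0: slide out the entry 0, lower the others by
  one, and give the vacated cell the largest rank.\<close>

definition promote :: "(int \<times> int) set \<Rightarrow> (int \<times> int \<Rightarrow> ennreal) \<Rightarrow> int \<times> int \<Rightarrow> ennreal" where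
  "promote T Q z = (if z \<in> T then (if slide Q z = \<infinity> then of_nat (card T - 1) else slide Q z - 1) else \<infinity>)"

lemma TT_down: "w \<in> TT c n \<Longrightarrow> z \<in> HH \<Longrightarrow> le_H z w \<Longrightarrow> z \<in> TT c n"
  by (auto simp: TT_def intro: le_H_trans)

locale staircase =
  fixes c :: int and n :: nat
  assumes odd: "odd (c + int n)" and ge2: "2 \<le> n"
begin

abbreviation "T \<equiv> TT c n"

lemma finT: "finite T" using finite_TT[OF odd] .

lemma apex: "(c, int n - 1) \<in> T" using ge2 odd by (auto simp: TT_def HH_def)

lemma neT: "T \<noteq> {}" using apex by auto

lemma cardT: "card T > 0" using finT neT by (simp add: card_gt_0_iff)

lemma ranks_tableau:
  assumes "Q \<in> ranks T"
  shows "fin_tableau Q" "supp Q = T"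
proof -
  show S: "supp Q = T" unfolding supp_def ranks_finite_iff[OF assms] using TT_HH[of c n] by blast
  have "Q z \<le> Q w" if "z \<in> HH" "w \<in> HH" "le_H z w" for z w
  proof (cases "w \<in> T")
    case True
    then have "z \<in> T" using TT_down that by blast
    then show ?thesis using ranksD(4)[OF assms] that True by blast
  next
    case False
    then show ?thesis using ranksD(1)[OF assms False] by simp
  qed
  moreover have "Q z = \<infinity>" if "z \<notin> HH" for z using ranksD(1)[OF assms] that TT_HH by blast
  ultimately show "fin_tableau Q"
    unfolding fin_tableau_def S using finT ranksD(2)[OF assms] by blast
qed

lemma slide_ranks_values:
  assumes "Q \<in> ranks T"
  shows "slide Q ` supp (slide Q) = of_nat ` {1..<card T}" "Q (min_point Q) = 0"
    "supp (slide Q) \<subseteq> T" "slide Q z \<noteq> \<infinity> \<Longrightarrow> \<exists>i. slide Q z = of_nat (Suc i) \<and> Suc i < card T"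
proof -
  note tab = ranks_tableau[OF assms]
  have ne: "supp Q \<noteq> {}" using tab neT by simp
  note mp = min_point_props[OF tab(1) ne]
  have "(of_nat 0 :: ennreal) \<in> Q ` T" unfolding ranksD(3)[OF assms] using cardT by blast
  then obtain z0 where "z0 \<in> T" "Q z0 = 0" by auto
  then show z: "Q (min_point Q) = 0" using mp(2)[of z0] TT_HH by force
  have "slide Q ` supp (slide Q) = of_nat ` {..<card T} - {0}"
    unfolding slide_values[OF tab(1) ne] z tab(2) ranksD(3)[OF assms] ..
  also have "\<dots> = of_nat ` {1..<card T}" by (auto simp: image_iff)
  finally show v: "slide Q ` supp (slide Q) = of_nat ` {1..<card T}" .
  show "supp (slide Q) \<subseteq> T" using supp_slide_subset[OF tab(1) ne] tab(2) by simp
  assume f: "slide Q z \<noteq> \<infinity>"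
  have "z \<in> supp (slide Q)" using f fin_tableauD(1)[OF fin_tableau_slide[OF tab(1) ne], of z] unfolding supp_def by blast
  then have "slide Q z \<in> of_nat ` {1..<card T}" using v by blast
  then obtain k where "slide Q z = of_nat k" "1 \<le> k" "k < card T" by auto
  then show "\<exists>i. slide Q z = of_nat (Suc i) \<and> Suc i < card T" by (intro exI[of _ "k - 1"]) auto
qed

lemma of_nat_Suc_minus_one: "(of_nat (Suc i) :: ennreal) - 1 = of_nat i"
proof -
  have "(of_nat (Suc i) :: ennreal) = 1 + of_nat i" by simp
  then show ?thesis using ennreal_add_diff_cancel_left[of 1 "of_nat i"] by simp
qed

lemma promote_of_slide:
  assumes "Q \<in> ranks T" "z \<in> T" "slide Q z \<noteq> \<infinity>"
  shows "slide Q z = promote T Q z + 1"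
proof -
  obtain i where "slide Q z = of_nat (Suc i)" using slide_ranks_values(4)[OF assms(1,3)] by auto
  then show ?thesis using assms of_nat_Suc_minus_one[of i] by (simp add: promote_def add.commute)
qed

lemma promote_ranks:
  assumes "Q \<in> ranks T"
  shows "promote T Q \<in> ranks T"
proof -
  note tab = ranks_tableau[OF assms]
  have ne: "supp Q \<noteq> {}" using tab neT by simp
  note sl = slide_ranks_values[OF assms]
  note st = fin_tableau_slide[OF tab(1) ne]
  let ?P = "promote T Q"
  have val: "(slide Q z = \<infinity> \<and> ?P z = of_nat (card T - 1)) \<or>
      (\<exists>i. slide Q z = of_nat (Suc i) \<and> Suc i < card T \<and> ?P z = of_nat i)" if "z \<in> T" for z
  proof (cases "slide Q z = \<infinity>")
    case False
    then obtain i where "slide Q z = of_nat (Suc i)" "Suc i < card T" using sl(4) by blast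
    then show ?thesis using that of_nat_Suc_minus_one[of i] by (simp add: promote_def)
  qed (use that in \<open>auto simp: promote_def\<close>)
  have card1: "card (supp (slide Q)) = card T - 1"
    using card_supp_slide[OF tab(1) ne] tab(2) by simp
  have one: "z = w" if h: "z \<in> T" "w \<in> T" "slide Q z = \<infinity>" "slide Q w = \<infinity>" for z w
  proof (rule ccontr)
    assume "z \<noteq> w"
    then have "card {z, w} = 2" by simp
    moreover have "{z, w} \<subseteq> T - supp (slide Q)" using h by (auto simp: supp_def)
    ultimately have "2 \<le> card (T - supp (slide Q))" using finT card_mono by (metis finite_Diff)
    moreover have "card (T - supp (slide Q)) = 1"
      using card_Diff_subset[OF finite_subset[OF sl(3) finT] sl(3)] card1 cardT by simp
    ultimately show False by simp
  qed
  have inj: "inj_on ?P T"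
  proof (rule inj_onI)
    fix z w assume h: "z \<in> T" "w \<in> T" "?P z = ?P w"
    show "z = w"
    proof (cases "slide Q z = \<infinity>")
      case True
      then have "?P z = of_nat (card T - 1)" using h by (simp add: promote_def)
      then have "slide Q w = \<infinity>" using val[OF h(2)] h(3) by auto
      then show ?thesis using one h True by blast
    next
      case False
      then obtain i where i: "slide Q z = of_nat (Suc i)" "Suc i < card T" "?P z = of_nat i" using val[OF h(1)] by blast
      then have w: "slide Q w = of_nat (Suc i)" using val[OF h(2)] h(3) by auto
      then have "z \<in> supp (slide Q)" "w \<in> supp (slide Q)" using h TT_HH i ennreal_of_nat_neq_top
        by (auto simp: supp_def simp del: of_nat_Suc)
      then show ?thesis using inj_onD[OF fin_tableauD(3)[OF st]] i w by simp
    qed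
  qed
  have "?P ` T \<subseteq> of_nat ` {..<card T}"
  proof
    fix y assume "y \<in> ?P ` T"
    then obtain z where z: "z \<in> T" "y = ?P z" by blast
    from val[OF z(1)] show "y \<in> of_nat ` {..<card T}"
    proof
      assume "slide Q z = \<infinity> \<and> ?P z = of_nat (card T - 1)"
      then show ?thesis using z cardT by (intro image_eqI[of _ _ "card T - 1"]) auto
    next
      assume "\<exists>i. slide Q z = of_nat (Suc i) \<and> Suc i < card T \<and> ?P z = of_nat i"
      then obtain i where "Suc i < card T" "?P z = of_nat i" by blast
      then show ?thesis using z by (intro image_eqI[of _ _ i]) auto
    qed
  qed
  moreover have "card (?P ` T) = card (of_nat ` {..<card T} :: ennreal set)"
    using inj by (simp add: card_image inj_on_def)
  ultimately have img: "?P ` T = of_nat ` {..<card T}" by (intro card_subset_eq) auto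
  have mono: "?P z \<le> ?P w" if h: "z \<in> T" "w \<in> T" "le_H z w" for z w
  proof -
    have le: "slide Q z \<le> slide Q w" using fin_tableauD(4)[OF st _ _ h(3)] h(1,2) TT_HH[of c n] by blast
    from val[OF h(2)] show ?thesis
    proof
      assume w: "slide Q w = \<infinity> \<and> ?P w = of_nat (card T - 1)"
      from val[OF h(1)] show ?thesis using w by auto
    next
      assume "\<exists>i. slide Q w = of_nat (Suc i) \<and> Suc i < card T \<and> ?P w = of_nat i"
      then obtain i where i: "slide Q w = of_nat (Suc i)" "?P w = of_nat i" by blast
      then have "slide Q z \<noteq> \<infinity>" using le ennreal_of_nat_neq_top[of "Suc i"] by (auto simp: top_unique simp del: of_nat_Suc)
      then obtain j where j: "slide Q z = of_nat (Suc j)" "?P z = of_nat j" using val[OF h(1)] by blast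
      have "Suc j \<le> Suc i" using le unfolding i j of_nat_le_iff .
      then show ?thesis using i j by simp
    qed
  qed
  have "?P z = \<infinity>" if "z \<notin> T" for z using that by (simp add: promote_def)
  then show ?thesis unfolding ranks_def bij_betw_def using inj img mono by blast
qed

text \<open>Every cell of the triangle other than the apex has an upper neighbour in the triangle,
  and the path prefers a finite value to infinity.\<close>

lemma slide_path_in_T:
  assumes "Q \<in> ranks T"
  shows "Suc m < n \<Longrightarrow> slide_path Q m \<in> T"
proof (induction m)
  case 0
  then show ?case using min_point_props(1)[OF ranks_tableau(1)[OF assms]] ranks_tableau(2)[OF assms] neT by simp
next
  case (Suc m)
  let ?z = "slide_path Q m"
  note tab = ranks_tableau[OF assms]
  have mp: "snd (min_point Q) = 1" using min_point_props(3)[OF tab(1)] tab(2) neT by simp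
  have z: "?z \<in> T" using Suc by simp
  then have H: "?z \<in> HH" "(c, int n - 1) \<in> HH" "le_H ?z (c, int n - 1)" using apex by (auto simp: TT_def)
  have "?z \<noteq> (c, int n - 1)" using snd_slide_path[of Q m] mp Suc.prems by (auto simp: prod_eq_iff)
  from le_H_cover[OF H this] obtain v where
    v: "v = (fst ?z - 1, snd ?z + 1) \<or> v = (fst ?z + 1, snd ?z + 1)" "le_H v (c, int n - 1)" by blast
  have "v \<in> HH" using v(1) HH_up[OF H(1)] by auto
  then have "v \<in> T" using v(2) by (simp add: TT_def)
  then have "Q v \<noteq> \<infinity>" using ranks_finite_iff[OF assms] by blast
  moreover have "Q (slide_path Q (Suc m)) \<le> Q v" using v(1) slide_path_le_up[of Q m] by auto
  ultimately have "Q (slide_path Q (Suc m)) \<noteq> \<infinity>" by (auto simp: top_unique)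
  then show ?case using ranks_finite_iff[OF assms] by blast
qed

lemma slide_path_top:
  assumes "Q \<in> ranks T"
  shows "slide_path Q (n - 2) = (c, int n - 1)"
proof -
  note tab = ranks_tableau[OF assms]
  have mp: "snd (min_point Q) = 1" using min_point_props(3)[OF tab(1)] tab(2) neT by simp
  have "snd (slide_path Q (n - 2)) = int n - 1" using snd_slide_path[of Q "n - 2"] mp ge2 by (simp add: of_nat_diff)
  moreover have "slide_path Q (n - 2) \<in> T" using slide_path_in_T[OF assms, of "n - 2"] ge2 by simp
  ultimately show ?thesis by (auto simp: TT_def le_H_def prod_eq_iff)
qed

text \<open>Promotion is undone by walking down from the apex: the preceding point of the sliding path is
  the lower neighbour with the larger promoted value.\<close>

lemma promote_pred:
  assumes Q: "Q \<in> ranks T" and m: "Suc (Suc m) < n"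
    and v': "v' \<in> T" "v' \<noteq> slide_path Q m" "snd v' = snd (slide_path Q m)" "le_H v' (slide_path Q (Suc m))"
  shows "promote T Q v' < promote T Q (slide_path Q m)"
proof -
  note tab = ranks_tableau[OF Q]
  let ?v = "slide_path Q m" and ?u = "slide_path Q (Suc m)"
  have inT: "?v \<in> T" "?u \<in> T" using slide_path_in_T[OF Q] m by auto
  have off: "slide_path Q k \<noteq> v'" for k
    using v'(2,3) snd_slide_path[of Q k] snd_slide_path[of Q m] by auto
  have s1: "slide Q ?v = Q ?u" by (rule slide_on)
  have s2: "slide Q v' = Q v'" using off by (rule slide_off)
  have f: "Q ?u \<noteq> \<infinity>" "Q v' \<noteq> \<infinity>" using inT v' ranks_finite_iff[OF Q] by auto
  have "v' \<noteq> ?u" using off[of "Suc m"] by auto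
  then have "Q v' < Q ?u"
    using fin_tableau_strict[OF tab(1) _ _ v'(4)] v'(1) inT TT_HH[of c n] f by blast
  then have "slide Q v' < slide Q ?v" unfolding s1 s2 .
  then have "promote T Q v' + 1 < promote T Q ?v + 1"
    using promote_of_slide[OF Q v'(1)] promote_of_slide[OF Q inT(1)] f s1 s2 by simp
  then show ?thesis by (simp add: add.commute[of _ 1] ennreal_add_left_cancel_less)
qed

text \<open>Both sliding paths pass through the apex and can be traced back downwards from the
  common promotion; once the paths agree, the slide is undone cell by cell.\<close>

lemma promote_inj: "inj_on (promote T) (ranks T)"
proof (rule inj_onI)
  fix Q Q' assume Q: "Q \<in> ranks T" and Q': "Q' \<in> ranks T" and e: "promote T Q = promote T Q'"
  note mpr = min_point_props(3)[OF ranks_tableau(1)]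
  have rows: "snd (slide_path Q m) = snd (slide_path Q' m)" for m
    using mpr[OF Q] mpr[OF Q'] ranks_tableau(2)[OF Q] ranks_tableau(2)[OF Q'] neT snd_slide_path by simp
  \<comment> \<open>If the paths had different points below a common one, then by
    \<open>promote_pred\<close> each of the two points would have to carry the strictly larger
    promoted value.\<close>
  have path_from_top: "k \<le> n - 2 \<Longrightarrow> slide_path Q (n - 2 - k) = slide_path Q' (n - 2 - k)" for k
  proof (induction k)
    case 0
    then show ?case using slide_path_top[OF Q] slide_path_top[OF Q'] by simp
  next
    case (Suc k)
    let ?m = "n - 2 - Suc k"
    have S: "Suc ?m = n - 2 - k" "Suc (Suc ?m) < n" using Suc.prems by auto
    have IH: "slide_path Q (Suc ?m) = slide_path Q' (Suc ?m)" using Suc S by simp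
    have inT: "slide_path Q ?m \<in> T" "slide_path Q' ?m \<in> T"
      using slide_path_in_T[OF Q] slide_path_in_T[OF Q'] S by auto
    show ?case
    proof (rule ccontr)
      assume ne: "slide_path Q ?m \<noteq> slide_path Q' ?m"
      have "promote T Q (slide_path Q' ?m) < promote T Q (slide_path Q ?m)"
        by (rule promote_pred[OF Q S(2) inT(2)]) (use ne rows slide_path_le[of Q' ?m] IH in auto)
      moreover have "promote T Q' (slide_path Q ?m) < promote T Q' (slide_path Q' ?m)"
        by (rule promote_pred[OF Q' S(2) inT(1)]) (use ne rows slide_path_le[of Q ?m] IH in auto)
      ultimately show False using e by simp
    qed
  qed
  have path: "slide_path Q m = slide_path Q' m" if "m \<le> n - 2" for m
    using path_from_top[of "n - 2 - m"] that by (metis diff_diff_cancel diff_le_self)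
  have off_ge: "slide_path Q m \<notin> T \<and> slide_path Q' m \<notin> T" if "m > n - 2" for m
  proof -
    have "snd (slide_path Q m) \<ge> int n"
      using snd_slide_path[of Q m] mpr[OF Q] ranks_tableau(2)[OF Q] neT that by auto
    then show ?thesis using rows[of m] by (auto simp: TT_def le_H_def)
  qed
  show "Q = Q'"
  proof
    fix z
    show "Q z = Q' z"
    proof (cases "z \<in> T")
      case False
      then show ?thesis using ranksD(1)[OF Q] ranksD(1)[OF Q'] by simp
    next
      case zT: True
      show ?thesis
      proof (cases "\<exists>m. slide_path Q m = z")
        case True
        then obtain m where m: "slide_path Q m = z" by blast
        have le: "m \<le> n - 2" using off_ge[of m] m zT by (meson not_less)
        have m': "slide_path Q' m = z" using path[OF le] m by simp
        show ?thesis
        proof (cases m)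
          case 0
          then have "z = min_point Q" "z = min_point Q'" using m m' by auto
          then show ?thesis using slide_ranks_values(2)[OF Q] slide_ranks_values(2)[OF Q'] by simp
        next
          case (Suc k)
          let ?v = "slide_path Q k"
          have v': "?v = slide_path Q' k" using path Suc le by simp
          have vT: "?v \<in> T" using slide_path_in_T[OF Q] Suc le ge2 by simp
          have s: "slide Q ?v = Q z" "slide Q' ?v = Q' z" using slide_on[of Q k] slide_on[of Q' k] m m' Suc v' by auto
          have "Q z \<noteq> \<infinity>" "Q' z \<noteq> \<infinity>" using zT ranks_finite_iff[OF Q] ranks_finite_iff[OF Q'] by auto
          then show ?thesis
            using promote_of_slide[OF Q vT] promote_of_slide[OF Q' vT] s e by simp
        qed
      next
        case False
        have "slide_path Q' m \<noteq> z" for m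
        proof
          assume m: "slide_path Q' m = z"
          have "m \<le> n - 2" using off_ge[of m] m zT by (meson not_less)
          then show False using path False m by auto
        qed
        then have "slide Q' z = Q' z" by (rule slide_off)
        moreover have "slide Q z = Q z" using False by (intro slide_off) auto
        moreover have "Q z \<noteq> \<infinity>" "Q' z \<noteq> \<infinity>" using zT ranks_finite_iff[OF Q] ranks_finite_iff[OF Q'] by auto
        ultimately show ?thesis
          using promote_of_slide[OF Q zT] promote_of_slide[OF Q' zT] e by simp
      qed
    qed
  qed
qed

lemma finite_ranks: "finite (ranks T)"
  using bij_betw_finite[OF list_rank_bij[OF finT]] finite_LE[OF finT] by simp

lemma promote_bij: "bij_betw (promote T) (ranks T) (ranks T)"
  unfolding bij_betw_def
proof
  show "inj_on (promote T) (ranks T)" by (rule promote_inj)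
  show "promote T ` ranks T = ranks T"
    by (rule endo_inj_surj[OF finite_ranks _ promote_inj]) (auto intro: promote_ranks)
qed

lemma promote_power_bij: "bij_betw (promote T ^^ j) (ranks T) (ranks T)"
proof (induction j)
  case (Suc j)
  show ?case unfolding funpow.simps by (rule bij_betw_trans[OF Suc.IH promote_bij])
qed (simp add: bij_betw_def)

text \<open>Apart from the refilled cell, the promotion is the slid tableau with all times lowered
  by one. The refilled cell carries the largest rank and is hidden by looking only below level
  \<open>card T - 1\<close>.\<close>

lemma sw_promote:
  assumes Q: "Q \<in> ranks T" and i: "Suc i < card T"
  shows "(k, of_nat (Suc i)) \<in> sw Q \<longleftrightarrow> (k, of_nat i) \<in> sw (promote T Q)"
proof -
  note tab = ranks_tableau[OF Q]
  have ne: "supp Q \<noteq> {}" using tab neT by simp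
  note sl = slide_ranks_values[OF Q]
  note st = fin_tableau_slide[OF tab(1) ne]
  let ?P = "promote T Q"
  note P = promote_ranks[OF Q]
  \<comment> \<open>The value 0 is left out: truncated subtraction would send 0 and 1 to the same
    number. After the slide no rank 0 remains.\<close>
  define A where "A = insert \<infinity> (range (\<lambda>i. of_nat (Suc i) :: ennreal))"
  have A: "range (slide Q) \<subseteq> A" "\<infinity> \<in> A"
  proof -
    have "slide Q z \<in> A" for z using sl(4)[of z] by (cases "slide Q z = \<infinity>") (auto simp: A_def simp del: of_nat_Suc)
    then show "range (slide Q) \<subseteq> A" by blast
  qed (simp add: A_def)
  have infm: "(\<infinity> :: ennreal) - 1 = \<infinity>" by simp
  have phi: "\<forall>a\<in>A. \<forall>b\<in>A. a - 1 \<le> b - 1 \<longleftrightarrow> a \<le> (b :: ennreal)"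
  proof (intro ballI)
    fix a b assume "a \<in> A" "b \<in> A"
    then consider "b = \<infinity>" | i where "a = \<infinity>" "b = of_nat (Suc i)" | i j where "a = of_nat (Suc i)" "b = of_nat (Suc j)"
      unfolding A_def by blast
    then show "a - 1 \<le> b - 1 \<longleftrightarrow> a \<le> b"
    proof cases
      case 2
      have "\<not> \<infinity> \<le> (of_nat i :: ennreal)" "\<not> \<infinity> \<le> (of_nat (Suc i) :: ennreal)"
        by (simp_all add: top_unique del: of_nat_Suc)
      then show ?thesis unfolding 2 infm of_nat_Suc_minus_one by blast
    next
      case 3
      show ?thesis unfolding 3 of_nat_Suc_minus_one of_nat_le_iff by simp
    qed simp
  qed
  have rel: "sw (\<lambda>z. slide Q z - 1) = (\<lambda>(k, v). (k, v - 1)) ` sw (slide Q)"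
    using sw_shift_relabel[OF st _ A phi infm, of 0] by simp
  let ?L = "{v. v < of_nat (card T - 1)} :: ennreal set"
  have L: "lower_set ?L" by (auto simp: lower_set_def)
  have "view UNIV ?L ?P = (\<lambda>z. slide Q z - 1)"
  proof
    fix z
    show "view UNIV ?L ?P z = slide Q z - 1"
    proof (cases "slide Q z = \<infinity>")
      case True
      then show ?thesis by (auto simp: view_def promote_def)
    next
      case False
      then obtain j where j: "slide Q z = of_nat (Suc j)" "Suc j < card T" using sl(4) by blast
      have "z \<in> supp (slide Q)" using False fin_tableauD(1)[OF st, of z] unfolding supp_def by blast
      then have zT: "z \<in> T" "z \<in> HH" using sl(3) TT_HH by auto
      have "?P z = of_nat j" using zT False j of_nat_Suc_minus_one[of j] by (simp add: promote_def)
      moreover have "(of_nat j :: ennreal) < of_nat (card T - 1)" using j(2) by (simp only: of_nat_less_iff)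
      ultimately show ?thesis using zT unfolding j(1) of_nat_Suc_minus_one by (simp add: view_def)
    qed
  qed
  then have "sw (\<lambda>z. slide Q z - 1) = {(k, v) \<in> sw ?P. v \<in> ?L}"
    using sw_view[OF ranks_tableau(1)[OF P] L, of UNIV] by (simp add: separated_def)
  then have eq: "{(k, v) \<in> sw ?P. v \<in> ?L} = (\<lambda>(k, v). (k, v - 1)) ` sw (slide Q)" using rel by simp
  have "(k, of_nat (Suc i)) \<in> sw Q \<longleftrightarrow> (k, of_nat (Suc i)) \<in> sw (slide Q)"
    unfolding sw_rec[OF tab(1) ne] sl(2) by simp
  also have "\<dots> \<longleftrightarrow> (k, of_nat i) \<in> (\<lambda>(k, v). (k, v - 1)) ` sw (slide Q)"
  proof
    assume "(k, of_nat (Suc i)) \<in> sw (slide Q)"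
    then show "(k, of_nat i) \<in> (\<lambda>(k, v). (k, v - 1)) ` sw (slide Q)"
      using of_nat_Suc_minus_one[of i] by force
  next
    assume "(k, of_nat i) \<in> (\<lambda>(k, v). (k, v - 1)) ` sw (slide Q)"
    then obtain v where v: "(k, v) \<in> sw (slide Q)" "of_nat i = v - 1" by auto
    obtain z where "v = slide Q z" "slide Q z \<noteq> \<infinity>" using sw_finite_value[OF st v(1)] by blast
    then obtain j where j: "v = of_nat (Suc j)" using sl(4) by blast
    then have "i = j" using v(2) unfolding j of_nat_Suc_minus_one by simp
    then show "(k, of_nat (Suc i)) \<in> sw (slide Q)" using v(1) j by simp
  qed
  also have "\<dots> \<longleftrightarrow> (k, of_nat i) \<in> sw ?P"
  proof -
    have "(of_nat i :: ennreal) < of_nat (card T - 1)" using i by (simp only: of_nat_less_iff)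
    then show ?thesis unfolding eq[symmetric] by simp
  qed
  finally show ?thesis .
qed

lemma sw_promote_power:
  assumes "Q \<in> ranks T" "i + j < card T"
  shows "(k, of_nat (i + j)) \<in> sw Q \<longleftrightarrow> (k, of_nat i) \<in> sw ((promote T ^^ j) Q)"
  using assms
proof (induction j arbitrary: Q)
  case (Suc j)
  have "(k, of_nat (i + Suc j)) \<in> sw Q \<longleftrightarrow> (k, of_nat (i + j)) \<in> sw (promote T Q)"
    using sw_promote[OF Suc.prems(1), of "i + j" k] Suc.prems(2) by simp
  also have "\<dots> \<longleftrightarrow> (k, of_nat i) \<in> sw ((promote T ^^ j) (promote T Q))"
    using Suc.IH[OF promote_ranks[OF Suc.prems(1)]] Suc.prems(2) by simp
  finally show ?case by (simp add: funpow_swap1)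
qed simp

lemma card_ranks_stationary:
  assumes "\<And>Q. Q \<in> ranks T \<Longrightarrow> P Q \<longleftrightarrow> P' ((promote T ^^ j) Q)"
  shows "card {Q \<in> ranks T. P Q} = card {Q \<in> ranks T. P' Q}"
proof -
  have "bij_betw (promote T ^^ j) {Q \<in> ranks T. P Q} {Q \<in> ranks T. P' Q}"
    
  proof (rule bij_betw_imageI)
    show "inj_on (promote T ^^ j) {Q \<in> ranks T. P Q}"
      using promote_power_bij[of j] by (auto simp: bij_betw_def intro: inj_on_subset)
    have e: "(promote T ^^ j) ` ranks T = ranks T" using promote_power_bij[of j] by (simp add: bij_betw_def)
    have "{Q \<in> ranks T. P Q} = {Q \<in> ranks T. P' ((promote T ^^ j) Q)}"
      using assms by (intro Collect_cong conj_cong) auto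
    then have "(promote T ^^ j) ` {Q \<in> ranks T. P Q} = {Q \<in> (promote T ^^ j) ` ranks T. P' Q}" by auto
    then show "(promote T ^^ j) ` {Q \<in> ranks T. P Q} = {Q \<in> ranks T. P' Q}" unfolding e .
  qed
  then show ?thesis by (rule bij_betw_same_card)
qed

lemma card_ranks_LE: "card {zs \<in> LE T. P (list_rank zs)} = card {Q \<in> ranks T. P Q}"
proof -
  have "bij_betw list_rank {zs \<in> LE T. P (list_rank zs)} {Q \<in> ranks T. P Q}"
    
  proof (rule bij_betw_imageI)
    show "inj_on list_rank {zs \<in> LE T. P (list_rank zs)}"
      using list_rank_bij[OF finT] by (auto simp: bij_betw_def intro: inj_on_subset)
    have e: "list_rank ` LE T = ranks T" using list_rank_bij[OF finT] by (simp add: bij_betw_def)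
    have "list_rank ` {zs \<in> LE T. P (list_rank zs)} = {Q \<in> list_rank ` LE T. P Q}" by auto
    then show "list_rank ` {zs \<in> LE T. P (list_rank zs)} = {Q \<in> ranks T. P Q}" unfolding e .
  qed
  then show ?thesis by (rule bij_betw_same_card)
qed

text \<open>Promotion permutes the linear extensions and turns swap \<open>i\<close> into swap 0, so
  all swaps have the location law of the first one, and the first swap is at the first cell of the
  extension.\<close>

theorem card_swap_at:
  assumes x: "(x, 1) \<in> T" and i: "i < card T"
  shows "real (card {zs \<in> LE T. (x, of_nat i) \<in> sw (list_rank zs)}) = hook_prob T (x, 1) * real (card (LE T))"
proof -
  have "card {zs \<in> LE T. (x, of_nat i) \<in> sw (list_rank zs)} = card {Q \<in> ranks T. (x, of_nat i) \<in> sw Q}"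
    by (rule card_ranks_LE)
  also have "\<dots> = card {Q \<in> ranks T. (x, of_nat 0) \<in> sw Q}"
    by (rule card_ranks_stationary[where j = i]) (use sw_promote_power[of _ 0 i x] i in simp)
  also have "\<dots> = card {zs \<in> LE T. (x, of_nat 0) \<in> sw (list_rank zs)}"
    by (rule card_ranks_LE[symmetric])
  also have "{zs \<in> LE T. (x, of_nat 0) \<in> sw (list_rank zs)} = {zs \<in> LE T. hd zs = (x, 1)}"
  proof (rule Collect_cong, rule conj_cong[OF refl])
    fix zs assume zs: "zs \<in> LE T"
    have Q: "list_rank zs \<in> ranks T" using list_rank_bij[OF finT] zs by (auto simp: bij_betw_def)
    note tab = ranks_tableau[OF Q]
    have sz: "set zs = T" using zs by (simp add: LE_def)
    then have nonempty: "zs \<noteq> []" using neT by auto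
    then have hd: "hd zs = zs ! 0" "0 < length zs" "hd zs \<in> T"
      using sz hd_in_set[OF nonempty] by (simp_all add: hd_conv_nth)
    then have r0: "list_rank zs (hd zs) = 0" using list_rank_nth[OF LE_distinct[OF zs], of 0] by simp
    show "(x, of_nat 0) \<in> sw (list_rank zs) \<longleftrightarrow> hd zs = (x, 1)"
    proof
      assume "(x, of_nat 0) \<in> sw (list_rank zs)"
      then have "list_rank zs (x, 1) \<le> 0" using sw_location[OF tab(1)] by fastforce
      then have "list_rank zs (x, 1) = list_rank zs (hd zs)" using r0 by simp
      then show "hd zs = (x, 1)" using inj_onD[OF ranksD(2)[OF Q] _ x hd(3)] by simp
    next
      assume "hd zs = (x, 1)"
      then show "(x, of_nat 0) \<in> sw (list_rank zs)"
        using sw_first[OF tab(1), of x] r0 x tab(2) by simp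
    qed
  qed
  finally show ?thesis using card_LE_first[OF odd corner_TT[OF x]] by simp
qed

text \<open>Promotion moves the block of steps to \<open>0, ..., m - 1\<close>. If
  \<open>(x, 1)\<close> were among the first \<open>m\<close> cells, its rank would be the time of a
  swap at \<open>x\<close>; so a block without swaps at \<open>x\<close> forces the cell to be
  avoided.\<close>

theorem card_no_swap:
  assumes x: "(x, 1) \<in> T" and i: "j + m \<le> card T"
  shows "real (card {zs \<in> LE T. \<forall>i<m. (x, of_nat (i + j)) \<notin> sw (list_rank zs)}) \<le>
    (1 - hook_prob T (x, 1)) ^ m * real (card (LE T))"
proof -
  have "card {zs \<in> LE T. \<forall>i<m. (x, of_nat (i + j)) \<notin> sw (list_rank zs)} =
      card {Q \<in> ranks T. \<forall>i<m. (x, of_nat (i + j)) \<notin> sw Q}"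
    by (rule card_ranks_LE)
  also have "\<dots> = card {Q \<in> ranks T. \<forall>i<m. (x, of_nat i) \<notin> sw Q}"
    by (rule card_ranks_stationary[where j = j]) (use sw_promote_power[of _ _ j x] i in auto)
  also have "\<dots> = card {zs \<in> LE T. \<forall>i<m. (x, of_nat i) \<notin> sw (list_rank zs)}"
    by (rule card_ranks_LE[symmetric])
  also have "\<dots> \<le> card {zs \<in> LE T. (x, 1) \<notin> set (take m zs)}"
  proof (rule card_mono)
    show "finite {zs \<in> LE T. (x, 1) \<notin> set (take m zs)}" using finite_LE[OF finT] by simp
    show "{zs \<in> LE T. \<forall>i<m. (x, of_nat i) \<notin> sw (list_rank zs)} \<subseteq> {zs \<in> LE T. (x, 1) \<notin> set (take m zs)}"
    proof safe
      fix zs assume zs: "zs \<in> LE T" "\<forall>i<m. (x, of_nat i) \<notin> sw (list_rank zs)" "(x, 1) \<in> set (take m zs)"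
      have Q: "list_rank zs \<in> ranks T" using list_rank_bij[OF finT] zs by (auto simp: bij_betw_def)
      note tab = ranks_tableau[OF Q]
      obtain i where i: "i < m" "i < length zs" "zs ! i = (x, 1)" using zs(3) by (auto simp: in_set_conv_nth)
      then have "list_rank zs (x, 1) = of_nat i" using list_rank_nth[OF LE_distinct[OF zs(1)] i(2)] by simp
      then show False using sw_first[OF tab(1), of x] x tab(2) zs(2) i by auto
    qed
  qed
  finally have "real (card {zs \<in> LE T. \<forall>i<m. (x, of_nat (i + j)) \<notin> sw (list_rank zs)}) \<le>
    real (card {zs \<in> LE T. (x, 1) \<notin> set (take m zs)})" by simp
  then show ?thesis using card_LE_avoid[OF odd corner_TT[OF x] up_closed_TT x, of m] by linarith
qed

end

section \<open>The law of the tableau process\<close>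

text \<open>\<open>s k\<close> is the holding time in the state with \<open>k\<close> cells, so cell
  number \<open>i\<close>, counted from 0, enters after the holding times
  \<open>0, ..., i\<close>.\<close>

definition arrival :: "(int \<times> int) list \<Rightarrow> (nat \<Rightarrow> real) \<Rightarrow> int \<times> int \<Rightarrow> ennreal" where
  "arrival zs s z = (if z \<in> set zs then ennreal (\<Sum>k\<le>(LEAST i. i < length zs \<and> zs ! i = z). s k) else \<infinity>)"

lemma arrival_nth:
  assumes "distinct zs" "i < length zs"
  shows "arrival zs s (zs ! i) = ennreal (\<Sum>k\<le>i. s k)"
proof -
  have "(LEAST k. k < length zs \<and> zs ! k = zs ! i) = i"
    by (rule Least_equality) (use assms nth_eq_iff_index_eq in auto)
  then show ?thesis using assms by (simp add: arrival_def)
qed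

context staircase
begin

abbreviation "St \<equiv> tableau_states c n"

lemma finite_St: "finite St"
  by (rule finite_subset[of _ "Pow T"]) (use finT in \<open>auto simp: tableau_states_def\<close>)

lemma St_up_closed: "A \<in> St \<Longrightarrow> up_closed c n (T - A)"
  unfolding up_closed_def tableau_states_def down_closed_def using TT_HH[of c n] by blast

lemma St_insert:
  assumes "A \<in> St" "z \<in> corners (T - A)"
  shows "insert z A \<in> St"
proof -
  note u = St_up_closed[OF assms(1)]
  have z: "z \<in> T" "\<forall>w\<in>T - A. le_H w z \<longrightarrow> w = z" using assms(2)[unfolded corner_iff[OF u]] by auto
  have A: "A \<subseteq> T" "\<forall>v\<in>A. \<forall>w\<in>HH. le_H w v \<longrightarrow> w \<in> A" using assms(1) by (auto simp: tableau_states_def down_closed_def)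
  have "w \<in> insert z A" if w: "w \<in> HH" "le_H w z" for w
  proof -
    have "w \<in> T" using TT_down[OF z(1) w] .
    then show ?thesis using z(2) w(2) by blast
  qed
  then have "\<forall>v\<in>insert z A. \<forall>w\<in>HH. le_H w v \<longrightarrow> w \<in> insert z A" using A(2) by blast
  then show ?thesis using A(1) z(1) TT_HH[of c n] by (auto simp: tableau_states_def down_closed_def)
qed

lemma tableau_rate_insert:
  assumes "z \<in> corners (T - A)"
  shows "tableau_rate c n r A (insert z A) = r * hook_prob (T - A) z"
proof -
  have "corners (T - A) \<inter> A = {}" by (auto simp: corners_def)
  then have "{z' \<in> corners (T - A). insert z A = insert z' A} = {z}" using assms by blast
  then show ?thesis by (simp add: tableau_rate_def)
qed

text \<open>The corner probabilities sum to 1, so the total rate is the same in every state but the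
  full one: the jumps follow a Poisson clock that stops after \<open>card T\<close> rings.\<close>

lemma exit_rate_tableau:
  assumes "A \<in> St"
  shows "exit_rate St (tableau_rate c n r) A = (if A = T then 0 else r)"
proof -
  let ?C = "corners (T - A)"
  have fC: "finite ?C" using finT by (auto simp: corners_def)
  have "exit_rate St (tableau_rate c n r) A =
    (\<Sum>A'\<in>St. \<Sum>z\<in>?C. if A' = insert z A then r * hook_prob (T - A) z else 0)"
    unfolding exit_rate_def tableau_rate_def
    by (rule sum.cong[OF refl], rule sum.mono_neutral_cong_left) (use fC in auto)
  also have "\<dots> = (\<Sum>z\<in>?C. \<Sum>A'\<in>St. if A' = insert z A then r * hook_prob (T - A) z else 0)"
    by (rule sum.swap)
  also have "\<dots> = (\<Sum>z\<in>?C. r * hook_prob (T - A) z)"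
    using St_insert[OF assms] finite_St by (intro sum.cong) (auto simp: sum.delta)
  also have "\<dots> = (if A = T then 0 else r)"
  proof (cases "A = T")
    case True
    then show ?thesis by (simp add: corners_def)
  next
    case False
    then have "T - A \<noteq> {}" using assms by (auto simp: tableau_states_def)
    then show ?thesis using False sum_hook_prob[OF odd St_up_closed[OF assms]] by (simp flip: sum_distrib_left)
  qed
  finally show ?thesis .
qed

text \<open>A cell below an entry of the list cannot come later in it, so every initial segment is
  downward closed.\<close>

lemma prefix_state:
  assumes zs: "zs \<in> LE T"
  shows "set (take i zs) \<in> St"
proof -
  have T: "set zs = T" and srt: "sorted_wrt (\<lambda>z w. \<not> le_H w z) zs" using zs by (auto simp: LE_def)
  have sub: "set (take i zs) \<subseteq> T" using set_take_subset[of i zs] T by simp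
  have "w \<in> set (take i zs)" if h: "z \<in> set (take i zs)" "w \<in> HH" "le_H w z" for z w
  proof -
    obtain a where a: "a < i" "a < length zs" "z = zs ! a" using h(1) by (auto simp: in_set_conv_nth)
    have "z \<in> T" using h(1) sub by blast
    then have "w \<in> set zs" unfolding T using TT_down h(2,3) by blast
    then obtain b where b: "b < length zs" "w = zs ! b" by (auto simp: in_set_conv_nth)
    have "b < i"
    proof (rule ccontr)
      assume "\<not> b < i"
      then have "\<not> le_H (zs ! b) (zs ! a)" using sorted_wrt_nth_less[OF srt, of a b] a b by simp
      then show False using h(3) a b by simp
    qed
    then show ?thesis using b by (auto simp: in_set_conv_nth)
  qed
  then show ?thesis using sub TT_HH[of c n] unfolding tableau_states_def down_closed_def by blast
qed

lemma prefix_Suc: "i < length zs \<Longrightarrow> set (take (Suc i) zs) = insert (zs ! i) (set (take i zs))"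
  by (simp add: take_Suc_conv_app_nth)

lemma prefix_neq:
  assumes "zs \<in> LE T" "i < length zs"
  shows "set (take i zs) \<noteq> T" "zs ! i \<notin> set (take i zs)"
proof -
  have d: "distinct zs" using LE_distinct[OF assms(1)] .
  have T: "set zs = T" using assms(1) by (simp add: LE_def)
  show n: "zs ! i \<notin> set (take i zs)"
  proof
    assume "zs ! i \<in> set (take i zs)"
    then obtain k where "k < i" "zs ! k = zs ! i" using assms(2) by (auto simp: in_set_conv_nth)
    then show False using d assms(2) by (simp add: nth_eq_iff_index_eq)
  qed
  then show "set (take i zs) \<noteq> T" using T nth_mem[OF assms(2)] by auto
qed

end

text \<open>Fixes the jump chain and the holding times whose existence the description of the
  process asserts.\<close>

locale staircase_process = staircase +
  fixes M :: "'w measure" and r :: real and Y :: "nat \<Rightarrow> 'w \<Rightarrow> (int \<times> int) set"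
    and S :: "nat \<Rightarrow> 'w \<Rightarrow> ennreal" and X :: "real \<Rightarrow> 'w \<Rightarrow> (int \<times> int) set"
  assumes pM: "prob_space M" and r: "0 < r"
    and Ym: "\<And>k. Y k \<in> measurable M (count_space St)"
    and Sm: "\<And>k. S k \<in> borel_measurable M"
    and formula: "\<And>k ys s. (\<forall>i\<le>k. ys i \<in> St \<and> 0 \<le> s i) \<Longrightarrow>
           measure M {\<omega> \<in> space M. \<forall>i\<le>k. Y i \<omega> = ys i \<and> ennreal (s i) < S i \<omega>} =
             of_bool (ys 0 = {}) *
             (\<Prod>i<k. jump_prob St (tableau_rate c n r) (ys i) (ys (Suc i))) *
             (\<Prod>i\<le>k. exp (- (exit_rate St (tableau_rate c n r) (ys i) * s i)))"
    and window: "\<And>\<omega> t. \<omega> \<in> space M \<Longrightarrow> 0 \<le> t \<Longrightarrow> \<exists>k.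
           (\<Sum>i<k. S i \<omega>) \<le> ennreal t \<and> ennreal t < (\<Sum>i\<le>k. S i \<omega>) \<and> X t \<omega> = Y k \<omega>"
begin

abbreviation "N \<equiv> card T"
abbreviation "e \<equiv> card (LE T)"

sublocale prob_space M by (rule pM)

lemma e_pos: "e > 0" using card_LE_pos[OF odd up_closed_TT] .

lemma Sm' [measurable]: "S k \<in> borel_measurable M" by (rule Sm)

lemma Y_event [measurable]: "Measurable.pred M (\<lambda>\<omega>. Y i \<omega> = A)"
proof -
  have "Y i -` ({A} \<inter> St) \<inter> space M \<in> sets M" by (rule measurable_sets[OF Ym]) simp
  moreover have "Y i -` ({A} \<inter> St) \<inter> space M = {\<omega> \<in> space M. Y i \<omega> = A}"
    using measurable_space[OF Ym, of _ i] by auto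
  ultimately show ?thesis by (simp add: pred_def)
qed

lemma Y_mem_event [measurable]: "Measurable.pred M (\<lambda>\<omega>. z \<in> Y i \<omega>)"
proof -
  have "Y i -` {A \<in> St. z \<in> A} \<inter> space M \<in> sets M" by (rule measurable_sets[OF Ym]) simp
  moreover have "Y i -` {A \<in> St. z \<in> A} \<inter> space M = {\<omega> \<in> space M. z \<in> Y i \<omega>}"
    using measurable_space[OF Ym, of _ i] by auto
  ultimately show ?thesis by (simp add: pred_def)
qed

text \<open>The constant exit rate decouples states from holding times, and the jump probabilities
  multiply to \<open>1 / e\<close> for every path (\<open>LE_path_prob\<close>). The full state has
  rate 0 and contributes a factor 1, so only \<open>i < N\<close> remain on the right.\<close>

lemma path_formula:
  assumes zs: "zs \<in> LE T" and s: "\<And>i. i \<le> N \<Longrightarrow> 0 \<le> s i"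
  shows "prob {\<omega> \<in> space M. \<forall>i\<le>N. Y i \<omega> = set (take i zs) \<and> ennreal (s i) < S i \<omega>} =
    1 / real e * (\<Prod>i<N. exp (- (r * s i)))"
proof -
  let ?ys = "\<lambda>i. set (take i zs)"
  have len: "length zs = N" using LE_length[OF zs] .
  have T: "set zs = T" using zs by (simp add: LE_def)
  have ex: "exit_rate St (tableau_rate c n r) (?ys i) = (if i < N then r else 0)" if "i \<le> N" for i
  proof (cases "i < N")
    case True
    then show ?thesis using exit_rate_tableau[OF prefix_state[OF zs]] prefix_neq(1)[OF zs, of i] len by simp
  next
    case False
    then have "?ys i = T" using that len T by simp
    then show ?thesis using exit_rate_tableau[OF prefix_state[OF zs, of i]] False by simp
  qed
  have jp: "jump_prob St (tableau_rate c n r) (?ys i) (?ys (Suc i)) = hook_prob (T - ?ys i) (zs ! i)" if "i < N" for i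
  proof -
    have "zs ! i \<in> corners (T - ?ys i)" using LE_step[OF up_closed_TT zs] that len by simp
    then have "tableau_rate c n r (?ys i) (?ys (Suc i)) = r * hook_prob (T - ?ys i) (zs ! i)"
      using tableau_rate_insert prefix_Suc that len by metis
    then show ?thesis using ex[of i] that r by (simp add: jump_prob_def)
  qed
  have "prob {\<omega> \<in> space M. \<forall>i\<le>N. Y i \<omega> = ?ys i \<and> ennreal (s i) < S i \<omega>} =
     of_bool (?ys 0 = {}) * (\<Prod>i<N. jump_prob St (tableau_rate c n r) (?ys i) (?ys (Suc i))) *
             (\<Prod>i\<le>N. exp (- (exit_rate St (tableau_rate c n r) (?ys i) * s i)))"
    by (rule formula) (use prefix_state[OF zs] s in auto)
  also have "(\<Prod>i<N. jump_prob St (tableau_rate c n r) (?ys i) (?ys (Suc i))) = (\<Prod>i<N. hook_prob (T - ?ys i) (zs ! i))"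
    by (rule prod.cong) (auto simp: jp)
  also have "\<dots> = 1 / real e" using LE_path_prob[OF odd up_closed_TT zs] len by simp
  also have "(\<Prod>i\<le>N. exp (- (exit_rate St (tableau_rate c n r) (?ys i) * s i))) = (\<Prod>i\<le>N. exp (- ((if i < N then r else 0) * s i)))"
    by (rule prod.cong) (auto simp: ex)
  also have "\<dots> = (\<Prod>i<N. exp (- (r * s i)))"
    by (simp add: lessThan_Suc_atMost[symmetric])
  finally show ?thesis by simp
qed

text \<open>Positivity of the holding times is built in, so that the probability of this event is
  \<open>path_formula\<close> at \<open>s = 0\<close>.\<close>

definition E :: "(int \<times> int) list \<Rightarrow> 'w set" where
  "E zs = {\<omega> \<in> space M. \<forall>i\<le>N. Y i \<omega> = set (take i zs) \<and> 0 < S i \<omega>}"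

lemma E_sets [measurable]: "E zs \<in> sets M"
  unfolding E_def by measurable

lemma prob_E: "zs \<in> LE T \<Longrightarrow> prob (E zs) = 1 / real e"
  using path_formula[of zs "\<lambda>_. 0"] by (simp add: E_def)

text \<open>Consecutive states differ by the cell just added, so the list can be read off from the
  states.\<close>

lemma E_disjoint: "disjoint_family_on E (LE T)"
proof (unfold disjoint_family_on_def, intro ballI impI)
  fix xs ys assume a: "xs \<in> LE T" "ys \<in> LE T" "xs \<noteq> ys"
  show "E xs \<inter> E ys = {}"
  proof (rule ccontr)
    assume "E xs \<inter> E ys \<noteq> {}"
    then have eq: "\<And>i. i \<le> N \<Longrightarrow> set (take i xs) = set (take i ys)" by (auto simp: E_def)
    have len: "length xs = N" "length ys = N" using LE_length a by auto
    have "xs = ys"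
    proof (rule nth_equalityI)
      show "length xs = length ys" using len by simp
      fix i assume i: "i < length xs"
      have "insert (xs ! i) (set (take i xs)) = insert (ys ! i) (set (take i ys))"
        using prefix_Suc[of i xs] prefix_Suc[of i ys] eq[of "Suc i"] i len by simp
      moreover have "set (take i xs) = set (take i ys)" using eq i len by simp
      moreover have "xs ! i \<notin> set (take i xs)" "ys ! i \<notin> set (take i ys)"
        using prefix_neq(2) a i len by auto
      ultimately show "xs ! i = ys ! i" by blast
    qed
    then show False using a by simp
  qed
qed

lemma AE_E: "AE \<omega> in M. \<exists>zs\<in>LE T. \<omega> \<in> E zs"
proof -
  have fin: "finite (LE T)" using finite_LE[OF finT] .
  have "prob (\<Union>zs\<in>LE T. E zs) = (\<Sum>zs\<in>LE T. prob (E zs))"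
    by (rule finite_measure_finite_Union[OF fin _ E_disjoint]) (auto intro: E_sets)
  also have "\<dots> = 1" using prob_E e_pos by simp
  finally have "AE \<omega> in M. \<omega> \<in> (\<Union>zs\<in>LE T. E zs)" by (rule AE_prob_1)
  then show ?thesis by simp
qed

lemma tail_zero: "(\<lambda>m. 1 / real e * exp (- (r * real m))) \<longlonglongrightarrow> 0"
proof -
  have "filterlim (\<lambda>m. r * real m) at_top sequentially"
    by (rule filterlim_tendsto_pos_mult_at_top[OF tendsto_const r filterlim_real_sequentially])
  then have "(\<lambda>m. exp (- (r * real m))) \<longlonglongrightarrow> 0"
    by (intro filterlim_compose[OF exp_at_bot]) (simp add: filterlim_uminus_at_bot)
  from tendsto_mult_right[OF this, of "1 / real e"] show ?thesis by simp
qed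

text \<open>The event lies in all tail events \<open>S i > m\<close>, whose probabilities decay
  exponentially because the state is left at rate \<open>r > 0\<close>.\<close>

lemma AE_finite:
  assumes zs: "zs \<in> LE T" and i: "i < N"
  shows "AE \<omega> in M. \<omega> \<in> E zs \<longrightarrow> S i \<omega> \<noteq> \<infinity>"
proof -
  let ?B = "{\<omega> \<in> space M. \<omega> \<in> E zs \<and> S i \<omega> = \<infinity>}"
  have "prob ?B \<le> 1 / real e * exp (- (r * real m))" for m
  proof -
    let ?s = "\<lambda>k. if k = i then real m else 0"
    have "prob ?B \<le> prob {\<omega> \<in> space M. \<forall>k\<le>N. Y k \<omega> = set (take k zs) \<and> ennreal (?s k) < S k \<omega>}"
      by (rule finite_measure_mono) (auto simp: E_def)
    also have "\<dots> = 1 / real e * (\<Prod>k<N. exp (- (r * ?s k)))" by (rule path_formula[OF zs]) auto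
    also have "(\<Prod>k<N. exp (- (r * ?s k))) = (\<Prod>k<N. if k = i then exp (- (r * real m)) else 1)"
      by (rule prod.cong) auto
    also have "\<dots> = exp (- (r * real m))" using i by (simp add: prod.delta)
    finally show ?thesis .
  qed
  then have "prob ?B \<le> 0" by (intro LIMSEQ_le_const[OF tail_zero]) auto
  then have "prob ?B = 0" using measure_nonneg[of M ?B] by linarith
  moreover have "?B \<in> sets M" by measurable
  ultimately have "AE \<omega> in M. \<omega> \<notin> ?B" by (simp add: prob_eq_0)
  then show ?thesis by (rule AE_mp) (rule AE_I2, auto)
qed

text \<open>State \<open>N\<close> is the full triangle, left at rate 0, so the additional
  requirement \<open>S N > m\<close> costs no probability, for any \<open>m\<close>.\<close>

lemma AE_infinite:
  assumes zs: "zs \<in> LE T"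
  shows "AE \<omega> in M. \<omega> \<in> E zs \<longrightarrow> S N \<omega> = \<infinity>"
proof -
  have "AE \<omega> in M. \<omega> \<in> E zs \<longrightarrow> ennreal (real m) < S N \<omega>" for m :: nat
  proof -
    let ?s = "\<lambda>k. if k = N then real m else 0"
    let ?G = "{\<omega> \<in> space M. \<forall>k\<le>N. Y k \<omega> = set (take k zs) \<and> ennreal (?s k) < S k \<omega>}"
    have G: "?G \<in> sets M" by measurable
    have "prob ?G = 1 / real e * (\<Prod>k<N. exp (- (r * ?s k)))" by (rule path_formula[OF zs]) auto
    also have "(\<Prod>k<N. exp (- (r * ?s k))) = 1" by (rule prod.neutral) auto
    finally have pG: "prob ?G = prob (E zs)" using prob_E[OF zs] by simp
    have sub: "?G \<subseteq> E zs"
    proof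
      fix \<omega> assume "\<omega> \<in> ?G"
      then show "\<omega> \<in> E zs" unfolding E_def by (auto intro: le_less_trans[OF zero_le])
    qed
    have "prob (E zs - ?G) = 0" using finite_measure_Diff[OF E_sets G sub] pG by simp
    then have "AE \<omega> in M. \<omega> \<notin> E zs - ?G" using G by (subst (asm) prob_eq_0) auto
    then show ?thesis by (rule AE_mp) (rule AE_I2, auto)
  qed
  then have "AE \<omega> in M. \<forall>m::nat. \<omega> \<in> E zs \<longrightarrow> ennreal (real m) < S N \<omega>" by (subst AE_all_countable) (rule allI)
  then show ?thesis
  proof (rule AE_mp, intro AE_I2 impI)
    fix \<omega> assume "\<forall>m::nat. \<omega> \<in> E zs \<longrightarrow> ennreal (real m) < S N \<omega>" "\<omega> \<in> E zs"
    then have "\<And>m::nat. of_nat m < S N \<omega>" by (simp add: ennreal_of_nat_eq_real_of_nat)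
    then show "S N \<omega> = \<infinity>" using ennreal_Ex_less_of_nat[of "S N \<omega>"] less_asym by (metis infinity_ennreal_def top.not_eq_extremum)
  qed
qed

section \<open>Law of the holding times given the path\<close>

definition \<sigma> :: "nat \<Rightarrow> 'w \<Rightarrow> real" where "\<sigma> i \<omega> = enn2real (S i \<omega>)"

lemma \<sigma>_measurable [measurable]: "\<sigma> i \<in> borel_measurable M"
  unfolding \<sigma>_def by measurable

lemma AE_good:
  assumes "zs \<in> LE T"
  shows "AE \<omega> in M. \<omega> \<in> E zs \<longrightarrow> (\<forall>i<N. S i \<omega> = ennreal (\<sigma> i \<omega>) \<and> 0 < \<sigma> i \<omega>) \<and> S N \<omega> = \<infinity>"
proof -
  have "AE \<omega> in M. \<forall>i\<in>{..<N}. \<omega> \<in> E zs \<longrightarrow> S i \<omega> \<noteq> \<infinity>"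
    using AE_finite[OF assms] by (subst AE_finite_all) auto
  with AE_infinite[OF assms] show ?thesis
  proof eventually_elim
    case (elim \<omega>)
    show ?case
    proof (intro impI conjI allI)
      assume w: "\<omega> \<in> E zs"
      then show "S N \<omega> = \<infinity>" using elim by simp
      fix i assume i: "i < N"
      then have "S i \<omega> < \<top>" using elim w by (auto simp: less_top)
      moreover have "0 < S i \<omega>" using w i by (auto simp: E_def)
      ultimately show "S i \<omega> = ennreal (\<sigma> i \<omega>)" "0 < \<sigma> i \<omega>"
        by (auto simp: \<sigma>_def enn2real_positive_iff)
    qed
  qed
qed

text \<open>The truncation \<open>max 0\<close> accommodates negative thresholds, which the
  half-lines generating the Borel sets include.\<close>

lemma prob_joint:
  assumes zs: "zs \<in> LE T" and J: "J \<subseteq> {..<N}"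
  shows "prob {\<omega> \<in> space M. \<omega> \<in> E zs \<and> (\<forall>i\<in>J. s i < \<sigma> i \<omega>)} = 1 / real e * (\<Prod>i\<in>J. exp (- (r * max 0 (s i))))"
proof -
  let ?s = "\<lambda>i. if i \<in> J then max 0 (s i) else 0"
  have finJ: "finite J" using J finite_subset by blast
  have "prob {\<omega> \<in> space M. \<omega> \<in> E zs \<and> (\<forall>i\<in>J. s i < \<sigma> i \<omega>)} =
      prob {\<omega> \<in> space M. \<forall>k\<le>N. Y k \<omega> = set (take k zs) \<and> ennreal (?s k) < S k \<omega>}"
  proof (rule finite_measure_eq_AE)
    show "AE \<omega> in M. (\<omega> \<in> {\<omega> \<in> space M. \<omega> \<in> E zs \<and> (\<forall>i\<in>J. s i < \<sigma> i \<omega>)}) =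
       (\<omega> \<in> {\<omega> \<in> space M. \<forall>k\<le>N. Y k \<omega> = set (take k zs) \<and> ennreal (?s k) < S k \<omega>})"
      using AE_good[OF zs] AE_space
    proof eventually_elim
      case (elim \<omega>)
      have *: "s i < \<sigma> i \<omega> \<longleftrightarrow> ennreal (?s i) < S i \<omega>" if "i \<in> J" "\<omega> \<in> E zs" for i
      proof -
        have "i < N" using that J by auto
        then have "S i \<omega> = ennreal (\<sigma> i \<omega>)" "0 < \<sigma> i \<omega>" using elim that by auto
        then show ?thesis using that by (cases "0 \<le> s i") (auto simp: ennreal_less_iff ennreal_neg)
      qed
      show ?case
      proof
        assume a: "\<omega> \<in> {\<omega> \<in> space M. \<omega> \<in> E zs \<and> (\<forall>i\<in>J. s i < \<sigma> i \<omega>)}"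
        have "ennreal (?s k) < S k \<omega>" if "k \<le> N" for k
          using a * that by (cases "k \<in> J") (auto simp: E_def)
        then show "\<omega> \<in> {\<omega> \<in> space M. \<forall>k\<le>N. Y k \<omega> = set (take k zs) \<and> ennreal (?s k) < S k \<omega>}"
          using a by (auto simp: E_def)
      next
        assume a: "\<omega> \<in> {\<omega> \<in> space M. \<forall>k\<le>N. Y k \<omega> = set (take k zs) \<and> ennreal (?s k) < S k \<omega>}"
        then have E: "\<omega> \<in> E zs" unfolding E_def by (auto intro: le_less_trans[OF zero_le])
        moreover have "s i < \<sigma> i \<omega>" if "i \<in> J" for i
        proof -
          have "i \<le> N" using that J by auto
          then show ?thesis using a * that E by auto
        qed
        ultimately show "\<omega> \<in> {\<omega> \<in> space M. \<omega> \<in> E zs \<and> (\<forall>i\<in>J. s i < \<sigma> i \<omega>)}" using a by auto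
      qed
    qed
    show "{\<omega> \<in> space M. \<omega> \<in> E zs \<and> (\<forall>i\<in>J. s i < \<sigma> i \<omega>)} \<in> sets M" using finJ by measurable
    show "{\<omega> \<in> space M. \<forall>k\<le>N. Y k \<omega> = set (take k zs) \<and> ennreal (?s k) < S k \<omega>} \<in> sets M" by measurable
  qed
  also have "\<dots> = 1 / real e * (\<Prod>i<N. exp (- (r * ?s i)))" by (rule path_formula[OF zs]) auto
  also have "(\<Prod>i<N. exp (- (r * ?s i))) = (\<Prod>i\<in>J. exp (- (r * max 0 (s i))))"
    by (rule prod.mono_neutral_cong_right) (use J in auto)
  finally show ?thesis .
qed

abbreviation "U zs \<equiv> uniform_measure M (E zs)"

lemma U_measurable [measurable]: "\<sigma> i \<in> borel_measurable (U zs)"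
  by (simp add: measurable_cong_sets[OF sets_uniform_measure refl])

lemma U_prob_space: "zs \<in> LE T \<Longrightarrow> prob_space (U zs)"
  using prob_E[of zs] e_pos by (intro prob_space_uniform_measure) (auto simp: emeasure_eq_measure)

lemma U_joint:
  assumes zs: "zs \<in> LE T" and J: "J \<subseteq> {..<N}"
  shows "measure (U zs) {\<omega> \<in> space M. \<forall>i\<in>J. s i < \<sigma> i \<omega>} = (\<Prod>i\<in>J. exp (- (r * max 0 (s i))))"
proof -
  have finJ: "finite J" using J finite_subset by blast
  have m: "{\<omega> \<in> space M. \<forall>i\<in>J. s i < \<sigma> i \<omega>} \<in> sets M" using finJ by measurable
  have "measure (U zs) {\<omega> \<in> space M. \<forall>i\<in>J. s i < \<sigma> i \<omega>} = prob (E zs \<inter> {\<omega> \<in> space M. \<forall>i\<in>J. s i < \<sigma> i \<omega>}) / prob (E zs)"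
    using prob_E[OF zs] e_pos m by (intro measure_uniform_measure) (auto simp: emeasure_eq_measure)
  also have "E zs \<inter> {\<omega> \<in> space M. \<forall>i\<in>J. s i < \<sigma> i \<omega>} = {\<omega> \<in> space M. \<omega> \<in> E zs \<and> (\<forall>i\<in>J. s i < \<sigma> i \<omega>)}" by auto
  finally show ?thesis unfolding prob_joint[OF assms] prob_E[OF zs] using e_pos by simp
qed

lemma U_distributed:
  assumes zs: "zs \<in> LE T" and i: "i < N"
  shows "distributed (U zs) lborel (\<sigma> i) (exponential_density r)"
proof (rule exponential_distributedI[OF U_measurable r])
  interpret U: prob_space "U zs" using U_prob_space[OF zs] .
  fix a :: real assume a: "0 \<le> a"
  have "U.prob {\<omega> \<in> space (U zs). \<sigma> i \<omega> \<le> a} = 1 - U.prob {\<omega> \<in> space (U zs). a < \<sigma> i \<omega>}"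
  proof -
    have "{\<omega> \<in> space (U zs). \<sigma> i \<omega> \<le> a} = space (U zs) - {\<omega> \<in> space (U zs). a < \<sigma> i \<omega>}" by auto
    then show ?thesis using U.prob_compl[of "{\<omega> \<in> space (U zs). a < \<sigma> i \<omega>}"] by simp
  qed
  also have "U.prob {\<omega> \<in> space (U zs). a < \<sigma> i \<omega>} = exp (- a * r)"
    using U_joint[OF zs, of "{i}" "\<lambda>_. a"] i a by (simp add: mult.commute)
  finally show "emeasure (U zs) {\<omega> \<in> space (U zs). \<sigma> i \<omega> \<le> a} = 1 - ennreal (exp (- a * r))"
    by (simp add: U.emeasure_eq_measure ennreal_minus ennreal_1[symmetric] del: ennreal_1)
qed

text \<open>The half-lines \<open>s < \<sigma> i\<close> form an intersection-stable generator, and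
  on them \<open>U_joint\<close> is a product.\<close>

lemma U_indep:
  assumes zs: "zs \<in> LE T"
  shows "prob_space.indep_vars (U zs) (\<lambda>_. borel) \<sigma> {..<N}"
proof -
  interpret U: prob_space "U zs" using U_prob_space[OF zs] .
  define F where "F = (\<lambda>i. {{\<omega> \<in> space M. s < \<sigma> i \<omega>} | s. True})"
  have gen: "U.indep_sets (\<lambda>i. sigma_sets (space (U zs)) (F i)) {..<N}"
  proof (rule U.indep_sets_sigma)
    show "Int_stable (F i)" for i
      unfolding Int_stable_def F_def
    proof clarsimp
      fix s s'
      have "{\<omega> \<in> space M. s < \<sigma> i \<omega>} \<inter> {\<omega> \<in> space M. s' < \<sigma> i \<omega>} = {\<omega> \<in> space M. max s s' < \<sigma> i \<omega>}" by auto
      then show "\<exists>s''. {\<omega> \<in> space M. s < \<sigma> i \<omega>} \<inter> {\<omega> \<in> space M. s' < \<sigma> i \<omega>} = {\<omega> \<in> space M. s'' < \<sigma> i \<omega>}" by blast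
    qed
    show "U.indep_sets F {..<N}"
    proof (rule U.indep_setsI)
      show "F i \<subseteq> U.events" for i unfolding F_def by auto
      fix A J assume J: "J \<noteq> {}" "J \<subseteq> {..<N}" "finite J" "\<forall>j\<in>J. A j \<in> F j"
      have "\<forall>j\<in>J. \<exists>s. A j = {\<omega> \<in> space M. s < \<sigma> j \<omega>}" using J(4) by (auto simp: F_def)
      then obtain s where s: "\<And>j. j \<in> J \<Longrightarrow> A j = {\<omega> \<in> space M. s j < \<sigma> j \<omega>}" by metis
      have "(\<Inter>j\<in>J. A j) = {\<omega> \<in> space M. \<forall>j\<in>J. s j < \<sigma> j \<omega>}" using s J(1) by auto
      then have "U.prob (\<Inter>j\<in>J. A j) = (\<Prod>j\<in>J. exp (- (r * max 0 (s j))))"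
        using U_joint[OF zs J(2)] by simp
      also have "\<dots> = (\<Prod>j\<in>J. U.prob (A j))"
      proof (rule prod.cong[OF refl])
        fix j assume j: "j \<in> J"
        then show "exp (- (r * max 0 (s j))) = U.prob (A j)"
          using U_joint[OF zs, of "{j}" s] J(2) by (auto simp: s[OF j])
      qed
      finally show "U.prob (\<Inter>j\<in>J. A j) = (\<Prod>j\<in>J. U.prob (A j))" .
    qed
  qed
  show ?thesis
    unfolding U.indep_vars_def2
  proof (intro conjI ballI)
    show "U.random_variable borel (\<sigma> i)" for i by (rule U_measurable)
    show "U.indep_sets (\<lambda>i. {\<sigma> i -` A \<inter> space (U zs) |A. A \<in> sets borel}) {..<N}"
    proof (rule U.indep_sets_mono_sets[OF gen])
      fix i assume "i \<in> {..<N}"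
      have FP: "F i \<subseteq> Pow (space M)" by (auto simp: F_def)
      have "\<sigma> i \<in> borel_measurable (sigma (space M) (F i))"
        unfolding borel_measurable_iff_greater
      proof
        fix a
        have "{\<omega> \<in> space M. a < \<sigma> i \<omega>} \<in> F i" by (auto simp: F_def)
        then show "{\<omega> \<in> space (sigma (space M) (F i)). a < \<sigma> i \<omega>} \<in> sets (sigma (space M) (F i))"
          by (simp add: space_measure_of[OF FP] sets_measure_of[OF FP])
      qed
      from measurable_sets[OF this]
      show "{\<sigma> i -` A \<inter> space (U zs) |A. A \<in> sets borel} \<subseteq> sigma_sets (space (U zs)) (F i)"
        by (auto simp: space_measure_of[OF FP] sets_measure_of[OF FP])
    qed
  qed
qed

text \<open>Conditioning on the path leaves no trace on the right-hand side: the holding times are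
  independent of the linear extension.\<close>

lemma U_law:
  assumes zs: "zs \<in> LE T"
  shows "distr (U zs) (PiM {..<N} (\<lambda>_. borel)) (\<lambda>\<omega>. \<lambda>i\<in>{..<N}. \<sigma> i \<omega>) =
     PiM {..<N} (\<lambda>_. density lborel (exponential_density r))"
proof -
  interpret U: prob_space "U zs" using U_prob_space[OF zs] .
  have "distr (U zs) (PiM {..<N} (\<lambda>_. borel)) (\<lambda>\<omega>. \<lambda>i\<in>{..<N}. \<sigma> i \<omega>) = PiM {..<N} (\<lambda>i. distr (U zs) borel (\<sigma> i))"
    using U.indep_vars_iff_distr_eq_PiM'[where I = "{..<N}" and M' = "\<lambda>_. borel" and X = \<sigma>] U_indep[OF zs] cardT by auto
  also have "\<dots> = PiM {..<N} (\<lambda>_. density lborel (exponential_density r))"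
  proof (rule PiM_cong[OF refl])
    fix i assume "i \<in> {..<N}"
    then have "distr (U zs) lborel (\<sigma> i) = density lborel (exponential_density r)"
      using distributed_distr_eq_density[OF U_distributed[OF zs]] by simp
    moreover have "distr (U zs) lborel (\<sigma> i) = distr (U zs) borel (\<sigma> i)" by (rule distr_cong) auto
    ultimately show "distr (U zs) borel (\<sigma> i) = density lborel (exponential_density r)" by simp
  qed
  finally show ?thesis .
qed

lemma U_erlang:
  assumes zs: "zs \<in> LE T" and i: "i < N"
  shows "distributed (U zs) lborel (\<lambda>\<omega>. \<Sum>k\<le>i. \<sigma> k \<omega>) (erlang_density i r)"
proof -
  interpret U: prob_space "U zs" using U_prob_space[OF zs] .
  have ind: "U.indep_vars (\<lambda>_. borel) \<sigma> {..i}"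
    by (rule U.indep_vars_subset[OF U_indep[OF zs]]) (use i in auto)
  have "distributed (U zs) lborel (\<lambda>\<omega>. \<Sum>k\<in>{..i}. \<sigma> k \<omega>) (erlang_density (card {..i} - 1) r)"
    by (rule U.exponential_distributed_sum[OF _ _ r _ ind]) (use U_distributed[OF zs] i in auto)
  then show ?thesis by simp
qed

lemma partial_sums_mono: "k \<le> l \<Longrightarrow> (\<Sum>i<k. S i \<omega>) \<le> (\<Sum>i<l. S i \<omega>)"
  by (rule sum_mono2) auto

text \<open>Replaces an infimum over uncountably many times by one over the jump index, which yields
  measurability. A state with holding time 0 is never occupied and must not count.\<close>

lemma inclusion_fun_INF:
  assumes w: "\<omega> \<in> space M"
  shows "inclusion_fun X \<omega> z =
    (INF k. if z \<in> Y k \<omega> \<and> 0 < S k \<omega> then (\<Sum>i<k. S i \<omega>) else \<infinity>)"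
  unfolding inclusion_fun_def
proof (rule antisym)
  show "(INF t\<in>{t. 0 \<le> t \<and> z \<in> X t \<omega>}. ennreal t) \<le> (INF k. if z \<in> Y k \<omega> \<and> 0 < S k \<omega> then (\<Sum>i<k. S i \<omega>) else \<infinity>)"
  proof (rule INF_greatest)
    fix k
    show "(INF t\<in>{t. 0 \<le> t \<and> z \<in> X t \<omega>}. ennreal t) \<le> (if z \<in> Y k \<omega> \<and> 0 < S k \<omega> then (\<Sum>i<k. S i \<omega>) else \<infinity>)"
    proof (cases "z \<in> Y k \<omega> \<and> 0 < S k \<omega> \<and> (\<Sum>i<k. S i \<omega>) < \<top>")
      case True
      define t where "t = enn2real (\<Sum>i<k. S i \<omega>)"
      have t: "0 \<le> t" "ennreal t = (\<Sum>i<k. S i \<omega>)" using True by (auto simp: t_def)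
      have lt: "ennreal t < (\<Sum>i<Suc k. S i \<omega>)"
        using True ennreal_add_left_cancel_less[of "\<Sum>i<k. S i \<omega>" 0 "S k \<omega>"] unfolding t(2) by (auto simp: less_top)
      obtain l where l: "(\<Sum>i<l. S i \<omega>) \<le> ennreal t" "ennreal t < (\<Sum>i<Suc l. S i \<omega>)" "X t \<omega> = Y l \<omega>"
        using window[OF w t(1)] by (auto simp: lessThan_Suc_atMost)
      have "\<not> Suc l \<le> k" using l(2) t(2) partial_sums_mono[of "Suc l" k \<omega>] by auto
      moreover have "\<not> Suc k \<le> l" using l(1) lt partial_sums_mono[of "Suc k" l \<omega>] by (meson leD order_trans)
      ultimately have "l = k" by simp
      then have "t \<in> {t. 0 \<le> t \<and> z \<in> X t \<omega>}" using t True l by auto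
      then have "(INF t\<in>{t. 0 \<le> t \<and> z \<in> X t \<omega>}. ennreal t) \<le> ennreal t" by (rule INF_lower)
      then show ?thesis using True t by simp
    next
      case F: False
      show ?thesis
      proof (cases "z \<in> Y k \<omega> \<and> 0 < S k \<omega>")
        case True
        then have "(\<Sum>i<k. S i \<omega>) = \<top>" using F by (meson less_top)
        then show ?thesis unfolding if_P[OF True] by (simp only: top_greatest)
      next
        case False
        show ?thesis unfolding if_not_P[OF False] by simp
      qed
    qed
  qed
  show "(INF k. if z \<in> Y k \<omega> \<and> 0 < S k \<omega> then (\<Sum>i<k. S i \<omega>) else \<infinity>) \<le> (INF t\<in>{t. 0 \<le> t \<and> z \<in> X t \<omega>}. ennreal t)"
  proof (rule INF_greatest)
    fix t assume t: "t \<in> {t. 0 \<le> t \<and> z \<in> X t \<omega>}"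
    obtain l where l: "(\<Sum>i<l. S i \<omega>) \<le> ennreal t" "ennreal t < (\<Sum>i<Suc l. S i \<omega>)" "X t \<omega> = Y l \<omega>"
      using window[OF w, of t] t by (auto simp: lessThan_Suc_atMost)
    have "S l \<omega> \<noteq> 0"
    proof
      assume "S l \<omega> = 0"
      then show False using l(1,2) by simp
    qed
    then have "(if z \<in> Y l \<omega> \<and> 0 < S l \<omega> then (\<Sum>i<l. S i \<omega>) else \<infinity>) \<le> ennreal t"
      using l t by (simp add: zero_less_iff_neq_zero)
    then show "(INF k. if z \<in> Y k \<omega> \<and> 0 < S k \<omega> then (\<Sum>i<k. S i \<omega>) else \<infinity>) \<le> ennreal t"
      by (rule INF_lower2[rotated]) simp
  qed
qed

lemma inclusion_fun_measurable: "(\<lambda>\<omega>. inclusion_fun X \<omega> z) \<in> borel_measurable M"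
proof -
  have "(\<lambda>\<omega>. INF k. if z \<in> Y k \<omega> \<and> 0 < S k \<omega> then (\<Sum>i<k. S i \<omega>) else \<infinity>) \<in> borel_measurable M"
    by measurable
  then show ?thesis by (subst measurable_cong[OF inclusion_fun_INF])
qed

lemma inclusion_fun_arrival:
  assumes zs: "zs \<in> LE T" and w: "\<omega> \<in> E zs"
    and good: "\<forall>i<N. S i \<omega> = ennreal (\<sigma> i \<omega>) \<and> 0 < \<sigma> i \<omega>" "S N \<omega> = \<infinity>"
  shows "inclusion_fun X \<omega> = arrival zs (\<lambda>i. \<sigma> i \<omega>)"
proof
  fix z
  have ws: "\<omega> \<in> space M" using w by (simp add: E_def)
  have len: "length zs = N" using LE_length[OF zs] .
  have d: "distinct zs" using LE_distinct[OF zs] .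
  have state: "\<exists>k\<le>N. (\<Sum>i<k. S i \<omega>) \<le> ennreal t \<and> ennreal t < (\<Sum>i<Suc k. S i \<omega>) \<and> X t \<omega> = set (take k zs)" if t0: "0 \<le> t" for t
  proof -
    obtain k where k: "(\<Sum>i<k. S i \<omega>) \<le> ennreal t" "ennreal t < (\<Sum>i<Suc k. S i \<omega>)" "X t \<omega> = Y k \<omega>"
      using window[OF ws t0] by (auto simp: lessThan_Suc_atMost)
    have "k \<le> N"
    proof (rule ccontr)
      assume "\<not> k \<le> N"
      then have "(\<Sum>i<Suc N. S i \<omega>) \<le> (\<Sum>i<k. S i \<omega>)" by (intro partial_sums_mono) simp
      then have "\<top> \<le> ennreal t" using k(1) good(2) order_trans by simp
      then show False by (simp add: top_unique)
    qed
    then show ?thesis using k w by (auto simp: E_def)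
  qed
  have ps: "(\<Sum>i<k. S i \<omega>) = ennreal (\<Sum>i<k. \<sigma> i \<omega>)" if "k \<le> N" for k
  proof -
    have "(\<Sum>i<k. S i \<omega>) = (\<Sum>i<k. ennreal (\<sigma> i \<omega>))" using good that by (intro sum.cong) auto
    also have "\<dots> = ennreal (\<Sum>i<k. \<sigma> i \<omega>)" by (rule sum_ennreal) (use good that in \<open>auto simp: less_imp_le\<close>)
    finally show ?thesis .
  qed
  show "inclusion_fun X \<omega> z = arrival zs (\<lambda>i. \<sigma> i \<omega>) z"
  proof (cases "z \<in> set zs")
    case False
    have "z \<notin> X t \<omega>" if "0 \<le> t" for t
      using state[OF that] False by (auto dest: in_set_takeD)
    then have "{t. 0 \<le> t \<and> z \<in> X t \<omega>} = {}" by auto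
    then show ?thesis using False by (simp add: inclusion_fun_def arrival_def)
  next
    case True
    then obtain i where i: "i < length zs" "zs ! i = z" by (auto simp: in_set_conv_nth)
    let ?t = "\<Sum>k<Suc i. \<sigma> k \<omega>"
    have t0: "0 \<le> ?t" by (rule sum_nonneg) (use good i len in \<open>auto simp: less_imp_le\<close>)
    have mem: "z \<in> set (take k zs) \<longleftrightarrow> i < k" for k
    proof
      assume "z \<in> set (take k zs)"
      then obtain j where "j < k" "j < length zs" "zs ! j = z" by (auto simp: in_set_conv_nth)
      then show "i < k" using d i by (metis nth_eq_iff_index_eq)
    next
      assume "i < k"
      then show "z \<in> set (take k zs)" using i by (auto simp: in_set_conv_nth intro!: exI[of _ i])
    qed
    have "z \<in> X t \<omega> \<longleftrightarrow> ?t \<le> t" if t: "0 \<le> t" for t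
    proof -
      obtain k where k: "k \<le> N" "(\<Sum>i<k. S i \<omega>) \<le> ennreal t" "ennreal t < (\<Sum>i<Suc k. S i \<omega>)" "X t \<omega> = set (take k zs)"
        using state[OF t] by blast
      have T: "(\<Sum>k<Suc i. S k \<omega>) = ennreal ?t" using ps[of "Suc i"] i len by simp
      show ?thesis
      proof (cases "i < k")
        case True
        then have "(\<Sum>k<Suc i. S k \<omega>) \<le> (\<Sum>i<k. S i \<omega>)" by (intro partial_sums_mono) simp
        then have "ennreal ?t \<le> ennreal t" using k(2) T by simp
        then show ?thesis using True k(4) mem t by simp
      next
        case False
        then have "(\<Sum>i<Suc k. S i \<omega>) \<le> (\<Sum>k<Suc i. S k \<omega>)" by (intro partial_sums_mono) simp
        then have "ennreal t < ennreal ?t" using k(3) T by simp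
        then show ?thesis using False k(4) mem t by (simp add: ennreal_less_iff)
      qed
    qed
    then have "{t. 0 \<le> t \<and> z \<in> X t \<omega>} = {?t..}" using t0 by auto
    then have "inclusion_fun X \<omega> z = (INF t\<in>{?t..}. ennreal t)" by (simp add: inclusion_fun_def)
    also have "\<dots> = ennreal ?t"
      by (rule antisym) (auto intro!: INF_lower INF_greatest ennreal_leI)
    also have "\<dots> = arrival zs (\<lambda>i. \<sigma> i \<omega>) z" using arrival_nth[OF d i(1)] i(2) by (simp add: lessThan_Suc_atMost)
    finally show ?thesis .
  qed
qed

lemma AE_arrival:
  "AE \<omega> in M. \<exists>zs\<in>LE T. \<omega> \<in> E zs \<and> (\<forall>i<N. 0 < \<sigma> i \<omega>) \<and> inclusion_fun X \<omega> = arrival zs (\<lambda>i. \<sigma> i \<omega>)"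
proof -
  have "AE \<omega> in M. \<forall>zs\<in>LE T. \<omega> \<in> E zs \<longrightarrow> (\<forall>i<N. S i \<omega> = ennreal (\<sigma> i \<omega>) \<and> 0 < \<sigma> i \<omega>) \<and> S N \<omega> = \<infinity>"
    using AE_good by (subst AE_finite_all) (auto simp: finite_LE[OF finT])
  with AE_E show ?thesis
  proof eventually_elim
    case (elim \<omega>)
    then obtain zs where zs: "zs \<in> LE T" "\<omega> \<in> E zs" by blast
    then show ?case using inclusion_fun_arrival[OF zs] elim by blast
  qed
qed

end

lemma (in staircase) tableau_process_staircase_process:
  assumes "tableau_process M c n r X" "0 < r"
  obtains Y S where "staircase_process c n M r Y S X"
proof -
  from assms(1)[unfolded tableau_process_def markov_jump_process_def]
  obtain Y :: "nat \<Rightarrow> 'a \<Rightarrow> (int \<times> int) set" and S :: "nat \<Rightarrow> 'a \<Rightarrow> ennreal" where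
    "prob_space M" "\<forall>k. Y k \<in> measurable M (count_space St)" "\<forall>k. S k \<in> borel_measurable M"
    "\<forall>k ys s. (\<forall>i\<le>k. ys i \<in> St \<and> 0 \<le> s i) \<longrightarrow>
           measure M {\<omega> \<in> space M. \<forall>i\<le>k. Y i \<omega> = ys i \<and> ennreal (s i) < S i \<omega>} =
             of_bool (ys 0 = {}) *
             (\<Prod>i<k. jump_prob St (tableau_rate c n r) (ys i) (ys (Suc i))) *
             (\<Prod>i\<le>k. exp (- (exit_rate St (tableau_rate c n r) (ys i) * s i)))"
    "\<forall>\<omega>\<in>space M. \<forall>t\<ge>0. \<exists>k.
           (\<Sum>i<k. S i \<omega>) \<le> ennreal t \<and> ennreal t < (\<Sum>i\<le>k. S i \<omega>) \<and> X t \<omega> = Y k \<omega>"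
    by blast
  then have "staircase_process c n M r Y S X"
    using assms(2) staircase_axioms by (simp add: staircase_process_def staircase_process_axioms_def)
  then show ?thesis by (rule that)
qed

section \<open>Swaps of the tableau process\<close>

text \<open>\<open>erlang_CDF k l t\<close> is the probability that a Poisson variable with mean
  \<open>l * t\<close> exceeds \<open>k\<close>; summed over all \<open>k\<close> these tails give
  the mean, and a partial sum is no larger.\<close>

lemma sum_erlang_CDF_le:
  assumes l: "0 < l" and t: "0 \<le> t"
  shows "(\<Sum>k<K. erlang_CDF k l t) \<le> l * t"
proof -
  let ?y = "l * t"
  define p where "p n = ?y ^ n * exp (- ?y) / fact n" for n
  have p0: "p n \<ge> 0" for n using l t by (simp add: p_def)
  have "(\<lambda>n. ?y ^ n /\<^sub>R fact n * exp (- ?y)) sums (exp ?y * exp (- ?y))"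
    by (rule sums_mult2[OF exp_converges])
  then have p1: "p sums 1" by (simp add: p_def[abs_def] divide_inverse mult_ac exp_minus)
  have "(\<lambda>n. real (Suc n) * p (Suc n)) = (\<lambda>n. ?y * p n)"
  proof
    fix n :: nat
    have "real (Suc n) * (a / (real (Suc n) * b)) = a / b" for a b :: real
      by (simp del: of_nat_Suc)
    then have "real (Suc n) * p (Suc n) = ?y ^ Suc n * exp (- ?y) / fact n"
      unfolding p_def fact_Suc by simp
    then show "real (Suc n) * p (Suc n) = ?y * p n" by (simp add: p_def)
  qed
  then have "(\<lambda>n. real (Suc n) * p (Suc n)) sums (?y * 1)" using sums_mult[OF p1, of ?y] by simp
  then have mean: "(\<lambda>n. real n * p n) sums ?y" by (subst (asm) sums_Suc_iff) simp
  have tail: "(\<lambda>n. if n \<le> k then 0 else p n) sums erlang_CDF k l t" for k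
  proof -
    have "(\<lambda>n. if n \<in> {..k} then p n else 0) sums (\<Sum>n\<in>{..k}. p n)" by (rule sums_If_finite_set) simp
    from sums_diff[OF p1 this]
    have "(\<lambda>n. p n - (if n \<le> k then p n else 0)) sums (1 - (\<Sum>n\<le>k. p n))" by simp
    moreover have "(\<lambda>n. p n - (if n \<le> k then p n else 0)) = (\<lambda>n. if n \<le> k then 0 else p n)" by auto
    moreover have "erlang_CDF k l t = 1 - (\<Sum>n\<le>k. p n)" using t by (simp add: erlang_CDF_def p_def)
    ultimately show ?thesis by simp
  qed
  have S: "(\<lambda>n. \<Sum>k<K. if n \<le> k then 0 else p n) sums (\<Sum>k<K. erlang_CDF k l t)"
    by (rule sums_sum) (rule tail)
  have B: "(\<Sum>k<K. if n \<le> k then 0 else p n) \<le> real n * p n" for n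
  proof -
    have "(\<Sum>k<K. if n \<le> k then 0 else p n) \<le> (\<Sum>k<K. if k \<in> {..<n} then p n else 0)"
      by (rule sum_mono) auto
    also have "\<dots> = (\<Sum>k\<in>{..<K} \<inter> {..<n}. p n)" by (rule sum.inter_restrict[symmetric]) simp
    also have "\<dots> = real (card ({..<K} \<inter> {..<n})) * p n" by simp
    also have "\<dots> \<le> real n * p n"
      using card_mono[of "{..<n}" "{..<K} \<inter> {..<n}"] p0 by (intro mult_right_mono) auto
    finally show ?thesis .
  qed
  show ?thesis by (rule sums_le[OF B S mean])
qed

context staircase
begin

lemma LE_ranks: "zs \<in> LE T \<Longrightarrow> list_rank zs \<in> ranks T"
  using list_rank_bij[OF finT] by (auto simp: bij_betw_def)

text \<open>With positive holding times the arrival times are a strictly increasing function of the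
  ranks, so swap locations are those of \<open>list_rank zs\<close> and only the times
  change.\<close>

lemma arrival_relabel:
  assumes zs: "zs \<in> LE T" and s: "\<And>i. i < card T \<Longrightarrow> 0 < s i"
  shows "fin_tableau (arrival zs s)"
    "(k, v) \<in> sw (arrival zs s) \<longleftrightarrow>
      (\<exists>i<card T. (k, of_nat i) \<in> sw (list_rank zs) \<and> v = ennreal (\<Sum>j\<le>i. s j))"
proof -
  let ?N = "card T"
  define A where "A = insert \<infinity> (of_nat ` {..<?N} :: ennreal set)"
  define \<phi> where "\<phi> v = (if v = \<infinity> then \<infinity> else ennreal (\<Sum>j\<le>(THE i. v = (of_nat i :: ennreal)). s j))" for v
  have phi_nat: "\<phi> (of_nat i) = ennreal (\<Sum>j\<le>i. s j)" for i
    by (simp add: \<phi>_def)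
  have phi_inf: "\<phi> \<infinity> = \<infinity>" by (simp add: \<phi>_def)
  have strict: "(\<Sum>j\<le>i. s j) < (\<Sum>j\<le>k. s j)" if "i < k" "k < ?N" for i k
    by (rule sum_strict_mono2[where b = k]) (use that s in \<open>auto simp: less_imp_le\<close>)
  have nn: "0 \<le> (\<Sum>j\<le>k. s j)" if "k < ?N" for k
    by (rule sum_nonneg) (use that s in \<open>auto simp: less_imp_le\<close>)
  have phi_le: "\<forall>a\<in>A. \<forall>b\<in>A. \<phi> a \<le> \<phi> b \<longleftrightarrow> a \<le> b"
  proof (intro ballI)
    fix a b assume "a \<in> A" "b \<in> A"
    then consider "b = \<infinity>" | i where "a = \<infinity>" "b = of_nat i" | i k where "a = of_nat i" "b = of_nat k" "i < ?N" "k < ?N"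
      unfolding A_def by blast
    then show "\<phi> a \<le> \<phi> b \<longleftrightarrow> a \<le> b"
    proof cases
      case 1
      show ?thesis unfolding 1 phi_inf by simp
    next
      case 2
      show ?thesis unfolding 2 phi_inf phi_nat by (simp add: top_unique)
    next
      case 3
      have "(\<Sum>j\<le>i. s j) \<le> (\<Sum>j\<le>k. s j) \<longleftrightarrow> i \<le> k"
        using strict[of i k] strict[of k i] 3 by (cases i k rule: linorder_cases) auto
      then show ?thesis using nn 3 by (simp add: phi_nat ennreal_le_iff)
    qed
  qed
  have Q: "list_rank zs \<in> ranks T" using LE_ranks[OF zs] .
  note tab = ranks_tableau[OF Q]
  have set: "set zs = T" using zs by (simp add: LE_def)
  have rA: "range (list_rank zs) \<subseteq> A"
  proof
    fix v assume "v \<in> range (list_rank zs)"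
    then obtain z where z: "v = list_rank zs z" by blast
    show "v \<in> A"
    proof (cases "z \<in> T")
      case True
      obtain i where "list_rank zs z = of_nat i" "i < ?N" by (rule ranks_value[OF Q True])
      then show ?thesis using z by (simp add: A_def)
    next
      case False
      then show ?thesis using ranksD(1)[OF Q False] z by (simp add: A_def)
    qed
  qed
  have infA: "\<infinity> \<in> A" by (simp add: A_def)
  have eq: "(\<lambda>z. \<phi> (list_rank zs (fst z + 0, snd z))) = arrival zs s"
  proof
    fix z
    show "\<phi> (list_rank zs (fst z + 0, snd z)) = arrival zs s z"
    proof (cases "z \<in> set zs")
      case True
      then obtain i where i: "i < length zs" "z = zs ! i" by (auto simp: in_set_conv_nth)
      then show ?thesis using list_rank_nth[OF LE_distinct[OF zs] i(1)] arrival_nth[OF LE_distinct[OF zs] i(1), of s]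
        by (simp add: phi_nat)
    next
      case False
      then have "list_rank zs z = \<infinity>" "arrival zs s z = \<infinity>" by (simp_all add: list_rank_def arrival_def)
      then show ?thesis using phi_inf by simp
    qed
  qed
  have ev: "even (0 :: int)" by simp
  show "fin_tableau (arrival zs s)"
    using shift_relabel_step(1)[OF tab(1) ev rA infA phi_le phi_inf] unfolding eq .
  have sw: "sw (arrival zs s) = (\<lambda>(k, v). (k - 0, \<phi> v)) ` sw (list_rank zs)"
    using sw_shift_relabel[OF tab(1) ev rA infA phi_le phi_inf] unfolding eq .
  have val: "\<exists>i<?N. w = of_nat i" if kw: "(k', w) \<in> sw (list_rank zs)" for k' w
  proof -
    obtain z where z: "w = list_rank zs z" "list_rank zs z \<noteq> \<infinity>" using sw_finite_value[OF tab(1) kw] by blast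
    then have "z \<in> T" using ranks_finite_iff[OF Q] by blast
    then obtain i where "list_rank zs z = of_nat i" "i < ?N" by (rule ranks_value[OF Q])
    then show ?thesis using z by auto
  qed
  show "(k, v) \<in> sw (arrival zs s) \<longleftrightarrow>
      (\<exists>i<?N. (k, of_nat i) \<in> sw (list_rank zs) \<and> v = ennreal (\<Sum>j\<le>i. s j))"
  proof
    assume "(k, v) \<in> sw (arrival zs s)"
    then obtain w where w: "(k, w) \<in> sw (list_rank zs)" "v = \<phi> w" unfolding sw by auto
    then obtain i where "i < ?N" "w = of_nat i" using val by blast
    then show "\<exists>i<?N. (k, of_nat i) \<in> sw (list_rank zs) \<and> v = ennreal (\<Sum>j\<le>i. s j)"
      using w phi_nat by blast
  next
    assume "\<exists>i<?N. (k, of_nat i) \<in> sw (list_rank zs) \<and> v = ennreal (\<Sum>j\<le>i. s j)"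
    then obtain i where i: "(k, of_nat i) \<in> sw (list_rank zs)" "v = \<phi> (of_nat i)" using phi_nat by auto
    then show "(k, v) \<in> sw (arrival zs s)" unfolding sw by force
  qed
qed

end

context staircase_process
begin

definition \<tau> :: "nat \<Rightarrow> 'w \<Rightarrow> real" where "\<tau> i \<omega> = (\<Sum>k\<le>i. \<sigma> k \<omega>)"

lemma \<tau>_measurable [measurable]: "\<tau> i \<in> borel_measurable M"
  unfolding \<tau>_def by measurable

text \<open>A single almost sure event on which the process is a linear extension with its ranks
  replaced by jump times; the later estimates for its swaps start from here.\<close>

lemma AE_swaps:
  "AE \<omega> in M. \<exists>zs\<in>LE T. \<omega> \<in> E zs \<and> fin_tableau (inclusion_fun X \<omega>) \<and> (\<forall>z. z \<notin> T \<longrightarrow> inclusion_fun X \<omega> z = \<infinity>) \<and>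
     (\<forall>i j. i \<le> j \<longrightarrow> j < N \<longrightarrow> \<tau> i \<omega> \<le> \<tau> j \<omega>) \<and>
     (\<forall>i j. i < N \<longrightarrow> j < N \<longrightarrow> \<tau> i \<omega> = \<tau> j \<omega> \<longrightarrow> i = j) \<and> (\<forall>i<N. 0 \<le> \<tau> i \<omega>) \<and>
     (\<forall>k v. (k, v) \<in> sw (inclusion_fun X \<omega>) \<longleftrightarrow> (\<exists>i<N. (k, of_nat i) \<in> sw (list_rank zs) \<and> v = ennreal (\<tau> i \<omega>)))"
  using AE_arrival
proof (rule AE_mp, intro AE_I2 impI)
  fix \<omega> assume "\<exists>zs\<in>LE T. \<omega> \<in> E zs \<and> (\<forall>i<N. 0 < \<sigma> i \<omega>) \<and> inclusion_fun X \<omega> = arrival zs (\<lambda>i. \<sigma> i \<omega>)"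
  then obtain zs where zs: "zs \<in> LE T" "\<omega> \<in> E zs" "\<And>i. i < N \<Longrightarrow> 0 < \<sigma> i \<omega>" "inclusion_fun X \<omega> = arrival zs (\<lambda>i. \<sigma> i \<omega>)" by blast
  note rel = arrival_relabel[OF zs(1), of "\<lambda>i. \<sigma> i \<omega>", OF zs(3)]
  have set: "set zs = T" using zs(1) by (simp add: LE_def)
  have mono: "\<tau> i \<omega> \<le> \<tau> j \<omega>" if "i \<le> j" "j < N" for i j
    unfolding \<tau>_def by (rule sum_mono2) (use that zs(3) in \<open>auto simp: less_imp_le\<close>)
  have strict: "\<tau> i \<omega> < \<tau> j \<omega>" if "i < j" "j < N" for i j
    unfolding \<tau>_def by (rule sum_strict_mono2[where b = j]) (use that zs(3) in \<open>auto simp: less_imp_le\<close>)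
  have inj: "i = j" if "i < N" "j < N" "\<tau> i \<omega> = \<tau> j \<omega>" for i j
    using strict[of i j] strict[of j i] that by (cases i j rule: linorder_cases) auto
  have nn: "0 \<le> \<tau> i \<omega>" if "i < N" for i
    unfolding \<tau>_def by (rule sum_nonneg) (use that zs(3) in \<open>auto simp: less_imp_le\<close>)
  have out: "inclusion_fun X \<omega> z = \<infinity>" if "z \<notin> T" for z using that set by (simp add: zs(4) arrival_def)
  have sw: "(k, v) \<in> sw (inclusion_fun X \<omega>) \<longleftrightarrow> (\<exists>i<N. (k, of_nat i) \<in> sw (list_rank zs) \<and> v = ennreal (\<tau> i \<omega>))" for k v
    using rel(2)[of k v] unfolding zs(4) \<tau>_def .
  have tab: "fin_tableau (inclusion_fun X \<omega>)" using rel(1) unfolding zs(4) .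
  show "\<exists>zs\<in>LE T. \<omega> \<in> E zs \<and> fin_tableau (inclusion_fun X \<omega>) \<and> (\<forall>z. z \<notin> T \<longrightarrow> inclusion_fun X \<omega> z = \<infinity>) \<and>
     (\<forall>i j. i \<le> j \<longrightarrow> j < N \<longrightarrow> \<tau> i \<omega> \<le> \<tau> j \<omega>) \<and>
     (\<forall>i j. i < N \<longrightarrow> j < N \<longrightarrow> \<tau> i \<omega> = \<tau> j \<omega> \<longrightarrow> i = j) \<and> (\<forall>i<N. 0 \<le> \<tau> i \<omega>) \<and>
     (\<forall>k v. (k, v) \<in> sw (inclusion_fun X \<omega>) \<longleftrightarrow> (\<exists>i<N. (k, of_nat i) \<in> sw (list_rank zs) \<and> v = ennreal (\<tau> i \<omega>)))"
    using zs(1,2) tab out mono inj nn sw by blast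
qed

lemma prob_E_Int:
  assumes zs: "zs \<in> LE T" and A: "A \<in> sets M"
  shows "prob (E zs \<inter> A) = measure (U zs) A / real e"
proof -
  have "measure (U zs) A = prob (E zs \<inter> A) / prob (E zs)"
    using prob_E[OF zs] e_pos A by (intro measure_uniform_measure) (auto simp: emeasure_eq_measure)
  then show ?thesis using prob_E[OF zs] e_pos by simp
qed

lemma U_tau_less:
  assumes zs: "zs \<in> LE T" and i: "i < N" and t: "0 \<le> t"
  shows "measure (U zs) {\<omega> \<in> space M. \<tau> i \<omega> < t} \<le> erlang_CDF i r t"
proof -
  interpret U: prob_space "U zs" using U_prob_space[OF zs] .
  have "U.prob {\<omega> \<in> space M. \<tau> i \<omega> < t} \<le> U.prob {\<omega> \<in> space (U zs). (\<Sum>k\<le>i. \<sigma> k \<omega>) \<le> t}"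
    unfolding \<tau>_def by (rule U.finite_measure_mono) auto
  then show ?thesis using U.erlang_distributed_le[OF U_erlang[OF zs i] r t] by simp
qed

text \<open>Path and jump times are independent, each step is a swap at \<open>x\<close> with
  probability \<open>p\<close>, and the expected number of jumps before \<open>t\<close> is at most
  \<open>r * t\<close>. Stating this for any \<open>\<Phi>\<close> below the swap count avoids
  measurability of the count itself.\<close>

theorem expected_swaps_le:
  assumes x: "(x, 1) \<in> T" and t: "0 \<le> t"
    and \<Phi>: "AE \<omega> in M. \<Phi> \<omega> \<le> of_nat (card {v. (x, v) \<in> sw (inclusion_fun X \<omega>) \<and> v < ennreal t})"
  shows "(\<integral>\<^sup>+\<omega>. \<Phi> \<omega> \<partial>M) \<le> ennreal (r * hook_prob T (x, 1) * t)"
proof -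
  define I where "I zs = {i. i < N \<and> (x, of_nat i) \<in> sw (list_rank zs)}" for zs
  have finI: "finite (I zs)" for zs by (simp add: I_def)
  have finL: "finite (LE T)" using finite_LE[OF finT] .
  let ?A = "\<lambda>zs i. E zs \<inter> {\<omega> \<in> space M. \<tau> i \<omega> < t}"
  have mA: "?A zs i \<in> sets M" for zs i by measurable
  have "AE \<omega> in M. \<Phi> \<omega> \<le> (\<Sum>zs\<in>LE T. \<Sum>i\<in>I zs. indicator (?A zs i) \<omega>)"
    using \<Phi> AE_swaps AE_space
  proof eventually_elim
    case (elim \<omega>)
    obtain zs where zs: "zs \<in> LE T" "\<omega> \<in> E zs"
      "\<And>k v. (k, v) \<in> sw (inclusion_fun X \<omega>) \<longleftrightarrow> (\<exists>i<N. (k, of_nat i) \<in> sw (list_rank zs) \<and> v = ennreal (\<tau> i \<omega>))"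
      using elim(2) by blast
    let ?J = "{i \<in> I zs. \<tau> i \<omega> < t}"
    have "{v. (x, v) \<in> sw (inclusion_fun X \<omega>) \<and> v < ennreal t} \<subseteq> (\<lambda>i. ennreal (\<tau> i \<omega>)) ` ?J"
    proof
      fix v assume v: "v \<in> {v. (x, v) \<in> sw (inclusion_fun X \<omega>) \<and> v < ennreal t}"
      then obtain i where i: "i < N" "(x, of_nat i) \<in> sw (list_rank zs)" "v = ennreal (\<tau> i \<omega>)" using zs(3) by blast
      then have "\<tau> i \<omega> < t" using v by (auto simp: ennreal_less_iff) (metis ennreal_leI not_less)
      then show "v \<in> (\<lambda>i. ennreal (\<tau> i \<omega>)) ` ?J" using i by (auto simp: I_def)
    qed
    then have "card {v. (x, v) \<in> sw (inclusion_fun X \<omega>) \<and> v < ennreal t} \<le> card ((\<lambda>i. ennreal (\<tau> i \<omega>)) ` ?J)"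
      by (intro card_mono) (auto simp: finI)
    also have "\<dots> \<le> card ?J" by (rule card_image_le) (simp add: finI)
    finally have "\<Phi> \<omega> \<le> of_nat (card ?J)" using elim(1) by (meson of_nat_mono order_trans)
    also have "of_nat (card ?J) = (\<Sum>i\<in>I zs. indicator (?A zs i) \<omega> :: ennreal)"
    proof -
      have "(\<Sum>i\<in>I zs. indicator (?A zs i) \<omega> :: ennreal) = (\<Sum>i\<in>I zs. if \<tau> i \<omega> < t then 1 else 0)"
        using zs(2) elim(3) by (intro sum.cong) (auto simp: indicator_def)
      also have "\<dots> = (\<Sum>i\<in>?J. 1)" by (rule sum.inter_filter[OF finI, symmetric])
      finally show ?thesis by simp
    qed
    also have "\<dots> \<le> (\<Sum>zs\<in>LE T. \<Sum>i\<in>I zs. indicator (?A zs i) \<omega>)"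
      by (rule member_le_sum[OF zs(1)]) (auto simp: finL)
    finally show ?case .
  qed
  then have "(\<integral>\<^sup>+\<omega>. \<Phi> \<omega> \<partial>M) \<le> (\<integral>\<^sup>+\<omega>. (\<Sum>zs\<in>LE T. \<Sum>i\<in>I zs. indicator (?A zs i) \<omega>) \<partial>M)"
    by (rule nn_integral_mono_AE)
  also have "\<dots> = (\<Sum>zs\<in>LE T. \<integral>\<^sup>+\<omega>. (\<Sum>i\<in>I zs. indicator (?A zs i) \<omega>) \<partial>M)"
    by (rule nn_integral_sum) (intro borel_measurable_sum borel_measurable_indicator mA)
  also have "\<dots> = (\<Sum>zs\<in>LE T. \<Sum>i\<in>I zs. \<integral>\<^sup>+\<omega>. indicator (?A zs i) \<omega> \<partial>M)"
    by (rule sum.cong[OF refl], rule nn_integral_sum) (intro borel_measurable_indicator mA)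
  also have "\<dots> = (\<Sum>zs\<in>LE T. \<Sum>i\<in>I zs. ennreal (prob (?A zs i)))"
    by (simp only: nn_integral_indicator[OF mA] emeasure_eq_measure)
  also have "\<dots> = ennreal (\<Sum>zs\<in>LE T. \<Sum>i\<in>I zs. prob (?A zs i))"
    by (simp add: sum_nonneg)
  also have "\<dots> \<le> ennreal (r * hook_prob T (x, 1) * t)"
  proof (rule ennreal_leI)
    have "(\<Sum>zs\<in>LE T. \<Sum>i\<in>I zs. prob (?A zs i)) \<le> (\<Sum>zs\<in>LE T. \<Sum>i\<in>I zs. erlang_CDF i r t / real e)"
    proof (intro sum_mono)
      fix zs i assume a: "zs \<in> LE T" "i \<in> I zs"
      then have "prob (?A zs i) = measure (U zs) {\<omega> \<in> space M. \<tau> i \<omega> < t} / real e" by (intro prob_E_Int) auto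
      also have "\<dots> \<le> erlang_CDF i r t / real e"
        by (intro divide_right_mono U_tau_less) (use a t in \<open>auto simp: I_def\<close>)
      finally show "prob (?A zs i) \<le> erlang_CDF i r t / real e" .
    qed
    also have "\<dots> = (\<Sum>zs\<in>LE T. \<Sum>i<N. if (x, of_nat i) \<in> sw (list_rank zs) then erlang_CDF i r t / real e else 0)"
    proof (rule sum.cong[OF refl])
      fix zs
      have "I zs = {i \<in> {..<N}. (x, of_nat i) \<in> sw (list_rank zs)}" by (auto simp: I_def)
      then show "(\<Sum>i\<in>I zs. erlang_CDF i r t / real e) =
        (\<Sum>i<N. if (x, of_nat i) \<in> sw (list_rank zs) then erlang_CDF i r t / real e else 0)"
        by (simp only: sum.inter_filter[OF finite_lessThan])
    qed
    also have "\<dots> = (\<Sum>i<N. \<Sum>zs\<in>LE T. if (x, of_nat i) \<in> sw (list_rank zs) then erlang_CDF i r t / real e else 0)"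
      by (rule sum.swap)
    also have "\<dots> = (\<Sum>i<N. hook_prob T (x, 1) * erlang_CDF i r t)"
    proof (rule sum.cong[OF refl])
      fix i assume i: "i \<in> {..<N}"
      have "(\<Sum>zs\<in>LE T. if (x, of_nat i) \<in> sw (list_rank zs) then erlang_CDF i r t / real e else 0) =
        (\<Sum>zs\<in>{zs \<in> LE T. (x, of_nat i) \<in> sw (list_rank zs)}. erlang_CDF i r t / real e)"
        by (simp only: sum.inter_filter[OF finL])
      also have "\<dots> = real (card {zs \<in> LE T. (x, of_nat i) \<in> sw (list_rank zs)}) * (erlang_CDF i r t / real e)" by simp
      also have "\<dots> = hook_prob T (x, 1) * real e * (erlang_CDF i r t / real e)"
        using card_swap_at[OF x, of i] i by simp
      also have "\<dots> = hook_prob T (x, 1) * erlang_CDF i r t" using e_pos by simp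
      finally show "(\<Sum>zs\<in>LE T. if (x, of_nat i) \<in> sw (list_rank zs) then erlang_CDF i r t / real e else 0) =
        hook_prob T (x, 1) * erlang_CDF i r t" .
    qed
    also have "\<dots> = hook_prob T (x, 1) * (\<Sum>i<N. erlang_CDF i r t)" by (simp add: sum_distrib_left)
    also have "\<dots> \<le> hook_prob T (x, 1) * (r * t)"
      using hook_prob_bounds(1)[OF odd up_closed_TT corner_TT[OF x]] sum_erlang_CDF_le[OF r t] by (intro mult_left_mono) auto
    finally show "(\<Sum>zs\<in>LE T. \<Sum>i\<in>I zs. prob (?A zs i)) \<le> r * hook_prob T (x, 1) * t" by (simp add: mult_ac)
  qed
  finally show ?thesis .
qed

text \<open>The time of step \<open>i\<close> is a sum of \<open>i + 1\<close> independent
  exponential variables, with mean \<open>(i + 1) / r\<close> and variance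
  \<open>(i + 1) / r\<^sup>2\<close>.\<close>

lemma U_tau_chebyshev:
  assumes zs: "zs \<in> LE T" and i: "i < N" and d: "0 < d"
  shows "measure (U zs) {\<omega> \<in> space M. d \<le> \<bar>\<tau> i \<omega> - real (Suc i) / r\<bar>} \<le> real (Suc i) / (r * d)\<^sup>2"
proof -
  interpret U: prob_space "U zs" using U_prob_space[OF zs] .
  note D = U_erlang[OF zs i, folded \<tau>_def]
  have int2: "integrable (U zs) (\<lambda>\<omega>. (\<tau> i \<omega>)\<^sup>2)" by (rule U.erlang_ith_moment_integrable[OF r D])
  have ex: "U.expectation (\<tau> i) = real (Suc i) / r"
  proof -
    have "(fact (i + 1) :: real) / (fact i * r ^ 1) = real (Suc i) / r"
      unfolding Suc_eq_plus1[symmetric] fact_Suc by simp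
    then show ?thesis using U.erlang_ith_moment[OF r D, of 1] by simp
  qed
  have var: "U.variance (\<tau> i) = (real i + 1) / r\<^sup>2" using U.erlang_distributed_variance[OF r D] by (simp add: add.commute)
  have "U.prob {\<omega> \<in> space (U zs). \<bar>\<tau> i \<omega> - U.expectation (\<tau> i)\<bar> \<ge> d} \<le> U.variance (\<tau> i) / d\<^sup>2"
    by (rule U.Chebyshev_inequality[OF _ int2 d]) simp
  moreover have "U.expectation (\<lambda>\<omega>. (\<tau> i \<omega> - real (Suc i) / r)\<^sup>2) = (real i + 1) / r\<^sup>2" using var by (simp only: ex)
  ultimately have "U.prob {\<omega> \<in> space (U zs). \<bar>\<tau> i \<omega> - real (Suc i) / r\<bar> \<ge> d} \<le> (real i + 1) / r\<^sup>2 / d\<^sup>2"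
    by (simp only: ex)
  then show ?thesis by (simp add: power_mult_distrib add.commute)
qed

text \<open>Off two Chebyshev events, for the first and the last step, the steps
  \<open>j, ..., j + m - 1\<close> all happen within \<open>[a, b]\<close>, and then none of them
  may be a swap at \<open>x\<close>. Jump times increase, so controlling the two ends is
  enough.\<close>

theorem no_swap_prob_le:
  assumes x: "(x, 1) \<in> T" and B: "B \<in> sets M"
    and none: "AE \<omega> in M. \<omega> \<in> B \<longrightarrow> (\<forall>v. (x, v) \<in> sw (inclusion_fun X \<omega>) \<longrightarrow> \<not> (ennreal a \<le> v \<and> v \<le> ennreal b))"
    and jm: "j + m \<le> N" "0 < m" and d: "0 < d"
    and lo: "a + d \<le> real (Suc j) / r" and hi: "real (j + m) / r \<le> b - d"
  shows "prob B \<le> real (Suc j) / (r * d)\<^sup>2 + real (j + m) / (r * d)\<^sup>2 + (1 - hook_prob T (x, 1)) ^ m"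
proof -
  have finL: "finite (LE T)" using finite_LE[OF finT] .
  let ?k = "j + m - 1"
  have k: "?k < N" "Suc ?k = j + m" "j < N" using jm by auto
  define B1 where "B1 = {\<omega> \<in> space M. d \<le> \<bar>\<tau> j \<omega> - real (Suc j) / r\<bar>}"
  define B2 where "B2 = {\<omega> \<in> space M. d \<le> \<bar>\<tau> ?k \<omega> - real (Suc ?k) / r\<bar>}"
  define L where "L = {zs \<in> LE T. \<forall>i<m. (x, of_nat (i + j)) \<notin> sw (list_rank zs)}"
  have B12 [measurable]: "B1 \<in> sets M" "B2 \<in> sets M" unfolding B1_def B2_def by measurable
  have "prob B \<le> prob ((\<Union>zs\<in>LE T. E zs \<inter> B1) \<union> (\<Union>zs\<in>LE T. E zs \<inter> B2) \<union> (\<Union>zs\<in>L. E zs))"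
  proof (rule finite_measure_mono_AE)
    show "AE \<omega> in M. \<omega> \<in> B \<longrightarrow> \<omega> \<in> (\<Union>zs\<in>LE T. E zs \<inter> B1) \<union> (\<Union>zs\<in>LE T. E zs \<inter> B2) \<union> (\<Union>zs\<in>L. E zs)"
      using none AE_swaps AE_space
    proof eventually_elim
      case (elim \<omega>)
      obtain zs where zs: "zs \<in> LE T" "\<omega> \<in> E zs" "\<forall>i j. i \<le> j \<longrightarrow> j < N \<longrightarrow> \<tau> i \<omega> \<le> \<tau> j \<omega>"
        "\<And>k v. (k, v) \<in> sw (inclusion_fun X \<omega>) \<longleftrightarrow> (\<exists>i<N. (k, of_nat i) \<in> sw (list_rank zs) \<and> v = ennreal (\<tau> i \<omega>))"
        using elim(2) by blast
      show ?case
      proof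
        assume w: "\<omega> \<in> B"
        show "\<omega> \<in> (\<Union>zs\<in>LE T. E zs \<inter> B1) \<union> (\<Union>zs\<in>LE T. E zs \<inter> B2) \<union> (\<Union>zs\<in>L. E zs)"
        proof (cases "\<omega> \<in> B1 \<or> \<omega> \<in> B2")
          case True
          then show ?thesis using zs(1,2) by blast
        next
          case False
          then have "\<bar>\<tau> j \<omega> - real (Suc j) / r\<bar> < d" "\<bar>\<tau> ?k \<omega> - real (Suc ?k) / r\<bar> < d"
            using elim(3) by (auto simp: B1_def B2_def)
          moreover have "real (Suc ?k) / r \<le> b - d" using hi k(2) by simp
          ultimately have ab: "a \<le> \<tau> j \<omega>" "\<tau> ?k \<omega> \<le> b" using lo by linarith+
          have "(x, of_nat (i + j)) \<notin> sw (list_rank zs)" if i: "i < m" for i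
          proof
            assume s: "(x, of_nat (i + j)) \<in> sw (list_rank zs)"
            have ij: "i + j \<le> ?k" "j \<le> i + j" "i + j < N" using i jm by auto
            then have "\<tau> j \<omega> \<le> \<tau> (i + j) \<omega>" "\<tau> (i + j) \<omega> \<le> \<tau> ?k \<omega>" using zs(3) k by auto
            then have "ennreal a \<le> ennreal (\<tau> (i + j) \<omega>) \<and> ennreal (\<tau> (i + j) \<omega>) \<le> ennreal b"
              using ab by (auto intro: ennreal_leI)
            moreover have "(x, ennreal (\<tau> (i + j) \<omega>)) \<in> sw (inclusion_fun X \<omega>)" using zs(4) s ij by blast
            ultimately show False using elim(1) w by blast
          qed
          then have "zs \<in> L" using zs(1) by (simp add: L_def)
          then show ?thesis using zs(2) by blast
        qed
      qed
    qed
    show "(\<Union>zs\<in>LE T. E zs \<inter> B1) \<union> (\<Union>zs\<in>LE T. E zs \<inter> B2) \<union> (\<Union>zs\<in>L. E zs) \<in> sets M"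
      using finL by (intro sets.Un sets.finite_UN) (auto simp: L_def)
  qed
  also have "\<dots> \<le> prob (\<Union>zs\<in>LE T. E zs \<inter> B1) + prob (\<Union>zs\<in>LE T. E zs \<inter> B2) + prob (\<Union>zs\<in>L. E zs)"
  proof -
    have m: "(\<Union>zs\<in>LE T. E zs \<inter> B1) \<in> sets M" "(\<Union>zs\<in>LE T. E zs \<inter> B2) \<in> sets M" "(\<Union>zs\<in>L. E zs) \<in> sets M"
      using finL by (auto simp: L_def intro!: sets.finite_UN)
    show ?thesis
      using measure_Un_le[of "(\<Union>zs\<in>LE T. E zs \<inter> B1) \<union> (\<Union>zs\<in>LE T. E zs \<inter> B2)" M "\<Union>zs\<in>L. E zs"]
        measure_Un_le[of "\<Union>zs\<in>LE T. E zs \<inter> B1" M "\<Union>zs\<in>LE T. E zs \<inter> B2"] m by auto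
  qed
  also have "prob (\<Union>zs\<in>L. E zs) \<le> (1 - hook_prob T (x, 1)) ^ m"
  proof -
    have "prob (\<Union>zs\<in>L. E zs) \<le> (\<Sum>zs\<in>L. prob (E zs))"
      by (rule measure_UNION_le) (use finL in \<open>auto simp: L_def\<close>)
    also have "\<dots> = (\<Sum>zs\<in>L. 1 / real e)" by (rule sum.cong) (auto simp: L_def prob_E)
    also have "\<dots> = real (card L) / real e" by simp
    also have "\<dots> \<le> ((1 - hook_prob T (x, 1)) ^ m * real e) / real e"
      using card_no_swap[OF x jm(1)] by (intro divide_right_mono) (auto simp: L_def)
    also have "\<dots> = (1 - hook_prob T (x, 1)) ^ m" using e_pos by simp
    finally show ?thesis .
  qed
  also have "prob (\<Union>zs\<in>LE T. E zs \<inter> B1) \<le> real (Suc j) / (r * d)\<^sup>2"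
  proof -
    have "prob (\<Union>zs\<in>LE T. E zs \<inter> B1) \<le> (\<Sum>zs\<in>LE T. prob (E zs \<inter> B1))"
      by (rule measure_UNION_le) (use finL in auto)
    also have "\<dots> \<le> (\<Sum>zs\<in>LE T. real (Suc j) / (r * d)\<^sup>2 / real e)"
    proof (rule sum_mono)
      fix zs assume zs: "zs \<in> LE T"
      have "prob (E zs \<inter> B1) = measure (U zs) B1 / real e" by (rule prob_E_Int[OF zs B12(1)])
      also have "\<dots> \<le> real (Suc j) / (r * d)\<^sup>2 / real e"
        unfolding B1_def by (intro divide_right_mono U_tau_chebyshev[OF zs k(3) d]) simp
      finally show "prob (E zs \<inter> B1) \<le> real (Suc j) / (r * d)\<^sup>2 / real e" .
    qed
    also have "\<dots> = real (Suc j) / (r * d)\<^sup>2" using e_pos by simp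
    finally show ?thesis .
  qed
  also have "prob (\<Union>zs\<in>LE T. E zs \<inter> B2) \<le> real (j + m) / (r * d)\<^sup>2"
  proof -
    have "prob (\<Union>zs\<in>LE T. E zs \<inter> B2) \<le> (\<Sum>zs\<in>LE T. prob (E zs \<inter> B2))"
      by (rule measure_UNION_le) (use finL in auto)
    also have "\<dots> \<le> (\<Sum>zs\<in>LE T. real (Suc ?k) / (r * d)\<^sup>2 / real e)"
    proof (rule sum_mono)
      fix zs assume zs: "zs \<in> LE T"
      have "prob (E zs \<inter> B2) = measure (U zs) B2 / real e" by (rule prob_E_Int[OF zs B12(2)])
      also have "\<dots> \<le> real (Suc ?k) / (r * d)\<^sup>2 / real e"
        unfolding B2_def by (intro divide_right_mono U_tau_chebyshev[OF zs k(1) d]) simp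
      finally show "prob (E zs \<inter> B2) \<le> real (Suc ?k) / (r * d)\<^sup>2 / real e" .
    qed
    also have "\<dots> = real (j + m) / (r * d)\<^sup>2" using e_pos k(2) by simp
    finally show ?thesis .
  qed
  finally show ?thesis by simp
qed

lemma arrival_borel: "set zs = T \<Longrightarrow> length zs = N \<Longrightarrow> arrival zs \<in> borel_measurable (PiM {..<N} (\<lambda>_. borel))"
proof (rule measurable_coordinatewise_then_product)
  fix z assume l: "set zs = T" "length zs = N"
  show "(\<lambda>s. arrival zs s z) \<in> borel_measurable (PiM {..<N} (\<lambda>_. borel))"
  proof (cases "z \<in> set zs")
    case True
    then obtain i where "i < length zs \<and> zs ! i = z" by (auto simp: in_set_conv_nth)
    then have "(LEAST i. i < length zs \<and> zs ! i = z) < length zs" by (metis (mono_tags, lifting) LeastI)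
    then have "\<And>k. k \<le> (LEAST i. i < length zs \<and> zs ! i = z) \<Longrightarrow> k \<in> {..<N}" using l by auto
    then show ?thesis using True unfolding arrival_def
      by (auto intro!: measurable_compose[OF _ measurable_ennreal] borel_measurable_sum measurable_component_singleton)
  qed (simp add: arrival_def)
qed

lemma arrival_restrict: "length zs = N \<Longrightarrow> arrival zs (\<lambda>i\<in>{..<N}. s i) = arrival zs s"
proof
  fix z assume l: "length zs = N"
  show "arrival zs (\<lambda>i\<in>{..<N}. s i) z = arrival zs s z"
  proof (cases "z \<in> set zs")
    case True
    then obtain i where "i < length zs \<and> zs ! i = z" by (auto simp: in_set_conv_nth)
    then have "(LEAST i. i < length zs \<and> zs ! i = z) < length zs" by (metis (mono_tags, lifting) LeastI)
    then show ?thesis using l by (auto simp: arrival_def intro!: arg_cong[where f = ennreal] sum.cong)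
  qed (simp add: arrival_def)
qed

text \<open>A mixture over the uniform path of arrival times with independent exponential holding
  times. Besides \<open>r\<close>, only the linear extensions of the triangle enter, so processes
  with translated apexes can be compared.\<close>

theorem inclusion_fun_law:
  fixes f :: "(int \<times> int \<Rightarrow> ennreal) \<Rightarrow> ennreal"
  assumes f: "f \<in> borel_measurable borel"
  shows "(\<integral>\<^sup>+\<omega>. f (inclusion_fun X \<omega>) \<partial>M) =
    (\<Sum>zs\<in>LE T. (\<integral>\<^sup>+s. f (arrival zs s) \<partial>PiM {..<N} (\<lambda>_. density lborel (exponential_density r))) / of_nat e)"
proof -
  have finL: "finite (LE T)" using finite_LE[OF finT] .
  have fa: "(\<lambda>s. f (arrival zs s)) \<in> borel_measurable (PiM {..<N} (\<lambda>_. borel))" if "zs \<in> LE T" for zs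
    by (rule measurable_compose[OF arrival_borel f]) (use that LE_length[OF that] in \<open>auto simp: LE_def\<close>)
  have rm: "(\<lambda>\<omega>. \<lambda>i\<in>{..<N}. \<sigma> i \<omega>) \<in> measurable M (PiM {..<N} (\<lambda>_. borel))" by measurable
  have fs: "(\<lambda>\<omega>. f (arrival zs (\<lambda>i. \<sigma> i \<omega>))) \<in> borel_measurable M" if "zs \<in> LE T" for zs
    using measurable_compose[OF rm fa[OF that]] by (simp add: arrival_restrict LE_length[OF that])
  have "(\<integral>\<^sup>+\<omega>. f (inclusion_fun X \<omega>) \<partial>M) = (\<integral>\<^sup>+\<omega>. (\<Sum>zs\<in>LE T. f (arrival zs (\<lambda>i. \<sigma> i \<omega>)) * indicator (E zs) \<omega>) \<partial>M)"
  proof (rule nn_integral_cong_AE)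
    show "AE \<omega> in M. f (inclusion_fun X \<omega>) = (\<Sum>zs\<in>LE T. f (arrival zs (\<lambda>i. \<sigma> i \<omega>)) * indicator (E zs) \<omega>)"
      using AE_arrival
    proof eventually_elim
      case (elim \<omega>)
      then obtain zs where zs: "zs \<in> LE T" "\<omega> \<in> E zs" "inclusion_fun X \<omega> = arrival zs (\<lambda>i. \<sigma> i \<omega>)" by blast
      have "\<omega> \<notin> E ys" if "ys \<in> LE T - {zs}" for ys
        using E_disjoint zs(1,2) that unfolding disjoint_family_on_def by blast
      then have "(\<Sum>zs\<in>LE T - {zs}. f (arrival zs (\<lambda>i. \<sigma> i \<omega>)) * indicator (E zs) \<omega>) = 0"
        by (intro sum.neutral) auto
      then show ?case using zs by (simp add: sum.remove[OF finL zs(1)])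
    qed
  qed
  also have "\<dots> = (\<Sum>zs\<in>LE T. \<integral>\<^sup>+\<omega>. f (arrival zs (\<lambda>i. \<sigma> i \<omega>)) * indicator (E zs) \<omega> \<partial>M)"
    by (rule nn_integral_sum) (use fs in auto)
  also have "\<dots> = (\<Sum>zs\<in>LE T. (\<integral>\<^sup>+s. f (arrival zs s) \<partial>PiM {..<N} (\<lambda>_. density lborel (exponential_density r))) / of_nat e)"
  proof (rule sum.cong[OF refl])
    fix zs assume zs: "zs \<in> LE T"
    have emE: "emeasure M (E zs) = ennreal (1 / real e)" using prob_E[OF zs] by (simp add: emeasure_eq_measure)
    have "(\<integral>\<^sup>+s. f (arrival zs s) \<partial>PiM {..<N} (\<lambda>_. density lborel (exponential_density r))) =
      (\<integral>\<^sup>+s. f (arrival zs s) \<partial>distr (U zs) (PiM {..<N} (\<lambda>_. borel)) (\<lambda>\<omega>. \<lambda>i\<in>{..<N}. \<sigma> i \<omega>))"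
      by (simp only: U_law[OF zs])
    also have "\<dots> = (\<integral>\<^sup>+\<omega>. f (arrival zs (\<lambda>i\<in>{..<N}. \<sigma> i \<omega>)) \<partial>U zs)"
      by (rule nn_integral_distr) (use rm fa[OF zs] in \<open>auto simp: measurable_cong_sets[OF sets_uniform_measure refl]\<close>)
    also have "\<dots> = (\<integral>\<^sup>+\<omega>. f (arrival zs (\<lambda>i. \<sigma> i \<omega>)) * indicator (E zs) \<omega> \<partial>M) / emeasure M (E zs)"
      unfolding arrival_restrict[OF LE_length[OF zs]] by (rule nn_integral_uniform_measure) (use fs[OF zs] in auto)
    finally have "(\<integral>\<^sup>+s. f (arrival zs s) \<partial>PiM {..<N} (\<lambda>_. density lborel (exponential_density r))) / of_nat e =
      (\<integral>\<^sup>+\<omega>. f (arrival zs (\<lambda>i. \<sigma> i \<omega>)) * indicator (E zs) \<omega> \<partial>M) / ennreal (1 / real e) / of_nat e"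
      unfolding emE by simp
    also have "\<dots> = (\<integral>\<^sup>+\<omega>. f (arrival zs (\<lambda>i. \<sigma> i \<omega>)) * indicator (E zs) \<omega> \<partial>M) * (inverse (ennreal (1 / real e)) * inverse (ennreal (real e)))"
      by (simp add: divide_ennreal_def ennreal_of_nat_eq_real_of_nat mult.assoc)
    also have "inverse (ennreal (1 / real e)) * inverse (ennreal (real e)) = 1"
      using e_pos by (simp add: inverse_ennreal ennreal_mult[symmetric])
    finally show "(\<integral>\<^sup>+\<omega>. f (arrival zs (\<lambda>i. \<sigma> i \<omega>)) * indicator (E zs) \<omega> \<partial>M) =
      (\<integral>\<^sup>+s. f (arrival zs s) \<partial>PiM {..<N} (\<lambda>_. density lborel (exponential_density r))) / of_nat e" by simp
  qed
  finally show ?thesis .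
qed

end

section \<open>Swaps of a function on the half-plane\<close>

text \<open>What remains of \<open>fin_tableau\<close> without finite support; finiteness is
  restored by viewing over a finite set \<open>R\<close> (\<open>ordered_view\<close>).\<close>

definition ordered :: "(int \<times> int \<Rightarrow> ennreal) \<Rightarrow> bool" where
  "ordered G \<longleftrightarrow> (\<forall>z\<in>HH. \<forall>w\<in>HH. le_H z w \<longrightarrow> G z \<le> G w) \<and> inj_on G {z \<in> HH. G z \<noteq> \<infinity>}"

lemma orderedD:
  assumes "ordered G"
  shows "z \<in> HH \<Longrightarrow> w \<in> HH \<Longrightarrow> le_H z w \<Longrightarrow> G z \<le> G w" "inj_on G {z \<in> HH. G z \<noteq> \<infinity>}"
  using assms unfolding ordered_def by blast+

lemma fin_tableau_ordered: "fin_tableau G \<Longrightarrow> ordered G"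
  unfolding ordered_def fin_tableau_def supp_def by blast

lemma ordered_view:
  assumes "ordered G" "finite R" "lower_set L"
  shows "fin_tableau (view R L G)"
proof (rule fin_tableau_viewI[OF assms(3)])
  have "{z \<in> HH. base z \<subseteq> R \<and> G z \<in> L} \<subseteq> {z \<in> HH. base z \<subseteq> R}" by blast
  then show "finite {z \<in> HH. base z \<subseteq> R \<and> G z \<in> L}" using finite_base_subset[OF assms(2)] by (rule finite_subset)
  have "{z \<in> HH. base z \<subseteq> R \<and> G z \<in> L} \<subseteq> {z \<in> HH. G z \<noteq> \<infinity>}" using lower_setD(4)[OF assms(3)] by blast
  then show "inj_on G {z \<in> HH. base z \<subseteq> R \<and> G z \<in> L}" by (rule inj_on_subset[OF orderedD(2)[OF assms(1)]])
qed (rule orderedD(1)[OF assms(1)])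

lemma view_view:
  assumes "lower_set L" "R \<subseteq> R'" "L \<subseteq> L'"
  shows "view R L (view R' L' G) = view R L G"
proof
  fix z show "view R L (view R' L' G) z = view R L G z"
    using assms(2,3) lower_setD(3)[OF assms(1)] by (auto simp: view_def)
qed

lemma sw_view_mono:
  assumes G: "ordered G" and R: "finite R'" "R \<subseteq> R'" and L: "lower_set L" "lower_set L'" "L \<subseteq> L'"
    and sep: "separated R L G"
  shows "sw (view R L G) = {(k, v) \<in> sw (view R' L' G). k \<in> R \<and> v \<in> L}"
proof -
  have "separated R L (view R' L' G)"
    using sep lower_setD(3)[OF L(1)] unfolding separated_def view_def by auto
  from sw_view[OF ordered_view[OF G R(1) L(2)] L(1) this] show ?thesis
    unfolding view_view[OF L(1) R(2) L(3)] .
qed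

lemma lower_set_Un: "lower_set L \<Longrightarrow> lower_set L' \<Longrightarrow> lower_set (L \<union> L')"
  by (auto simp: lower_set_def)

lemma lower_set_le: "c \<noteq> \<infinity> \<Longrightarrow> lower_set {v. v \<le> c}"
  by (auto simp: lower_set_def top_unique)

lemma lower_set_less: "lower_set {v. v < c}"
  by (auto simp: lower_set_def)

lemma sw_view_range:
  assumes "ordered G" "finite R" "lower_set L" "(k, v) \<in> sw (view R L G)"
  shows "k \<in> R" "v \<in> L" "odd k" "G (k, 1) \<le> v"
proof -
  have loc: "odd k" "(k, 1) \<in> supp (view R L G)" "view R L G (k, 1) \<le> v"
    using sw_location[OF ordered_view[OF assms(1-3)] assms(4)] by auto
  then have "base (k, 1) \<subseteq> R" "G (k, 1) \<in> L" unfolding supp_view[OF assms(3)] by auto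
  then show "k \<in> R" using loc(1) by (auto simp: base_iff)
  show "odd k" by fact
  show "G (k, 1) \<le> v" using loc(3) view_ge order_trans by blast
  obtain z where "v = view R L G z" "view R L G z \<noteq> \<infinity>"
    using sw_finite_value[OF ordered_view[OF assms(1-3)] assms(4)] by blast
  then show "v \<in> L" by (auto simp: view_def split: if_splits)
qed

text \<open>The two windows are compared inside their union. The union need not be separated, since
  locality asks this only of the smaller window.\<close>

lemma sw_view_indep:
  assumes G: "ordered G"
    and 1: "finite R" "lower_set L" "separated R L G" "x \<in> R" "v \<in> L"
    and 2: "finite R'" "lower_set L'" "separated R' L' G" "x \<in> R'" "v \<in> L'"
  shows "(x, v) \<in> sw (view R L G) \<longleftrightarrow> (x, v) \<in> sw (view R' L' G)"
proof -
  have f: "finite (R \<union> R')" "lower_set (L \<union> L')" using 1 2 lower_set_Un by auto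
  have "sw (view R L G) = {(k, v) \<in> sw (view (R \<union> R') (L \<union> L') G). k \<in> R \<and> v \<in> L}"
    by (rule sw_view_mono[OF G f(1) _ 1(2) f(2) _ 1(3)]) auto
  moreover have "sw (view R' L' G) = {(k, v) \<in> sw (view (R \<union> R') (L \<union> L') G). k \<in> R' \<and> v \<in> L'}"
    by (rule sw_view_mono[OF G f(1) _ 2(2) f(2) _ 2(3)]) auto
  ultimately show ?thesis using 1 2 by simp
qed

text \<open>Swaps without a chosen decomposition: any separated finite window detects them, and all
  windows agree by \<open>sw_view_iff_swap_times\<close>. This form behaves well under perturbation
  and translation.\<close>

definition swap_times :: "(int \<times> int \<Rightarrow> ennreal) \<Rightarrow> int \<Rightarrow> ennreal set" where
  "swap_times G x = {v. \<exists>R L. finite R \<and> lower_set L \<and> separated R L G \<and> x \<in> R \<and> (x, v) \<in> sw (view R L G)}"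

lemma sw_view_iff_swap_times:
  assumes "ordered G" "finite R" "lower_set L" "separated R L G" "x \<in> R"
  shows "(x, v) \<in> sw (view R L G) \<longleftrightarrow> v \<in> swap_times G x \<and> v \<in> L"
proof
  assume a: "(x, v) \<in> sw (view R L G)"
  then show "v \<in> swap_times G x \<and> v \<in> L"
    using sw_view_range(2)[OF assms(1-3) a] assms unfolding swap_times_def by blast
next
  assume a: "v \<in> swap_times G x \<and> v \<in> L"
  then obtain R' L' where b: "finite R'" "lower_set L'" "separated R' L' G" "x \<in> R'" "(x, v) \<in> sw (view R' L' G)"
    unfolding swap_times_def by blast
  have "v \<in> L'" using sw_view_range(2)[OF assms(1) b(1,2,5)] .
  then show "(x, v) \<in> sw (view R L G)"
    using sw_view_indep[OF assms(1) b(1-4) _ assms(2-5), of v] a b(5) by blast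
qed

abbreviation tri_base :: "int \<times> nat \<Rightarrow> int set" where
  "tri_base d \<equiv> {k. odd k \<and> fst d - int (snd d) < k \<and> k < fst d + int (snd d)}"

lemma finite_tri_base: "finite (tri_base d)"
  by (rule finite_subset[of _ "{fst d - int (snd d)..fst d + int (snd d)}"]) auto

lemma TT_base:
  assumes "odd (l + int k)"
  shows "TT l k = {z \<in> HH. base z \<subseteq> tri_base (l, k)}"
proof -
  have "le_H z (l, int k - 1) \<longleftrightarrow> base z \<subseteq> tri_base (l, k)" if z: "z \<in> HH" for z
  proof -
    obtain a b where ab: "z = (a, b)" by (cases z)
    have p: "even (a + b)" "1 \<le> b" using z by (auto simp: HH_def ab)
    show ?thesis
    proof
      assume "le_H z (l, int k - 1)"
      then show "base z \<subseteq> tri_base (l, k)" by (auto simp: le_H_def ab base_iff)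
    next
      assume s: "base z \<subseteq> tri_base (l, k)"
      have "a - b + 1 \<in> base z" "a + b - 1 \<in> base z" using p by (auto simp: ab base_iff)
      then have "l - int k < a - b + 1" "a + b - 1 < l + int k" using s by auto
      moreover have "even (a - b)" "odd (l - int k)" using p assms by auto
      ultimately have "l - int k < a - b" "a + b < l + int k" using p(1) assms by presburger+
      then show "le_H z (l, int k - 1)" by (auto simp: le_H_def ab)
    qed
  qed
  then show ?thesis unfolding TT_def by blast
qed

definition proper :: "(int \<times> int \<Rightarrow> ennreal) \<Rightarrow> bool" where
  "proper G \<longleftrightarrow> G \<in> swap_class \<and> (\<forall>z\<in>HH. G z < \<infinity>)"

lemma proper_ordered: "proper G \<Longrightarrow> ordered G"
  unfolding proper_def ordered_def swap_class_def by (auto simp: less_top)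

lemma proper_gap:
  assumes "proper G" "0 \<le> t"
  obtains a b where "odd a" "odd b" "a < x" "x < b" "ennreal t < G (a, 1)" "ennreal t < G (b, 1)"
proof -
  have inf: "infinite {x. 0 < x \<and> (x, 1) \<in> HH \<and> ennreal t < G (x, 1)}"
    "infinite {x. x < 0 \<and> (x, 1) \<in> HH \<and> ennreal t < G (x, 1)}"
    using assms unfolding proper_def swap_class_def by blast+
  have "\<not> {x. 0 < x \<and> (x, 1) \<in> HH \<and> ennreal t < G (x, 1)} \<subseteq> {0..x}"
    using inf(1) finite_subset by blast
  then obtain b where "b \<in> {x. 0 < x \<and> (x, 1) \<in> HH \<and> ennreal t < G (x, 1)}" "b \<notin> {0..x}" by blast
  then have b: "x < b" "(b, 1) \<in> HH" "ennreal t < G (b, 1)" by auto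
  have "\<not> {x. x < 0 \<and> (x, 1) \<in> HH \<and> ennreal t < G (x, 1)} \<subseteq> {x..0}"
    using inf(2) finite_subset by blast
  then obtain a where "a \<in> {x. x < 0 \<and> (x, 1) \<in> HH \<and> ennreal t < G (x, 1)}" "a \<notin> {x..0}" by blast
  then have a: "a < x" "(a, 1) \<in> HH" "ennreal t < G (a, 1)" by auto
  have "odd a" "odd b" using a(2) b(2) by (auto simp: HH_def)
  then show ?thesis using that a b by blast
qed

lemma nearest_gap:
  fixes P :: "int \<Rightarrow> bool" and x :: int
  assumes "odd x" "P x" "odd a0" "a0 < x" "\<not> P a0" "odd b0" "x < b0" "\<not> P b0"
  obtains a b where "odd a" "odd b" "a < x" "x < b" "\<not> P a" "\<not> P b" "\<And>k. odd k \<Longrightarrow> a < k \<Longrightarrow> k < b \<Longrightarrow> P k"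
proof -
  define A where "A = {k. odd k \<and> a0 \<le> k \<and> k < x \<and> \<not> P k}"
  define B where "B = {k. odd k \<and> x < k \<and> k \<le> b0 \<and> \<not> P k}"
  have fA: "finite A" by (rule finite_subset[of _ "{a0..x}"]) (auto simp: A_def)
  have fB: "finite B" by (rule finite_subset[of _ "{x..b0}"]) (auto simp: B_def)
  have ne: "A \<noteq> {}" "B \<noteq> {}" using assms by (auto simp: A_def B_def)
  have MA: "Max A \<in> A" and MB: "Min B \<in> B" using Max_in[OF fA ne(1)] Min_in[OF fB ne(2)] by auto
  show ?thesis
  proof (rule that[of "Max A" "Min B"])
    fix k assume k: "odd k" "Max A < k" "k < Min B"
    show "P k"
    proof (rule ccontr)
      assume "\<not> P k"
      then have "k \<noteq> x" using assms by auto
      then consider "k < x" | "x < k" by linarith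
      then show False
      proof cases
        case 1
        then have "k \<in> A" using k \<open>\<not> P k\<close> MA by (auto simp: A_def)
        then show False using Max_ge[OF fA] k(2) by fastforce
      next
        case 2
        then have "k \<in> B" using k \<open>\<not> P k\<close> MB by (auto simp: B_def)
        then show False using Min_le[OF fB] k(3) by fastforce
      qed
    qed
  qed (use MA MB in \<open>auto simp: A_def B_def\<close>)
qed

lemma base_self:
  assumes "z \<in> HH"
  shows "\<exists>k. k \<in> base z \<and> (k = fst z \<or> k = fst z - 1)"
proof -
  obtain a b where z: "z = (a, b)" by (cases z)
  have "1 \<le> b" "even (a + b)" using assms by (auto simp: HH_def z)
  show ?thesis
  proof (cases "odd a")
    case True
    then show ?thesis using \<open>1 \<le> b\<close> by (auto simp: z base_iff)
  next
    case False
    then have "b \<noteq> 1" using \<open>even (a + b)\<close> by auto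
    then have "a - 1 \<in> base (a, b)" using \<open>1 \<le> b\<close> False by (auto simp: base_iff)
    then show ?thesis by (auto simp: z)
  qed
qed

lemma base_le_row: "ordered G \<Longrightarrow> z \<in> HH \<Longrightarrow> k \<in> base z \<Longrightarrow> G (k, 1) \<le> G z"
  using orderedD(1)[of G "(k, 1)" z] by (auto simp: base_def row_one_HH)

lemma base_between: "k \<in> base z \<Longrightarrow> k' \<in> base z \<Longrightarrow> odd y \<Longrightarrow> k \<le> y \<Longrightarrow> y \<le> k' \<Longrightarrow> y \<in> base z"
  by (auto simp: base_def le_H_def)

lemma decomposition_exists:
  assumes G: "proper G" and t: "0 \<le> t"
  shows "\<exists>D. decomposition G t D"
proof -
  have ord: "ordered G" using proper_ordered[OF G] .
  \<comment> \<open>The bases are the gaps between neighbouring bottom positions with value above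
    \<open>t\<close>; adjacent or equal ends give empty triangles, which do no harm.\<close>
  define D where "D = {(l, k :: nat). odd (l + int k) \<and> ennreal t < G (l - int k, 1) \<and> ennreal t < G (l + int k, 1) \<and>
    (\<forall>y. odd y \<longrightarrow> l - int k < y \<longrightarrow> y < l + int k \<longrightarrow> G (y, 1) \<le> ennreal t)}"
  have Dd: "odd (fst d + int (snd d))" "ennreal t < G (fst d - int (snd d), 1)" "ennreal t < G (fst d + int (snd d), 1)"
    "\<And>y. odd y \<Longrightarrow> fst d - int (snd d) < y \<Longrightarrow> y < fst d + int (snd d) \<Longrightarrow> G (y, 1) \<le> ennreal t" if "d \<in> D" for d
    using that by (auto simp: D_def)
  have TTd: "TT (fst d) (snd d) = {z \<in> HH. base z \<subseteq> tri_base d}" if "d \<in> D" for d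
    using TT_base[OF Dd(1)[OF that]] by simp
  have "disjoint_family_on (\<lambda>d. TT (fst d) (snd d)) D"
    unfolding disjoint_family_on_def
  proof (intro ballI impI)
    fix d d' assume d: "d \<in> D" "d' \<in> D" "d \<noteq> d'"
    show "TT (fst d) (snd d) \<inter> TT (fst d') (snd d') = {}"
    proof (rule ccontr)
      assume "TT (fst d) (snd d) \<inter> TT (fst d') (snd d') \<noteq> {}"
      then obtain z where z: "z \<in> HH" "base z \<subseteq> tri_base d" "base z \<subseteq> tri_base d'" using TTd d by blast
      obtain k where "k \<in> base z" using base_self[OF z(1)] by blast
      then have k: "k \<in> tri_base d" "k \<in> tri_base d'" using z by auto
      have key: "fst e - int (snd e) \<le> fst e' - int (snd e') \<and> fst e' + int (snd e') \<le> fst e + int (snd e)"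
        if e: "e \<in> D" "e' \<in> D" "k \<in> tri_base e" "k \<in> tri_base e'" for e e'
      proof -
        have odd: "odd (fst e - int (snd e))" "odd (fst e + int (snd e))" using Dd(1)[OF e(1)] by auto
        have "\<not> G (fst e - int (snd e), 1) \<le> ennreal t" "\<not> G (fst e + int (snd e), 1) \<le> ennreal t"
          using Dd(2,3)[OF e(1)] by auto
        then have "\<not> (fst e' - int (snd e') < fst e - int (snd e) \<and> fst e - int (snd e) < fst e' + int (snd e'))"
          "\<not> (fst e' - int (snd e') < fst e + int (snd e) \<and> fst e + int (snd e) < fst e' + int (snd e'))"
          using Dd(4)[OF e(2)] odd by blast+
        then show ?thesis using e(3,4) by auto
      qed
      have "fst d - int (snd d) = fst d' - int (snd d')" "fst d + int (snd d) = fst d' + int (snd d')"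
        using key[OF d(1,2) k] key[OF d(2,1) k(2,1)] by auto
      then have "d = d'" by (auto simp: prod_eq_iff)
      then show False using d by simp
    qed
  qed
  moreover have "finite (piece G t d) \<and> down_closed (piece G t d)" if d: "d \<in> D" for d
  proof
    have "piece G t d \<subseteq> {z \<in> HH. base z \<subseteq> tri_base d}" using TTd[OF d] by (auto simp: piece_def)
    then show "finite (piece G t d)" using finite_base_subset[OF finite_tri_base] by (rule finite_subset)
    show "down_closed (piece G t d)"
      unfolding down_closed_def
    proof (intro conjI ballI impI)
      show "piece G t d \<subseteq> HH" using TT_HH by (auto simp: piece_def)
      fix z w assume a: "z \<in> piece G t d" "w \<in> HH" "le_H w z"
      then have z: "z \<in> TT (fst d) (snd d)" "G z \<le> ennreal t" by (auto simp: piece_def)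
      then have "z \<in> HH" using TT_HH by blast
      then have "G w \<le> G z" using orderedD(1)[OF ord a(2) _ a(3)] by blast
      then show "w \<in> piece G t d" using TT_down[OF z(1) a(2,3)] z(2) by (simp add: piece_def)
    qed
  qed
  moreover have "{z \<in> HH. G z \<le> ennreal t} = (\<Union>d\<in>D. piece G t d)"
  proof (intro equalityI subsetI)
    fix z assume "z \<in> {z \<in> HH. G z \<le> ennreal t}"
    then have z: "z \<in> HH" "G z \<le> ennreal t" by auto
    have row: "G (k, 1) \<le> ennreal t" if "k \<in> base z" for k
      using base_le_row[OF ord z(1) that] z(2) by simp
    obtain x where x: "x \<in> base z" using base_self[OF z(1)] by blast
    have ox: "odd x" using x by (simp add: base_def)
    obtain a0 b0 where 0: "odd a0" "odd b0" "a0 < x" "x < b0" "ennreal t < G (a0, 1)" "ennreal t < G (b0, 1)"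
      by (rule proper_gap[OF G t, of x])
    obtain a b where ab: "odd a" "odd b" "a < x" "x < b" "\<not> G (a, 1) \<le> ennreal t" "\<not> G (b, 1) \<le> ennreal t"
      "\<And>k. odd k \<Longrightarrow> a < k \<Longrightarrow> k < b \<Longrightarrow> G (k, 1) \<le> ennreal t"
      by (rule nearest_gap[of x "\<lambda>k. G (k, 1) \<le> ennreal t" a0 b0]) (use 0 ox row[OF x] in \<open>auto simp: not_le\<close>)
    define l where "l = (a + b) div 2"
    define k where "k = nat ((b - a) div 2)"
    have lk: "l - int k = a" "l + int k = b" using ab(1-4) by (auto simp: l_def k_def elim!: oddE)
    have "base z \<subseteq> tri_base (l, k)"
    proof
      fix y assume y: "y \<in> base z"
      have "a \<notin> base z" "b \<notin> base z" using row ab(5,6) by auto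
      then have "\<not> (y \<le> a)" "\<not> (b \<le> y)"
        using base_between[OF y x ab(1)] base_between[OF x y ab(2)] ab(3,4) by auto
      then show "y \<in> tri_base (l, k)" using y lk by (auto simp: base_def)
    qed
    moreover have "(l, k) \<in> D" unfolding D_def using lk ab by (auto simp: not_le)
    moreover have "odd (l + int k)" using lk ab by simp
    ultimately have "z \<in> piece G t (l, k)" using TT_base[of l k] z by (simp add: piece_def)
    then show "z \<in> (\<Union>d\<in>D. piece G t d)" using \<open>(l, k) \<in> D\<close> by blast
  next
    fix z assume "z \<in> (\<Union>d\<in>D. piece G t d)"
    then show "z \<in> {z \<in> HH. G z \<le> ennreal t}" using TT_HH by (auto simp: piece_def)
  qed
  ultimately show ?thesis unfolding decomposition_def using Dd(1) by blast
qed

text \<open>Disjoint triangles have disjoint bases, so at most one of them produces swaps at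
  \<open>x\<close>. Its base is a separated window, and its swaps have different times, so counting
  indexed triples is counting times.\<close>

theorem swaps_eq_card:
  assumes G: "proper G" and t: "0 \<le> t"
  shows "finite {v \<in> swap_times G x. v < ennreal t}"
    "swaps G x t = of_nat (card {v \<in> swap_times G x. v < ennreal t})"
proof -
  have ord: "ordered G" using proper_ordered[OF G] .
  define D where "D = (SOME D. decomposition G t D)"
  have "decomposition G t D" unfolding D_def by (rule someI_ex[OF decomposition_exists[OF assms]])
  then have D: "\<And>d. d \<in> D \<Longrightarrow> odd (fst d + int (snd d))" "disjoint_family_on (\<lambda>d. TT (fst d) (snd d)) D"
    "{z \<in> HH. G z \<le> ennreal t} = (\<Union>d\<in>D. piece G t d)"
    unfolding decomposition_def by auto
  let ?L = "{v. v \<le> ennreal t}"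
  have L: "lower_set ?L" by (rule lower_set_le) simp
  let ?V = "\<lambda>d. view (tri_base d) ?L G"
  have V: "fin_tableau (?V d)" for d by (rule ordered_view[OF ord finite_tri_base L])
  have TTd: "TT (fst d) (snd d) = {z \<in> HH. base z \<subseteq> tri_base d}" if "d \<in> D" for d
    using TT_base[OF D(1)[OF that]] by simp
  have pc: "piece G t d = supp (?V d)" if "d \<in> D" for d
    unfolding supp_view[OF L] piece_def TTd[OF that] by auto
  have EG: "EG_state G (piece G t d) j = (slide ^^ j) (?V d)" if "d \<in> D" for d j
  proof -
    have "(\<lambda>z. if z \<in> piece G t d then G z else \<infinity>) = ?V d"
      unfolding piece_def TTd[OF that] by (auto simp: view_def)
    then show ?thesis by (simp add: EG_state_def)
  qed
  have sep: "separated (tri_base d) ?L G" if d: "d \<in> D" for d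
    unfolding separated_def
  proof (intro ballI impI)
    fix z assume z: "z \<in> HH" "G z \<in> ?L"
    then have "z \<in> (\<Union>d\<in>D. piece G t d)" using D(3) by auto
    then obtain d' where d': "d' \<in> D" "z \<in> TT (fst d') (snd d')" by (auto simp: piece_def)
    show "base z \<subseteq> tri_base d \<or> base z \<inter> tri_base d = {}"
    proof (cases "d' = d")
      case True
      then show ?thesis using d' TTd by blast
    next
      case False
      have "base z \<inter> tri_base d = {}"
      proof (rule ccontr)
        assume "base z \<inter> tri_base d \<noteq> {}"
        then obtain k where k: "k \<in> base z" "k \<in> tri_base d" by blast
        have ok: "odd k" using k(2) by simp
        have "base (k, 1) = {k}" using ok by (auto simp: base_iff)
        then have "(k, 1) \<in> TT (fst d) (snd d)" using TTd[OF d] k(2) row_one_HH[OF ok] by auto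
        moreover have "k \<in> tri_base d'" using k(1) d' TTd by blast
        then have "(k, 1) \<in> TT (fst d') (snd d')" using TTd[OF d'(1)] row_one_HH[OF ok] \<open>base (k, 1) = {k}\<close> by auto
        ultimately show False using disjoint_family_onD[OF D(2) d d'(1)] False by auto
      qed
      then show ?thesis by blast
    qed
  qed
  define f where "f d j = (fst (min_point ((slide ^^ j) (?V d))), ((slide ^^ j) (?V d)) (min_point ((slide ^^ j) (?V d))))" for d j
  have swV: "sw (?V d) = f d ` {..<card (supp (?V d))}" for d unfolding sw_def f_def ..
  have EGs: "EG_swaps G t = {((d, j), f d j) | d j. d \<in> D \<and> j < card (supp (?V d))}"
    unfolding EG_swaps_def D_def[symmetric] Let_def f_def using EG pc by auto
  define W where "W = {e \<in> EG_swaps G t. fst (snd e) = x \<and> snd (snd e) < ennreal t}"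
  have S: "swaps G x t = emeasure (count_space UNIV) W" by (simp add: swaps_def W_def)
  have loc: "x \<in> tri_base d" if "((d, j), f d j) \<in> W" for d j
  proof -
    have d: "d \<in> D" "j < card (supp (?V d))" "fst (f d j) = x" using that unfolding W_def EGs by auto
    then have "(x, snd (f d j)) \<in> sw (?V d)" unfolding swV by (intro image_eqI[of _ _ j]) (auto simp: prod_eq_iff)
    then show ?thesis using sw_view_range(1)[OF ord finite_tri_base L] by blast
  qed
  show "finite {v \<in> swap_times G x. v < ennreal t}"
    and "swaps G x t = of_nat (card {v \<in> swap_times G x. v < ennreal t})"
  proof -
    have "finite {v \<in> swap_times G x. v < ennreal t} \<and> swaps G x t = of_nat (card {v \<in> swap_times G x. v < ennreal t})"
    proof (cases "\<exists>d\<in>D. x \<in> tri_base d")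
      case True
      then obtain d where d: "d \<in> D" "x \<in> tri_base d" by blast
      have times: "{v \<in> swap_times G x. v < ennreal t} = {v. (x, v) \<in> sw (?V d) \<and> v < ennreal t}"
        using sw_view_iff_swap_times[OF ord finite_tri_base L sep[OF d(1)] d(2)] less_imp_le by blast
      have uniq: "d' = d" if "d' \<in> D" "x \<in> tri_base d'" for d'
      proof (rule ccontr)
        assume ne: "d' \<noteq> d"
        have ox: "odd x" using d by simp
        have "base (x, 1) = {x}" using ox by (auto simp: base_iff)
        then have "(x, 1) \<in> TT (fst d) (snd d)" "(x, 1) \<in> TT (fst d') (snd d')"
          using TTd d that row_one_HH[OF ox] by auto
        then show False using disjoint_family_onD[OF D(2) d(1) that(1)] ne by auto
      qed
      let ?J = "{j. j < card (supp (?V d)) \<and> fst (f d j) = x \<and> snd (f d j) < ennreal t}"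
      have W: "W = (\<lambda>j. ((d, j), f d j)) ` ?J"
      proof (intro equalityI subsetI)
        fix w assume w: "w \<in> W"
        then obtain d' j where dj: "w = ((d', j), f d' j)" "d' \<in> D" "j < card (supp (?V d'))"
          "fst (f d' j) = x" "snd (f d' j) < ennreal t" unfolding W_def EGs by auto
        have "d' = d" using uniq[OF dj(2)] loc[of d' j] w dj(1) by blast
        then show "w \<in> (\<lambda>j. ((d, j), f d j)) ` ?J" using dj by blast
      next
        fix w assume "w \<in> (\<lambda>j. ((d, j), f d j)) ` ?J"
        then show "w \<in> W" unfolding W_def EGs using d by auto
      qed
      have finJ: "finite ?J" by simp
      have injf: "inj_on (f d) {..<card (supp (?V d))}"
        by (rule eq_card_imp_inj_on) (simp_all flip: swV add: card_sw[OF V])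
      have injsnd: "inj_on (\<lambda>j. snd (f d j)) ?J"
      proof (rule inj_onI)
        fix i j assume ij: "i \<in> ?J" "j \<in> ?J" "snd (f d i) = snd (f d j)"
        then have "f d i = f d j" by (auto simp: prod_eq_iff)
        then show "i = j" using inj_onD[OF injf] ij by auto
      qed
      have "{v. (x, v) \<in> sw (?V d) \<and> v < ennreal t} = (\<lambda>j. snd (f d j)) ` ?J"
      proof (intro set_eqI iffI)
        fix v assume "v \<in> {v. (x, v) \<in> sw (?V d) \<and> v < ennreal t}"
        then obtain j where "j < card (supp (?V d))" "(x, v) = f d j" "v < ennreal t" unfolding swV by blast
        then show "v \<in> (\<lambda>j. snd (f d j)) ` ?J" by (intro image_eqI[of _ _ j]) (auto simp: prod_eq_iff)
      next
        fix v assume "v \<in> (\<lambda>j. snd (f d j)) ` ?J"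
        then obtain j where j: "j < card (supp (?V d))" "fst (f d j) = x" "snd (f d j) < ennreal t" "v = snd (f d j)" by blast
        then have "(x, v) = f d j" by (simp add: prod_eq_iff)
        then show "v \<in> {v. (x, v) \<in> sw (?V d) \<and> v < ennreal t}" unfolding swV using j by auto
      qed
      then have c: "finite {v. (x, v) \<in> sw (?V d) \<and> v < ennreal t}" "card {v. (x, v) \<in> sw (?V d) \<and> v < ennreal t} = card ?J"
        using card_image[OF injsnd] finJ by auto
      have "inj_on (\<lambda>j. ((d, j), f d j)) ?J" by (auto simp: inj_on_def)
      then have "card W = card ?J" "finite W" using W finJ by (auto simp: card_image)
      then show ?thesis unfolding S times using c by (simp add: emeasure_count_space)
    next
      case False
      have W0: "W = {}"
      proof (rule ccontr)
        assume "W \<noteq> {}"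
        then obtain d j where "d \<in> D" "((d, j), f d j) \<in> W" unfolding W_def EGs by auto
        then show False using loc False by blast
      qed
      have V0: "{v \<in> swap_times G x. v < ennreal t} = {}"
      proof (rule ccontr)
        assume "{v \<in> swap_times G x. v < ennreal t} \<noteq> {}"
        then obtain v R L' where v: "v < ennreal t" "finite R" "lower_set L'" "(x, v) \<in> sw (view R L' G)"
          unfolding swap_times_def by blast
        have ox: "odd x" and "G (x, 1) \<le> v" using sw_view_range(3,4)[OF ord v(2-4)] by auto
        then have "(x, 1) \<in> {z \<in> HH. G z \<le> ennreal t}" using v(1) row_one_HH by auto
        then obtain d where d: "d \<in> D" "(x, 1) \<in> TT (fst d) (snd d)" unfolding D(3) by (auto simp: piece_def)
        then have "base (x, 1) \<subseteq> tri_base d" using TTd by blast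
        then have "x \<in> tri_base d" using ox by (auto simp: base_iff)
        then show False using False d by blast
      qed
      show ?thesis unfolding S W0 V0 by simp
    qed
    then show "finite {v \<in> swap_times G x. v < ennreal t}"
      and "swaps G x t = of_nat (card {v \<in> swap_times G x. v < ennreal t})" by blast+
  qed
qed

section \<open>Swap conditions as open conditions\<close>

abbreviation odd_interval :: "int \<Rightarrow> int \<Rightarrow> int set" where
  "odd_interval a b \<equiv> {k. odd k \<and> a \<le> k \<and> k \<le> b}"

lemma finite_odd_interval: "finite (odd_interval a b)"
  by (rule finite_subset[of _ "{a..b}"]) auto

text \<open>Records on which side of \<open>c\<close> each value over \<open>R\<close> lies and how
  the values below \<open>c\<close> are ordered: finitely many strict inequalities for finite
  \<open>R\<close>, hence an open set containing \<open>G\<close>.\<close>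

definition close_to :: "int set \<Rightarrow> ennreal \<Rightarrow> (int \<times> int \<Rightarrow> ennreal) \<Rightarrow> (int \<times> int \<Rightarrow> ennreal) set" where
  "close_to R c G = {G'. \<forall>z\<in>{z \<in> HH. base z \<subseteq> R}. (G z < c \<longrightarrow> G' z < c) \<and> (c < G z \<longrightarrow> c < G' z) \<and>
     (\<forall>w\<in>{z \<in> HH. base z \<subseteq> R}. G z < c \<longrightarrow> G w < c \<longrightarrow> G z < G w \<longrightarrow> G' z < G' w)}"

lemma open_imp: "open {x. Q x} \<Longrightarrow> open {x. P \<longrightarrow> Q x}"
  by (cases P) auto

lemma open_less_const: "open {G :: int \<times> int \<Rightarrow> ennreal. G z < c}"
  by (rule open_Collect_less) (auto intro: continuous_on_product_coordinates)

lemma open_const_less: "open {G :: int \<times> int \<Rightarrow> ennreal. c < G z}"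
  by (rule open_Collect_less) (auto intro: continuous_on_product_coordinates)

lemma open_less_coord: "open {G :: int \<times> int \<Rightarrow> ennreal. G z < G w}"
  by (rule open_Collect_less) (auto intro: continuous_on_product_coordinates)

lemma open_Ball: "finite A \<Longrightarrow> (\<And>z. z \<in> A \<Longrightarrow> open {x. Q z x}) \<Longrightarrow> open {x. \<forall>z\<in>A. Q z x}"
  using open_INT[of A "\<lambda>z. {x. Q z x}"] by (auto simp: Collect_ball_eq)

lemma open_close_to: "finite R \<Longrightarrow> open (close_to R c G)"
  unfolding close_to_def
  by (intro open_Ball open_Collect_conj open_imp open_less_const open_const_less open_less_coord finite_base_subset)

text \<open>Nearby functions show the same cells below level \<open>c\<close> in the same order, so
  the two views differ by an order-preserving relabelling \<open>\<phi>\<close>, under which the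
  swaps correspond.\<close>

lemma close_to_relabel:
  assumes R: "finite R" and c: "c \<noteq> \<infinity>" and H: "fin_tableau (view R {v. v \<le> c} G)"
    and nc: "\<And>z. z \<in> HH \<Longrightarrow> base z \<subseteq> R \<Longrightarrow> G z \<noteq> c" and G': "G' \<in> close_to R c G"
  shows "\<exists>\<phi>. fin_tableau (view R {v. v \<le> c} G') \<and>
    sw (view R {v. v \<le> c} G') = (\<lambda>(k, v). (k, \<phi> v)) ` sw (view R {v. v \<le> c} G) \<and>
    (\<forall>z\<in>supp (view R {v. v \<le> c} G). \<phi> (G z) = G' z) \<and>
    inj_on \<phi> (G ` supp (view R {v. v \<le> c} G)) \<and>
    (\<forall>z\<in>HH. base z \<subseteq> R \<longrightarrow> G' z \<noteq> c)"
proof -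
  let ?L = "{v. v \<le> c}"
  let ?H = "view R ?L G" and ?H' = "view R ?L G'"
  have L: "lower_set ?L" using lower_set_le[OF c] .
  have lt: "G z < c" "z \<in> HH" "base z \<subseteq> R" "?H z = G z" "G' z < c" "?H' z = G' z" if z: "z \<in> supp ?H" for z
  proof -
    have a: "z \<in> HH" "base z \<subseteq> R" "G z \<le> c" using z unfolding supp_view[OF L] by auto
    then show "z \<in> HH" "base z \<subseteq> R" "?H z = G z" by (auto simp: view_def)
    show g: "G z < c" using nc[OF a(1,2)] a(3) by auto
    show g': "G' z < c" using G' a g unfolding close_to_def by blast
    show "?H' z = G' z" using a g' by (auto simp: view_def)
  qed
  have injH: "inj_on ?H (supp ?H)" using fin_tableauD(3)[OF H] .
  define \<phi> where "\<phi> v = (if v = \<infinity> then \<infinity> else G' (the_inv_into (supp ?H) ?H v))" for v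
  have phi: "\<phi> (?H z) = G' z" if "z \<in> supp ?H" for z
    using the_inv_into_f_f[OF injH that] that by (auto simp: \<phi>_def supp_def)
  have phi_inf: "\<phi> \<infinity> = \<infinity>" by (simp add: \<phi>_def)
  have notsupp: "?H z = \<infinity>" if "z \<notin> supp ?H" for z
    using that fin_tableauD(1)[OF H] unfolding supp_def by blast
  have eq: "(\<lambda>z. \<phi> (?H (fst z + 0, snd z))) = ?H'"
  proof
    fix z
    show "\<phi> (?H (fst z + 0, snd z)) = ?H' z"
    proof (cases "z \<in> supp ?H")
      case True
      then show ?thesis using phi[OF True] lt(6)[OF True] by simp
    next
      case False
      have "\<not> (z \<in> HH \<and> base z \<subseteq> R \<and> G' z \<le> c)"
      proof
        assume a: "z \<in> HH \<and> base z \<subseteq> R \<and> G' z \<le> c"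
        then have "\<not> G z \<le> c" using False unfolding supp_view[OF L] by blast
        then have "c < G' z" using G' a unfolding close_to_def by (auto simp: not_le)
        then show False using a by auto
      qed
      then have "?H' z = \<infinity>" by (auto simp: view_def)
      then show ?thesis using notsupp[OF False] phi_inf by simp
    qed
  qed
  define A where "A = insert \<infinity> (?H ` supp ?H)"
  have rA: "range ?H \<subseteq> A"
  proof
    fix v assume "v \<in> range ?H"
    then obtain z where "v = ?H z" by blast
    then show "v \<in> A" using notsupp[of z] by (cases "z \<in> supp ?H") (auto simp: A_def)
  qed
  have less: "G' z < G' w" if "z \<in> supp ?H" "w \<in> supp ?H" "G z < G w" for z w
    using G' lt(1-3)[OF that(1)] lt(1-3)[OF that(2)] that(3) unfolding close_to_def by blast
  have phi_le: "\<forall>a\<in>A. \<forall>b\<in>A. \<phi> a \<le> \<phi> b \<longleftrightarrow> a \<le> b"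
  proof (intro ballI)
    fix a b assume "a \<in> A" "b \<in> A"
    then consider "b = \<infinity>" | w where "a = \<infinity>" "b = ?H w" "w \<in> supp ?H"
      | z w where "a = ?H z" "z \<in> supp ?H" "b = ?H w" "w \<in> supp ?H"
      unfolding A_def by blast
    then show "\<phi> a \<le> \<phi> b \<longleftrightarrow> a \<le> b"
    proof cases
      case 1
      show ?thesis unfolding 1 phi_inf by simp
    next
      case 2
      have "\<not> \<infinity> \<le> G' w" "\<not> \<infinity> \<le> ?H w" using lt[OF 2(3)] c by (auto simp: top_unique)
      then show ?thesis unfolding 2(1,2) phi_inf phi[OF 2(3)] by blast
    next
      case 3
      have "G' z \<le> G' w \<longleftrightarrow> G z \<le> G w"
      proof (cases "G z" "G w" rule: linorder_cases)
        case less
        then show ?thesis using \<open>\<And>z w. z \<in> supp ?H \<Longrightarrow> w \<in> supp ?H \<Longrightarrow> G z < G w \<Longrightarrow> G' z < G' w\<close>[OF 3(2,4)] by auto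
      next
        case equal
        then have "?H z = ?H w" using lt(4)[OF 3(2)] lt(4)[OF 3(4)] by simp
        then have "z = w" using inj_onD[OF injH _ 3(2,4)] by blast
        then show ?thesis by simp
      next
        case greater
        then show ?thesis using \<open>\<And>z w. z \<in> supp ?H \<Longrightarrow> w \<in> supp ?H \<Longrightarrow> G z < G w \<Longrightarrow> G' z < G' w\<close>[OF 3(4,2)] by auto
      qed
      then show ?thesis unfolding 3(1,3) phi[OF 3(2)] phi[OF 3(4)] unfolding lt(4)[OF 3(2)] lt(4)[OF 3(4)] .
    qed
  qed
  have ev: "even (0 :: int)" by simp
  have infA: "\<infinity> \<in> A" by (simp add: A_def)
  show ?thesis
  proof (intro exI[of _ \<phi>] conjI ballI impI)
    show "fin_tableau ?H'" using shift_relabel_step(1)[OF H ev rA infA phi_le phi_inf] unfolding eq .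
    show "sw ?H' = (\<lambda>(k, v). (k, \<phi> v)) ` sw ?H"
      using sw_shift_relabel[OF H ev rA infA phi_le phi_inf] unfolding eq by simp
    show "\<phi> (G z) = G' z" if "z \<in> supp ?H" for z using phi[OF that] lt(4)[OF that] by simp
    have "G ` supp ?H \<subseteq> A" using lt(4) by (force simp: A_def)
    then show "inj_on \<phi> (G ` supp ?H)" using phi_le by (intro inj_onI antisym) (metis order_refl subsetD)+
    show "G' z \<noteq> c" if "z \<in> HH" "base z \<subseteq> R" for z
    proof (cases "G z < c")
      case True
      then have "G' z < c" using G' that unfolding close_to_def by blast
      then show ?thesis by auto
    next
      case False
      then have "c < G z" using nc[OF that] by auto
      then have "c < G' z" using G' that unfolding close_to_def by blast
      then show ?thesis by auto
    qed
  qed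
qed

text \<open>All inequalities are strict, so that only finitely many open conditions on the values of
  \<open>G\<close> are involved.\<close>

definition window :: "(int \<times> int \<Rightarrow> ennreal) \<Rightarrow> int \<Rightarrow> int \<Rightarrow> ennreal \<Rightarrow> bool" where
  "window G a b c \<longleftrightarrow> odd a \<and> odd b \<and> c \<noteq> \<infinity> \<and> c < G (a - 2, 1) \<and> c < G (b + 2, 1) \<and>
     (\<forall>z\<in>HH. base z \<subseteq> odd_interval a b \<longrightarrow> G z \<noteq> c) \<and> fin_tableau (view (odd_interval a b) {v. v \<le> c} G)"

definition many_swaps :: "int \<Rightarrow> ennreal \<Rightarrow> nat \<Rightarrow> (int \<times> int \<Rightarrow> ennreal) set" where
  "many_swaps x t j = {G. \<exists>a b c. window G a b c \<and> x \<in> odd_interval a b \<and> t < c \<and>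
     j \<le> card {v. (x, v) \<in> sw (view (odd_interval a b) {v. v \<le> c} G) \<and> v < t}}"

definition no_swap :: "int \<Rightarrow> ennreal \<Rightarrow> ennreal \<Rightarrow> (int \<times> int \<Rightarrow> ennreal) set" where
  "no_swap x s t = {G. \<exists>a b c. window G a b c \<and> x \<in> odd_interval a b \<and> t < c \<and>
     (\<forall>v. (x, v) \<in> sw (view (odd_interval a b) {v. v \<le> c} G) \<longrightarrow> v < s \<or> t < v)}"

lemma many_swapsI:
  "window G a b c \<Longrightarrow> x \<in> odd_interval a b \<Longrightarrow> t < c \<Longrightarrow>
   j \<le> card {v. (x, v) \<in> sw (view (odd_interval a b) {v. v \<le> c} G) \<and> v < t} \<Longrightarrow> G \<in> many_swaps x t j"
  unfolding many_swaps_def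
  by (rule CollectI, rule exI[of _ a], rule exI[of _ b], rule exI[of _ c]) (rule conjI, assumption, rule conjI, assumption, rule conjI, assumption, assumption)

lemma finite_sw_times: "finite {v. (x, v) \<in> sw H \<and> P v}"
proof -
  have "{v. (x, v) \<in> sw H \<and> P v} \<subseteq> snd ` sw H" by force
  then show ?thesis using finite_sw[of H] finite_subset by blast
qed

lemma sw_view_value:
  assumes "fin_tableau (view R {v. v \<le> c} G)" "c \<noteq> \<infinity>" "(k, v) \<in> sw (view R {v. v \<le> c} G)"
  obtains z where "z \<in> supp (view R {v. v \<le> c} G)" "v = G z" "z \<in> HH" "base z \<subseteq> R"
proof -
  obtain z where z: "z \<in> HH" "v = view R {v. v \<le> c} G z" "view R {v. v \<le> c} G z \<noteq> \<infinity>"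
    using sw_finite_value[OF assms(1,3)] by blast
  then have s: "z \<in> supp (view R {v. v \<le> c} G)" by (auto simp: supp_def)
  moreover have "base z \<subseteq> R" "G z \<in> {v. v \<le> c}" using s unfolding supp_view[OF lower_set_le[OF assms(2)]] by auto
  moreover have "v = G z" using z calculation by (simp add: view_def)
  ultimately show ?thesis using that z(1) by blast
qed

text \<open>The sets \<open>A z\<close> leave room for one further open condition for each of the
  finitely many cells over the window.\<close>

lemma window_open:
  assumes W: "window G a b c" "x \<in> odd_interval a b"
    and tri: "\<And>z. z \<in> HH \<Longrightarrow> base z \<subseteq> odd_interval a b \<Longrightarrow> open (A z) \<and> G \<in> A z"
  obtains Op where "open Op" "G \<in> Op"
    "\<And>G'. G' \<in> Op \<Longrightarrow> window G' a b c \<and> (\<forall>z\<in>HH. base z \<subseteq> odd_interval a b \<longrightarrow> G' \<in> A z) \<and>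
       G' \<in> close_to (odd_interval a b) c G"
proof -
  let ?R = "odd_interval a b"
  let ?O = "close_to ?R c G \<inter> {G'. c < G' (a - 2, 1)} \<inter> {G'. c < G' (b + 2, 1)} \<inter> {G'. \<forall>z\<in>{z \<in> HH. base z \<subseteq> ?R}. G' \<in> A z}"
  have w: "odd a" "odd b" "c \<noteq> \<infinity>" "c < G (a - 2, 1)" "c < G (b + 2, 1)"
    "\<And>z. z \<in> HH \<Longrightarrow> base z \<subseteq> ?R \<Longrightarrow> G z \<noteq> c" "fin_tableau (view ?R {v. v \<le> c} G)"
    using W(1) unfolding window_def by blast+
  show ?thesis
  proof (rule that[of ?O])
    show "open ?O"
      by (intro open_Int open_close_to finite_odd_interval open_const_less open_Ball finite_base_subset) (use tri in auto)
    show "G \<in> ?O" using w tri by (auto simp: close_to_def)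
    fix G' assume G': "G' \<in> ?O"
    then have cl: "G' \<in> close_to ?R c G" by blast
    have "fin_tableau (view ?R {v. v \<le> c} G')" "\<forall>z\<in>HH. base z \<subseteq> ?R \<longrightarrow> G' z \<noteq> c"
      using close_to_relabel[OF finite_odd_interval w(3,7,6) cl] by blast+
    then show "window G' a b c \<and> (\<forall>z\<in>HH. base z \<subseteq> ?R \<longrightarrow> G' \<in> A z) \<and> G' \<in> close_to ?R c G"
      using G' w(1-3) unfolding window_def by blast
  qed
qed

text \<open>For a nearby function the relabelling carries the swap times before \<open>t\<close>
  injectively to swap times, and these stay before \<open>t\<close> because the strict inequalities
  \<open>G z < t\<close> were made part of the neighbourhood.\<close>

lemma open_many_swaps: "open (many_swaps x t j)"
proof (subst open_subopen, intro ballI)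
  fix G assume "G \<in> many_swaps x t j"
  then obtain a b c where W: "window G a b c" "x \<in> odd_interval a b" "t < c"
    "j \<le> card {v. (x, v) \<in> sw (view (odd_interval a b) {v. v \<le> c} G) \<and> v < t}"
    unfolding many_swaps_def by blast
  let ?R = "odd_interval a b"
  let ?A = "\<lambda>z. {G'. G z < t \<longrightarrow> G' z < t}"
  have opA: "open (?A z) \<and> G \<in> ?A z" for z by (auto intro: open_imp open_less_const)
  obtain Op where Op: "open Op" "G \<in> Op"
    "\<And>G'. G' \<in> Op \<Longrightarrow> window G' a b c \<and> (\<forall>z\<in>HH. base z \<subseteq> ?R \<longrightarrow> G' \<in> ?A z) \<and> G' \<in> close_to ?R c G"
    by (rule window_open[OF W(1,2), of ?A]) (use opA in auto)
  have w: "c \<noteq> \<infinity>" "\<And>z. z \<in> HH \<Longrightarrow> base z \<subseteq> ?R \<Longrightarrow> G z \<noteq> c" "fin_tableau (view ?R {v. v \<le> c} G)"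
    using W(1) unfolding window_def by blast+
  have "G' \<in> many_swaps x t j" if G': "G' \<in> Op" for G'
  proof -
    note o = Op(3)[OF G']
    let ?H = "view ?R {v. v \<le> c} G" and ?H' = "view ?R {v. v \<le> c} G'"
    obtain \<phi> where phi: "sw ?H' = (\<lambda>(k, v). (k, \<phi> v)) ` sw ?H" "\<forall>z\<in>supp ?H. \<phi> (G z) = G' z"
      "inj_on \<phi> (G ` supp ?H)"
      using close_to_relabel[OF finite_odd_interval w(1,3,2) conjunct2[OF conjunct2[OF o]]] by blast
    let ?S = "{v. (x, v) \<in> sw ?H \<and> v < t}" and ?S' = "{v. (x, v) \<in> sw ?H' \<and> v < t}"
    have "\<phi> ` ?S \<subseteq> ?S'"
    proof
      fix v' assume "v' \<in> \<phi> ` ?S"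
      then obtain v where v: "v' = \<phi> v" "(x, v) \<in> sw ?H" "v < t" by blast
      obtain z where z: "z \<in> supp ?H" "v = G z" "z \<in> HH" "base z \<subseteq> ?R" by (rule sw_view_value[OF w(3,1) v(2)])
      have "G' z < t" using o z v(3) by blast
      moreover have "\<phi> v = G' z" using phi(2) z(1,2) by blast
      moreover have "(x, \<phi> v) \<in> sw ?H'" unfolding phi(1) using v(2) by force
      ultimately show "v' \<in> ?S'" using v(1) by simp
    qed
    then have 1: "card (\<phi> ` ?S) \<le> card ?S'" by (rule card_mono[OF finite_sw_times])
    have "?S \<subseteq> G ` supp ?H"
    proof
      fix v assume "v \<in> ?S"
      then have "(x, v) \<in> sw ?H" by blast
      then obtain z where "z \<in> supp ?H" "v = G z" by (rule sw_view_value[OF w(3,1)])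
      then show "v \<in> G ` supp ?H" by blast
    qed
    then have "card (\<phi> ` ?S) = card ?S" by (intro card_image inj_on_subset[OF phi(3)])
    then have "card ?S \<le> card ?S'" using 1 by linarith
    then have "j \<le> card ?S'" using W(4) by linarith
    then show ?thesis by (rule many_swapsI[OF conjunct1[OF o] W(2,3)])
  qed
  then show "\<exists>T. open T \<and> G \<in> T \<and> T \<subseteq> many_swaps x t j" using Op(1,2) by blast
qed

text \<open>Swap times are values of cells, and both alternatives \<open>v < s\<close> and
  \<open>t < v\<close> are strict; so for a nearby function every swap time stays on its side of the
  closed interval.\<close>

lemma open_no_swap: "open (no_swap x s t)"
proof (subst open_subopen, intro ballI)
  fix G assume "G \<in> no_swap x s t"
  then obtain a b c where W: "window G a b c" "x \<in> odd_interval a b" "t < c"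
    "\<forall>v. (x, v) \<in> sw (view (odd_interval a b) {v. v \<le> c} G) \<longrightarrow> v < s \<or> t < v"
    unfolding no_swap_def by blast
  let ?R = "odd_interval a b"
  let ?A = "\<lambda>z. {G'. (G z < s \<longrightarrow> G' z < s) \<and> (t < G z \<longrightarrow> t < G' z)}"
  have opA: "open (?A z) \<and> G \<in> ?A z" for z
    by (auto intro!: open_Collect_conj open_imp open_less_const open_const_less)
  obtain Op where Op: "open Op" "G \<in> Op"
    "\<And>G'. G' \<in> Op \<Longrightarrow> window G' a b c \<and> (\<forall>z\<in>HH. base z \<subseteq> ?R \<longrightarrow> G' \<in> ?A z) \<and> G' \<in> close_to ?R c G"
    by (rule window_open[OF W(1,2), of ?A]) (use opA in auto)
  have w: "c \<noteq> \<infinity>" "\<And>z. z \<in> HH \<Longrightarrow> base z \<subseteq> ?R \<Longrightarrow> G z \<noteq> c" "fin_tableau (view ?R {v. v \<le> c} G)"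
    using W(1) unfolding window_def by blast+
  have "G' \<in> no_swap x s t" if G': "G' \<in> Op" for G'
  proof -
    note o = Op(3)[OF G']
    let ?H = "view ?R {v. v \<le> c} G" and ?H' = "view ?R {v. v \<le> c} G'"
    obtain \<phi> where phi: "sw ?H' = (\<lambda>(k, v). (k, \<phi> v)) ` sw ?H" "\<forall>z\<in>supp ?H. \<phi> (G z) = G' z"
      using close_to_relabel[OF finite_odd_interval w(1,3,2) conjunct2[OF conjunct2[OF o]]] by blast
    have "v' < s \<or> t < v'" if "(x, v') \<in> sw ?H'" for v'
    proof -
      obtain v where v: "v' = \<phi> v" "(x, v) \<in> sw ?H" using \<open>(x, v') \<in> sw ?H'\<close> unfolding phi(1) by auto
      obtain z where z: "z \<in> supp ?H" "v = G z" "z \<in> HH" "base z \<subseteq> ?R" by (rule sw_view_value[OF w(3,1) v(2)])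
      have "G z < s \<or> t < G z" using W(4) v(2) z(2) by blast
      then have "G' z < s \<or> t < G' z" using o z by blast
      moreover have "v' = G' z" using phi(2) z(1,2) v(1) by simp
      ultimately show ?thesis by simp
    qed
    then show ?thesis using o W(2,3) unfolding no_swap_def by blast
  qed
  then show "\<exists>T. open T \<and> G \<in> T \<and> T \<subseteq> no_swap x s t" using Op(1,2) by blast
qed

lemma window_separated:
  assumes "ordered G" "window G a b c"
  shows "separated (odd_interval a b) {v. v \<le> c} G" "lower_set {v. v \<le> c}"
proof -
  have w: "odd a" "odd b" "c \<noteq> \<infinity>" "c < G (a - 2, 1)" "c < G (b + 2, 1)" using assms(2) unfolding window_def by blast+
  show L: "lower_set {v. v \<le> c}" by (rule lower_set_le[OF w(3)])
  show "separated (odd_interval a b) {v. v \<le> c} G"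
    by (rule separated_interval[OF orderedD(1)[OF assms(1)] L w(1,2)]) (use w in auto)
qed

lemma tableau_many_swaps:
  assumes J: "fin_tableau J" and m: "J \<in> many_swaps x t j"
  shows "j \<le> card {v. (x, v) \<in> sw J \<and> v < t}"
proof -
  obtain a b c where W: "window J a b c" "x \<in> odd_interval a b" "t < c"
    "j \<le> card {v. (x, v) \<in> sw (view (odd_interval a b) {v. v \<le> c} J) \<and> v < t}"
    using m unfolding many_swaps_def by blast
  note sep = window_separated[OF fin_tableau_ordered[OF J] W(1)]
  have "card {v. (x, v) \<in> sw (view (odd_interval a b) {v. v \<le> c} J) \<and> v < t} \<le> card {v. (x, v) \<in> sw J \<and> v < t}"
    unfolding sw_view[OF J sep(2,1)] by (rule card_mono[OF finite_sw_times]) auto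
  then show ?thesis using W(4) by linarith
qed

lemma tableau_no_swap:
  assumes J: "fin_tableau J" and m: "J \<in> no_swap x s t" and v: "(x, v) \<in> sw J"
  shows "\<not> (s \<le> v \<and> v \<le> t)"
proof
  assume st: "s \<le> v \<and> v \<le> t"
  obtain a b c where W: "window J a b c" "x \<in> odd_interval a b" "t < c"
    "\<forall>v. (x, v) \<in> sw (view (odd_interval a b) {v. v \<le> c} J) \<longrightarrow> v < s \<or> t < v"
    using m unfolding no_swap_def by blast
  note sep = window_separated[OF fin_tableau_ordered[OF J] W(1)]
  have "v \<le> c" using st W(3) by auto
  then have "(x, v) \<in> sw (view (odd_interval a b) {v. v \<le> c} J)" using v W(2) unfolding sw_view[OF J sep(2,1)] by auto
  then have "v < s \<or> t < v" using W(4) by blast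
  then show False using st by auto
qed

text \<open>Walls of height above \<open>t + 1\<close> exist on both sides of \<open>x\<close>, and
  a level \<open>c\<close> between \<open>t\<close> and \<open>t + 1\<close> can avoid the finitely
  many values over the window.\<close>

lemma window_exists:
  assumes G: "proper G" and t: "0 \<le> t" and x: "odd x"
  obtains a b c where "window G a b c" "x \<in> odd_interval a b" "ennreal t < c"
proof -
  have ord: "ordered G" using proper_ordered[OF G] .
  have "0 \<le> t + 1" using t by simp
  from proper_gap[OF G this, of x] obtain a0 b0 where
    0: "odd a0" "odd b0" "a0 < x" "x < b0" "ennreal (t + 1) < G (a0, 1)" "ennreal (t + 1) < G (b0, 1)" by blast
  define a where "a = a0 + 2"
  define b where "b = b0 - 2"
  have ab: "odd a" "odd b" "a \<le> x" "x \<le> b" "a - 2 = a0" "b + 2 = b0"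
  proof -
    have "a0 + 2 \<le> x" "x \<le> b0 - 2" using 0 x by presburger+
    then show "a \<le> x" "x \<le> b" by (auto simp: a_def b_def)
  qed (use 0 in \<open>auto simp: a_def b_def\<close>)
  let ?R = "odd_interval a b"
  have "finite ((\<lambda>z. enn2real (G z)) ` {z \<in> HH. base z \<subseteq> ?R})"
    using finite_base_subset[OF finite_odd_interval] by (rule finite_imageI)
  moreover have "infinite {t<..<t + 1}" by (rule infinite_Ioo) simp
  ultimately have "\<not> {t<..<t + 1} \<subseteq> (\<lambda>z. enn2real (G z)) ` {z \<in> HH. base z \<subseteq> ?R}"
    using finite_subset by blast
  then obtain c where c: "c \<in> {t<..<t + 1}" "c \<notin> (\<lambda>z. enn2real (G z)) ` {z \<in> HH. base z \<subseteq> ?R}" by blast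
  have nc: "G z \<noteq> ennreal c" if "z \<in> HH" "base z \<subseteq> ?R" for z
  proof
    assume "G z = ennreal c"
    then have "enn2real (G z) = c" using c(1) t by simp
    then show False using c(2) that by blast
  qed
  have "ennreal c \<le> ennreal (t + 1)" using c(1) by (intro ennreal_leI) simp
  then have cb: "ennreal c < G (a - 2, 1)" "ennreal c < G (b + 2, 1)" using 0 ab(5,6) by auto
  have "fin_tableau (view ?R {v. v \<le> ennreal c} G)"
    by (rule ordered_view[OF ord finite_odd_interval lower_set_le]) simp
  then have "window G a b (ennreal c)" unfolding window_def using ab(1,2) cb nc by simp
  moreover have "ennreal t < ennreal c" using c(1) t by (simp add: ennreal_less_iff)
  moreover have "x \<in> ?R" using x ab by simp
  ultimately show ?thesis using that by blast
qed

text \<open>All windows with level above \<open>t\<close> show the same swaps before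
  \<open>t\<close>, and for a proper function there is at least one such window; so the open
  condition loses nothing.\<close>

lemma proper_many_swaps_iff:
  assumes G: "proper G" and t: "0 \<le> t" and x: "odd x"
  shows "G \<in> many_swaps x (ennreal t) j \<longleftrightarrow> j \<le> card {v \<in> swap_times G x. v < ennreal t}"
proof -
  have ord: "ordered G" using proper_ordered[OF G] .
  have eq: "{v. (x, v) \<in> sw (view (odd_interval a b) {v. v \<le> c} G) \<and> v < ennreal t} = {v \<in> swap_times G x. v < ennreal t}"
    if W: "window G a b c" "x \<in> odd_interval a b" "ennreal t < c" for a b c
  proof -
    note sep = window_separated[OF ord W(1)]
    have "v < ennreal t \<Longrightarrow> v \<in> {v. v \<le> c}" for v using W(3) by auto
    then show ?thesis
      using sw_view_iff_swap_times[OF ord finite_odd_interval sep(2,1) W(2)] by blast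
  qed
  show ?thesis
  proof
    assume "G \<in> many_swaps x (ennreal t) j"
    then obtain a b c where W: "window G a b c" "x \<in> odd_interval a b" "ennreal t < c"
      "j \<le> card {v. (x, v) \<in> sw (view (odd_interval a b) {v. v \<le> c} G) \<and> v < ennreal t}"
      unfolding many_swaps_def by blast
    show "j \<le> card {v \<in> swap_times G x. v < ennreal t}" using W(4) unfolding eq[OF W(1-3)] .
  next
    assume j: "j \<le> card {v \<in> swap_times G x. v < ennreal t}"
    obtain a b c where W: "window G a b c" "x \<in> odd_interval a b" "ennreal t < c" by (rule window_exists[OF assms])
    have "j \<le> card {v. (x, v) \<in> sw (view (odd_interval a b) {v. v \<le> c} G) \<and> v < ennreal t}"
      using j unfolding eq[OF W] .
    then show "G \<in> many_swaps x (ennreal t) j" by (rule many_swapsI[OF W])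
  qed
qed

lemma proper_no_swap:
  assumes G: "proper G" and t: "0 \<le> t" and x: "odd x" and n: "G \<notin> no_swap x s (ennreal t)"
  shows "\<exists>v\<in>swap_times G x. s \<le> v \<and> v \<le> ennreal t"
proof -
  have ord: "ordered G" using proper_ordered[OF G] .
  obtain a b c where W: "window G a b c" "x \<in> odd_interval a b" "ennreal t < c" by (rule window_exists[OF G t x])
  note sep = window_separated[OF ord W(1)]
  have "\<not> (\<forall>v. (x, v) \<in> sw (view (odd_interval a b) {v. v \<le> c} G) \<longrightarrow> v < s \<or> ennreal t < v)"
    using n W unfolding no_swap_def by blast
  then obtain v where v: "(x, v) \<in> sw (view (odd_interval a b) {v. v \<le> c} G)" "s \<le> v" "v \<le> ennreal t" by (auto simp: not_less)
  then show ?thesis using sw_view_iff_swap_times[OF ord finite_odd_interval sep(2,1) W(2)] by blast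
qed

section \<open>Mass transport\<close>

text \<open>A maximal run of bottom positions with values below \<open>t\<close>. The cells of value
  below \<open>t\<close> over it form a pile separated from the rest.\<close>

definition cluster :: "(int \<times> int \<Rightarrow> ennreal) \<Rightarrow> ennreal \<Rightarrow> int \<Rightarrow> int \<Rightarrow> bool" where
  "cluster G t a b \<longleftrightarrow> odd a \<and> odd b \<and> (\<forall>k. odd k \<longrightarrow> a \<le> k \<longrightarrow> k \<le> b \<longrightarrow> G (k, 1) < t) \<and>
     t \<le> G (a - 2, 1) \<and> t \<le> G (b + 2, 1)"

definition column :: "(int \<times> int \<Rightarrow> ennreal) \<Rightarrow> int \<Rightarrow> ennreal \<Rightarrow> (int \<times> int) set" where
  "column G x t = {z \<in> HH. fst z \<in> {x, x + 1} \<and> G z < t}"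

lemma col_height_column: "col_height G x t = emeasure (count_space UNIV) (column G x (ennreal t))"
  by (simp add: col_height_def column_def)

lemma column_base:
  assumes "odd x" "z \<in> column G x t"
  shows "x \<in> base z"
proof -
  have z: "z \<in> HH" "fst z = x \<or> fst z = x + 1" using assms(2) by (auto simp: column_def)
  obtain k where k: "k \<in> base z" "k = fst z \<or> k = fst z - 1" using base_self[OF z(1)] by blast
  have "odd k" using k(1) by (simp add: base_def)
  then have "k = x" using k(2) z(2) assms(1) by auto
  then show ?thesis using k(1) by simp
qed

lemma Sigma_slices: "(\<And>k v. (k, v) \<in> W \<Longrightarrow> k \<in> A) \<Longrightarrow> W = Sigma A (\<lambda>k. {v. (k, v) \<in> W})"
  by auto

text \<open>Every cell of the pile over the cluster causes exactly one swap, at some position of the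
  cluster (\<open>card_sw\<close>), and lies in exactly one pair of columns
  \<open>{k, k + 1}\<close> with \<open>k\<close> odd. Both sums count the pile.\<close>

lemma cluster_sum:
  assumes G: "proper G" and t: "0 \<le> t" and cl: "cluster G (ennreal t) a b"
  shows "(\<Sum>k\<in>odd_interval a b. swaps G k t) = (\<Sum>k\<in>odd_interval a b. col_height G k t)"
proof -
  let ?R = "odd_interval a b" and ?L = "{v. v < ennreal t}"
  let ?V = "view ?R ?L G"
  have ord: "ordered G" using proper_ordered[OF G] .
  have finR: "finite ?R" by (rule finite_odd_interval)
  have L: "lower_set ?L" by (rule lower_set_less)
  have c: "odd a" "odd b" "ennreal t \<le> G (a - 2, 1)" "ennreal t \<le> G (b + 2, 1)"
    using cl unfolding cluster_def by blast+
  have sep: "separated ?R ?L G"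
    by (rule separated_interval[OF orderedD(1)[OF ord] L c(1,2)]) (use c(3,4) in auto)
  have V: "fin_tableau ?V" by (rule ordered_view[OF ord finR L])
  have times: "{v \<in> swap_times G k. v < ennreal t} = {v. (k, v) \<in> sw ?V}" if "k \<in> ?R" for k
    using sw_view_iff_swap_times[OF ord finR L sep that] by simp
  have fin: "finite {v. (k, v) \<in> sw ?V}" for k using finite_sw_times[of k ?V "\<lambda>_. True"] by simp
  have "sw ?V = Sigma ?R (\<lambda>k. {v. (k, v) \<in> sw ?V})"
    by (rule Sigma_slices) (rule sw_view_range(1)[OF ord finR L])
  then have "card (sw ?V) = card (Sigma ?R (\<lambda>k. {v. (k, v) \<in> sw ?V}))" by (rule arg_cong)
  also have "\<dots> = (\<Sum>k\<in>?R. card {v. (k, v) \<in> sw ?V})"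
    using finR fin by (intro card_SigmaI) auto
  finally have 1: "(\<Sum>k\<in>?R. card {v. (k, v) \<in> sw ?V}) = card (supp ?V)" using card_sw[OF V] by simp
  have S: "supp ?V = (\<Union>k\<in>?R. column G k (ennreal t))"
  proof (intro equalityI subsetI)
    fix z assume "z \<in> supp ?V"
    then have z: "z \<in> HH" "base z \<subseteq> ?R" "G z < ennreal t" unfolding supp_view[OF L] by auto
    obtain k where "k \<in> base z" "k = fst z \<or> k = fst z - 1" using base_self[OF z(1)] by blast
    then have "k \<in> ?R" "z \<in> column G k (ennreal t)" using z by (auto simp: column_def)
    then show "z \<in> (\<Union>k\<in>?R. column G k (ennreal t))" by blast
  next
    fix z assume "z \<in> (\<Union>k\<in>?R. column G k (ennreal t))"
    then obtain k where k: "k \<in> ?R" "z \<in> column G k (ennreal t)" by blast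
    have "k \<in> base z" using column_base[OF _ k(2)] k(1) by blast
    then have "base z \<inter> ?R \<noteq> {}" using k(1) by blast
    moreover have z: "z \<in> HH" "G z \<in> ?L" using k(2) by (auto simp: column_def)
    ultimately have "base z \<subseteq> ?R" using sep unfolding separated_def by blast
    then show "z \<in> supp ?V" unfolding supp_view[OF L] using z by blast
  qed
  have fc: "finite (column G k (ennreal t))" if "k \<in> ?R" for k
    by (rule finite_subset[OF _ fin_tableauD(2)[OF V]]) (use S that in blast)
  have disj: "column G k (ennreal t) \<inter> column G k' (ennreal t) = {}" if "k \<in> ?R" "k' \<in> ?R" "k \<noteq> k'" for k k'
  proof -
    have "fst z = k \<or> fst z = k + 1 \<Longrightarrow> fst z = k' \<or> fst z = k' + 1 \<Longrightarrow> False" for z :: "int \<times> int"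
      using that by auto
    then show ?thesis unfolding column_def by blast
  qed
  have 2: "card (supp ?V) = (\<Sum>k\<in>?R. card (column G k (ennreal t)))"
    unfolding S by (rule card_UN_disjoint) (use finR fc disj in auto)
  have "(\<Sum>k\<in>?R. swaps G k t) = (\<Sum>k\<in>?R. of_nat (card {v. (k, v) \<in> sw ?V}))"
    by (rule sum.cong) (auto simp: swaps_eq_card(2)[OF G t] times)
  also have "\<dots> = of_nat (card (supp ?V))" unfolding 1[symmetric] by simp
  also have "\<dots> = (\<Sum>k\<in>?R. of_nat (card (column G k (ennreal t))))" unfolding 2 by simp
  also have "\<dots> = (\<Sum>k\<in>?R. col_height G k t)"
    by (rule sum.cong) (auto simp: col_height_column emeasure_count_space fc)
  finally show ?thesis .
qed

lemma outside_cluster: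
  assumes G: "proper G" and t: "0 \<le> t" and x: "odd x" "ennreal t \<le> G (x, 1)"
  shows "swaps G x t = 0" "col_height G x t = 0"
proof -
  have ord: "ordered G" using proper_ordered[OF G] .
  have "{v \<in> swap_times G x. v < ennreal t} = {}"
  proof (rule ccontr)
    assume "{v \<in> swap_times G x. v < ennreal t} \<noteq> {}"
    then obtain v R L where v: "v < ennreal t" "finite R" "lower_set L" "(x, v) \<in> sw (view R L G)"
      unfolding swap_times_def by blast
    have "G (x, 1) \<le> v" using sw_view_range(4)[OF ord v(2-4)] .
    then show False using v(1) x(2) by auto
  qed
  then show "swaps G x t = 0" using swaps_eq_card(2)[OF G t, of x] by (simp only: card.empty of_nat_0)
  have "column G x (ennreal t) = {}"
  proof (rule ccontr)
    assume "column G x (ennreal t) \<noteq> {}"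
    then obtain z where z: "z \<in> column G x (ennreal t)" by blast
    then have "z \<in> HH" "G z < ennreal t" by (auto simp: column_def)
    then show False using base_le_row[OF ord _ column_base[OF x(1) z]] x(2) by auto
  qed
  then show "col_height G x t = 0" by (simp add: col_height_column)
qed

text \<open>The position next to an end of one cluster has value at least \<open>t\<close>, so it
  cannot lie in the other.\<close>

lemma cluster_unique:
  assumes "cluster G t a b" "cluster G t a' b'" "a \<le> x" "x \<le> b" "a' \<le> x" "x \<le> b'"
  shows "a = a' \<and> b = b'"
proof -
  have key: "c' \<le> c \<and> d \<le> d'" if "cluster G t c d" "cluster G t c' d'" "c \<le> x" "x \<le> d" "c' \<le> x" "x \<le> d'" for c d c' d'
  proof -
    have o: "odd c" "odd d" "odd c'" "odd d'" using that(1,2) by (auto simp: cluster_def)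
    have l: "\<And>k. odd k \<Longrightarrow> c' \<le> k \<Longrightarrow> k \<le> d' \<Longrightarrow> G (k, 1) < t" using that(2) by (auto simp: cluster_def)
    have "\<not> G (c - 2, 1) < t" "\<not> G (d + 2, 1) < t" using that(1) by (auto simp: cluster_def)
    then have n: "\<not> (c' \<le> c - 2 \<and> c - 2 \<le> d')" "\<not> (c' \<le> d + 2 \<and> d + 2 \<le> d')" using l o by auto
    have l': "\<And>k. odd k \<Longrightarrow> c \<le> k \<Longrightarrow> k \<le> d \<Longrightarrow> G (k, 1) < t" using that(1) by (auto simp: cluster_def)
    have "\<not> G (c' - 2, 1) < t" "\<not> G (d' + 2, 1) < t" using that(2) by (auto simp: cluster_def)
    then have n': "\<not> (c \<le> c' - 2 \<and> c' - 2 \<le> d)" "\<not> (c \<le> d' + 2 \<and> d' + 2 \<le> d)" using l' o by auto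
    have "\<not> c < c'"
    proof
      assume "c < c'"
      then have "c \<le> c' - 2" using o by presburger
      then show False using n'(1) that(4,5) by auto
    qed
    moreover have "\<not> d' < d"
    proof
      assume "d' < d"
      then have "d' + 2 \<le> d" using o by presburger
      then show False using n'(2) that(3,6) by auto
    qed
    ultimately show ?thesis by auto
  qed
  show ?thesis using key[OF assms] key[OF assms(2,1,5,6,3,4)] by auto
qed

text \<open>Phrased through the distances \<open>i\<close> and \<open>k\<close> to the two ends, in
  steps of 2, so that the position of \<open>x\<close> in its cluster can be summed over.\<close>

lemma cluster_exists:
  assumes G: "proper G" and t: "0 \<le> t" and x: "odd x" "G (x, 1) < ennreal t"
  shows "\<exists>i k :: nat. \<forall>i' k' :: nat. cluster G (ennreal t) (x - 2 * int i') (x + 2 * int k') \<longleftrightarrow> i' = i \<and> k' = k"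
proof -
  obtain a0 b0 where 0: "odd a0" "odd b0" "a0 < x" "x < b0" "ennreal t < G (a0, 1)" "ennreal t < G (b0, 1)"
    by (rule proper_gap[OF G t, of x])
  obtain a b where ab: "odd a" "odd b" "a < x" "x < b" "\<not> G (a, 1) < ennreal t" "\<not> G (b, 1) < ennreal t"
    "\<And>k. odd k \<Longrightarrow> a < k \<Longrightarrow> k < b \<Longrightarrow> G (k, 1) < ennreal t"
    by (rule nearest_gap[of x "\<lambda>k. G (k, 1) < ennreal t" a0 b0]) (use 0 x in \<open>auto simp: not_less\<close>)
  define i where "i = nat ((x - a - 2) div 2)"
  define k where "k = nat ((b - x - 2) div 2)"
  have "a + 2 \<le> x" "x \<le> b - 2" using ab(1-4) x(1) by presburger+
  moreover have "even (x - a - 2)" "even (b - x - 2)" using ab(1,2) x(1) by auto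
  ultimately have ik: "x - 2 * int i = a + 2" "x + 2 * int k = b - 2" by (auto simp: i_def k_def)
  have C: "cluster G (ennreal t) (x - 2 * int i) (x + 2 * int k)"
    unfolding ik cluster_def using ab by (auto simp: not_less)
  show ?thesis
  proof (rule exI[of _ i], rule exI[of _ k], intro allI)
    fix i' k' :: nat
    show "cluster G (ennreal t) (x - 2 * int i') (x + 2 * int k') \<longleftrightarrow> i' = i \<and> k' = k"
    proof
      assume "cluster G (ennreal t) (x - 2 * int i') (x + 2 * int k')"
      from cluster_unique[OF this C, of x] show "i' = i \<and> k' = k" by auto
    qed (use C in simp)
  qed
qed

lemma suminf_single_ennreal: "(\<Sum>i. if i = (k::nat) then f i else 0) = (f k :: ennreal)"
  using sums_unique[OF sums_single[of k f]] by simp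

lemma cluster_decompose:
  assumes G: "proper G" and t: "0 \<le> t" and x: "odd x" and 0: "ennreal t \<le> G (x, 1) \<Longrightarrow> c = (0 :: ennreal)"
  shows "c = (\<Sum>i. \<Sum>k. if cluster G (ennreal t) (x - 2 * int i) (x + 2 * int k) then c else 0)"
proof (cases "G (x, 1) < ennreal t")
  case False
  then have c0: "c = 0" using 0 by auto
  show ?thesis unfolding c0 if_cancel by simp
next
  case True
  obtain i0 k0 :: nat where "\<forall>i k :: nat. cluster G (ennreal t) (x - 2 * int i) (x + 2 * int k) \<longleftrightarrow> i = i0 \<and> k = k0"
    using cluster_exists[OF G t x True] by blast
  then have c: "\<And>i k :: nat. cluster G (ennreal t) (x - 2 * int i) (x + 2 * int k) \<longleftrightarrow> i = i0 \<and> k = k0" by blast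
  have "(\<Sum>k. if cluster G (ennreal t) (x - 2 * int i) (x + 2 * int k) then c else 0) = (if i = i0 then c else 0)" for i
    unfolding c by (cases "i = i0") (simp_all add: suminf_single_ennreal)
  then show ?thesis by (simp add: suminf_single_ennreal)
qed

lemma suminf_swap_ennreal:
  fixes f :: "nat \<Rightarrow> nat \<Rightarrow> ennreal"
  shows "(\<Sum>i. \<Sum>j. f i j) = (\<Sum>j. \<Sum>i. f i j)"
proof -
  have "(\<Sum>i. \<Sum>j. f i j) = (\<Sum>i. \<integral>\<^sup>+j. f i j \<partial>count_space UNIV)" by (simp add: nn_integral_count_space_nat)
  also have "\<dots> = (\<integral>\<^sup>+j. (\<Sum>i. f i j) \<partial>count_space UNIV)" by (rule nn_integral_suminf[symmetric]) simp
  finally show ?thesis by (simp add: nn_integral_count_space_nat)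
qed

text \<open>Regroups by \<open>m = i + k\<close>: with \<open>i\<close> the position of
  \<open>x\<close> in its cluster, \<open>m\<close> is the length of the cluster.\<close>

lemma suminf_diagonal:
  fixes f :: "nat \<Rightarrow> nat \<Rightarrow> ennreal"
  shows "(\<Sum>i. \<Sum>k. f i (i + k)) = (\<Sum>m. \<Sum>i\<le>m. f i m)"
proof -
  have "(\<Sum>k. f i (i + k)) = (\<Sum>m. if i \<le> m then f i m else 0)" for i
  proof -
    have "(\<Sum>m. if i \<le> m then f i m else 0) =
      (\<Sum>k. if i \<le> k + i then f i (k + i) else 0) + (\<Sum>m<i. if i \<le> m then f i m else 0)"
      by (rule suminf_offset) simp
    moreover have "(\<Sum>m<i. if i \<le> m then f i m else 0) = 0" by (rule sum.neutral) auto
    ultimately show ?thesis by (simp add: add.commute)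
  qed
  then have "(\<Sum>i. \<Sum>k. f i (i + k)) = (\<Sum>i. \<Sum>m. if i \<le> m then f i m else 0)" by simp
  also have "\<dots> = (\<Sum>m. \<Sum>i. if i \<le> m then f i m else 0)" by (rule suminf_swap_ennreal)
  also have "\<dots> = (\<Sum>m. \<Sum>i\<le>m. f i m)"
  proof (rule suminf_cong)
    fix m
    have "(\<Sum>i. if i \<le> m then f i m else 0) = (\<Sum>i\<in>{..m}. if i \<le> m then f i m else 0)"
      by (rule suminf_finite) auto
    then show "(\<Sum>i. if i \<le> m then f i m else 0) = (\<Sum>i\<le>m. f i m)" by simp
  qed
  finally show ?thesis .
qed

definition translate :: "int \<Rightarrow> (int \<times> int \<Rightarrow> ennreal) \<Rightarrow> int \<times> int \<Rightarrow> ennreal" where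
  "translate d G z = G (fst z + d, snd z)"

lemma cluster_translate:
  assumes "even d"
  shows "cluster (translate d G) t a b \<longleftrightarrow> cluster G t (a + d) (b + d)"
proof -
  have "(\<forall>k. odd k \<longrightarrow> a \<le> k \<longrightarrow> k \<le> b \<longrightarrow> G (k + d, 1) < t) \<longleftrightarrow>
    (\<forall>k. odd k \<longrightarrow> a + d \<le> k \<longrightarrow> k \<le> b + d \<longrightarrow> G (k, 1) < t)"
  proof
    assume h: "\<forall>k. odd k \<longrightarrow> a \<le> k \<longrightarrow> k \<le> b \<longrightarrow> G (k + d, 1) < t"
    show "\<forall>k. odd k \<longrightarrow> a + d \<le> k \<longrightarrow> k \<le> b + d \<longrightarrow> G (k, 1) < t"
    proof (intro allI impI)
      fix k :: int assume "odd k" "a + d \<le> k" "k \<le> b + d"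
      then show "G (k, 1) < t" using h[rule_format, of "k - d"] assms by auto
    qed
  qed (use assms in auto)
  then show ?thesis using assms by (auto simp: cluster_def translate_def algebra_simps)
qed

text \<open>Split by the position of \<open>x\<close> in its cluster, and translate each case so
  that the cluster starts at \<open>x\<close>. What was the contribution of a single position
  becomes the total over a cluster, for which heights and swaps agree.\<close>

theorem mass_transport:
  fixes M :: "'a measure" and F :: "'a \<Rightarrow> int \<times> int \<Rightarrow> ennreal"
    and \<Phi> :: "int \<Rightarrow> (int \<times> int \<Rightarrow> ennreal) \<Rightarrow> ennreal"
  assumes F: "F \<in> borel_measurable M"
    and stat: "\<And>(i::nat) g. g \<in> borel_measurable borel \<Longrightarrow>
      (\<integral>\<^sup>+\<omega>. g (translate (2 * int i) (F \<omega>)) \<partial>M) = (\<integral>\<^sup>+\<omega>. g (F \<omega>) \<partial>M)"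
    and prp: "AE \<omega> in M. proper (F \<omega>)" and t: "0 \<le> t" and x: "odd x"
    and meas: "\<And>k. odd k \<Longrightarrow> \<Phi> k \<in> borel_measurable borel"
    and zero: "\<And>G k. proper G \<Longrightarrow> odd k \<Longrightarrow> ennreal t \<le> G (k, 1) \<Longrightarrow> \<Phi> k G = 0"
    and equiv: "\<And>G k i. proper G \<Longrightarrow> odd k \<Longrightarrow> \<Phi> k (translate (2 * int i) G) = \<Phi> (k + 2 * int i) G"
  shows "(\<integral>\<^sup>+\<omega>. \<Phi> x (F \<omega>) \<partial>M) =
    (\<Sum>m::nat. \<integral>\<^sup>+\<omega>. (if cluster (F \<omega>) (ennreal t) x (x + 2 * int m)
       then (\<Sum>k\<in>odd_interval x (x + 2 * int m). \<Phi> k (F \<omega>)) else 0) \<partial>M)"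
proof -
  let ?C = "\<lambda>G a b. cluster G (ennreal t) a b"
  have coord [measurable]: "(\<lambda>G :: int \<times> int \<Rightarrow> ennreal. G z) \<in> borel_measurable borel" for z
    by (rule borel_measurable_continuous_onI, rule continuous_on_product_coordinates)
  have cm [measurable]: "Measurable.pred borel (\<lambda>G. ?C G a b)" for a b
    unfolding cluster_def by measurable
  have gm: "(\<lambda>G. if ?C G a b then \<Phi> k G else 0) \<in> borel_measurable borel" if "odd k" for a b k
    using meas[OF that] by measurable
  have gF: "(\<lambda>\<omega>. if ?C (F \<omega>) a b then \<Phi> k (F \<omega>) else 0) \<in> borel_measurable M" if "odd k" for a b k
    by (rule measurable_compose[OF F gm[OF that]])
  have "(\<integral>\<^sup>+\<omega>. \<Phi> x (F \<omega>) \<partial>M) =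
    (\<integral>\<^sup>+\<omega>. (\<Sum>i. \<Sum>k. if ?C (F \<omega>) (x - 2 * int i) (x + 2 * int k) then \<Phi> x (F \<omega>) else 0) \<partial>M)"
  proof (rule nn_integral_cong_AE)
    show "AE \<omega> in M. \<Phi> x (F \<omega>) = (\<Sum>i. \<Sum>k. if ?C (F \<omega>) (x - 2 * int i) (x + 2 * int k) then \<Phi> x (F \<omega>) else 0)"
      using prp
    proof eventually_elim
      case (elim \<omega>)
      show ?case by (rule cluster_decompose[OF elim t x]) (rule zero[OF elim x])
    qed
  qed
  also have "\<dots> = (\<Sum>i. \<integral>\<^sup>+\<omega>. (\<Sum>k. if ?C (F \<omega>) (x - 2 * int i) (x + 2 * int k) then \<Phi> x (F \<omega>) else 0) \<partial>M)"
    by (rule nn_integral_suminf) (intro borel_measurable_suminf_order gF x)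
  also have "\<dots> = (\<Sum>i. \<Sum>k. \<integral>\<^sup>+\<omega>. (if ?C (F \<omega>) (x - 2 * int i) (x + 2 * int k) then \<Phi> x (F \<omega>) else 0) \<partial>M)"
    by (intro suminf_cong nn_integral_suminf gF x)
  also have "\<dots> = (\<Sum>i. \<Sum>k. \<integral>\<^sup>+\<omega>. (if ?C (F \<omega>) x (x + 2 * int (i + k)) then \<Phi> (x + 2 * int i) (F \<omega>) else 0) \<partial>M)"
  proof (intro suminf_cong)
    fix i k :: nat
    let ?g = "\<lambda>G. if ?C G (x - 2 * int i) (x + 2 * int k) then \<Phi> x G else 0"
    have "(\<integral>\<^sup>+\<omega>. ?g (F \<omega>) \<partial>M) = (\<integral>\<^sup>+\<omega>. ?g (translate (2 * int i) (F \<omega>)) \<partial>M)"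
      by (rule stat[OF gm[OF x], symmetric])
    also have "\<dots> = (\<integral>\<^sup>+\<omega>. (if ?C (F \<omega>) x (x + 2 * int (i + k)) then \<Phi> (x + 2 * int i) (F \<omega>) else 0) \<partial>M)"
    proof (rule nn_integral_cong_AE)
      show "AE \<omega> in M. ?g (translate (2 * int i) (F \<omega>)) = (if ?C (F \<omega>) x (x + 2 * int (i + k)) then \<Phi> (x + 2 * int i) (F \<omega>) else 0)"
        using prp
      proof eventually_elim
        case (elim \<omega>)
        have "?C (translate (2 * int i) (F \<omega>)) (x - 2 * int i) (x + 2 * int k) \<longleftrightarrow> ?C (F \<omega>) x (x + 2 * int (i + k))"
          by (subst cluster_translate) (simp_all add: algebra_simps)
        then show ?case using equiv[OF elim x, of i] by simp
      qed
    qed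
    finally show "(\<integral>\<^sup>+\<omega>. ?g (F \<omega>) \<partial>M) = (\<integral>\<^sup>+\<omega>. (if ?C (F \<omega>) x (x + 2 * int (i + k)) then \<Phi> (x + 2 * int i) (F \<omega>) else 0) \<partial>M)" .
  qed
  also have "\<dots> = (\<Sum>m. \<Sum>i\<le>m. \<integral>\<^sup>+\<omega>. (if ?C (F \<omega>) x (x + 2 * int m) then \<Phi> (x + 2 * int i) (F \<omega>) else 0) \<partial>M)"
    by (rule suminf_diagonal)
  also have "\<dots> = (\<Sum>m. \<integral>\<^sup>+\<omega>. (if ?C (F \<omega>) x (x + 2 * int m) then (\<Sum>k\<in>odd_interval x (x + 2 * int m). \<Phi> k (F \<omega>)) else 0) \<partial>M)"
  proof (rule suminf_cong)
    fix m :: nat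
    have bij: "odd_interval x (x + 2 * int m) = (\<lambda>i. x + 2 * int i) ` {..m}"
    proof (intro equalityI subsetI)
      fix k assume k: "k \<in> odd_interval x (x + 2 * int m)"
      then have "even (k - x)" "x \<le> k" "k \<le> x + 2 * int m" using x by auto
      then have "k = x + 2 * int (nat ((k - x) div 2))" "nat ((k - x) div 2) \<le> m" by auto
      then show "k \<in> (\<lambda>i. x + 2 * int i) ` {..m}" by blast
    qed (use x in auto)
    have "(\<Sum>i\<le>m. \<integral>\<^sup>+\<omega>. (if ?C (F \<omega>) x (x + 2 * int m) then \<Phi> (x + 2 * int i) (F \<omega>) else 0) \<partial>M) =
      (\<integral>\<^sup>+\<omega>. (\<Sum>i\<le>m. if ?C (F \<omega>) x (x + 2 * int m) then \<Phi> (x + 2 * int i) (F \<omega>) else 0) \<partial>M)"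
      by (rule nn_integral_sum[symmetric]) (rule gF, use x in simp)
    also have "\<dots> = (\<integral>\<^sup>+\<omega>. (if ?C (F \<omega>) x (x + 2 * int m) then (\<Sum>k\<in>odd_interval x (x + 2 * int m). \<Phi> k (F \<omega>)) else 0) \<partial>M)"
      unfolding bij by (intro nn_integral_cong) (simp add: sum.reindex inj_on_def)
    finally show "(\<Sum>i\<le>m. \<integral>\<^sup>+\<omega>. (if ?C (F \<omega>) x (x + 2 * int m) then \<Phi> (x + 2 * int i) (F \<omega>) else 0) \<partial>M) =
      (\<integral>\<^sup>+\<omega>. (if ?C (F \<omega>) x (x + 2 * int m) then (\<Sum>k\<in>odd_interval x (x + 2 * int m). \<Phi> k (F \<omega>)) else 0) \<partial>M)" .
  qed
  finally show ?thesis .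
qed

lemma HH_translate: "even d \<Longrightarrow> (fst z + d, snd z) \<in> HH \<longleftrightarrow> z \<in> HH"
  by (auto simp: HH_def split: prod.splits)

lemma base_translate:
  assumes "even d"
  shows "base (fst z + d, snd z) = (\<lambda>k. k + d) ` base z"
proof (intro equalityI subsetI)
  fix k assume "k \<in> base (fst z + d, snd z)"
  then have "k - d \<in> base z" using assms by (auto simp: base_def le_H_def)
  then show "k \<in> (\<lambda>k. k + d) ` base z" by (intro image_eqI[of _ _ "k - d"]) auto
qed (use assms in \<open>auto simp: base_def le_H_def\<close>)

text \<open>An even translation moves every window along with the function; the reverse inclusion is
  the same fact for \<open>- d\<close>.\<close>

lemma swap_times_translate_subset:
  assumes G: "ordered G" and d: "even d"
  shows "v \<in> swap_times G (x + d) \<Longrightarrow> v \<in> swap_times (translate d G) x"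
proof -
  assume "v \<in> swap_times G (x + d)"
  then obtain R L where RL: "finite R" "lower_set L" "separated R L G" "x + d \<in> R" "(x + d, v) \<in> sw (view R L G)"
    unfolding swap_times_def by blast
  let ?R = "(\<lambda>k. k - d) ` R"
  have inj: "inj (\<lambda>k :: int. k + d)" by (auto simp: inj_def)
  have R: "R = (\<lambda>k. k + d) ` ?R" by (auto simp: image_image)
  have sub: "base (fst z + d, snd z) \<subseteq> R \<longleftrightarrow> base z \<subseteq> ?R" for z
    unfolding base_translate[OF d] by (subst R) (rule inj_image_subset_iff[OF inj])
  have dis: "base (fst z + d, snd z) \<inter> R = {} \<longleftrightarrow> base z \<inter> ?R = {}" for z
    unfolding base_translate[OF d] by (subst R) (simp flip: image_Int[OF inj])
  have V: "view ?R L (translate d G) = (\<lambda>z. view R L G (fst z + d, snd z))"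
  proof
    fix z
    show "view ?R L (translate d G) z = view R L G (fst z + d, snd z)"
      unfolding view_def translate_def sub HH_translate[OF d] ..
  qed
  have "sw (\<lambda>z. id (view R L G (fst z + d, snd z))) = (\<lambda>(k, v). (k - d, id v)) ` sw (view R L G)"
    by (rule sw_shift_relabel[OF ordered_view[OF G RL(1,2)] d subset_UNIV UNIV_I]) auto
  then have "(x, v) \<in> sw (view ?R L (translate d G))" using RL(5) unfolding V by force
  moreover have "separated ?R L (translate d G)"
    unfolding separated_def
  proof (intro ballI impI)
    fix z assume z: "z \<in> HH" "translate d G z \<in> L"
    then have "(fst z + d, snd z) \<in> HH" "G (fst z + d, snd z) \<in> L" using HH_translate[OF d] by (auto simp: translate_def)
    then show "base z \<subseteq> ?R \<or> base z \<inter> ?R = {}" using RL(3) sub[of z] dis[of z] unfolding separated_def by blast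
  qed
  moreover have "x \<in> ?R" using RL(4) by force
  ultimately show "v \<in> swap_times (translate d G) x" unfolding swap_times_def using RL(1,2) finite_imageI by blast
qed

lemma ordered_translate:
  assumes "ordered G" "even d"
  shows "ordered (translate d G)"
  unfolding ordered_def
proof (intro conjI ballI impI)
  fix z w assume a: "z \<in> HH" "w \<in> HH" "le_H z w"
  then have "le_H (fst z + d, snd z) (fst w + d, snd w)" by (auto simp: le_H_def)
  then show "translate d G z \<le> translate d G w"
    unfolding translate_def using orderedD(1)[OF assms(1)] HH_translate[OF assms(2)] a by blast
next
  show "inj_on (translate d G) {z \<in> HH. translate d G z \<noteq> \<infinity>}"
  proof (rule inj_onI)
    fix z w assume a: "z \<in> {z \<in> HH. translate d G z \<noteq> \<infinity>}" "w \<in> {z \<in> HH. translate d G z \<noteq> \<infinity>}"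
      "translate d G z = translate d G w"
    then have "(fst z + d, snd z) = (fst w + d, snd w)"
      using inj_onD[OF orderedD(2)[OF assms(1)], of "(fst z + d, snd z)" "(fst w + d, snd w)"] HH_translate[OF assms(2)]
      by (auto simp: translate_def)
    then show "z = w" by (auto simp: prod_eq_iff)
  qed
qed

lemma swap_times_translate:
  assumes "ordered G" "even d"
  shows "swap_times (translate d G) x = swap_times G (x + d)"
proof (intro equalityI subsetI)
  fix v assume "v \<in> swap_times (translate d G) x"
  then have "v \<in> swap_times (translate d G) ((x + d) + - d)" by simp
  from swap_times_translate_subset[OF ordered_translate[OF assms] _ this]
  have "v \<in> swap_times (translate (- d) (translate d G)) (x + d)" using assms(2) by simp
  moreover have "translate (- d) (translate d G) = G" by (auto simp: translate_def)
  ultimately show "v \<in> swap_times G (x + d)" by simp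
qed (rule swap_times_translate_subset[OF assms])

lemma col_height_translate:
  assumes "even d"
  shows "col_height (translate d G) x t = col_height G (x + d) t"
proof -
  have "column (translate d G) x (ennreal t) = (\<lambda>z. (fst z - d, snd z)) ` column G (x + d) (ennreal t)"
  proof (intro equalityI subsetI)
    fix z assume z: "z \<in> column (translate d G) x (ennreal t)"
    then have "(fst z + d, snd z) \<in> column G (x + d) (ennreal t)"
      using HH_translate[OF assms] by (auto simp: column_def translate_def)
    then show "z \<in> (\<lambda>z. (fst z - d, snd z)) ` column G (x + d) (ennreal t)"
      by (intro image_eqI[of _ _ "(fst z + d, snd z)"]) auto
  next
    fix z assume "z \<in> (\<lambda>z. (fst z - d, snd z)) ` column G (x + d) (ennreal t)"
    then obtain w where w: "w \<in> column G (x + d) (ennreal t)" "z = (fst w - d, snd w)" by blast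
    then have "w = (fst z + d, snd z)" by simp
    then show "z \<in> column (translate d G) x (ennreal t)"
      using w(1) HH_translate[OF assms, of z] by (auto simp: column_def translate_def)
  qed
  moreover have "inj_on (\<lambda>z :: int \<times> int. (fst z - d, snd z)) A" for A by (auto simp: inj_on_def prod_eq_iff)
  ultimately have "finite (column (translate d G) x (ennreal t)) = finite (column G (x + d) (ennreal t))"
    "card (column (translate d G) x (ennreal t)) = card (column G (x + d) (ennreal t))"
    by (simp_all add: finite_image_iff card_image)
  then show ?thesis unfolding col_height_column
    by (cases "finite (column G (x + d) (ennreal t))") (simp_all add: emeasure_count_space)
qed

lemma borel_measurable_coord: "(\<lambda>G :: int \<times> int \<Rightarrow> ennreal. G z) \<in> borel_measurable borel"
  by (rule borel_measurable_continuous_onI, rule continuous_on_product_coordinates)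

lemma col_height_measurable: "(\<lambda>G. col_height G x t) \<in> borel_measurable borel"
proof -
  let ?f = "from_nat_into (UNIV :: (int \<times> int) set)"
  have bij: "bij_betw ?f UNIV UNIV" by (rule bij_betw_from_nat_into) (auto simp: infinite_UNIV_char_0 finite_prod)
  have "col_height G x t = (\<Sum>n. indicator {?f n \<in> HH \<and> fst (?f n) \<in> {x, x + 1} \<and> G (?f n) < ennreal t} True)" for G
  proof -
    have "col_height G x t = (\<integral>\<^sup>+z. indicator (column G x (ennreal t)) z \<partial>count_space UNIV)"
      unfolding col_height_column by simp
    also have "\<dots> = (\<integral>\<^sup>+n. indicator (column G x (ennreal t)) (?f n) \<partial>count_space UNIV)"
      by (rule nn_integral_bij_count_space[OF bij, symmetric])
    also have "\<dots> = (\<Sum>n. indicator (column G x (ennreal t)) (?f n))" by (rule nn_integral_count_space_nat)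
    finally show ?thesis by (simp add: column_def indicator_def)
  qed
  moreover have "(\<lambda>G. (\<Sum>n. indicator {?f n \<in> HH \<and> fst (?f n) \<in> {x, x + 1} \<and> G (?f n) < ennreal t} True) :: ennreal) \<in> borel_measurable borel"
    unfolding indicator_def using borel_measurable_coord[measurable] by measurable
  ultimately show ?thesis by simp
qed

text \<open>A sum of indicators of open sets, hence measurable and suited to the portmanteau
  inequality. It agrees with \<open>swaps\<close> for proper functions, odd \<open>x\<close> and
  \<open>t \<ge> 0\<close> (\<open>swap_count_eq\<close>).\<close>

definition swap_count :: "real \<Rightarrow> int \<Rightarrow> (int \<times> int \<Rightarrow> ennreal) \<Rightarrow> ennreal" where
  "swap_count t x G = (\<Sum>j. indicator (many_swaps x (ennreal t) (Suc j)) G)"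

lemma swap_count_measurable: "swap_count t x \<in> borel_measurable borel"
  unfolding swap_count_def
  by (intro borel_measurable_suminf_order borel_measurable_indicator borel_open open_many_swaps)

lemma suminf_indicator_le: "(\<Sum>j. of_bool (Suc j \<le> c)) = (of_nat c :: ennreal)"
proof -
  have "(\<Sum>j. of_bool (Suc j \<le> c)) = (\<Sum>j\<in>{..<c}. of_bool (Suc j \<le> c) :: ennreal)"
    by (rule suminf_finite) auto
  also have "\<dots> = (\<Sum>j\<in>{..<c}. 1)" by (rule sum.cong) auto
  finally show ?thesis by simp
qed

lemma swap_count_eq:
  assumes "proper G" "0 \<le> t" "odd x"
  shows "swap_count t x G = swaps G x t"
  unfolding swap_count_def swaps_eq_card(2)[OF assms(1,2)]
  using proper_many_swaps_iff[OF assms] by (simp add: indicator_def suminf_indicator_le del: of_nat_Suc)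

lemma proper_translate:
  assumes G: "proper G" and d: "even d"
  shows "proper (translate d G)"
proof -
  have fin: "\<forall>z\<in>HH. G z < \<infinity>" using G by (simp add: proper_def)
  have ord: "ordered (translate d G)" using ordered_translate[OF proper_ordered[OF G] d] .
  have "infinite {x. 0 < x \<and> (x, 1) \<in> HH \<and> ennreal t < translate d G (x, 1)}"
       "infinite {x. x < 0 \<and> (x, 1) \<in> HH \<and> ennreal t < translate d G (x, 1)}" if t: "0 \<le> t" for t
  proof -
    have up: "\<exists>b>y. (b, 1) \<in> HH \<and> ennreal t < translate d G (b, 1)"
      and down: "\<exists>a<y. (a, 1) \<in> HH \<and> ennreal t < translate d G (a, 1)" for y
    proof -
      obtain a b where ab: "odd a" "odd b" "a < y + d" "y + d < b" "ennreal t < G (a, 1)" "ennreal t < G (b, 1)"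
        by (rule proper_gap[OF G t])
      show "\<exists>b>y. (b, 1) \<in> HH \<and> ennreal t < translate d G (b, 1)"
        using ab d by (intro exI[of _ "b - d"]) (auto simp: translate_def HH_def)
      show "\<exists>a<y. (a, 1) \<in> HH \<and> ennreal t < translate d G (a, 1)"
        using ab d by (intro exI[of _ "a - d"]) (auto simp: translate_def HH_def)
    qed
    show "infinite {x. 0 < x \<and> (x, 1) \<in> HH \<and> ennreal t < translate d G (x, 1)}" (is "infinite ?A")
    proof
      assume f: "finite ?A"
      obtain b where "b > Max (insert 0 ?A)" "(b, 1) \<in> HH" "ennreal t < translate d G (b, 1)" using up by blast
      moreover from this have "b \<in> ?A" using Max_ge[of "insert 0 ?A" 0] f by auto
      ultimately show False using Max_ge[of "insert 0 ?A" b] f by auto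
    qed
    show "infinite {x. x < 0 \<and> (x, 1) \<in> HH \<and> ennreal t < translate d G (x, 1)}" (is "infinite ?A")
    proof
      assume f: "finite ?A"
      obtain b where "b < Min (insert 0 ?A)" "(b, 1) \<in> HH" "ennreal t < translate d G (b, 1)" using down by blast
      moreover from this have "b \<in> ?A" using Min_le[of "insert 0 ?A" 0] f by auto
      ultimately show False using Min_le[of "insert 0 ?A" b] f by auto
    qed
  qed
  moreover have "\<forall>z\<in>HH. translate d G z < \<infinity>"
    using fin HH_translate[OF d] by (auto simp: translate_def)
  moreover note orderedD[OF ord]
  ultimately show ?thesis unfolding proper_def swap_class_def by blast
qed

text \<open>Both quantities vanish off clusters, move along with even translations and have the same
  sum over every cluster, so \<open>mass_transport\<close> yields the same series for both. For
  measurability \<open>swap_count\<close> stands in for \<open>swaps\<close>.\<close>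

theorem expected_height_eq_swaps:
  fixes M :: "'a measure" and F :: "'a \<Rightarrow> int \<times> int \<Rightarrow> ennreal"
  assumes F: "F \<in> borel_measurable M"
    and stat: "\<And>(i::nat) g. g \<in> borel_measurable borel \<Longrightarrow>
      (\<integral>\<^sup>+\<omega>. g (translate (2 * int i) (F \<omega>)) \<partial>M) = (\<integral>\<^sup>+\<omega>. g (F \<omega>) \<partial>M)"
    and prp: "AE \<omega> in M. proper (F \<omega>)" and t: "0 \<le> t" and x: "odd x"
  shows "(\<integral>\<^sup>+\<omega>. col_height (F \<omega>) x t \<partial>M) = (\<integral>\<^sup>+\<omega>. swaps (F \<omega>) x t \<partial>M)"
proof -
  have h: "(\<integral>\<^sup>+\<omega>. col_height (F \<omega>) x t \<partial>M) =
    (\<Sum>m::nat. \<integral>\<^sup>+\<omega>. (if cluster (F \<omega>) (ennreal t) x (x + 2 * int m)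
       then (\<Sum>k\<in>odd_interval x (x + 2 * int m). col_height (F \<omega>) k t) else 0) \<partial>M)"
    by (rule mass_transport[where \<Phi> = "\<lambda>k G. col_height G k t", OF F stat prp t x col_height_measurable])
       (auto intro: outside_cluster(2) t simp: col_height_translate)
  have s: "(\<integral>\<^sup>+\<omega>. swap_count t x (F \<omega>) \<partial>M) =
    (\<Sum>m::nat. \<integral>\<^sup>+\<omega>. (if cluster (F \<omega>) (ennreal t) x (x + 2 * int m)
       then (\<Sum>k\<in>odd_interval x (x + 2 * int m). swap_count t k (F \<omega>)) else 0) \<partial>M)"
  proof (rule mass_transport[OF F stat prp t x swap_count_measurable])
    show "swap_count t k G = 0" if "proper G" "odd k" "ennreal t \<le> G (k, 1)" for G k
      using swap_count_eq[OF that(1) t that(2)] outside_cluster(1)[OF that(1) t that(2,3)] by simp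
    fix G :: "int \<times> int \<Rightarrow> ennreal" and k :: int and i :: nat
    assume G: "proper G" "odd k"
    have e: "even (2 * int i)" "odd (k + 2 * int i)" using G(2) by auto
    have "swap_count t k (translate (2 * int i) G) = swaps (translate (2 * int i) G) k t"
      by (rule swap_count_eq[OF proper_translate[OF G(1) e(1)] t G(2)])
    also have "\<dots> = swaps G (k + 2 * int i) t"
      unfolding swaps_eq_card(2)[OF proper_translate[OF G(1) e(1)] t] swaps_eq_card(2)[OF G(1) t]
        swap_times_translate[OF proper_ordered[OF G(1)] e(1)] ..
    also have "\<dots> = swap_count t (k + 2 * int i) G" by (rule swap_count_eq[OF G(1) t e(2), symmetric])
    finally show "swap_count t k (translate (2 * int i) G) = swap_count t (k + 2 * int i) G" .
  qed
  have "(\<integral>\<^sup>+\<omega>. col_height (F \<omega>) x t \<partial>M) = (\<integral>\<^sup>+\<omega>. swap_count t x (F \<omega>) \<partial>M)"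
    unfolding h s
  proof (intro suminf_cong nn_integral_cong_AE)
    fix m :: nat
    show "AE \<omega> in M. (if cluster (F \<omega>) (ennreal t) x (x + 2 * int m)
       then (\<Sum>k\<in>odd_interval x (x + 2 * int m). col_height (F \<omega>) k t) else 0) =
      (if cluster (F \<omega>) (ennreal t) x (x + 2 * int m)
       then (\<Sum>k\<in>odd_interval x (x + 2 * int m). swap_count t k (F \<omega>)) else 0)"
      using prp
    proof eventually_elim
      case (elim \<omega>)
      have "(\<Sum>k\<in>odd_interval x (x + 2 * int m). swap_count t k (F \<omega>)) = (\<Sum>k\<in>odd_interval x (x + 2 * int m). swaps (F \<omega>) k t)"
        by (rule sum.cong) (auto intro: swap_count_eq[OF elim t])
      then show ?case using cluster_sum[OF elim t, of x "x + 2 * int m"] by simp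
    qed
  qed
  also have "\<dots> = (\<integral>\<^sup>+\<omega>. swaps (F \<omega>) x t \<partial>M)"
  proof (rule nn_integral_cong_AE)
    show "AE \<omega> in M. swap_count t x (F \<omega>) = swaps (F \<omega>) x t"
      using prp by eventually_elim (rule swap_count_eq[OF _ t x])
  qed
  finally show ?thesis .
qed

section \<open>The hook probability of a point of the bottom row\<close>

lemma card_TT:
  assumes "odd (c + int n)"
  shows "real (card (TT c n)) = real n * (real n - 1) / 2"
proof -
  let ?D = "Sigma {..<n} (\<lambda>i. {..<n - Suc i})"
  have "TT c n = cell c n ` ?D"
  proof (intro equalityI subsetI)
    fix z assume "z \<in> TT c n"
    then obtain i j where "z = cell c n (i, j)" "i + j + 2 \<le> n" by (rule TT_cell[OF assms])
    then show "z \<in> cell c n ` ?D" by auto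
  next
    fix z assume "z \<in> cell c n ` ?D"
    then obtain i j where "z = cell c n (i, j)" "i < n" "j < n - Suc i" by auto
    then show "z \<in> TT c n" using cell_in_TT[OF assms, of i j] by simp
  qed
  then have "card (TT c n) = card ?D" by (simp add: card_image inj_on_subset[OF inj_cell])
  also have "\<dots> = (\<Sum>i<n. n - Suc i)" by simp
  also have "\<dots> = (\<Sum>i<n. i)" by (rule sum.nat_diff_reindex)
  finally have "real (card (TT c n)) = (\<Sum>i<n. real i)" by simp
  also have "\<dots> = real n * (real n - 1) / 2" by (induction n) (simp_all add: field_simps)
  finally show ?thesis .
qed

text \<open>In the full triangle both branches of a hook run down to the bottom row, one cell in
  each row below the head.\<close>

lemma card_hook_TT:
  assumes w: "w \<in> TT c n"
  shows "int (card (hook (TT c n) w)) = 2 * snd w - 1"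
proof -
  let ?f = "\<lambda>j. (fst w + j, snd w - \<bar>j\<bar>)"
  have wH: "1 \<le> snd w" "even (fst w + snd w)" "le_H w (c, int n - 1)"
    using w by (auto simp: TT_def HH_def)
  have inT: "?f j \<in> TT c n" if "\<bar>j\<bar> \<le> snd w - 1" for j
    using that wH by (auto simp: TT_def HH_def le_H_def abs_if)
  have "hook (TT c n) w = ?f ` {- (snd w - 1)..snd w - 1}"
  proof (intro equalityI subsetI)
    fix v assume "v \<in> hook (TT c n) w"
    then obtain k where k: "k \<ge> 0" "v = (fst w + k, snd w - k) \<or> v = (fst w - k, snd w - k)" "v \<in> TT c n"
      by (auto simp: hook_def)
    then have "1 \<le> snd v" by (auto simp: TT_def HH_def)
    then have "k \<le> snd w - 1" using k(2) by auto
    then show "v \<in> ?f ` {- (snd w - 1)..snd w - 1}"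
      using k(1,2) by (elim disjE) (auto intro: image_eqI[of _ _ k] image_eqI[of _ _ "- k"])
  next
    fix v assume "v \<in> ?f ` {- (snd w - 1)..snd w - 1}"
    then obtain j where j: "v = ?f j" "\<bar>j\<bar> \<le> snd w - 1" by auto
    then have "v \<in> TT c n" using inT by blast
    moreover have "\<exists>k\<ge>0. v = (fst w + k, snd w - k) \<or> v = (fst w - k, snd w - k)"
      using j(1) by (intro exI[of _ "\<bar>j\<bar>"]) (auto simp: abs_if)
    ultimately show "v \<in> hook (TT c n) w" by (auto simp: hook_def)
  qed
  moreover have "inj ?f" by (auto simp: inj_def)
  ultimately have "card (hook (TT c n) w) = card {- (snd w - 1)..snd w - 1}"
    by (simp add: card_image inj_on_subset)
  then show ?thesis using wH(1) by simp
qed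

definition odd_even_prod :: "nat \<Rightarrow> real" where
  "odd_even_prod a = (\<Prod>k=1..a. (2 * real k + 1) / (2 * real k))"

text \<open>\<open>a\<close> and \<open>b\<close> count the cells other than \<open>(x, 1)\<close>
  on the two diagonals rising from it. These cells form the reverse hook, and the one in row
  \<open>k + 1\<close> has hook length \<open>2 k + 1\<close>.\<close>

lemma hook_prob_bottom:
  fixes a b :: nat
  assumes odd: "odd (c + int n)" and x: "(x, 1) \<in> TT c n"
    and a: "2 * int a = c + int n - 2 - x" and b: "2 * int b = int n - 2 - c + x"
  shows "hook_prob (TT c n) (x, 1) = 2 / (real n * (real n - 1)) * (odd_even_prod a * odd_even_prod b)"
proof -
  let ?T = "TT c n"
  let ?r = "\<lambda>k. (x + int k, 1 + int k)" and ?l = "\<lambda>k. (x - int k, 1 + int k)"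
  have ox: "odd x" using x by (auto simp: TT_def HH_def)
  have rT: "?r k \<in> ?T \<longleftrightarrow> k \<le> a" for k using ox a b by (auto simp: TT_def HH_def le_H_def)
  have lT: "?l k \<in> ?T \<longleftrightarrow> k \<le> b" for k using ox a b by (auto simp: TT_def HH_def le_H_def)
  have R: "rev_hook ?T (x, 1) = ?r ` {1..a} \<union> ?l ` {1..b}"
  proof (intro equalityI subsetI)
    fix w assume "w \<in> rev_hook ?T (x, 1)"
    then obtain k where k: "w \<in> ?T" "w \<noteq> (x, 1)" "k \<ge> 0"
      "(x, 1) = (fst w + k, snd w - k) \<or> (x, 1) = (fst w - k, snd w - k)"
      by (auto simp: rev_hook_def hook_def)
    have "k \<noteq> 0" using k(2,4) by (auto simp: prod_eq_iff)
    then have kk: "nat k \<ge> 1" "int (nat k) = k" using k(3) by auto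
    from k(4) show "w \<in> ?r ` {1..a} \<union> ?l ` {1..b}"
    proof
      assume "(x, 1) = (fst w + k, snd w - k)"
      then have w: "w = ?l (nat k)" using kk by (auto simp: prod_eq_iff)
      then have "nat k \<in> {1..b}" using k(1) lT[of "nat k"] kk(1) by simp
      then show ?thesis using w by blast
    next
      assume "(x, 1) = (fst w - k, snd w - k)"
      then have w: "w = ?r (nat k)" using kk by (auto simp: prod_eq_iff)
      then have "nat k \<in> {1..a}" using k(1) rT[of "nat k"] kk(1) by simp
      then show ?thesis using w by blast
    qed
  next
    fix w assume "w \<in> ?r ` {1..a} \<union> ?l ` {1..b}"
    then obtain k where k: "1 \<le> k" "(w = ?r k \<and> k \<le> a) \<or> (w = ?l k \<and> k \<le> b)" by auto
    then have "w \<in> ?T - {(x, 1)}" using rT lT by auto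
    moreover have "(x, 1) \<in> hook ?T w"
      unfolding hook_def using x k(2) by (auto intro!: exI[of _ "int k"])
    ultimately show "w \<in> rev_hook ?T (x, 1)" by (simp add: rev_hook_def)
  qed
  let ?g = "\<lambda>w. real (card (hook ?T w)) / (real (card (hook ?T w)) - 1)"
  have g: "?g w = (2 * real k + 1) / (2 * real k)" if "w \<in> ?T" "snd w = 1 + int k" for w k
  proof -
    have "int (card (hook ?T w)) = int (2 * k + 1)" using card_hook_TT[OF that(1)] that(2) by simp
    then have "card (hook ?T w) = 2 * k + 1" by (simp only: of_nat_eq_iff)
    then show ?thesis by simp
  qed
  have "(\<Prod>w\<in>rev_hook ?T (x, 1). ?g w) = (\<Prod>w\<in>?r ` {1..a}. ?g w) * (\<Prod>w\<in>?l ` {1..b}. ?g w)"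
    unfolding R by (rule prod.union_disjoint) auto
  also have "(\<Prod>w\<in>?r ` {1..a}. ?g w) = odd_even_prod a"
    unfolding odd_even_prod_def by (subst prod.reindex) (auto simp: inj_on_def rT intro!: prod.cong g)
  also have "(\<Prod>w\<in>?l ` {1..b}. ?g w) = odd_even_prod b"
    unfolding odd_even_prod_def by (subst prod.reindex) (auto simp: inj_on_def lT intro!: prod.cong g)
  finally show ?thesis unfolding hook_prob_def card_TT[OF odd] by simp
qed

lemma odd_even_prod_pos: "odd_even_prod a > 0"
  unfolding odd_even_prod_def by (rule prod_pos) auto

lemma wallis_step:
  fixes k l m P :: real
  assumes "k \<noteq> 0" "l \<noteq> 0" "m \<noteq> 0" "P \<noteq> 0"
  shows "m / P\<^sup>2 * (4 * k\<^sup>2 / (m * l)) = l / (P * (l / (2 * k)))\<^sup>2"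
  using assms by (simp add: field_simps power2_eq_square)

text \<open>Links the partial Wallis products, with limit \<open>\<pi> / 2\<close>, to the hook
  products; the induction step uses
  \<open>4 * k\<^sup>2 - 1 = (2 * k - 1) * (2 * k + 1)\<close>.\<close>

lemma wallis_prod: "(\<Prod>k=1..a. (4 * real k ^ 2) / (4 * real k ^ 2 - 1)) = (2 * real a + 1) / (odd_even_prod a)\<^sup>2"
proof (induction a)
  case (Suc a)
  define k where "k = real (Suc a)"
  have k: "k \<ge> 1" "2 * real a + 1 = 2 * k - 1" "2 * real (Suc a) + 1 = 2 * k + 1" by (auto simp: k_def)
  have f: "4 * k\<^sup>2 - 1 = (2 * k - 1) * (2 * k + 1)" by (simp add: power2_eq_square algebra_simps)
  have P: "odd_even_prod (Suc a) = odd_even_prod a * ((2 * k + 1) / (2 * k))"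
    by (simp add: odd_even_prod_def k_def)
  have "(\<Prod>k=1..Suc a. (4 * real k ^ 2) / (4 * real k ^ 2 - 1)) =
    (2 * k - 1) / (odd_even_prod a)\<^sup>2 * (4 * k\<^sup>2 / ((2 * k - 1) * (2 * k + 1)))"
    using Suc k(2) f by (simp add: k_def)
  also have "\<dots> = (2 * k + 1) / (odd_even_prod a * ((2 * k + 1) / (2 * k)))\<^sup>2"
    by (rule wallis_step) (use k(1) odd_even_prod_pos[of a] in auto)
  finally show ?case using P k(3) by simp
qed (simp add: odd_even_prod_def)

lemma odd_even_prod_limit: "(\<lambda>a. odd_even_prod a / sqrt (2 * real a + 1)) \<longlonglongrightarrow> sqrt (2 / pi)"
proof -
  have "(\<lambda>a. inverse ((2 * real a + 1) / (odd_even_prod a)\<^sup>2)) \<longlonglongrightarrow> inverse (pi / 2)"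
    using wallis unfolding wallis_prod by (rule tendsto_inverse) simp
  then have "(\<lambda>a. sqrt ((odd_even_prod a)\<^sup>2 / (2 * real a + 1))) \<longlonglongrightarrow> sqrt (2 / pi)"
    by (intro tendsto_real_sqrt) simp
  moreover have "sqrt ((odd_even_prod a)\<^sup>2 / (2 * real a + 1)) = odd_even_prod a / sqrt (2 * real a + 1)" for a
    using odd_even_prod_pos[of a] by (simp add: real_sqrt_divide)
  ultimately show ?thesis by simp
qed

text \<open>Because \<open>c n / n\<close> tends to 0, the two diagonals have asymptotically equal
  lengths: \<open>2 a + 1\<close> and \<open>2 b + 1\<close> both behave like \<open>n\<close>,
  whatever \<open>x\<close> is.\<close>

theorem hook_prob_limit:
  fixes c :: "nat \<Rightarrow> int"
  assumes odd: "\<And>n. odd (c n + int n)" and c0: "(\<lambda>n. real_of_int (c n) / real n) \<longlonglongrightarrow> 0" and x: "odd x"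
  shows "eventually (\<lambda>n. (x, 1) \<in> TT (c n) n) sequentially"
    "(\<lambda>n. real n * hook_prob (TT (c n) n) (x, 1)) \<longlonglongrightarrow> 4 / pi"
proof -
  define a where "a n = nat ((c n + int n - 2 - x) div 2)" for n
  define b where "b n = nat ((int n - 2 - c n + x) div 2)" for n
  have small: "eventually (\<lambda>n. \<bar>c n\<bar> + \<bar>x\<bar> + 4 \<le> int n) sequentially"
  proof -
    have "eventually (\<lambda>n. dist (real_of_int (c n) / real n) 0 < 1 / 2) sequentially"
      using c0 by (rule tendstoD) simp
    moreover have "eventually (\<lambda>n. n \<ge> nat (2 * \<bar>x\<bar> + 8)) sequentially" by (rule eventually_ge_at_top)
    ultimately show ?thesis
    proof eventually_elim
      case (elim n)
      have n: "2 * \<bar>x\<bar> + 8 \<le> int n" using elim(2) by linarith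
      then have "real n > 0" by linarith
      then have "2 * \<bar>real_of_int (c n)\<bar> < real n" using elim(1) by (simp add: dist_real_def field_simps)
      then have "2 * \<bar>c n\<bar> < int n" by linarith
      then show ?case using n by linarith
    qed
  qed
  have ab: "eventually (\<lambda>n. (x, 1) \<in> TT (c n) n \<and> 2 * int (a n) = c n + int n - 2 - x \<and> 2 * int (b n) = int n - 2 - c n + x) sequentially"
    using small
  proof eventually_elim
    case (elim n)
    have "even (c n + int n - 2 - x)" "even (int n - 2 - c n + x)" using odd[of n] x by auto
    moreover have "c n + int n - 2 - x \<ge> 0" "int n - 2 - c n + x \<ge> 0" using elim by linarith+
    ultimately have "2 * int (a n) = c n + int n - 2 - x" "2 * int (b n) = int n - 2 - c n + x"
      by (auto simp: a_def b_def)
    moreover have "(x, 1) \<in> TT (c n) n" using elim x by (auto simp: TT_def HH_def le_H_def)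
    ultimately show ?case by blast
  qed
  then show "eventually (\<lambda>n. (x, 1) \<in> TT (c n) n) sequentially" by eventually_elim simp
  have xn: "(\<lambda>n. (real_of_int x + 1) / real n) \<longlonglongrightarrow> 0" "(\<lambda>n. (real_of_int x - 1) / real n) \<longlonglongrightarrow> 0"
    by (rule lim_const_over_n)+
  have A: "(\<lambda>n. (2 * real (a n) + 1) / real n) \<longlonglongrightarrow> 1"
  proof (rule Lim_transform_eventually)
    have "(\<lambda>n. real_of_int (c n) / real n + 1 - (real_of_int x + 1) / real n) \<longlonglongrightarrow> 0 + 1 - 0"
      by (intro tendsto_intros c0 xn)
    then show "(\<lambda>n. real_of_int (c n) / real n + 1 - (real_of_int x + 1) / real n) \<longlonglongrightarrow> 1" by simp
    show "eventually (\<lambda>n. real_of_int (c n) / real n + 1 - (real_of_int x + 1) / real n = (2 * real (a n) + 1) / real n) sequentially"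
      using ab eventually_gt_at_top[of 0]
    proof eventually_elim
      case (elim n)
      have "2 * real (a n) = real_of_int (c n) + real n - 2 - real_of_int x"
        using arg_cong[of _ _ real_of_int, OF conjunct1[OF conjunct2[OF elim(1)]]] by simp
      then have "2 * real (a n) + 1 = real_of_int (c n) + real n - (real_of_int x + 1)" by simp
      then show ?case using elim(2) by (simp only: add_divide_distrib diff_divide_distrib) simp
    qed
  qed
  have B: "(\<lambda>n. (2 * real (b n) + 1) / real n) \<longlonglongrightarrow> 1"
  proof (rule Lim_transform_eventually)
    have "(\<lambda>n. 1 - real_of_int (c n) / real n + (real_of_int x - 1) / real n) \<longlonglongrightarrow> 1 - 0 + 0"
      by (intro tendsto_intros c0 xn)
    then show "(\<lambda>n. 1 - real_of_int (c n) / real n + (real_of_int x - 1) / real n) \<longlonglongrightarrow> 1" by simp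
    show "eventually (\<lambda>n. 1 - real_of_int (c n) / real n + (real_of_int x - 1) / real n = (2 * real (b n) + 1) / real n) sequentially"
      using ab eventually_gt_at_top[of 0]
    proof eventually_elim
      case (elim n)
      have "2 * real (b n) = real n - 2 - real_of_int (c n) + real_of_int x"
        using arg_cong[of _ _ real_of_int, OF conjunct2[OF conjunct2[OF elim(1)]]] by simp
      then have "2 * real (b n) + 1 = real n - real_of_int (c n) + (real_of_int x - 1)" by simp
      then show ?case using elim(2) by (simp only: add_divide_distrib diff_divide_distrib) simp
    qed
  qed
  have top: "filterlim f at_top sequentially" if "(\<lambda>n. (2 * real (f n) + 1) / real n) \<longlonglongrightarrow> 1" for f :: "nat \<Rightarrow> nat"
  proof -
    have fl: "filterlim (\<lambda>n. (2 * real (f n) + 1) / real n * real n) at_top sequentially"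
      by (rule filterlim_tendsto_pos_mult_at_top[OF that _ filterlim_real_sequentially]) simp
    have ev: "eventually (\<lambda>n. (2 * real (f n) + 1) / real n * real n = 2 * real (f n) + 1) sequentially"
      using eventually_gt_at_top[of 0] by eventually_elim simp
    have "filterlim (\<lambda>n. 2 * real (f n) + 1) at_top sequentially"
      by (rule filterlim_cong[OF refl refl ev, THEN iffD1, OF fl])
    then have "eventually (\<lambda>n. 2 * real Z + 1 \<le> 2 * real (f n) + 1) sequentially" for Z
      unfolding filterlim_at_top by (rule spec)
    then show ?thesis unfolding filterlim_at_top by simp
  qed
  have PA: "(\<lambda>n. odd_even_prod (a n) / sqrt (2 * real (a n) + 1)) \<longlonglongrightarrow> sqrt (2 / pi)"
    by (rule filterlim_compose[OF odd_even_prod_limit top[OF A]])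
  have PB: "(\<lambda>n. odd_even_prod (b n) / sqrt (2 * real (b n) + 1)) \<longlonglongrightarrow> sqrt (2 / pi)"
    by (rule filterlim_compose[OF odd_even_prod_limit top[OF B]])
  have N: "(\<lambda>n. real n / (real n - 1)) \<longlonglongrightarrow> 1"
  proof (rule Lim_transform_eventually)
    have "(\<lambda>n. inverse (1 - 1 / real n)) \<longlonglongrightarrow> inverse (1 - 0)"
      by (intro tendsto_intros lim_const_over_n) simp
    then show "(\<lambda>n. inverse (1 - 1 / real n)) \<longlonglongrightarrow> 1" by simp
    show "eventually (\<lambda>n. inverse (1 - 1 / real n) = real n / (real n - 1)) sequentially"
      using eventually_gt_at_top[of 1] by eventually_elim (simp add: field_simps)
  qed
  show "(\<lambda>n. real n * hook_prob (TT (c n) n) (x, 1)) \<longlonglongrightarrow> 4 / pi"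
  proof (rule Lim_transform_eventually)
    \<comment> \<open>The product rearranged into factors with known limits; the square roots of
      \<open>2 a + 1\<close> and \<open>2 b + 1\<close> are inserted and cancelled again.\<close>
    let ?L = "\<lambda>n. 2 * (real n / (real n - 1)) * ((odd_even_prod (a n) / sqrt (2 * real (a n) + 1)) * (odd_even_prod (b n) / sqrt (2 * real (b n) + 1)))
      * (sqrt ((2 * real (a n) + 1) / real n) * sqrt ((2 * real (b n) + 1) / real n))"
    have "?L \<longlonglongrightarrow> 2 * 1 * (sqrt (2 / pi) * sqrt (2 / pi)) * (sqrt 1 * sqrt 1)"
      by (intro tendsto_mult tendsto_const N PA PB tendsto_real_sqrt A B)
    then show "?L \<longlonglongrightarrow> 4 / pi" by simp
    show "eventually (\<lambda>n. ?L n = real n * hook_prob (TT (c n) n) (x, 1)) sequentially"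
      using ab eventually_gt_at_top[of 1]
    proof eventually_elim
      case (elim n)
      have h: "hook_prob (TT (c n) n) (x, 1) = 2 / (real n * (real n - 1)) * (odd_even_prod (a n) * odd_even_prod (b n))"
        using elim(1) by (intro hook_prob_bottom odd) auto
      define u where "u = sqrt (2 * real (a n) + 1)"
      define v where "v = sqrt (2 * real (b n) + 1)"
      have uv: "u > 0" "v > 0" by (simp_all add: u_def v_def)
      have s: "sqrt ((2 * real (a n) + 1) / real n) * sqrt ((2 * real (b n) + 1) / real n) = u * v / real n"
        by (simp add: u_def v_def real_sqrt_divide)
      show ?case unfolding h s unfolding u_def[symmetric] v_def[symmetric] using uv elim(2) by (simp add: field_simps)
    qed
  qed
qed

lemma tendsto_div_n:
  fixes f :: "nat \<Rightarrow> real"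
  assumes "eventually (\<lambda>n. \<bar>f n - real n * y\<bar> \<le> C) sequentially"
  shows "(\<lambda>n. f n / real n) \<longlonglongrightarrow> y"
proof -
  have "(\<lambda>n. f n / real n - y) \<longlonglongrightarrow> 0"
  proof (rule Lim_null_comparison)
    show "(\<lambda>n. C / real n) \<longlonglongrightarrow> 0" by (rule lim_const_over_n)
    show "eventually (\<lambda>n. norm (f n / real n - y) \<le> C / real n) sequentially"
      using assms eventually_gt_at_top[of 0]
    proof eventually_elim
      case (elim n)
      have "norm (f n / real n - y) = \<bar>f n - real n * y\<bar> / real n"
        using elim(2) by (simp add: field_simps abs_divide flip: abs_mult)
      also have "\<dots> \<le> C / real n" using elim by (intro divide_right_mono) auto
      finally show ?case .
    qed
  qed
  then show ?thesis by (simp add: LIM_zero_iff)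
qed

text \<open>The steps \<open>j, \<dots>, j + m - 1\<close> of the speed \<open>n\<close> process lie in \<open>[s, u]\<close> with high
  probability; the slack \<open>d\<close> makes room for Chebyshev's inequality.\<close>

lemma window_bound_limit:
  fixes p :: "nat \<Rightarrow> real"
  assumes p: "(\<lambda>n. real n * p n) \<longlonglongrightarrow> q" and s: "0 \<le> s" and d: "0 < d" "s + 2 * d < u"
  obtains C where "C \<longlonglongrightarrow> exp (- (q * (u - s - 2 * d)))"
    "eventually (\<lambda>n. \<exists>j m. real (j + m) \<le> real n * (real n - 1) / 2 \<and> 0 < m \<and> s + d \<le> real (Suc j) / real n \<and>
       real (j + m) / real n \<le> u - d \<and>
       real (Suc j) / (real n * d)\<^sup>2 + real (j + m) / (real n * d)\<^sup>2 + exp (- (p n * real m)) \<le> C n) sequentially"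
proof -
  \<comment> \<open>Step \<open>i\<close> happens near time \<open>(i + 1) / n\<close>; the steps
    from \<open>j\<close> up to but excluding \<open>k\<close> therefore fall near the interval from
    \<open>s + d\<close> to \<open>u - d\<close>.\<close>
  define j where "j n = nat \<lceil>real n * (s + d)\<rceil>" for n
  define k where "k n = nat \<lfloor>real n * (u - d)\<rfloor>" for n
  have jb: "real n * (s + d) \<le> real (j n)" "real (j n) \<le> real n * (s + d) + 1" for n
  proof -
    have "0 \<le> real n * (s + d)" using s d by simp
    then have "real (j n) = of_int \<lceil>real n * (s + d)\<rceil>" unfolding j_def by (simp add: ceiling_mono order_trans)
    then show "real n * (s + d) \<le> real (j n)" "real (j n) \<le> real n * (s + d) + 1" by linarith+
  qed
  have kb: "real (k n) \<le> real n * (u - d)" "real n * (u - d) - 1 \<le> real (k n)" for n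
  proof -
    have "0 \<le> real n * (u - d)" using s d by simp
    then have "real (k n) = of_int \<lfloor>real n * (u - d)\<rfloor>" unfolding k_def by simp
    then show "real (k n) \<le> real n * (u - d)" "real n * (u - d) - 1 \<le> real (k n)" by linarith+
  qed
  have jl: "(\<lambda>n. real (j n) / real n) \<longlonglongrightarrow> s + d"
    by (rule tendsto_div_n[where C = 1], rule always_eventually, rule allI) (use jb in \<open>auto simp: abs_le_iff, smt\<close>)
  have kl: "(\<lambda>n. real (k n) / real n) \<longlonglongrightarrow> u - d"
    by (rule tendsto_div_n[where C = 1], rule always_eventually, rule allI) (use kb in \<open>auto simp: abs_le_iff, smt\<close>)
  have jk: "eventually (\<lambda>n. j n < k n) sequentially"
  proof -
    obtain n0 where n0: "real n0 * (u - s - 2 * d) > 2" using reals_Archimedean3[of "u - s - 2 * d"] d by auto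
    show ?thesis
      using eventually_ge_at_top[of n0]
    proof eventually_elim
      case (elim n)
      have "real n0 * (u - s - 2 * d) \<le> real n * (u - s - 2 * d)" using elim d by (intro mult_right_mono) auto
      then have "real n * (s + d) + 2 < real n * (u - d)" using n0 by (simp add: algebra_simps)
      then show ?case using jb(2)[of n] kb(2)[of n] by linarith
    qed
  qed
  define C where "C n = real (Suc (j n)) / (real n * d)\<^sup>2 + real (k n) / (real n * d)\<^sup>2 + exp (- (real n * p n * (real (k n) / real n - real (j n) / real n)))" for n
  have z: "(\<lambda>n. f n / real n * (1 / real n) / d\<^sup>2) \<longlonglongrightarrow> 0" if "(\<lambda>n. f n / real n) \<longlonglongrightarrow> y" for f :: "nat \<Rightarrow> real" and y
  proof -
    have "(\<lambda>n. f n / real n * (1 / real n) / d\<^sup>2) \<longlonglongrightarrow> y * 0 / d\<^sup>2"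
      by (intro tendsto_intros that lim_const_over_n) (use d in simp)
    then show ?thesis by simp
  qed
  have e: "f n / (real n * d)\<^sup>2 = f n / real n * (1 / real n) / d\<^sup>2" for f :: "nat \<Rightarrow> real" and n
    by (simp add: power2_eq_square)
  have sjl: "(\<lambda>n. real (Suc (j n)) / real n) \<longlonglongrightarrow> s + d"
    using tendsto_add[OF jl lim_const_over_n[of 1]] by (simp add: add_divide_distrib add.commute)
  have "C \<longlonglongrightarrow> 0 + 0 + exp (- (q * ((u - d) - (s + d))))"
    unfolding C_def e[of "\<lambda>n. real (Suc (j n))"] e[of "\<lambda>n. real (k n)"]
    by (intro tendsto_add z[OF sjl] z[OF kl] tendsto_exp tendsto_minus tendsto_mult p tendsto_diff jl kl)
  then have C: "C \<longlonglongrightarrow> exp (- (q * (u - s - 2 * d)))" by (simp add: algebra_simps)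
  \<comment> \<open>For large \<open>n\<close> the window ends before the triangle is full:
    \<open>n * (u - d)\<close> is at most the number \<open>n * (n - 1) / 2\<close> of its
    cells.\<close>
  have "eventually (\<lambda>n. real n * 2 \<ge> 2 * (2 * u + 2)) sequentially"
    using filterlim_real_sequentially unfolding filterlim_at_top by (auto elim!: allE[of _ "2 * u + 2"] eventually_mono)
  with jk eventually_gt_at_top[of 0]
  have "eventually (\<lambda>n. \<exists>j m. real (j + m) \<le> real n * (real n - 1) / 2 \<and> 0 < m \<and> s + d \<le> real (Suc j) / real n \<and>
       real (j + m) / real n \<le> u - d \<and>
       real (Suc j) / (real n * d)\<^sup>2 + real (j + m) / (real n * d)\<^sup>2 + exp (- (p n * real m)) \<le> C n) sequentially"
  proof eventually_elim
    case (elim n)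
    have jm: "j n + (k n - j n) = k n" using elim(1) by simp
    have n: "real n > 0" using elim(2) by simp
    show ?case
    proof (intro exI[of _ "j n"] exI[of _ "k n - j n"] conjI, unfold jm)
      have "real n * (u - d) \<le> real n * ((real n - 1) / 2)"
        by (rule mult_left_mono) (use elim(3) d in auto)
      then show "real (k n) \<le> real n * (real n - 1) / 2" using kb(1)[of n] by simp
      show "0 < k n - j n" using elim(1) by simp
      show "s + d \<le> real (Suc (j n)) / real n" using jb(1)[of n] n by (simp add: field_simps)
      show "real (k n) / real n \<le> u - d" using kb(1)[of n] n by (simp add: field_simps)
      have "real n * (real (k n) / real n - real (j n) / real n) = real (k n - j n)"
        using n elim(1) by (simp add: right_diff_distrib of_nat_diff)
      then have eq: "real n * p n * (real (k n) / real n - real (j n) / real n) = p n * real (k n - j n)"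
        by (metis mult.assoc mult.left_commute)
      show "real (Suc (j n)) / (real n * d)\<^sup>2 + real (k n) / (real n * d)\<^sup>2 + exp (- (p n * real (k n - j n))) \<le> C n"
        unfolding C_def eq by (rule order_refl)
    qed
  qed
  then show ?thesis using that C by blast
qed

section \<open>Convergence in distribution\<close>

definition squash :: "ennreal \<Rightarrow> real" where "squash v = enn2real (inverse (v + 1))"
definition unsquash :: "real \<Rightarrow> ennreal" where "unsquash r = inverse (ennreal r) - 1"

lemma inverse_plus_one:
  fixes v :: ennreal
  shows "inverse (v + 1) < \<top>" "inverse (inverse (v + 1)) = v + 1"
proof -
  have "inverse (v + 1) < \<top> \<and> inverse (inverse (v + 1)) = v + 1"
  proof (cases v)
    case (real r)
    have "v + 1 = ennreal (r + 1)" using real by simp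
    moreover have "0 < r + 1" "0 < inverse (r + 1)" using real by auto
    ultimately show ?thesis by (simp add: inverse_ennreal del: ennreal_plus)
  qed simp
  then show "inverse (v + 1) < \<top>" "inverse (inverse (v + 1)) = v + 1" by blast+
qed

lemma unsquash_squash: "unsquash (squash v) = v"
proof -
  have "ennreal (squash v) = inverse (v + 1)" unfolding squash_def using inverse_plus_one(1) by simp
  then show ?thesis by (simp add: unsquash_def inverse_plus_one(2))
qed

lemma unsquash_0: "unsquash 0 = \<infinity>" by (simp add: unsquash_def)

lemma continuous_squash: "continuous_on UNIV squash"
  unfolding continuous_on_def squash_def
proof
  fix v :: ennreal
  have "continuous_on UNIV (\<lambda>v :: ennreal. inverse (v + 1))"
    by (intro continuous_on_inverse_ennreal continuous_on_add_ennreal continuous_on_id continuous_on_const)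
  then have "((\<lambda>v. inverse (v + 1)) \<longlongrightarrow> inverse (v + 1)) (at v)" by (simp add: continuous_on_def)
  then have "((\<lambda>v. inverse (v + 1)) \<longlongrightarrow> ennreal (enn2real (inverse (v + 1)))) (at v)"
    using inverse_plus_one(1)[of v] by simp
  then show "((\<lambda>v. enn2real (inverse (v + 1))) \<longlongrightarrow> enn2real (inverse (v + 1))) (at v)"
    by (rule tendsto_enn2real) simp
qed

lemma continuous_unsquash: "continuous_on UNIV unsquash"
  unfolding continuous_on_def unsquash_def
proof
  fix r :: real
  have "continuous_on UNIV (\<lambda>r. inverse (ennreal r))"
    by (intro continuous_on_inverse_ennreal continuous_on_ennreal continuous_on_id)
  then have "((\<lambda>r. inverse (ennreal r)) \<longlongrightarrow> inverse (ennreal r)) (at r)" by (simp add: continuous_on_def)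
  then show "((\<lambda>r. inverse (ennreal r) - 1) \<longlongrightarrow> inverse (ennreal r) - 1) (at r)"
    by (intro tendsto_diff_ennreal_general tendsto_const) auto
qed

text \<open>Functions with values in \<open>[0,\<infinity>]\<close> carry no metric in the library; replacing a value \<open>v\<close> by
  \<open>1 / (1 + v)\<close> makes \<open>infdist\<close> available.\<close>

definition emb :: "(int \<times> int \<Rightarrow> ennreal) \<Rightarrow> int \<times> int \<Rightarrow> real" where
  "emb G z = (if z \<in> HH then squash (G z) else 0)"

text \<open>Values off the lattice carry no information; fixing them at infinity gives a
  representative that is measurable into the full product space.\<close>

definition extend :: "(int \<times> int \<Rightarrow> ennreal) \<Rightarrow> int \<times> int \<Rightarrow> ennreal" where
  "extend G z = (if z \<in> HH then G z else \<infinity>)"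

text \<open>Continuous functions that increase in \<open>m\<close> to the indicator of an open
  \<open>U\<close>. The full space is treated apart because \<open>infdist\<close> to the empty set
  is 0 by convention.\<close>

definition bump :: "nat \<Rightarrow> (int \<times> int \<Rightarrow> ennreal) set \<Rightarrow> (int \<times> int \<Rightarrow> real) \<Rightarrow> real" where
  "bump m U u = (let W = {u. (\<lambda>z. unsquash (u z)) \<in> U} in
     if W = UNIV then 1 else min 1 (real m * infdist u (- W)))"

lemma emb_ext: "(\<lambda>z. unsquash (emb G z)) = extend G"
  by (auto simp: emb_def extend_def unsquash_squash unsquash_0)

lemma continuous_unsquash_fun: "continuous_on UNIV (\<lambda>u :: int \<times> int \<Rightarrow> real. \<lambda>z. unsquash (u z))"
  by (intro continuous_on_coordinatewise_then_product continuous_on_compose2[OF continuous_unsquash]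
      continuous_on_product_coordinates) auto

lemma open_unsquash: "open U \<Longrightarrow> open {u :: int \<times> int \<Rightarrow> real. (\<lambda>z. unsquash (u z)) \<in> U}"
  using open_vimage[OF _ continuous_unsquash_fun] by (simp add: vimage_def)

lemma bump_bounds: "0 \<le> bump m U u" "bump m U u \<le> 1"
  by (auto simp: bump_def Let_def infdist_nonneg)

lemma continuous_bump: "continuous_on UNIV (bump m U)"
  unfolding bump_def Let_def
  by (cases "{u. (\<lambda>z. unsquash (u z)) \<in> U} = UNIV") (auto intro!: continuous_intros)

lemma bump_le_indicator: "bump m U (emb G) \<le> indicator U (extend G)"
proof (cases "extend G \<in> U")
  case True
  then show ?thesis using bump_bounds by simp
next
  case False
  let ?W = "{u. (\<lambda>z. unsquash (u z)) \<in> U}"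
  have "emb G \<in> - ?W" using False by (simp add: emb_ext)
  then have "?W \<noteq> UNIV" "infdist (emb G) (- ?W) = 0" by auto
  then show ?thesis using False by (simp add: bump_def Let_def)
qed

lemma bump_mono:
  assumes "m \<le> m'"
  shows "bump m U u \<le> bump m' U u"
proof -
  let ?W = "{u. (\<lambda>z. unsquash (u z)) \<in> U}"
  have "min 1 (real m * infdist u (- ?W)) \<le> min 1 (real m' * infdist u (- ?W))"
    using assms by (intro min.mono order_refl mult_right_mono infdist_nonneg) simp
  then show ?thesis unfolding bump_def Let_def by (cases "?W = UNIV") (simp_all only: if_True if_False order_refl HOL.simp_thms)
qed

lemma bump_limit:
  assumes "open U"
  shows "(\<lambda>m. bump m U (emb G)) \<longlonglongrightarrow> indicator U (extend G)"
proof (cases "extend G \<in> U")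
  case False
  have "bump m U (emb G) = 0" for m
    using bump_le_indicator[of m U G] bump_bounds(1)[of m U "emb G"] False by simp
  then show ?thesis using False by simp
next
  case True
  let ?W = "{u. (\<lambda>z. unsquash (u z)) \<in> U}"
  show ?thesis
  proof (cases "?W = UNIV")
    case True
    then show ?thesis using \<open>extend G \<in> U\<close> by (simp add: bump_def)
  next
    case False
    have cl: "closed (- ?W)" using open_unsquash[OF assms] by (simp only: closed_def double_complement)
    have "emb G \<notin> - ?W" using True by (simp add: emb_ext)
    moreover have "- ?W \<noteq> {}" using False by auto
    ultimately have pos: "infdist (emb G) (- ?W) > 0" by (intro infdist_pos_not_in_closed cl)
    obtain m0 where m0: "real m0 * infdist (emb G) (- ?W) > 1" using reals_Archimedean3[OF pos] by auto
    have "eventually (\<lambda>m. bump m U (emb G) = 1) sequentially"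
      using eventually_ge_at_top[of m0]
    proof eventually_elim
      case (elim m)
      have "real m0 * infdist (emb G) (- ?W) \<le> real m * infdist (emb G) (- ?W)"
        using elim pos by (intro mult_right_mono) auto
      then show ?case using m0 False by (simp add: bump_def Let_def)
    qed
    then show ?thesis using True by (simp add: tendsto_eventually)
  qed
qed

lemma nn_bump_SUP:
  assumes "open U"
  shows "(SUP m. ennreal (bump m U (emb G))) = indicator U (extend G)"
proof -
  have "incseq (\<lambda>m. ennreal (bump m U (emb G)))" by (auto simp: incseq_def intro!: ennreal_leI bump_mono)
  moreover have "(\<lambda>m. ennreal (bump m U (emb G))) \<longlonglongrightarrow> ennreal (indicator U (extend G))"
    by (intro tendsto_ennrealI bump_limit assms)
  ultimately show ?thesis
    using LIMSEQ_unique[OF LIMSEQ_SUP] by (simp add: ennreal_indicator)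
qed

lemma continuous_emb: "continuous_on UNIV emb"
proof (rule continuous_on_coordinatewise_then_product)
  fix z show "continuous_on UNIV (\<lambda>G. emb G z)"
    unfolding emb_def
    by (cases "z \<in> HH") (auto intro!: continuous_on_compose2[OF continuous_squash] continuous_on_product_coordinates)
qed

lemma continuous_translate: "continuous_on UNIV (translate d)"
  by (rule continuous_on_coordinatewise_then_product) (simp add: translate_def continuous_on_product_coordinates)

text \<open>An even translation maps the lattice to itself, so only coordinates in \<open>HH\<close>
  are read and the function qualifies as a test function for \<open>conv_in_distr\<close>.\<close>

lemma continuous_map_bump:
  assumes "even d"
  shows "continuous_map (product_topology (\<lambda>_. euclidean) HH) euclidean (\<lambda>g. bump m U (emb (translate d g)))"
proof -
  have "continuous_map (product_topology (\<lambda>_. euclidean) HH) (product_topology (\<lambda>_. euclidean) UNIV) (\<lambda>g. emb (translate d g))"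
    unfolding continuous_map_componentwise_UNIV
  proof
    fix z
    show "continuous_map (product_topology (\<lambda>_. euclidean) HH) euclideanreal (\<lambda>g. emb (translate d g) z)"
    proof (cases "z \<in> HH")
      case True
      then have "(fst z + d, snd z) \<in> HH" using HH_translate[OF assms] by simp
      then have "continuous_map (product_topology (\<lambda>_. euclidean) HH) euclidean (\<lambda>g. g (fst z + d, snd z) :: ennreal)"
        by (rule continuous_map_product_projection)
      moreover have "continuous_map euclidean euclidean squash" using continuous_squash by simp
      ultimately have "continuous_map (product_topology (\<lambda>_. euclidean) HH) euclidean (squash \<circ> (\<lambda>g. g (fst z + d, snd z)))"
        by (rule continuous_map_compose)
      then show ?thesis using True by (simp add: emb_def translate_def o_def)
    next
      case False
      then show ?thesis by (simp add: emb_def)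
    qed
  qed
  then have "continuous_map (product_topology (\<lambda>_. euclidean) HH) euclidean (\<lambda>g. emb (translate d g))"
    by (simp add: euclidean_product_topology)
  moreover have "continuous_map euclidean euclidean (bump m U)" using continuous_bump by simp
  ultimately have "continuous_map (product_topology (\<lambda>_. euclidean) HH) euclidean (bump m U \<circ> (\<lambda>g. emb (translate d g)))"
    by (rule continuous_map_compose)
  then show ?thesis by (simp add: o_def)
qed

lemma emb_translate_restrict: "even d \<Longrightarrow> emb (translate d (restrict G HH)) = emb (translate d G)"
  by (rule HOL.ext) (auto simp: emb_def translate_def HH_translate)

lemma conv_bump:
  assumes "conv_in_distr N J M F" "even d"
  shows "(\<lambda>n. \<integral>\<omega>. bump m U (emb (translate d (J n \<omega>))) \<partial>N n) \<longlonglongrightarrow> (\<integral>\<omega>. bump m U (emb (translate d (F \<omega>))) \<partial>M)"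
proof -
  have "bounded ((\<lambda>g. bump m U (emb (translate d g))) ` (HH \<rightarrow>\<^sub>E UNIV))"
    by (rule bounded_subset[of "{0..1}"]) (auto simp: bump_bounds)
  then have "(\<lambda>n. \<integral>\<omega>. bump m U (emb (translate d (restrict (J n \<omega>) HH))) \<partial>N n) \<longlonglongrightarrow>
    (\<integral>\<omega>. bump m U (emb (translate d (restrict (F \<omega>) HH))) \<partial>M)"
    using assms(1)[unfolded conv_in_distr_def] continuous_map_bump[OF assms(2)] by blast
  then show ?thesis by (simp add: emb_translate_restrict[OF assms(2)])
qed

lemma translate_0: "translate 0 G = G"
  by (auto simp: translate_def)

lemma ext_measurable:
  assumes "\<And>z. z \<in> HH \<Longrightarrow> (\<lambda>\<omega>. F \<omega> z) \<in> borel_measurable M"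
  shows "(\<lambda>\<omega>. extend (F \<omega>)) \<in> borel_measurable M"
proof (rule measurable_coordinatewise_then_product)
  fix z show "(\<lambda>\<omega>. extend (F \<omega>) z) \<in> borel_measurable M"
    using assms[of z] by (cases "z \<in> HH") (auto simp: extend_def)
qed

lemma emb_translate_of_ext: "even d \<Longrightarrow> emb (translate d (extend G)) = emb (translate d G)"
  by (rule HOL.ext) (auto simp: emb_def extend_def translate_def HH_translate)

lemma bump_measurable:
  assumes "\<And>z. z \<in> HH \<Longrightarrow> (\<lambda>\<omega>. F \<omega> z) \<in> borel_measurable M" "even d"
  shows "(\<lambda>\<omega>. bump m U (emb (translate d (F \<omega>)))) \<in> borel_measurable M"
proof -
  have "continuous_on UNIV (\<lambda>G. bump m U (emb (translate d G)))"
    by (rule continuous_on_compose2[OF continuous_bump continuous_on_compose2[OF continuous_emb continuous_translate]]) auto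
  then have "(\<lambda>G. bump m U (emb (translate d G))) \<in> borel_measurable borel" by (rule borel_measurable_continuous_onI)
  from measurable_compose[OF ext_measurable[OF assms(1)] this] show ?thesis
    by (simp add: emb_translate_of_ext[OF assms(2)])
qed

lemma ennreal_bump_integral:
  assumes "prob_space M" "\<And>z. z \<in> HH \<Longrightarrow> (\<lambda>\<omega>. F \<omega> z) \<in> borel_measurable M" "even d"
  shows "(\<integral>\<^sup>+\<omega>. ennreal (bump m U (emb (translate d (F \<omega>)))) \<partial>M) = ennreal (\<integral>\<omega>. bump m U (emb (translate d (F \<omega>))) \<partial>M)"
proof (rule nn_integral_eq_integral)
  interpret prob_space M by (rule assms(1))
  show "integrable M (\<lambda>\<omega>. bump m U (emb (translate d (F \<omega>))))"
    by (rule integrable_const_bound[where B = 1]) (use bump_bounds bump_measurable[OF assms(2,3)] in auto)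
qed (simp add: bump_bounds)

text \<open>The indicator of \<open>U\<close> is approximated from below by \<open>bump\<close>: for
  fixed \<open>m\<close> the expectations converge along \<open>n\<close>, and each is at most the
  probability of the open event.\<close>

theorem portmanteau_open:
  assumes conv: "conv_in_distr N J M F" and M: "prob_space M"
    and F: "\<And>z. z \<in> HH \<Longrightarrow> (\<lambda>\<omega>. F \<omega> z) \<in> borel_measurable M"
    and N: "eventually (\<lambda>n. prob_space (N n) \<and> (\<forall>z\<in>HH. (\<lambda>\<omega>. J n \<omega> z) \<in> borel_measurable (N n))) sequentially"
    and U: "open U"
  shows "emeasure M {\<omega> \<in> space M. extend (F \<omega>) \<in> U} \<le> liminf (\<lambda>n. emeasure (N n) {\<omega> \<in> space (N n). extend (J n \<omega>) \<in> U})"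
proof -
  have ev: "even (0 :: int)" by simp
  have mU: "{\<omega> \<in> space M. extend (F \<omega>) \<in> U} \<in> sets M"
    using measurable_sets[OF ext_measurable[OF F] borel_open[OF U]] by (simp add: vimage_def Int_def conj_commute)
  have "emeasure M {\<omega> \<in> space M. extend (F \<omega>) \<in> U} = (\<integral>\<^sup>+\<omega>. indicator U (extend (F \<omega>)) \<partial>M)"
  proof -
    have "(\<integral>\<^sup>+\<omega>. indicator U (extend (F \<omega>)) \<partial>M) = (\<integral>\<^sup>+\<omega>. indicator {\<omega> \<in> space M. extend (F \<omega>) \<in> U} \<omega> \<partial>M)"
      by (rule nn_integral_cong) (auto simp: indicator_def)
    then show ?thesis using mU by simp
  qed
  also have "\<dots> = (\<integral>\<^sup>+\<omega>. (SUP m. ennreal (bump m U (emb (translate 0 (F \<omega>))))) \<partial>M)"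
    by (simp add: nn_bump_SUP[OF U] translate_0)
  also have "\<dots> = (SUP m. \<integral>\<^sup>+\<omega>. ennreal (bump m U (emb (translate 0 (F \<omega>)))) \<partial>M)"
  proof (rule nn_integral_monotone_convergence_SUP)
    show "incseq (\<lambda>m \<omega>. ennreal (bump m U (emb (translate 0 (F \<omega>)))))"
      by (auto simp: incseq_def le_fun_def intro!: ennreal_leI bump_mono)
    show "(\<lambda>\<omega>. ennreal (bump m U (emb (translate 0 (F \<omega>))))) \<in> borel_measurable M" for m
      by (rule measurable_compose[OF bump_measurable[OF F ev] measurable_ennreal])
  qed
  also have "\<dots> \<le> liminf (\<lambda>n. emeasure (N n) {\<omega> \<in> space (N n). extend (J n \<omega>) \<in> U})"
  proof (rule SUP_least)
    fix m
    have "(\<lambda>n. ennreal (\<integral>\<omega>. bump m U (emb (translate 0 (J n \<omega>))) \<partial>N n)) \<longlonglongrightarrow> ennreal (\<integral>\<omega>. bump m U (emb (translate 0 (F \<omega>))) \<partial>M)"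
      by (intro tendsto_ennrealI conv_bump conv ev)
    from lim_imp_Liminf[OF sequentially_bot this]
    have "(\<integral>\<^sup>+\<omega>. ennreal (bump m U (emb (translate 0 (F \<omega>)))) \<partial>M) = liminf (\<lambda>n. ennreal (\<integral>\<omega>. bump m U (emb (translate 0 (J n \<omega>))) \<partial>N n))"
      using ennreal_bump_integral[OF M F ev, where m = m and U = U] by simp
    also have "\<dots> \<le> liminf (\<lambda>n. emeasure (N n) {\<omega> \<in> space (N n). extend (J n \<omega>) \<in> U})"
    proof (rule Liminf_mono)
      show "eventually (\<lambda>n. ennreal (\<integral>\<omega>. bump m U (emb (translate 0 (J n \<omega>))) \<partial>N n) \<le> emeasure (N n) {\<omega> \<in> space (N n). extend (J n \<omega>) \<in> U}) sequentially"
        using N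
      proof eventually_elim
        case (elim n)
        then have P: "prob_space (N n)" and J: "\<And>z. z \<in> HH \<Longrightarrow> (\<lambda>\<omega>. J n \<omega> z) \<in> borel_measurable (N n)" by auto
        have mJ: "{\<omega> \<in> space (N n). extend (J n \<omega>) \<in> U} \<in> sets (N n)"
          using measurable_sets[OF ext_measurable[OF J] borel_open[OF U]] by (simp add: vimage_def Int_def conj_commute)
        have "ennreal (\<integral>\<omega>. bump m U (emb (translate 0 (J n \<omega>))) \<partial>N n) = (\<integral>\<^sup>+\<omega>. ennreal (bump m U (emb (translate 0 (J n \<omega>)))) \<partial>N n)"
          by (rule ennreal_bump_integral[OF P J ev, symmetric])
        also have "\<dots> \<le> (\<integral>\<^sup>+\<omega>. indicator {\<omega> \<in> space (N n). extend (J n \<omega>) \<in> U} \<omega> \<partial>N n)"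
        proof (rule nn_integral_mono)
          fix \<omega> assume "\<omega> \<in> space (N n)"
          moreover have "ennreal (bump m U (emb (J n \<omega>))) \<le> ennreal (indicator U (extend (J n \<omega>)))"
            by (intro ennreal_leI bump_le_indicator)
          then have "ennreal (bump m U (emb (J n \<omega>))) \<le> indicator U (extend (J n \<omega>))" by (simp only: ennreal_indicator)
          ultimately show "ennreal (bump m U (emb (translate 0 (J n \<omega>)))) \<le> indicator {\<omega> \<in> space (N n). extend (J n \<omega>) \<in> U} \<omega>"
            by (simp only: translate_0 indicator_def mem_Collect_eq simp_thms)
        qed
        also have "\<dots> = emeasure (N n) {\<omega> \<in> space (N n). extend (J n \<omega>) \<in> U}" using mJ by simp
        finally show ?case .
      qed
    qed
    finally show "(\<integral>\<^sup>+\<omega>. ennreal (bump m U (emb (translate 0 (F \<omega>)))) \<partial>M) \<le> liminf (\<lambda>n. emeasure (N n) {\<omega> \<in> space (N n). extend (J n \<omega>) \<in> U})" .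
  qed
  finally show ?thesis .
qed

text \<open>The expectations of the bumps determine the measure of every open set, and the open sets
  form an intersection-stable generator of the Borel sets.\<close>

lemma law_eq_of_bump:
  assumes M: "prob_space M" and F: "\<And>z. z \<in> HH \<Longrightarrow> (\<lambda>\<omega>. F \<omega> z) \<in> borel_measurable M" and d: "even d"
    and eq: "\<And>m U. (\<integral>\<omega>. bump m U (emb (translate d (F \<omega>))) \<partial>M) = (\<integral>\<omega>. bump m U (emb (F \<omega>)) \<partial>M)"
    and g: "g \<in> borel_measurable borel"
  shows "(\<integral>\<^sup>+\<omega>. g (translate d (extend (F \<omega>))) \<partial>M) = (\<integral>\<^sup>+\<omega>. g (extend (F \<omega>)) \<partial>M)"
proof -
  have ev: "even (0 :: int)" by simp
  interpret prob_space M by (rule M)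
  note mF = ext_measurable[OF F]
  have mT: "(\<lambda>\<omega>. translate d (extend (F \<omega>))) \<in> borel_measurable M"
    by (rule measurable_compose[OF mF borel_measurable_continuous_onI[OF continuous_translate]])
  have extT: "extend (translate d (F \<omega>)) = translate d (extend (F \<omega>))" for \<omega>
    by (rule HOL.ext) (auto simp: extend_def translate_def HH_translate[OF d])
  have integ: "(\<integral>\<^sup>+\<omega>. indicator U (extend (translate d' (F \<omega>))) \<partial>M) = (SUP m. ennreal (\<integral>\<omega>. bump m U (emb (translate d' (F \<omega>))) \<partial>M))"
    if U: "open U" and d': "even d'" for U d'
  proof -
    have "(\<integral>\<^sup>+\<omega>. indicator U (extend (translate d' (F \<omega>))) \<partial>M) = (\<integral>\<^sup>+\<omega>. (SUP m. ennreal (bump m U (emb (translate d' (F \<omega>))))) \<partial>M)"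
      by (simp add: nn_bump_SUP[OF U])
    also have "\<dots> = (SUP m. \<integral>\<^sup>+\<omega>. ennreal (bump m U (emb (translate d' (F \<omega>)))) \<partial>M)"
    proof (rule nn_integral_monotone_convergence_SUP)
      show "incseq (\<lambda>m \<omega>. ennreal (bump m U (emb (translate d' (F \<omega>)))))"
        by (auto simp: incseq_def le_fun_def intro!: ennreal_leI bump_mono)
      show "(\<lambda>\<omega>. ennreal (bump m U (emb (translate d' (F \<omega>))))) \<in> borel_measurable M" for m
        by (rule measurable_compose[OF bump_measurable[OF F d'] measurable_ennreal])
    qed
    finally show ?thesis by (simp add: ennreal_bump_integral[OF M F d'])
  qed
  have "distr M borel (\<lambda>\<omega>. translate d (extend (F \<omega>))) = distr M borel (\<lambda>\<omega>. extend (F \<omega>))"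
  proof (rule measure_eqI_generator_eq[where E = "{S. open S}" and A = "\<lambda>_. UNIV" and \<Omega> = UNIV])
    show "Int_stable {S. open S}" by (auto simp: Int_stable_def)
    show "sets (distr M borel (\<lambda>\<omega>. translate d (extend (F \<omega>)))) = sigma_sets UNIV {S. open S}"
      "sets (distr M borel (\<lambda>\<omega>. extend (F \<omega>))) = sigma_sets UNIV {S. open S}"
      by (simp_all add: borel_def)
    show "emeasure (distr M borel (\<lambda>\<omega>. translate d (extend (F \<omega>)))) UNIV \<noteq> \<infinity>"
      using mT by (simp add: emeasure_distr)
    fix U :: "(int \<times> int \<Rightarrow> ennreal) set" assume "U \<in> {S. open S}"
    then have U: "open U" by simp
    have "emeasure (distr M borel (\<lambda>\<omega>. translate d (extend (F \<omega>)))) U = (\<integral>\<^sup>+\<omega>. indicator U (extend (translate d (F \<omega>))) \<partial>M)"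
      unfolding extT using U nn_integral_distr[OF mT, where f = "indicator U"] by simp
    also have "\<dots> = (\<integral>\<^sup>+\<omega>. indicator U (extend (translate 0 (F \<omega>))) \<partial>M)"
      using integ[OF U d] integ[OF U ev] by (simp add: translate_0 eq)
    also have "\<dots> = emeasure (distr M borel (\<lambda>\<omega>. extend (F \<omega>))) U"
      unfolding translate_0 using U nn_integral_distr[OF mF, where f = "indicator U"] by simp
    finally show "emeasure (distr M borel (\<lambda>\<omega>. translate d (extend (F \<omega>)))) U = emeasure (distr M borel (\<lambda>\<omega>. extend (F \<omega>))) U" .
  qed auto
  then show ?thesis using nn_integral_distr[OF mT, where f = g] nn_integral_distr[OF mF, where f = g] g by simp
qed

lemma stationary_power:
  assumes F: "F \<in> borel_measurable M"
    and st: "\<And>g. g \<in> borel_measurable borel \<Longrightarrow> (\<integral>\<^sup>+\<omega>. g (translate 2 (F \<omega>)) \<partial>M) = (\<integral>\<^sup>+\<omega>. g (F \<omega>) \<partial>M)"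
    and g: "g \<in> borel_measurable borel"
  shows "(\<integral>\<^sup>+\<omega>. g (translate (2 * int i) (F \<omega>)) \<partial>M) = (\<integral>\<^sup>+\<omega>. g (F \<omega>) \<partial>M)"
proof (induction i)
  case (Suc i)
  have m: "(\<lambda>G. g (translate (2 * int i) G)) \<in> borel_measurable borel"
    by (rule measurable_compose[OF borel_measurable_continuous_onI[OF continuous_translate] g])
  have "translate (2 * int (Suc i)) G = translate (2 * int i) (translate 2 G)" for G
    by (auto simp: translate_def algebra_simps)
  then have "(\<integral>\<^sup>+\<omega>. g (translate (2 * int (Suc i)) (F \<omega>)) \<partial>M) = (\<integral>\<^sup>+\<omega>. g (translate (2 * int i) (F \<omega>)) \<partial>M)"
    using st[OF m] by simp
  then show ?case using Suc by simp
qed (simp add: translate_0)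

section \<open>Invariance of the limit under translation by 2\<close>

definition shift_cell :: "int \<times> int \<Rightarrow> int \<times> int" where "shift_cell z = (fst z + 2, snd z)"

lemma inj_shift_cell: "inj shift_cell" by (auto simp: inj_def shift_cell_def prod_eq_iff)

lemma TT_shift: "TT (c + 2) n = shift_cell ` TT c n"
proof -
  have "z \<in> TT (c + 2) n \<longleftrightarrow> (fst z + - 2, snd z) \<in> TT c n" for z
    using HH_translate[of "- 2" z] by (auto simp: TT_def le_H_def)
  moreover have "(fst z + - 2, snd z) \<in> TT c n \<longleftrightarrow> z \<in> shift_cell ` TT c n" for z
    by (auto simp: shift_cell_def image_iff prod_eq_iff intro!: bexI[of _ "(fst z - 2, snd z)"])
  ultimately show ?thesis by blast
qed

lemma LE_shift: "LE (shift_cell ` B) = map shift_cell ` LE B"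
proof (intro equalityI subsetI)
  have le: "le_H (shift_cell w) (shift_cell z) \<longleftrightarrow> le_H w z" for w z by (auto simp: le_H_def shift_cell_def)
  {
    fix zs assume "zs \<in> LE (shift_cell ` B)"
    then have zs: "set zs = shift_cell ` B" "sorted_wrt (\<lambda>z w. \<not> le_H w z) zs" by (auto simp: LE_def)
    define ys where "ys = map (inv shift_cell) zs"
    have "shift_cell (inv shift_cell z) = z" if "z \<in> set zs" for z
      using that zs(1) by (auto simp: inj_shift_cell)
    then have m: "zs = map shift_cell ys" by (simp add: ys_def map_idI)
    have "set ys = B" using zs(1) inj_shift_cell by (simp add: ys_def image_image)
    moreover have "sorted_wrt (\<lambda>z w. \<not> le_H w z) ys" using zs(2) unfolding m sorted_wrt_map le .
    ultimately show "zs \<in> map shift_cell ` LE B" using m by (auto simp: LE_def)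
  next
    fix zs assume "zs \<in> map shift_cell ` LE B"
    then show "zs \<in> LE (shift_cell ` B)" by (auto simp: LE_def sorted_wrt_map le)
  }
qed

lemma translate_arrival_shift: "translate 2 (arrival (map shift_cell zs) s) = arrival zs s"
proof
  fix z
  have "shift_cell z \<in> shift_cell ` set zs \<longleftrightarrow> z \<in> set zs" using inj_shift_cell by (simp add: inj_image_mem_iff)
  moreover have "i < length (map shift_cell zs) \<and> map shift_cell zs ! i = shift_cell z \<longleftrightarrow> i < length zs \<and> zs ! i = z" for i
    using inj_shift_cell by (auto simp: inj_eq)
  ultimately show "translate 2 (arrival (map shift_cell zs) s) z = arrival zs s z"
    unfolding translate_def arrival_def shift_cell_def[symmetric] by simp
qed

text \<open>By \<open>inclusion_fun_law\<close> the law is computed from the linear extensions of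
  the triangle, and translation by 2 maps those of one triangle bijectively to those of the
  other.\<close>

lemma process_shift_law:
  assumes P: "staircase_process c n M r Y S X" and P': "staircase_process (c + 2) n M' r Y' S' X'"
    and f: "f \<in> borel_measurable borel"
  shows "(\<integral>\<^sup>+\<omega>. f (translate 2 (inclusion_fun X' \<omega>)) \<partial>M') = (\<integral>\<^sup>+\<omega>. f (inclusion_fun X \<omega>) \<partial>M)"
proof -
  have f2: "(\<lambda>G. f (translate 2 G)) \<in> borel_measurable borel"
    by (rule measurable_compose[OF borel_measurable_continuous_onI[OF continuous_translate] f])
  have cardT: "card (TT (c + 2) n) = card (TT c n)"
    unfolding TT_shift by (rule card_image) (rule inj_on_subset[OF inj_shift_cell subset_UNIV])
  have inj: "inj_on (map shift_cell) A" for A by (rule inj_on_subset[OF inj_mapI[OF inj_shift_cell] subset_UNIV])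
  have cardL: "card (LE (TT (c + 2) n)) = card (LE (TT c n))"
    unfolding TT_shift LE_shift by (rule card_image[OF inj])
  show ?thesis
    unfolding staircase_process.inclusion_fun_law[OF P' f2] staircase_process.inclusion_fun_law[OF P f] cardT cardL
    unfolding TT_shift LE_shift by (simp add: sum.reindex[OF inj] translate_arrival_shift)
qed

lemma proper_ext:
  assumes "G \<in> swap_class" "\<And>z. z \<in> HH \<Longrightarrow> G z < \<infinity>"
  shows "proper (extend G)"
proof -
  have e: "extend G z = G z" if "z \<in> HH" for z using that by (simp add: extend_def)
  have "\<forall>z\<in>HH. \<forall>w\<in>HH. extend G z \<noteq> \<infinity> \<longrightarrow> extend G w \<noteq> \<infinity> \<longrightarrow> le_H z w \<longrightarrow> extend G z \<le> extend G w"
    using assms(1) e by (auto simp: swap_class_def)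
  moreover have "inj_on (extend G) {z \<in> HH. extend G z \<noteq> \<infinity>}"
  proof (rule inj_onI)
    fix z w assume a: "z \<in> {z \<in> HH. extend G z \<noteq> \<infinity>}" "w \<in> {z \<in> HH. extend G z \<noteq> \<infinity>}" "extend G z = extend G w"
    have "inj_on G {z \<in> HH. G z \<noteq> \<infinity>}" using assms(1) unfolding swap_class_def by blast
    from inj_onD[OF this, of z w] show "z = w" using a e by auto
  qed
  moreover have "{x. 0 < x \<and> (x, 1) \<in> HH \<and> ennreal t < extend G (x, 1)} = {x. 0 < x \<and> (x, 1) \<in> HH \<and> ennreal t < G (x, 1)}"
    "{x. x < 0 \<and> (x, 1) \<in> HH \<and> ennreal t < extend G (x, 1)} = {x. x < 0 \<and> (x, 1) \<in> HH \<and> ennreal t < G (x, 1)}" for t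
    using e by auto
  moreover have "\<forall>t::real. 0 \<le> t \<longrightarrow> infinite {x. 0 < x \<and> (x, 1) \<in> HH \<and> ennreal t < G (x, 1)} \<and>
        infinite {x. x < 0 \<and> (x, 1) \<in> HH \<and> ennreal t < G (x, 1)}"
    using assms(1) unfolding swap_class_def by blast
  ultimately have "extend G \<in> swap_class" unfolding swap_class_def by simp
  then show ?thesis using assms(2) e by (auto simp: proper_def)
qed

lemma proper_self:
  assumes "G \<in> swap_class" "\<And>z. z \<in> HH \<Longrightarrow> G z < \<infinity>"
  shows "proper G"
  using assms by (simp add: proper_def)

lemma swap_times_ext: "swap_times (extend G) x = swap_times G x"
proof -
  have "view R L (extend G) = view R L G" for R L by (auto simp: view_def extend_def)
  moreover have "separated R L (extend G) = separated R L G" for R L by (auto simp: separated_def extend_def)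
  ultimately show ?thesis by (simp add: swap_times_def)
qed

lemma swaps_ext:
  assumes "G \<in> swap_class" "\<And>z. z \<in> HH \<Longrightarrow> G z < \<infinity>" "0 \<le> t"
  shows "swaps (extend G) x t = swaps G x t"
  using swaps_eq_card(2)[OF proper_ext[OF assms(1,2)] assms(3), of x]
    swaps_eq_card(2)[OF proper_self[OF assms(1,2)] assms(3), of x] by (simp only: swap_times_ext)

lemma col_height_ext: "col_height (extend G) x t = col_height G x t"
proof -
  have "column (extend G) x (ennreal t) = column G x (ennreal t)" by (auto simp: column_def extend_def)
  then show ?thesis by (simp add: col_height_column)
qed

section \<open>The expected number of swaps\<close>

context staircase_process
begin

lemma AE_inclusion_fun: "AE \<omega> in M. fin_tableau (inclusion_fun X \<omega>) \<and> extend (inclusion_fun X \<omega>) = inclusion_fun X \<omega>"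
  using AE_swaps
proof eventually_elim
  case (elim \<omega>)
  then have "fin_tableau (inclusion_fun X \<omega>)" "\<forall>z. z \<notin> T \<longrightarrow> inclusion_fun X \<omega> z = \<infinity>" by blast+
  moreover have "T \<subseteq> HH" by (auto simp: TT_def)
  ultimately show ?case by (auto simp: extend_def fun_eq_iff)
qed

text \<open>In a finite tableau membership in \<open>many_swaps\<close> forces as many true swaps
  (\<open>tableau_many_swaps\<close>), so \<open>swap_count\<close> lies below the count bounded by
  \<open>expected_swaps_le\<close>.\<close>

lemma expected_swap_count_le:
  assumes x: "(x, 1) \<in> T" and t: "0 \<le> t"
  shows "(\<integral>\<^sup>+\<omega>. swap_count t x (extend (inclusion_fun X \<omega>)) \<partial>M) \<le> ennreal (r * hook_prob T (x, 1) * t)"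
proof (rule expected_swaps_le[OF x t])
  show "AE \<omega> in M. swap_count t x (extend (inclusion_fun X \<omega>)) \<le>
      of_nat (card {v. (x, v) \<in> sw (inclusion_fun X \<omega>) \<and> v < ennreal t})"
    using AE_inclusion_fun
  proof eventually_elim
    case (elim \<omega>)
    let ?J = "inclusion_fun X \<omega>" and ?c = "card {v. (x, v) \<in> sw (inclusion_fun X \<omega>) \<and> v < ennreal t}"
    have "indicator (many_swaps x (ennreal t) (Suc j)) ?J \<le> (of_bool (Suc j \<le> ?c) :: ennreal)" for j
      using tableau_many_swaps[of ?J x "ennreal t" "Suc j"] elim by (simp add: indicator_def del: of_nat_Suc)
    then have "swap_count t x ?J \<le> (\<Sum>j. of_bool (Suc j \<le> ?c))"
      unfolding swap_count_def by (intro suminf_le) auto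
    then show ?case using elim by (simp only: suminf_indicator_le)
  qed
qed

text \<open>The estimate \<open>no_swap_prob_le\<close> with \<open>1 - p \<le> exp (- p)\<close>
  inserted, since the limit is taken in \<open>p * m\<close>.\<close>

lemma no_swap_event_le:
  assumes x: "(x, 1) \<in> T" and jm: "j + m \<le> card T" "0 < m" and d: "0 < d"
    and lo: "s + d \<le> real (Suc j) / r" and hi: "real (j + m) / r \<le> u - d"
  shows "emeasure M {\<omega> \<in> space M. extend (inclusion_fun X \<omega>) \<in> no_swap x (ennreal s) (ennreal u)} \<le>
    ennreal (real (Suc j) / (r * d)\<^sup>2 + real (j + m) / (r * d)\<^sup>2 + exp (- (hook_prob T (x, 1) * real m)))"
proof -
  let ?p = "hook_prob T (x, 1)"
  let ?B = "{\<omega> \<in> space M. extend (inclusion_fun X \<omega>) \<in> no_swap x (ennreal s) (ennreal u)}"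
  have B: "?B \<in> sets M"
    using measurable_sets[OF ext_measurable[OF inclusion_fun_measurable] borel_open[OF open_no_swap]]
    by (simp add: vimage_def Int_def conj_commute)
  have none: "AE \<omega> in M. \<omega> \<in> ?B \<longrightarrow> (\<forall>v. (x, v) \<in> sw (inclusion_fun X \<omega>) \<longrightarrow> \<not> (ennreal s \<le> v \<and> v \<le> ennreal u))"
    using AE_inclusion_fun
  proof eventually_elim
    case (elim \<omega>)
    then show ?case using tableau_no_swap[of "inclusion_fun X \<omega>" x "ennreal s" "ennreal u"] by auto
  qed
  have "prob ?B \<le> real (Suc j) / (r * d)\<^sup>2 + real (j + m) / (r * d)\<^sup>2 + (1 - ?p) ^ m"
    by (rule no_swap_prob_le[OF x B none jm d lo hi])
  moreover have "(1 - ?p) ^ m \<le> exp (- (?p * real m))"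
  proof -
    have "0 \<le> 1 - ?p" using hook_prob_bounds[OF odd up_closed_TT corner_TT[OF x]] by simp
    then have "(1 - ?p) ^ m \<le> exp (- ?p) ^ m"
      by (intro power_mono) (use exp_ge_add_one_self[of "- ?p"] in simp_all)
    also have "\<dots> = exp (- (?p * real m))" by (simp add: exp_of_nat_mult[symmetric] mult.commute)
    finally show ?thesis .
  qed
  ultimately show ?thesis unfolding emeasure_eq_measure by (intro ennreal_leI) linarith
qed

end

text \<open>The second sequence is in law the first one translated by 2, yet both converge to
  \<open>F\<close>; so \<open>F\<close> has the law of its own translate.\<close>

lemma stationary_limit:
  assumes M: "prob_space M" and F: "\<And>z. z \<in> HH \<Longrightarrow> (\<lambda>\<omega>. F \<omega> z) \<in> borel_measurable M"
    and conv: "conv_in_distr N (\<lambda>n. inclusion_fun (X n)) M F" "conv_in_distr N' (\<lambda>n. inclusion_fun (X' n)) M F"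
    and P: "eventually (\<lambda>n. \<exists>Y S. staircase_process (c n) n (N n) (r n) Y S (X n)) sequentially"
    and P': "eventually (\<lambda>n. \<exists>Y S. staircase_process (c n + 2) n (N' n) (r n) Y S (X' n)) sequentially"
    and g: "g \<in> borel_measurable borel"
  shows "(\<integral>\<^sup>+\<omega>. g (translate 2 (extend (F \<omega>))) \<partial>M) = (\<integral>\<^sup>+\<omega>. g (extend (F \<omega>)) \<partial>M)"
proof (rule law_eq_of_bump[OF M F _ _ g, where d = 2])
  have ev: "even (0 :: int)" "even (2 :: int)" by simp_all
  fix m :: nat and U :: "(int \<times> int \<Rightarrow> ennreal) set"
  let ?f = "\<lambda>G. bump m U (emb G)"
  have "eventually (\<lambda>n. (\<integral>\<omega>. ?f (translate 2 (inclusion_fun (X' n) \<omega>)) \<partial>N' n) =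
    (\<integral>\<omega>. ?f (translate 0 (inclusion_fun (X n) \<omega>)) \<partial>N n)) sequentially"
    using P P'
  proof eventually_elim
    case (elim n)
    obtain Y S where Q: "staircase_process (c n) n (N n) (r n) Y S (X n)" using elim(1) by blast
    obtain Y' S' where Q': "staircase_process (c n + 2) n (N' n) (r n) Y' S' (X' n)" using elim(2) by blast
    have "continuous_on UNIV ?f" by (rule continuous_on_compose2[OF continuous_bump continuous_emb]) simp
    then have "?f \<in> borel_measurable borel" by (rule borel_measurable_continuous_onI)
    then have "(\<lambda>G. ennreal (?f G)) \<in> borel_measurable borel" by (rule measurable_compose[OF _ measurable_ennreal])
    from process_shift_law[OF Q Q' this]
    have "ennreal (\<integral>\<omega>. ?f (translate 2 (inclusion_fun (X' n) \<omega>)) \<partial>N' n) = ennreal (\<integral>\<omega>. ?f (translate 0 (inclusion_fun (X n) \<omega>)) \<partial>N n)"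
      using ennreal_bump_integral[OF staircase_process.pM[OF Q] staircase_process.inclusion_fun_measurable[OF Q] ev(1), where m = m and U = U]
        ennreal_bump_integral[OF staircase_process.pM[OF Q'] staircase_process.inclusion_fun_measurable[OF Q'] ev(2), where m = m and U = U]
      by (simp add: translate_0)
    moreover have "0 \<le> (\<integral>\<omega>. ?f (translate 2 (inclusion_fun (X' n) \<omega>)) \<partial>N' n)" "0 \<le> (\<integral>\<omega>. ?f (translate 0 (inclusion_fun (X n) \<omega>)) \<partial>N n)"
      by (simp_all add: bump_bounds)
    ultimately show ?case by simp
  qed
  from Lim_transform_eventually[OF conv_bump[OF conv(2) ev(2)] this]
  have "(\<lambda>n. \<integral>\<omega>. ?f (translate 0 (inclusion_fun (X n) \<omega>)) \<partial>N n) \<longlonglongrightarrow> (\<integral>\<omega>. ?f (translate 2 (F \<omega>)) \<partial>M)" .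
  from LIMSEQ_unique[OF this conv_bump[OF conv(1) ev(1)]]
  show "(\<integral>\<omega>. ?f (translate 2 (F \<omega>)) \<partial>M) = (\<integral>\<omega>. ?f (F \<omega>) \<partial>M)" by (simp add: translate_0)
next
  show "even (2 :: int)" by simp
qed

locale staircase_limit =
  fixes M :: "'a measure" and F :: "'a \<Rightarrow> int \<times> int \<Rightarrow> ennreal" and N :: "nat \<Rightarrow> 'b measure"
    and X :: "nat \<Rightarrow> real \<Rightarrow> 'b \<Rightarrow> (int \<times> int) set" and c :: "nat \<Rightarrow> int" and x :: int
  assumes M: "prob_space M" and F: "\<And>z. z \<in> HH \<Longrightarrow> (\<lambda>\<omega>. F \<omega> z) \<in> borel_measurable M"
    and conv: "conv_in_distr N (\<lambda>n. inclusion_fun (X n)) M F"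
    and P: "\<And>n. 2 \<le> n \<Longrightarrow> \<exists>Y S. staircase_process (c n) n (N n) (real n) Y S (X n)"
    and odd: "\<And>n. odd (c n + int n)" and c0: "(\<lambda>n. real_of_int (c n) / real n) \<longlonglongrightarrow> 0" and x: "odd x"
    and prp: "AE \<omega> in M. proper (extend (F \<omega>))"
begin

sublocale prob_space M by (rule M)

lemma portmanteau:
  assumes "open U"
  shows "emeasure M {\<omega> \<in> space M. extend (F \<omega>) \<in> U} \<le>
    liminf (\<lambda>n. emeasure (N n) {\<omega> \<in> space (N n). extend (inclusion_fun (X n) \<omega>) \<in> U})"
proof (rule portmanteau_open[OF conv M F _ assms])
  show "eventually (\<lambda>n. prob_space (N n) \<and> (\<forall>z\<in>HH. (\<lambda>\<omega>. inclusion_fun (X n) \<omega> z) \<in> borel_measurable (N n))) sequentially"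
    using eventually_ge_at_top[of 2]
  proof eventually_elim
    case (elim n)
    obtain Y S where Q: "staircase_process (c n) n (N n) (real n) Y S (X n)" using P[OF elim] by blast
    show ?case using staircase_process.pM[OF Q] staircase_process.inclusion_fun_measurable[OF Q] by blast
  qed
qed

lemma event_sets: "open U \<Longrightarrow> {\<omega> \<in> space M. extend (F \<omega>) \<in> U} \<in> events"
  using measurable_sets[OF ext_measurable[OF F] borel_open] by (simp add: vimage_def Int_def conj_commute)

text \<open>The count is expanded into a series of probabilities of open events. The portmanteau
  inequality applies term by term, and Fatou's lemma, for counting measure on \<open>j\<close>,
  takes the liminf out of the series.\<close>

lemma expected_swaps_upper:
  assumes t: "0 \<le> t"
  shows "(\<integral>\<^sup>+\<omega>. swaps (extend (F \<omega>)) x t \<partial>M) \<le> ennreal (4 / pi * t)"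
proof -
  let ?U = "\<lambda>j. many_swaps x (ennreal t) (Suc j)"
  let ?e = "\<lambda>n j. emeasure (N n) {\<omega> \<in> space (N n). extend (inclusion_fun (X n) \<omega>) \<in> ?U j}"
  have expand: "(\<integral>\<^sup>+\<omega>. swap_count t x (extend (G \<omega>)) \<partial>L) = (\<Sum>j. emeasure L {\<omega> \<in> space L. extend (G \<omega>) \<in> ?U j})"
    if G: "\<And>z. z \<in> HH \<Longrightarrow> (\<lambda>\<omega>. G \<omega> z) \<in> borel_measurable L" for L :: "'c measure" and G
  proof -
    have meas: "{\<omega> \<in> space L. extend (G \<omega>) \<in> ?U j} \<in> sets L" for j
      using measurable_sets[OF ext_measurable[OF G] borel_open[OF open_many_swaps]] by (simp add: vimage_def Int_def conj_commute)
    have "(\<integral>\<^sup>+\<omega>. swap_count t x (extend (G \<omega>)) \<partial>L) = (\<integral>\<^sup>+\<omega>. (\<Sum>j. indicator {\<omega> \<in> space L. extend (G \<omega>) \<in> ?U j} \<omega>) \<partial>L)"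
      unfolding swap_count_def by (intro nn_integral_cong suminf_cong) (simp add: indicator_def)
    also have "\<dots> = (\<Sum>j. \<integral>\<^sup>+\<omega>. indicator {\<omega> \<in> space L. extend (G \<omega>) \<in> ?U j} \<omega> \<partial>L)"
      by (rule nn_integral_suminf) (use meas in simp)
    finally show ?thesis using meas by simp
  qed
  have lim: "(\<lambda>n. ennreal (real n * hook_prob (TT (c n) n) (x, 1) * t)) \<longlonglongrightarrow> ennreal (4 / pi * t)"
    by (intro tendsto_ennrealI tendsto_mult hook_prob_limit(2)[OF odd c0 x] tendsto_const)
  have "(\<integral>\<^sup>+\<omega>. swaps (extend (F \<omega>)) x t \<partial>M) = (\<integral>\<^sup>+\<omega>. swap_count t x (extend (F \<omega>)) \<partial>M)"
    by (rule nn_integral_cong_AE) (use prp swap_count_eq[OF _ t x] in \<open>auto elim!: eventually_mono\<close>)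
  also have "\<dots> = (\<Sum>j. emeasure M {\<omega> \<in> space M. extend (F \<omega>) \<in> ?U j})" by (rule expand) (rule F)
  also have "\<dots> \<le> (\<Sum>j. liminf (\<lambda>n. ?e n j))"
    by (intro suminf_le portmanteau open_many_swaps) auto
  also have "\<dots> = (\<integral>\<^sup>+j. liminf (\<lambda>n. ?e n j) \<partial>count_space UNIV)" by (rule nn_integral_count_space_nat[symmetric])
  also have "\<dots> \<le> liminf (\<lambda>n. \<integral>\<^sup>+j. ?e n j \<partial>count_space UNIV)" by (rule nn_integral_liminf) simp
  also have "\<dots> \<le> liminf (\<lambda>n. ennreal (real n * hook_prob (TT (c n) n) (x, 1) * t))"
  proof (rule Liminf_mono)
    show "eventually (\<lambda>n. (\<integral>\<^sup>+j. ?e n j \<partial>count_space UNIV) \<le> ennreal (real n * hook_prob (TT (c n) n) (x, 1) * t)) sequentially"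
      using eventually_ge_at_top[of 2] hook_prob_limit(1)[OF odd c0 x]
    proof eventually_elim
      case (elim n)
      obtain Y S where Q: "staircase_process (c n) n (N n) (real n) Y S (X n)" using P[OF elim(1)] by blast
      have "(\<integral>\<^sup>+j. ?e n j \<partial>count_space UNIV) = (\<Sum>j. ?e n j)" by (rule nn_integral_count_space_nat)
      also have "\<dots> = (\<integral>\<^sup>+\<omega>. swap_count t x (extend (inclusion_fun (X n) \<omega>)) \<partial>N n)"
        by (rule expand[symmetric]) (rule staircase_process.inclusion_fun_measurable[OF Q])
      also have "\<dots> \<le> ennreal (real n * hook_prob (TT (c n) n) (x, 1) * t)"
        by (rule staircase_process.expected_swap_count_le[OF Q elim(2) t])
      finally show ?case .
    qed
  qed
  also have "\<dots> = ennreal (4 / pi * t)" by (rule lim_imp_Liminf[OF sequentially_bot lim])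
  finally show ?thesis .
qed

text \<open>For a fixed slack \<open>d\<close> the exponent involves \<open>u - s - 2 * d\<close>;
  then \<open>d\<close> is sent to 0 along \<open>(u - s) / k\<close>.\<close>

lemma no_swap_limit_le:
  assumes s: "0 \<le> s" "s < u"
  shows "prob {\<omega> \<in> space M. extend (F \<omega>) \<in> no_swap x (ennreal s) (ennreal u)} \<le> exp (- (4 / pi * (u - s)))"
proof -
  let ?U = "no_swap x (ennreal s) (ennreal u)"
  let ?p = "\<lambda>n. hook_prob (TT (c n) n) (x, 1)"
  have slack: "prob {\<omega> \<in> space M. extend (F \<omega>) \<in> ?U} \<le> exp (- (4 / pi * (u - s - 2 * d)))"
    if d: "0 < d" "s + 2 * d < u" for d
  proof -
    obtain C where C: "C \<longlonglongrightarrow> exp (- (4 / pi * (u - s - 2 * d)))"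
      "eventually (\<lambda>n. \<exists>j m. real (j + m) \<le> real n * (real n - 1) / 2 \<and> 0 < m \<and> s + d \<le> real (Suc j) / real n \<and>
         real (j + m) / real n \<le> u - d \<and>
         real (Suc j) / (real n * d)\<^sup>2 + real (j + m) / (real n * d)\<^sup>2 + exp (- (?p n * real m)) \<le> C n) sequentially"
      by (rule window_bound_limit[OF hook_prob_limit(2)[OF odd c0 x] s(1) d])
    have "emeasure M {\<omega> \<in> space M. extend (F \<omega>) \<in> ?U} \<le>
      liminf (\<lambda>n. emeasure (N n) {\<omega> \<in> space (N n). extend (inclusion_fun (X n) \<omega>) \<in> ?U})"
      by (rule portmanteau[OF open_no_swap])
    also have "\<dots> \<le> liminf (\<lambda>n. ennreal (C n))"
    proof (rule Liminf_mono)
      show "eventually (\<lambda>n. emeasure (N n) {\<omega> \<in> space (N n). extend (inclusion_fun (X n) \<omega>) \<in> ?U} \<le> ennreal (C n)) sequentially"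
        using eventually_ge_at_top[of 2] hook_prob_limit(1)[OF odd c0 x] C(2)
      proof eventually_elim
        case (elim n)
        obtain Y S where Q: "staircase_process (c n) n (N n) (real n) Y S (X n)" using P[OF elim(1)] by blast
        obtain j m where jm: "real (j + m) \<le> real n * (real n - 1) / 2" "0 < m" "s + d \<le> real (Suc j) / real n"
          "real (j + m) / real n \<le> u - d"
          "real (Suc j) / (real n * d)\<^sup>2 + real (j + m) / (real n * d)\<^sup>2 + exp (- (?p n * real m)) \<le> C n"
          using elim(3) by blast
        have "j + m \<le> card (TT (c n) n)"
          using jm(1) unfolding card_TT[OF odd, symmetric] by (rule of_nat_le_iff[THEN iffD1])
        from staircase_process.no_swap_event_le[OF Q elim(2) this jm(2) d(1) jm(3,4)] ennreal_leI[OF jm(5)]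
        show ?case by (rule order_trans)
      qed
    qed
    also have "\<dots> = ennreal (exp (- (4 / pi * (u - s - 2 * d))))"
      by (rule lim_imp_Liminf[OF sequentially_bot tendsto_ennrealI[OF C(1)]])
    finally show ?thesis unfolding emeasure_eq_measure by simp
  qed
  have "(\<lambda>k. exp (- (4 / pi * (u - s - 2 * ((u - s) / real k))))) \<longlonglongrightarrow> exp (- (4 / pi * (u - s - 2 * 0)))"
    by (intro tendsto_intros lim_const_over_n)
  moreover have "\<exists>k0. \<forall>k\<ge>k0. prob {\<omega> \<in> space M. extend (F \<omega>) \<in> ?U} \<le> exp (- (4 / pi * (u - s - 2 * ((u - s) / real k))))"
  \<comment> \<open>From \<open>k = 3\<close> on, the slack \<open>2 * (u - s) / k\<close> on both
    sides together is shorter than the interval.\<close>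
  proof (intro exI[of _ 3] allI impI)
    fix k :: nat assume k: "3 \<le> k"
    have "(u - s) / real k \<le> (u - s) / 3" by (rule divide_left_mono) (use k s in auto)
    then have "s + 2 * ((u - s) / real k) < u" using s by argo
    then show "prob {\<omega> \<in> space M. extend (F \<omega>) \<in> ?U} \<le> exp (- (4 / pi * (u - s - 2 * ((u - s) / real k))))"
      by (rule slack[rotated]) (use k s in simp)
  qed
  ultimately have "prob {\<omega> \<in> space M. extend (F \<omega>) \<in> ?U} \<le> exp (- (4 / pi * (u - s - 2 * 0)))" by (rule LIMSEQ_le_const)
  then show ?thesis by simp
qed

text \<open>Each window \<open>[s i, u i]\<close> that contains a swap contributes at least one to
  the count, and by linearity of expectation no independence between windows is required.\<close>

lemma expected_swaps_windows:
  assumes t: "0 < t" and m: "2 \<le> m"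
  shows "ennreal (real m * (1 - exp (- (4 / pi * (t / real m * (1 - 1 / real m)))))) \<le> (\<integral>\<^sup>+\<omega>. swaps (extend (F \<omega>)) x t \<partial>M)"
proof -
  define s where "s i = t / real m * real i" for i :: nat
  \<comment> \<open>Shortening by the factor \<open>1 - 1 / m\<close> makes the closed windows
    disjoint and lets the last one end strictly before \<open>t\<close>; the loss vanishes as
    \<open>m\<close> grows.\<close>
  define u where "u i = t / real m * (real i + (1 - 1 / real m))" for i :: nat
  let ?U = "\<lambda>i. no_swap x (ennreal (s i)) (ennreal (u i))"
  let ?A = "\<lambda>i. {\<omega> \<in> space M. extend (F \<omega>) \<in> ?U i}"
  have tm: "0 < t / real m" "0 < 1 - 1 / real m" "1 - 1 / real m < 1" using t m by auto
  have s0: "0 \<le> s i" for i unfolding s_def using less_imp_le[OF tm(1)] by (rule mult_nonneg_nonneg) simp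
  have su: "u i - s i = t / real m * (1 - 1 / real m)" for i by (simp only: s_def u_def flip: right_diff_distrib) simp
  have lt: "s i < u i" for i using su[of i] mult_pos_pos[OF tm(1,2)] by linarith
  have us: "u i < s j" if "i < j" for i j
    unfolding s_def u_def by (rule mult_strict_left_mono) (use that tm in linarith)+
  have sm: "s m = t" using m by (simp add: s_def)
  have count: "(\<Sum>i<m. indicator (space M - ?A i) \<omega>) \<le> swaps (extend (F \<omega>)) x t"
    if \<omega>: "\<omega> \<in> space M" and pr: "proper (extend (F \<omega>))" for \<omega>
  proof -
    let ?G = "extend (F \<omega>)"
    let ?I = "{i. i < m \<and> ?G \<notin> ?U i}"
    have "\<forall>i\<in>?I. \<exists>v. v \<in> swap_times ?G x \<and> ennreal (s i) \<le> v \<and> v \<le> ennreal (u i)"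
    proof
      fix i assume "i \<in> ?I"
      then show "\<exists>v. v \<in> swap_times ?G x \<and> ennreal (s i) \<le> v \<and> v \<le> ennreal (u i)"
      using proper_no_swap[OF pr _ x, of "u i" "ennreal (s i)"] s0[of i] lt[of i] by auto
    qed
    from bchoice[OF this] obtain v where
      v': "\<forall>i\<in>?I. v i \<in> swap_times ?G x \<and> ennreal (s i) \<le> v i \<and> v i \<le> ennreal (u i)" ..
    note v = bspec[OF v']
    have less: "v i < ennreal (s j)" if "i \<in> ?I" "i < j" for i j
    proof -
      have "ennreal (u i) < ennreal (s j)" using us[OF that(2)] s0[of i] lt[of i] by (intro ennreal_lessI) linarith+
      then show ?thesis using v[OF that(1)] by (blast intro: le_less_trans)
    qed
    have "inj_on v ?I"
    proof (rule linorder_inj_onI)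
      show "v i \<noteq> v j" if "i < j" "i \<in> ?I" "j \<in> ?I" for i j
        using less[OF that(2,1)] v[OF that(3)] by auto
    qed auto
    moreover have "v ` ?I \<subseteq> {v \<in> swap_times ?G x. v < ennreal t}"
      using v less[of _ m] sm by auto
    ultimately have "card ?I \<le> card {v \<in> swap_times ?G x. v < ennreal t}"
      using swaps_eq_card(1)[OF pr less_imp_le[OF t]] by (rule card_inj_on_le)
    then have "(of_nat (card ?I) :: ennreal) \<le> swaps ?G x t"
      unfolding swaps_eq_card(2)[OF pr less_imp_le[OF t]] by simp
    moreover have "(\<Sum>i<m. indicator (space M - ?A i) \<omega>) = (of_nat (card ?I) :: ennreal)"
    proof -
      have "(\<Sum>i<m. indicator (space M - ?A i) \<omega>) = (\<Sum>i<m. if i \<in> ?I then 1 else 0 :: ennreal)"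
        by (rule sum.cong) (use \<omega> in \<open>auto simp: indicator_def\<close>)
      also have "\<dots> = (\<Sum>i\<in>{..<m} \<inter> ?I. 1)" by (rule sum.inter_restrict[symmetric]) simp
      also have "{..<m} \<inter> ?I = ?I" by auto
      finally show ?thesis by simp
    qed
    ultimately show ?thesis by simp
  qed
  let ?q = "1 - exp (- (4 / pi * (t / real m * (1 - 1 / real m))))"
  have A: "?A i \<in> events" for i by (rule event_sets[OF open_no_swap])
  have "?q \<le> prob (space M - ?A i)" for i
    using no_swap_limit_le[OF s0 lt, of i] unfolding su by (simp add: prob_compl[OF A])
  then have "ennreal ?q \<le> emeasure M (space M - ?A i)" for i
    unfolding emeasure_eq_measure by (rule ennreal_leI)
  then have "(\<Sum>i<m. ennreal ?q) \<le> (\<Sum>i<m. emeasure M (space M - ?A i))" by (rule sum_mono)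
  moreover have "0 \<le> ?q"
  proof -
    have "0 \<le> 4 / pi * (t / real m * (1 - 1 / real m))"
      by (rule mult_nonneg_nonneg[OF _ less_imp_le[OF mult_pos_pos[OF tm(1,2)]]]) simp
    then show ?thesis by (simp only: diff_ge_0_iff_ge exp_le_one_iff neg_le_0_iff_le)
  qed
  then have "ennreal (real m * ?q) = (\<Sum>i<m. ennreal ?q)" by (simp add: ennreal_mult ennreal_of_nat_eq_real_of_nat)
  ultimately have "ennreal (real m * ?q) \<le> (\<Sum>i<m. emeasure M (space M - ?A i))" by simp
  also have "\<dots> = (\<Sum>i<m. \<integral>\<^sup>+\<omega>. indicator (space M - ?A i) \<omega> \<partial>M)"
    by (intro sum.cong refl nn_integral_indicator[symmetric] sets.compl_sets A)
  also have "\<dots> = (\<integral>\<^sup>+\<omega>. (\<Sum>i<m. indicator (space M - ?A i) \<omega>) \<partial>M)"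
    by (intro nn_integral_sum[symmetric] borel_measurable_indicator sets.compl_sets A)
  also have "\<dots> \<le> (\<integral>\<^sup>+\<omega>. swaps (extend (F \<omega>)) x t \<partial>M)"
  proof (rule nn_integral_mono_AE)
    show "AE \<omega> in M. (\<Sum>i<m. indicator (space M - ?A i) \<omega>) \<le> swaps (extend (F \<omega>)) x t"
      using prp AE_space by eventually_elim (rule count)
  qed
  finally show ?thesis .
qed

text \<open>For the lower bound \<open>exp (- y) \<le> 1 / (1 + y)\<close> turns the estimate over
  \<open>m\<close> windows into the rational expression \<open>m * y / (1 + y)\<close>, where
  \<open>y\<close> tends to 0 and \<open>m * y\<close> to \<open>4 t / \<pi>\<close>.\<close>

lemma expected_swaps_eq:
  assumes t: "0 \<le> t"
  shows "(\<integral>\<^sup>+\<omega>. swaps (extend (F \<omega>)) x t \<partial>M) = ennreal (4 / pi * t)"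
proof (rule antisym[OF expected_swaps_upper[OF t]])
  show "ennreal (4 / pi * t) \<le> (\<integral>\<^sup>+\<omega>. swaps (extend (F \<omega>)) x t \<partial>M)"
  proof (cases "t = 0")
    case False
    then have t: "0 < t" using t by simp
    define a where "a = 4 / pi * t"
    have a: "0 < a" using t by (simp add: a_def)
    have "(\<lambda>m. a * (1 - 1 / real m) / (1 + a / real m * (1 - 1 / real m))) \<longlonglongrightarrow> a * (1 - 0) / (1 + 0 * (1 - 0))"
      by (intro tendsto_intros lim_const_over_n) simp
    then have "(\<lambda>m. ennreal (a * (1 - 1 / real m) / (1 + a / real m * (1 - 1 / real m)))) \<longlonglongrightarrow> ennreal a"
      by (intro tendsto_ennrealI) simp
    moreover have "\<exists>m0. \<forall>m\<ge>m0. ennreal (a * (1 - 1 / real m) / (1 + a / real m * (1 - 1 / real m))) \<le> (\<integral>\<^sup>+\<omega>. swaps (extend (F \<omega>)) x t \<partial>M)"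
    proof (intro exI[of _ 2] allI impI)
      fix m :: nat assume m: "2 \<le> m"
      define y where "y = a / real m * (1 - 1 / real m)"
      have y: "0 < y" unfolding y_def using m a by (intro mult_pos_pos) auto
      have "exp (- y) \<le> 1 / (1 + y)"
        unfolding exp_minus inverse_eq_divide by (rule divide_left_mono) (use y exp_ge_add_one_self[of y] in auto)
      moreover have "1 - 1 / (1 + y) = y / (1 + y)" using y by (simp add: field_simps)
      ultimately have "real m * (y / (1 + y)) \<le> real m * (1 - exp (- y))" by (intro mult_left_mono) auto
      moreover have "real m * (y / (1 + y)) = a * (1 - 1 / real m) / (1 + y)" using m by (simp add: y_def)
      moreover have "4 / pi * (t / real m * (1 - 1 / real m)) = y" by (simp add: y_def a_def)
      ultimately show "ennreal (a * (1 - 1 / real m) / (1 + a / real m * (1 - 1 / real m))) \<le> (\<integral>\<^sup>+\<omega>. swaps (extend (F \<omega>)) x t \<partial>M)"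
        using expected_swaps_windows[OF t m] unfolding y_def[symmetric] by (auto intro: order_trans[OF ennreal_leI])
    qed
    ultimately show ?thesis unfolding a_def[symmetric] by (rule LIMSEQ_le_const2)
  qed simp
qed

end

theorem proposition7p10:
  fixes M :: "'a measure"
    and F :: "'a \<Rightarrow> int \<times> int \<Rightarrow> ennreal"
    and N :: "int \<Rightarrow> nat \<Rightarrow> 'b measure"
    and X :: "int \<Rightarrow> nat \<Rightarrow> real \<Rightarrow> 'b \<Rightarrow> (int \<times> int) set"
    and x :: int and t :: real
  assumes "\<And>c n. odd (c + int n) \<Longrightarrow> tableau_process (N c n) c n (real n) (X c n)"
    and "prob_space M"
    and "\<And>z. z \<in> HH \<Longrightarrow> (\<lambda>\<omega>. F \<omega> z) \<in> borel_measurable M"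
    and "\<And>\<omega> z. \<omega> \<in> space M \<Longrightarrow> z \<in> HH \<Longrightarrow> F \<omega> z < \<infinity>"
    and "\<And>c :: nat \<Rightarrow> int.
           (\<forall>n. odd (c n + int n)) \<Longrightarrow>
           (\<lambda>n. real_of_int (c n) / real n) \<longlonglongrightarrow> 0 \<Longrightarrow>
           conv_in_distr (\<lambda>n. N (c n) n) (\<lambda>n. inclusion_fun (X (c n) n)) M F"
    and "AE \<omega> in M. F \<omega> \<in> swap_class"
    and "odd x" and "0 \<le> t"
  shows "(\<integral>\<^sup>+\<omega>. col_height (F \<omega>) x t \<partial>M) = (\<integral>\<^sup>+\<omega>. swaps (F \<omega>) x t \<partial>M) \<and>
         (\<integral>\<^sup>+\<omega>. swaps (F \<omega>) x t \<partial>M) = ennreal (4 / pi * t)"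
proof -
  \<comment> \<open>The simplest apex positions of the right parity; \<open>c n + 2\<close> has the
    same parity, and both are bounded, hence \<open>o(n)\<close>. The first sequence serves for the
    swap count, the pair for translation invariance.\<close>
  define c :: "nat \<Rightarrow> int" where "c n = (if even n then 1 else 0)" for n
  have par: "odd (c n + int n)" "odd (c n + 2 + int n)" for n by (simp_all add: c_def)
  have small: "(\<lambda>n. real_of_int (f n) / real n) \<longlonglongrightarrow> 0" if f: "\<And>n. \<bar>f n\<bar> \<le> 3" for f :: "nat \<Rightarrow> int"
  proof (rule Lim_null_comparison)
    show "(\<lambda>n. 3 / real n) \<longlonglongrightarrow> 0" by (rule lim_const_over_n)
    have "\<bar>real_of_int (f n)\<bar> \<le> 3" for n using f[of n] by linarith
    then show "eventually (\<lambda>n. norm (real_of_int (f n) / real n) \<le> 3 / real n) sequentially"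
      by (intro always_eventually allI) (simp add: abs_divide divide_right_mono)
  qed
  have c0: "(\<lambda>n. real_of_int (c n) / real n) \<longlonglongrightarrow> 0" "(\<lambda>n. real_of_int (c n + 2) / real n) \<longlonglongrightarrow> 0"
    by (intro small; simp add: c_def)+
  have convs: "conv_in_distr (\<lambda>n. N (c n) n) (\<lambda>n. inclusion_fun (X (c n) n)) M F"
    "conv_in_distr (\<lambda>n. N (c n + 2) n) (\<lambda>n. inclusion_fun (X (c n + 2) n)) M F"
    by (rule assms(5); use par c0 in simp)+
  have proc: "\<exists>Y S. staircase_process d n (N d n) (real n) Y S (X d n)" if "odd (d + int n)" "2 \<le> n" for d n
  proof -
    interpret staircase d n using that by unfold_locales
    have "0 < real n" using that(2) by simp
    then show ?thesis using tableau_process_staircase_process[OF assms(1)[OF that(1)]] by blast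
  qed
  have AE: "AE \<omega> in M. F \<omega> \<in> swap_class \<and> (\<forall>z\<in>HH. F \<omega> z < \<infinity>)"
    using assms(6) AE_space by eventually_elim (use assms(4) in blast)
  have prp: "AE \<omega> in M. proper (extend (F \<omega>))"
    using AE by eventually_elim (rule proper_ext; blast)
  have swaps: "(\<integral>\<^sup>+\<omega>. swaps (extend (F \<omega>)) x t \<partial>M) = (\<integral>\<^sup>+\<omega>. swaps (F \<omega>) x t \<partial>M)"
  proof (rule nn_integral_cong_AE)
    show "AE \<omega> in M. swaps (extend (F \<omega>)) x t = swaps (F \<omega>) x t"
      using AE by eventually_elim (rule swaps_ext; use assms(8) in blast)
  qed
  interpret staircase_limit M F "\<lambda>n. N (c n) n" "\<lambda>n. X (c n) n" c x
    by (intro staircase_limit.intro assms(2,3,7) convs(1) par(1) c0(1) prp proc[OF par(1)])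
  have stat: "(\<integral>\<^sup>+\<omega>. g (translate 2 (extend (F \<omega>))) \<partial>M) = (\<integral>\<^sup>+\<omega>. g (extend (F \<omega>)) \<partial>M)"
    if g: "g \<in> borel_measurable borel" for g
  proof (rule stationary_limit[OF assms(2,3) convs _ _ g])
    show "eventually (\<lambda>n. \<exists>Y S. staircase_process (c n) n (N (c n) n) (real n) Y S (X (c n) n)) sequentially"
      using eventually_ge_at_top[of 2] by eventually_elim (rule proc[OF par(1)])
    show "eventually (\<lambda>n. \<exists>Y S. staircase_process (c n + 2) n (N (c n + 2) n) (real n) Y S (X (c n + 2) n)) sequentially"
      using eventually_ge_at_top[of 2] by eventually_elim (rule proc[OF par(2)])
  qed
  have "(\<integral>\<^sup>+\<omega>. col_height (extend (F \<omega>)) x t \<partial>M) = (\<integral>\<^sup>+\<omega>. swaps (extend (F \<omega>)) x t \<partial>M)"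
  proof (rule expected_height_eq_swaps[OF ext_measurable[OF assms(3)] _ prp assms(8,7)])
    show "(\<integral>\<^sup>+\<omega>. g (translate (2 * int i) (extend (F \<omega>))) \<partial>M) = (\<integral>\<^sup>+\<omega>. g (extend (F \<omega>)) \<partial>M)"
      if "g \<in> borel_measurable borel" for i g
      by (rule stationary_power[OF ext_measurable[OF assms(3)] stat that])
  qed
  then show ?thesis using expected_swaps_eq[OF assms(8)] swaps by (simp add: col_height_ext)
qed

end
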